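(* Given an XML document with node set $N$ (a rooted ordered tree stored as its sequence of start and end tags), its 1-index — the partition of $N$ into backward bisimilarity equivalence classes — can be computed in $O(\mathrm{Sort}(|N|))$ IOs in the external-memory model.
   Context: An XML document is viewed as a rooted labeled tree $G=\langle N,E,l\rangle$ (edges directed from parent to child, $l$ assigning a label/tag name to each node), stored in external memory as its sequence of tags in document order: each node contributes a start tag (carrying its label) and a matching end tag, with the tags of a node's descendants nested between them. Backward bisimilarity is bisimilarity on the graph with all edges reversed: nodes $n,m$ are backward bisimilar iff $l(n)=l(m)$, for every parent $n'$ of $n$ there is a parent $m'$ of $m$ that is backward bisimilar to $n'$, and vice versa (the largest such relation). The 1-index groups nodes into the equivalence classes of backward bisimilarity. External-memory model: a fast internal memory of $M$ units of data and an unbounded external memory; data is moved in blocks of $B$ units, each transfer being one IO; complexity is the number of IOs. $\mathrm{Sort}(n)=\Theta\big(\frac{n}{B}\log_{M/B}\frac{n}{B}\big)$. *)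

theory Defs
  imports Complex_Main
begin

section \<open>Labeled graphs, backward bisimilarity, the 1-index\<close>

record ('v, 'l) lgraph =
  nodes :: "'v set"
  edges :: "('v \<times> 'v) set"
  label :: "'v \<Rightarrow> 'l"

definition backward_bisimulation :: "('v, 'l) lgraph \<Rightarrow> 'v rel \<Rightarrow> bool" where
  "backward_bisimulation G R \<longleftrightarrow>
     R \<subseteq> nodes G \<times> nodes G \<and>
     (\<forall>n m. (n, m) \<in> R \<longrightarrow>
        label G n = label G m \<and>
        (\<forall>n'. (n', n) \<in> edges G \<longrightarrow> (\<exists>m'. (m', m) \<in> edges G \<and> (n', m') \<in> R)) \<and>
        (\<forall>m'. (m', m) \<in> edges G \<longrightarrow> (\<exists>n'. (n', n) \<in> edges G \<and> (n', m') \<in> R)))"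

text \<open>The largest backward bisimulation; see \<open>backward_bisimulation_bisimilar\<close> below.\<close>

definition backward_bisimilar :: "('v, 'l) lgraph \<Rightarrow> 'v rel" where
  "backward_bisimilar G = \<Union>{R. backward_bisimulation G R}"

definition one_index :: "('v, 'l) lgraph \<Rightarrow> 'v set set" where
  "one_index G = nodes G // backward_bisimilar G"

lemma backward_bisimulationI:
  assumes "\<And>n m. (n, m) \<in> R \<Longrightarrow> n \<in> nodes G \<and> m \<in> nodes G \<and> label G n = label G m"
    and "\<And>n m n'. (n, m) \<in> R \<Longrightarrow> (n', n) \<in> edges G \<Longrightarrow> \<exists>m'. (m', m) \<in> edges G \<and> (n', m') \<in> R"
    and "\<And>n m m'. (n, m) \<in> R \<Longrightarrow> (m', m) \<in> edges G \<Longrightarrow> \<exists>n'. (n', n) \<in> edges G \<and> (n', m') \<in> R"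
  shows "backward_bisimulation G R"
  unfolding backward_bisimulation_def
  by (intro conjI allI impI subrelI SigmaI) (simp_all add: assms)

lemma backward_bisimulationD:
  assumes "backward_bisimulation G R" and "(n, m) \<in> R"
  shows "n \<in> nodes G" "m \<in> nodes G" "label G n = label G m"
    and "(n', n) \<in> edges G \<Longrightarrow> \<exists>m'. (m', m) \<in> edges G \<and> (n', m') \<in> R"
    and "(m', m) \<in> edges G \<Longrightarrow> \<exists>n'. (n', n) \<in> edges G \<and> (n', m') \<in> R"
proof -
  have "R \<subseteq> nodes G \<times> nodes G"
    using assms(1) unfolding backward_bisimulation_def by (rule conjunct1)
  from subsetD[OF this assms(2)] show "n \<in> nodes G" "m \<in> nodes G" by simp_all
qed (use assms in \<open>simp_all add: backward_bisimulation_def\<close>)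

lemma backward_bisimulation_bisimilar:
  "backward_bisimulation G (backward_bisimilar G)"
proof (rule backward_bisimulationI)
  fix n m assume "(n, m) \<in> backward_bisimilar G"
  then obtain R where R: "backward_bisimulation G R" and nm: "(n, m) \<in> R"
    unfolding backward_bisimilar_def by blast
  have sub: "R \<subseteq> backward_bisimilar G"
    using R unfolding backward_bisimilar_def by blast
  note D = backward_bisimulationD[OF R nm]
  show "n \<in> nodes G \<and> m \<in> nodes G \<and> label G n = label G m"
    using D(1-3) by simp
  show "\<exists>m'. (m', m) \<in> edges G \<and> (n', m') \<in> backward_bisimilar G" if "(n', n) \<in> edges G" for n'
    using D(4)[OF that] sub by blast
  show "\<exists>n'. (n', n) \<in> edges G \<and> (n', m') \<in> backward_bisimilar G" if "(m', m) \<in> edges G" for m'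
    using D(5)[OF that] sub by blast
qed

lemma equiv_backward_bisimilar:
  assumes "edges G \<subseteq> nodes G \<times> nodes G"
  shows "equiv (nodes G) (backward_bisimilar G)"
proof (rule equivI)
  let ?R = "backward_bisimilar G"
  note D = backward_bisimulationD[OF backward_bisimulation_bisimilar[of G]]
  have mx: "S \<subseteq> ?R" if "backward_bisimulation G S" for S
    using that unfolding backward_bisimilar_def by blast
  show "?R \<subseteq> nodes G \<times> nodes G"
    by (intro subrelI SigmaI) (fact D(1,2))+
  have "backward_bisimulation G (Id_on (nodes G))"
    by (rule backward_bisimulationI) (use assms in blast)+
  from mx[OF this] show "refl_on (nodes G) ?R"
    unfolding refl_on_def by blast
  have "backward_bisimulation G (?R\<inverse>)"
  proof (rule backward_bisimulationI)
    fix n m assume "(n, m) \<in> ?R\<inverse>"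
    then have mn: "(m, n) \<in> ?R" by simp
    show "n \<in> nodes G \<and> m \<in> nodes G \<and> label G n = label G m"
      using D(1-3)[OF mn] by simp
    show "\<exists>m'. (m', m) \<in> edges G \<and> (n', m') \<in> ?R\<inverse>" if "(n', n) \<in> edges G" for n'
      using D(5)[OF mn that] by simp
    show "\<exists>n'. (n', n) \<in> edges G \<and> (n', m') \<in> ?R\<inverse>" if "(m', m) \<in> edges G" for m'
      using D(4)[OF mn that] by simp
  qed
  from mx[OF this] show "sym ?R"
    unfolding sym_def by blast
  have "backward_bisimulation G (?R O ?R)"
  proof (rule backward_bisimulationI)
    fix a c assume "(a, c) \<in> ?R O ?R"
    then obtain b where ab: "(a, b) \<in> ?R" and bc: "(b, c) \<in> ?R" by blast
    show "a \<in> nodes G \<and> c \<in> nodes G \<and> label G a = label G c"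
      using D(1-3)[OF ab] D(1-3)[OF bc] by simp
    show "\<exists>z. (z, c) \<in> edges G \<and> (x, z) \<in> ?R O ?R" if x: "(x, a) \<in> edges G" for x
    proof -
      from D(4)[OF ab x] obtain y where y: "(y, b) \<in> edges G" "(x, y) \<in> ?R" by blast
      from D(4)[OF bc y(1)] y(2) show ?thesis by blast
    qed
    show "\<exists>x. (x, a) \<in> edges G \<and> (x, z) \<in> ?R O ?R" if z: "(z, c) \<in> edges G" for z
    proof -
      from D(5)[OF bc z] obtain y where y: "(y, b) \<in> edges G" "(y, z) \<in> ?R" by blast
      from D(5)[OF ab y(1)] y(2) show ?thesis by blast
    qed
  qed
  from mx[OF this] show "trans ?R"
    unfolding trans_def by blast
qed


section \<open>XML documents\<close>

text \<open>Tag names are atomic values, each fitting into one unit of data; they are represented by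
  natural numbers.\<close>

datatype xml = Node nat "xml list"

datatype tag = Start nat | End

fun tags :: "xml \<Rightarrow> tag list" where
  "tags (Node a ts) = Start a # concat (map tags ts) @ [End]"

text \<open>A node is identified by its position, the list of child indices on the path from the root.
  \<open>doc_order t\<close> lists all nodes in the order in which their start tags occur in \<open>tags t\<close>.\<close>

primrec doc_order :: "xml \<Rightarrow> nat list list" where
  "doc_order (Node a ts) =
     [] # concat (map2 (\<lambda>i ps. map ((#) i) ps) [0..<length ts] (map doc_order ts))"

fun label_at :: "xml \<Rightarrow> nat list \<Rightarrow> nat" where
  "label_at (Node a ts) [] = a"
| "label_at (Node a ts) (i # p) = label_at (ts ! i) p"

definition xml_graph :: "xml \<Rightarrow> (nat list, nat) lgraph" where
  "xml_graph t =
     \<lparr> nodes = set (doc_order t),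
       edges = {(p, q). p \<in> set (doc_order t) \<and> q \<in> set (doc_order t) \<and> (\<exists>i. q = p @ [i])},
       label = label_at t \<rparr>"

lemma starts_doc_order:
  "[tag \<leftarrow> tags t. tag \<noteq> End] = map (\<lambda>p. Start (label_at t p)) (doc_order t)"
proof (induction t)
  case (Node a ts)
  have "concat (map (\<lambda>t. [tag \<leftarrow> tags t. tag \<noteq> End]) us) =
     map (\<lambda>p. Start (label_at (Node a (vs @ us)) p))
       (concat (map2 (\<lambda>i ps. map ((#) i) ps) [length vs..<length vs + length us]
          (map doc_order us)))"
    if "set us \<subseteq> set ts" for vs us
    using that
  proof (induction us arbitrary: vs)
    case (Cons u us)
    have "[length vs..<length vs + length (u # us)] =
        length vs # [length (vs @ [u])..<length (vs @ [u]) + length us]"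
      by (simp add: upt_rec)
    then show ?case
      using Cons.IH[of "vs @ [u]"] Cons.prems Node.IH[of u] by (simp add: comp_def)
  qed simp
  from this[of ts "[]"] show ?case
    by (simp add: filter_concat comp_def)
qed


section \<open>The external-memory model\<close>

text \<open>
  A program is a single piece of code in a RAM language with registers, an internal memory of
  \<open>M\<close> cells and an unbounded external memory whose block \<open>b\<close> consists of the \<open>B\<close> cells with
  addresses \<open>b * B, ..., b * B + B - 1\<close>. A program mentions only finitely many registers, so these
  hold \<open>O(1)\<close> units of data.
\<close>

datatype exp =
    Const nat
  | Reg nat
  | Add exp exp
  | Sub exp exp
  | Mul exp exp
  | Div exp exp
  | Mod exp exp

datatype test =
    Less exp exp
  | Equal exp exp
  | Neg test
  | Conj test test

datatype prog =
    Skip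
  | Assign nat exp
  | Load nat exp
  | Store exp exp
  | ReadBlock exp exp
  | WriteBlock exp exp
  | Seq prog prog
  | Cond test prog prog
  | While test prog

record config =
  regs :: "nat \<Rightarrow> nat"
  mem :: "nat \<Rightarrow> nat"
  disk :: "nat \<Rightarrow> nat"

primrec exp_val :: "exp \<Rightarrow> (nat \<Rightarrow> nat) \<Rightarrow> nat" where
  "exp_val (Const k) r = k"
| "exp_val (Reg x) r = r x"
| "exp_val (Add e f) r = exp_val e r + exp_val f r"
| "exp_val (Sub e f) r = exp_val e r - exp_val f r"
| "exp_val (Mul e f) r = exp_val e r * exp_val f r"
| "exp_val (Div e f) r = exp_val e r div exp_val f r"
| "exp_val (Mod e f) r = exp_val e r mod exp_val f r"

primrec test_val :: "test \<Rightarrow> (nat \<Rightarrow> nat) \<Rightarrow> bool" where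
  "test_val (Less e f) r \<longleftrightarrow> exp_val e r < exp_val f r"
| "test_val (Equal e f) r \<longleftrightarrow> exp_val e r = exp_val f r"
| "test_val (Neg b) r \<longleftrightarrow> \<not> test_val b r"
| "test_val (Conj b c) r \<longleftrightarrow> test_val b r \<and> test_val c r"

text \<open>
  \<open>exec M B W p s q s'\<close>: from \<open>s\<close>, the program \<open>p\<close> terminates in \<open>s'\<close> after exactly \<open>q\<close> IOs; only
  the two block transfers cost an IO. \<open>W\<close> bounds the contents of a unit of data: storing a value
  \<open>\<ge> W\<close> in a register or a memory cell, like accessing internal memory beyond its \<open>M\<close> cells, makes
  the program get stuck.
\<close>

inductive exec :: "nat \<Rightarrow> nat \<Rightarrow> nat \<Rightarrow> prog \<Rightarrow> config \<Rightarrow> nat \<Rightarrow> config \<Rightarrow> bool"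
  for M B W :: nat where
  Skip: "exec M B W Skip s 0 s"
| Assign: "exp_val e (regs s) < W \<Longrightarrow>
    exec M B W (Assign x e) s 0 (s\<lparr>regs := (regs s)(x := exp_val e (regs s))\<rparr>)"
| Load: "exp_val e (regs s) < M \<Longrightarrow>
    exec M B W (Load x e) s 0 (s\<lparr>regs := (regs s)(x := mem s (exp_val e (regs s)))\<rparr>)"
| Store: "exp_val a (regs s) < M \<Longrightarrow> exp_val e (regs s) < W \<Longrightarrow>
    exec M B W (Store a e) s 0 (s\<lparr>mem := (mem s)(exp_val a (regs s) := exp_val e (regs s))\<rparr>)"
| ReadBlock: "b = exp_val e (regs s) \<Longrightarrow> a = exp_val f (regs s) \<Longrightarrow> a + B \<le> M \<Longrightarrow>
    exec M B W (ReadBlock e f) s 1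
      (s\<lparr>mem := (\<lambda>i. if a \<le> i \<and> i < a + B then disk s (b * B + (i - a)) else mem s i)\<rparr>)"
| WriteBlock: "b = exp_val e (regs s) \<Longrightarrow> a = exp_val f (regs s) \<Longrightarrow> a + B \<le> M \<Longrightarrow>
    exec M B W (WriteBlock e f) s 1
      (s\<lparr>disk := (\<lambda>i. if b * B \<le> i \<and> i < b * B + B then mem s (a + (i - b * B)) else disk s i)\<rparr>)"
| Seq: "exec M B W p1 s q1 s' \<Longrightarrow> exec M B W p2 s' q2 s'' \<Longrightarrow>
    exec M B W (Seq p1 p2) s (q1 + q2) s''"
| CondTrue: "test_val c (regs s) \<Longrightarrow> exec M B W p1 s q s' \<Longrightarrow> exec M B W (Cond c p1 p2) s q s'"
| CondFalse: "\<not> test_val c (regs s) \<Longrightarrow> exec M B W p2 s q s' \<Longrightarrow> exec M B W (Cond c p1 p2) s q s'"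
| WhileFalse: "\<not> test_val c (regs s) \<Longrightarrow> exec M B W (While c p) s 0 s"
| WhileTrue: "test_val c (regs s) \<Longrightarrow> exec M B W p s q1 s' \<Longrightarrow> exec M B W (While c p) s' q2 s'' \<Longrightarrow>
    exec M B W (While c p) s (q1 + q2) s''"

inductive_cases exec_SkipE: "exec M B W Skip s q s'"
inductive_cases exec_AssignE: "exec M B W (Assign x e) s q s'"
inductive_cases exec_LoadE: "exec M B W (Load x e) s q s'"
inductive_cases exec_StoreE: "exec M B W (Store a e) s q s'"
inductive_cases exec_ReadBlockE: "exec M B W (ReadBlock e f) s q s'"
inductive_cases exec_WriteBlockE: "exec M B W (WriteBlock e f) s q s'"
inductive_cases exec_SeqE: "exec M B W (Seq p1 p2) s q s'"
inductive_cases exec_CondE: "exec M B W (Cond c p1 p2) s q s'"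
inductive_cases exec_WhileE: "exec M B W (While c p) s q s'"

lemma exec_deterministic:
  "exec M B W p s q s' \<Longrightarrow> exec M B W p s r s'' \<Longrightarrow> r = q \<and> s'' = s'"
proof (induction arbitrary: r s'' rule: exec.induct)
  case Skip
  from Skip.prems show ?case by (rule exec_SkipE) simp
next
  case Assign
  from Assign.prems show ?case by (rule exec_AssignE) simp
next
  case Load
  from Load.prems show ?case by (rule exec_LoadE) simp
next
  case Store
  from Store.prems show ?case by (rule exec_StoreE) simp
next
  case ReadBlock
  from ReadBlock.prems show ?case by (rule exec_ReadBlockE) (simp add: ReadBlock.hyps cong: if_cong)
next
  case WriteBlock
  from WriteBlock.prems show ?case by (rule exec_WriteBlockE) (simp add: WriteBlock.hyps cong: if_cong)
next
  case Seq
  from Seq.prems show ?case by (rule exec_SeqE) (use Seq.IH in blast)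
next
  case CondTrue
  from CondTrue.prems show ?case by (rule exec_CondE) (use CondTrue in blast)+
next
  case CondFalse
  from CondFalse.prems show ?case by (rule exec_CondE) (use CondFalse in blast)+
next
  case WhileFalse
  from WhileFalse.prems show ?case by (rule exec_WhileE) (use WhileFalse in blast)+
next
  case WhileTrue
  from WhileTrue.prems show ?case by (rule exec_WhileE) (use WhileTrue in blast)+
qed

fun tag_code :: "tag \<Rightarrow> nat" where
  "tag_code (Start a) = Suc a"
| "tag_code End = 0"

text \<open>The input occupies the external memory from address \<open>0\<close> on, one unit per tag; its length,
  \<open>M\<close> and \<open>B\<close> are given in registers.\<close>

definition initial :: "nat \<Rightarrow> nat \<Rightarrow> tag list \<Rightarrow> config" where
  "initial M B ts =
     \<lparr> regs = (\<lambda>_. 0)(0 := M, 1 := B, 2 := length ts),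
       mem = (\<lambda>_. 0),
       disk = (\<lambda>i. if i < length ts then tag_code (ts ! i) else 0) \<rparr>"

text \<open>The output is an array in external memory, starting at the address in register \<open>0\<close>, whose
  \<open>i\<close>-th entry is the identifier of the block that contains the \<open>i\<close>-th node.\<close>

definition block_id :: "config \<Rightarrow> nat \<Rightarrow> nat" where
  "block_id s i = disk s (regs s 0 + i)"

definition output_partition :: "config \<Rightarrow> 'v list \<Rightarrow> 'v set set" where
  "output_partition s vs =
     {{vs ! j | j. j < length vs \<and> block_id s j = block_id s i} | i. i < length vs}"

text \<open>
  A unit of data holds a value below a fixed power of the number of nodes, the memory size and the
  largest tag name, that is, \<open>O(log (|N| + M + \<sigma>))\<close> bits.
\<close>

definition word_bound :: "nat \<Rightarrow> nat \<Rightarrow> xml \<Rightarrow> nat" where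
  "word_bound k M t =
     (card (nodes (xml_graph t)) + M
        + Max (label (xml_graph t) ` nodes (xml_graph t)) + 2) ^ k"

text \<open>
  \<open>Sort(n) = (n/B) log\<^bsub>M/B\<^esub> (n/B)\<close>. At least one block is counted, and at least one pass over the
  data; for \<open>n \<ge> M\<close> the logarithm is at least \<open>1\<close> anyway and the maximum has no effect.
\<close>

definition Sort :: "nat \<Rightarrow> nat \<Rightarrow> nat \<Rightarrow> real" where
  "Sort M B n =
     real_of_int \<lceil>real n / real B\<rceil> * max 1 (log (real M / real B) (real n / real B))"

end

theory Submission
  imports Defs
begin

text \<open>
  Two nodes of a tree are backward bisimilar iff the label sequences on their paths to the root
  agree, so the task is to name these sequences. At stride \<open>h = 2 ^ lev\<close> we keep the nodes whose
  depth is congruent to a fixed residue modulo \<open>h\<close>, each with a name for its next \<open>h\<close> labels, so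
  that its parent in the contracted forest is its \<open>h\<close>-th ancestor. Of the two residues modulo
  \<open>2 * h\<close> the one with fewer nodes is kept; pairing the name of a node with that of its \<open>h\<close>-th
  ancestor and renaming the pairs by rank moves on to stride \<open>2 * h\<close> with at most half of the nodes.
  In document order the \<open>h\<close>-th ancestor of a node at depth \<open>d\<close> is the last preceding node at depth
  \<open>d - h\<close>, so the pairing needs just one sort and one scan. Once the nodes fit into a window of
  internal memory, their classes are found without further sorting. Ascending again, a dropped
  node is identified by the class of its \<open>h\<close>-th ancestor, which was kept, and its own name. Each
  level costs \<open>O(Sort n)\<close> for its \<open>n\<close> nodes, and the geometric sum over the levels is
  \<open>O(Sort |N|)\<close>.

  Sorting is done by \<open>K\<close>-way merging with \<open>K = \<Theta>(M / B)\<close> windows of \<open>w = \<Theta>(B)\<close> cells. The one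
  block of external memory that is currently cached in internal memory serves all accesses, so
  that loading a window or filling a block costs \<open>O(1)\<close> IOs.
\<close>

section \<open>A cached view of the machine\<close>

text \<open>The class of a node depends on that of its parent, so treating one depth at a time would
  take as many sorts as the tree is deep. Plain path doubling takes only logarithmically many, but
  each of them over all nodes. Dropping the larger residue class makes the arrays shrink
  geometrically, and this removes the extra logarithm. Still, by rounding, each level costs at least
  a constant number of IOs. The descent therefore stops once at most \<open>w\<close> nodes are
  left; before that, the rounding is absorbed by the node count divided by \<open>w\<close>. The
  base case may be quadratic, because computation in internal memory is free in the model.

  Only \<open>2 * B \<le> M\<close> is assumed. Windows of about a quarter of a block allow a fan-in
  of at least 2 next to the cached block even for \<open>M = 2 * B\<close>. From
  \<open>M / B \<le> 8 * K \<le> K ^ 4\<close> it follows that logarithms to base \<open>K\<close>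
  exceed those to base \<open>M / B\<close> by at most a factor of 4.

  Records pack up to five fields below \<open>X\<close> into one number. Together with
  \<open>X \<le> U\<close> and \<open>U = O(|N| + M + \<sigma>)\<close> this explains why a unit of
  data has to hold a fixed power of the input parameters.\<close>

notation Add (infixl "\<oplus>" 65)
notation Sub (infixl "\<ominus>" 65)
notation Mul (infixl "\<otimes>" 70)
notation Div (infixl "\<oslash>" 70)
notation Mod (infixl "\<odot>" 70)
notation Seq (infixr ";;" 60)

text \<open>The cells \<open>0, ..., B - 1\<close> of internal memory hold block \<open>cached\<close> of external memory, and
  \<open>store\<close> is external memory as seen through this cache. The other \<open>M - B\<close> cells, preceded by
  the four registers 100 to 103, form the virtual memory \<open>vmem\<close>; without the extra cells two windows
  would not fit into it for \<open>M = 2\<close> and \<open>B = 1\<close>.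

  Registers: 0 the size \<open>M\<close> and finally the address of the output; 1 the block size; 2 the length
  of the input; 3 the cached block; 4 the window size \<open>w\<close>; 5 the fan-in \<open>K\<close>; 6 the base \<open>X\<close> for
  packing records; 7 and 8 address and length of the current array; 9 the destination; 10 the index of a scan;
  11 the stride; 12 the residue; 13 the level; 14 the size \<open>Z\<close> of a storage area; 15 a saved address;
  20 the current element of a scan; 21 the number of emitted elements; 22 to 25 loading a window; 30
  to 37 local to the bodies of scans; 40 to 47 local to sorting.\<close>

record vstate =
  cost :: nat
  cached :: nat
  reg :: "nat \<Rightarrow> nat"
  vmem :: "nat \<Rightarrow> nat"
  store :: "nat \<Rightarrow> nat"

text \<open>Excluded are the registers that realise the view itself: 3 holds the number of the
  cached block, and 100 to 103 hold the first cells of \<open>vmem\<close>. Their contents are not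
  recorded in \<open>reg\<close>.\<close>

primrec exp_ok :: "exp \<Rightarrow> bool" where
  "exp_ok (Const k) = True"
| "exp_ok (Reg x) = (x < 100 \<and> x \<noteq> 3)"
| "exp_ok (e \<oplus> f) = (exp_ok e \<and> exp_ok f)"
| "exp_ok (e \<ominus> f) = (exp_ok e \<and> exp_ok f)"
| "exp_ok (e \<otimes> f) = (exp_ok e \<and> exp_ok f)"
| "exp_ok (e \<oslash> f) = (exp_ok e \<and> exp_ok f)"
| "exp_ok (e \<odot> f) = (exp_ok e \<and> exp_ok f)"

primrec test_ok :: "test \<Rightarrow> bool" where
  "test_ok (Less e f) = (exp_ok e \<and> exp_ok f)"
| "test_ok (Equal e f) = (exp_ok e \<and> exp_ok f)"
| "test_ok (Neg b) = test_ok b"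
| "test_ok (Conj b c) = (test_ok b \<and> test_ok c)"

text \<open>Register 1 may be read but not written, because the addressing code relies on it being
  the block size.\<close>

definition reg_ok :: "nat \<Rightarrow> bool" where
  "reg_ok x \<longleftrightarrow> x < 100 \<and> x \<noteq> 1 \<and> x \<noteq> 3"

lemma exp_val_cong: "exp_ok e \<Longrightarrow> (\<And>x. x < 100 \<Longrightarrow> x \<noteq> 3 \<Longrightarrow> r x = r' x) \<Longrightarrow> exp_val e r = exp_val e r'"
  by (induction e) auto

lemma test_val_cong: "test_ok c \<Longrightarrow> (\<And>x. x < 100 \<Longrightarrow> x \<noteq> 3 \<Longrightarrow> r x = r' x) \<Longrightarrow> test_val c r = test_val c r'"
proof (induction c)
  case (Less e f)
  then show ?case using exp_val_cong[of e r r'] exp_val_cong[of f r r'] by simp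
next
  case (Equal e f)
  then show ?case using exp_val_cong[of e r r'] exp_val_cong[of f r r'] by simp
qed auto

definition For :: "nat \<Rightarrow> exp \<Rightarrow> prog \<Rightarrow> prog" where
  "For i e p = Assign i (Const 0) ;; While (Less (Reg i) e) (p ;; Assign i (Reg i \<oplus> Const 1))"

definition vload :: "nat \<Rightarrow> exp \<Rightarrow> prog" where
  "vload x e = Cond (Less e (Const 4))
     (Cond (Equal e (Const 0)) (Assign x (Reg 100))
     (Cond (Equal e (Const 1)) (Assign x (Reg 101))
     (Cond (Equal e (Const 2)) (Assign x (Reg 102)) (Assign x (Reg 103)))))
     (Load x (Reg 1 \<oplus> (e \<ominus> Const 4)))"

definition vstore :: "exp \<Rightarrow> exp \<Rightarrow> prog" where
  "vstore e f = Cond (Less e (Const 4))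
     (Cond (Equal e (Const 0)) (Assign 100 f)
     (Cond (Equal e (Const 1)) (Assign 101 f)
     (Cond (Equal e (Const 2)) (Assign 102 f) (Assign 103 f))))
     (Store (Reg 1 \<oplus> (e \<ominus> Const 4)) f)"

text \<open>No dirty bit is kept: the old block is always written back, so each change of block
  costs exactly two IOs.\<close>

definition switch :: "exp \<Rightarrow> prog" where
  "switch e = Cond (Equal (e \<oslash> Reg 1) (Reg 3)) Skip
     (WriteBlock (Reg 3) (Const 0) ;; ReadBlock (e \<oslash> Reg 1) (Const 0) ;; Assign 3 (e \<oslash> Reg 1))"

definition cell_read :: "nat \<Rightarrow> exp \<Rightarrow> prog" where
  "cell_read x e = switch e ;; Load x (e \<odot> Reg 1)"

definition cell_write :: "exp \<Rightarrow> exp \<Rightarrow> prog" where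
  "cell_write e f = switch e ;; Store (e \<odot> Reg 1) f"

section \<open>Simulation by the cached view, and a weakest-precondition calculus that counts
  IOs\<close>

locale machine =
  fixes M B W :: nat
  assumes B_pos: "1 \<le> B" and M_ge: "2 * B \<le> M"
begin

abbreviation vsize :: nat where "vsize \<equiv> 4 + M - B"

text \<open>The bound \<open>W\<close> is stated only for the register-backed cells: these are read
  by \<open>Assign\<close>, which checks its value, whereas \<open>Load\<close> accepts any cell
  content.\<close>

definition rep :: "config \<Rightarrow> vstate \<Rightarrow> bool" where
  "rep s v \<longleftrightarrow> (\<forall>x<100. x \<noteq> 3 \<longrightarrow> regs s x = reg v x) \<and> regs s 3 = cached v \<and> reg v 1 = B \<and>
     (\<forall>x<4. regs s (100 + x) = vmem v x \<and> vmem v x < W) \<and>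
     (\<forall>x. 4 \<le> x \<longrightarrow> x < vsize \<longrightarrow> mem s (B + (x - 4)) = vmem v x) \<and>
     (\<forall>i. store v i = (if i div B = cached v then mem s (i mod B) else disk s i))"

text \<open>Total correctness, including the absence of stuck states. The ghost field
  \<open>cost\<close> has to advance by exactly the number of IOs performed, so bounds on IOs can be
  part of \<open>Q\<close>.\<close>

definition wp :: "prog \<Rightarrow> (vstate \<Rightarrow> bool) \<Rightarrow> vstate \<Rightarrow> bool" where
  "wp p Q v \<longleftrightarrow> (\<forall>s. rep s v \<longrightarrow>
     (\<exists>q s' v'. exec M B W p s q s' \<and> rep s' v' \<and> cost v' = cost v + q \<and> Q v'))"

definition touch :: "nat \<Rightarrow> vstate \<Rightarrow> vstate" where
  "touch a v = v\<lparr>cost := cost v + (if a div B = cached v then 0 else 2), cached := a div B\<rparr>"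

lemma touch_sel [simp]: "reg (touch a v) = reg v" "vmem (touch a v) = vmem v" "store (touch a v) = store v"
  "cached (touch a v) = a div B"
  by (simp_all add: touch_def)

lemma repD:
  assumes "rep s v"
  shows "x < 100 \<Longrightarrow> x \<noteq> 3 \<Longrightarrow> regs s x = reg v x" "regs s 3 = cached v" "regs s (Suc 0) = B" "reg v (Suc 0) = B"
    "x < 4 \<Longrightarrow> regs s (100 + x) = vmem v x" "x < 4 \<Longrightarrow> vmem v x < W"
    "4 \<le> x \<Longrightarrow> x < vsize \<Longrightarrow> mem s (B + (x - 4)) = vmem v x"
    "store v i = (if i div B = cached v then mem s (i mod B) else disk s i)"
  using assms unfolding rep_def by auto

lemma wp_mono: "wp p Q v \<Longrightarrow> (\<And>v'. Q v' \<Longrightarrow> Q' v') \<Longrightarrow> wp p Q' v"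
  unfolding wp_def by metis

lemma wp_Skip: "Q v \<Longrightarrow> wp Skip Q v"
  unfolding wp_def by (metis exec.Skip add_0_right)

lemma wp_Assign:
  assumes "exp_ok e" "reg_ok x" "exp_val e (reg v) < W" "Q (v\<lparr>reg := (reg v)(x := exp_val e (reg v))\<rparr>)"
  shows "wp (Assign x e) Q v"
  unfolding wp_def
proof (intro allI impI)
  fix s assume r: "rep s v"
  have e: "exp_val e (regs s) = exp_val e (reg v)"
    by (rule exp_val_cong[OF assms(1)]) (use repD[OF r] in auto)
  have "exec M B W (Assign x e) s 0 (s\<lparr>regs := (regs s)(x := exp_val e (regs s))\<rparr>)"
    by (rule exec.Assign) (simp add: e assms)
  moreover have "rep (s\<lparr>regs := (regs s)(x := exp_val e (regs s))\<rparr>) (v\<lparr>reg := (reg v)(x := exp_val e (reg v))\<rparr>)"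
    using r assms(2) unfolding rep_def reg_ok_def by (auto simp: e)
  ultimately show "\<exists>q s' v'. exec M B W (Assign x e) s q s' \<and> rep s' v' \<and> cost v' = cost v + q \<and> Q v'"
    using assms(4) by (metis add_0_right vstate.select_convs(1) vstate.update_convs(3) vstate.surjective)
qed

lemma wp_Seq: "wp p1 (wp p2 Q) v \<Longrightarrow> wp (p1 ;; p2) Q v"
  unfolding wp_def by (metis exec.Seq add.assoc)

lemma wp_Cond:
  assumes "test_ok c" "test_val c (reg v) \<Longrightarrow> wp p1 Q v" "\<not> test_val c (reg v) \<Longrightarrow> wp p2 Q v"
  shows "wp (Cond c p1 p2) Q v"
  unfolding wp_def
proof (intro allI impI)
  fix s assume r: "rep s v"
  have "test_val c (regs s) = test_val c (reg v)"
    by (rule test_val_cong[OF assms(1)]) (use repD[OF r] in auto)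
  with r assms(2,3) show "\<exists>q s' v'. exec M B W (Cond c p1 p2) s q s' \<and> rep s' v' \<and> cost v' = cost v + q \<and> Q v'"
    unfolding wp_def by (metis exec.CondTrue exec.CondFalse)
qed

lemma wp_While:
  fixes I :: "vstate \<Rightarrow> bool" and f :: "vstate \<Rightarrow> nat"
  assumes "test_ok c" "I v"
    and step: "\<And>v. I v \<Longrightarrow> test_val c (reg v) \<Longrightarrow> wp p (\<lambda>v'. I v' \<and> f v' < f v) v"
    and fin: "\<And>v. I v \<Longrightarrow> \<not> test_val c (reg v) \<Longrightarrow> Q v"
  shows "wp (While c p) Q v"
  using assms(2)
proof (induction "f v" arbitrary: v rule: less_induct)
  case less
  show ?case unfolding wp_def
  proof (intro allI impI)
    fix s assume r: "rep s v"
    have t: "test_val c (regs s) = test_val c (reg v)"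
      by (rule test_val_cong[OF assms(1)]) (use repD[OF r] in auto)
    show "\<exists>q s' v'. exec M B W (While c p) s q s' \<and> rep s' v' \<and> cost v' = cost v + q \<and> Q v'"
    proof (cases "test_val c (reg v)")
      case True
      from step[OF less.prems True] r obtain q s' v' where
        1: "exec M B W p s q s'" "rep s' v'" "cost v' = cost v + q" "I v'" "f v' < f v"
        unfolding wp_def by blast
      from less.hyps[OF 1(5,4)] 1(2) obtain q2 s2 v2 where
        2: "exec M B W (While c p) s' q2 s2" "rep s2 v2" "cost v2 = cost v' + q2" "Q v2"
        unfolding wp_def by blast
      have "exec M B W (While c p) s (q + q2) s2"
        using exec.WhileTrue[of c s] t True 1(1) 2(1) by auto
      then show ?thesis using 1 2 by (metis add.assoc)
    next
      case False
      then show ?thesis using exec.WhileFalse[of c s M B W p] t r fin[OF less.prems] by (metis add_0_right)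
    qed
  qed
qed

text \<open>The bound \<open>e\<close> is evaluated again at every turn, so the invariant has to fix
  its value \<open>n\<close>; the body has to leave the counter alone.\<close>

lemma wp_For:
  fixes I :: "nat \<Rightarrow> vstate \<Rightarrow> bool"
  assumes "exp_ok e" "reg_ok i" "n < W" "0 < W"
    and init: "I 0 (v\<lparr>reg := (reg v)(i := 0)\<rparr>)"
    and idx: "\<And>k v. I k v \<Longrightarrow> k \<le> n \<Longrightarrow> reg v i = k \<and> exp_val e (reg v) = n"
    and step: "\<And>k v. I k v \<Longrightarrow> k < n \<Longrightarrow>
      wp p (\<lambda>v'. reg v' i = k \<and> I (Suc k) (v'\<lparr>reg := (reg v')(i := Suc k)\<rparr>)) v"
    and fin: "\<And>v. I n v \<Longrightarrow> Q v"
  shows "wp (For i e p) Q v"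
  unfolding For_def
proof (rule wp_Seq, rule wp_Assign)
  let ?J = "\<lambda>v. I (reg v i) v \<and> reg v i \<le> n"
  have r: "exp_ok (Reg i)" "i < 100" using assms(2) by (auto simp: reg_ok_def)
  show "wp (While (Less (Reg i) e) (p ;; Assign i (Reg i \<oplus> Const 1))) Q
    (v\<lparr>reg := (reg v)(i := exp_val (Const 0) (reg v))\<rparr>)"
  proof (rule wp_While[where I = ?J and f = "\<lambda>v. n - reg v i"])
    show "test_ok (Less (Reg i) e)" using assms(1) r by simp
    show "?J (v\<lparr>reg := (reg v)(i := exp_val (Const 0) (reg v))\<rparr>)" using init by simp
  next
    fix v assume J: "?J v" and t: "test_val (Less (Reg i) e) (reg v)"
    then have lt: "reg v i < n" using idx[of "reg v i" v] by simp
    show "wp (p ;; Assign i (Reg i \<oplus> Const 1)) (\<lambda>v'. ?J v' \<and> n - reg v' i < n - reg v i) v"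
    proof (rule wp_Seq, rule wp_mono[OF step[of "reg v i" v]])
      show "I (reg v i) v" using J by simp
    next
      fix v' assume v': "reg v' i = reg v i \<and> I (Suc (reg v i)) (v'\<lparr>reg := (reg v')(i := Suc (reg v i))\<rparr>)"
      show "wp (Assign i (Reg i \<oplus> Const 1)) (\<lambda>v'. ?J v' \<and> n - reg v' i < n - reg v i) v'"
        by (rule wp_Assign) (use v' lt assms(2,3) r in simp_all)
    qed (fact lt)
  next
    fix v assume J: "?J v" and t: "\<not> test_val (Less (Reg i) e) (reg v)"
    then have "reg v i = n" using idx[of "reg v i" v] by simp
    then show "Q v" using fin[of v] J by simp
  qed
qed (use assms(2,4) in simp_all)

lemma wp_vload:
  assumes "exp_ok e" "reg_ok x" "exp_val e (reg v) < vsize" "Q (v\<lparr>reg := (reg v)(x := vmem v (exp_val e (reg v)))\<rparr>)"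
  shows "wp (vload x e) Q v"
  unfolding wp_def
proof (intro allI impI)
  fix s assume r: "rep s v"
  let ?a = "exp_val e (reg v)" and ?s = "s\<lparr>regs := (regs s)(x := vmem v (exp_val e (reg v)))\<rparr>"
  have e: "exp_val e (regs s) = ?a"
    by (rule exp_val_cong[OF assms(1)]) (use repD[OF r] in auto)
  have "exec M B W (vload x e) s 0 ?s"
  proof (cases "?a < 4")
    case True
    have A: "exec M B W (Assign x (Reg (100 + a))) s 0 (s\<lparr>regs := (regs s)(x := vmem v a)\<rparr>)" if "a < 4" for a
      using exec.Assign[of "Reg (100 + a)" s W M B x] repD(5,6)[OF r that] by simp
    from True have "?a = 0 \<or> ?a = 1 \<or> ?a = 2 \<or> ?a = 3" by arith
    then show ?thesis
      unfolding vload_def using A[of 0] A[of 1] A[of 2] A[of 3] e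
      by (elim disjE) (simp_all add: exec.CondTrue exec.CondFalse)
  next
    case False
    have "exec M B W (Load x (Reg 1 \<oplus> (e \<ominus> Const 4))) s 0 ?s"
      using exec.Load[where e="Reg 1 \<oplus> (e \<ominus> Const 4)" and s=s and M=M and x=x] False assms(3) M_ge e repD(3)[OF r] repD(7)[OF r, of ?a] by simp
    then show ?thesis unfolding vload_def using False e by (simp add: exec.CondFalse)
  qed
  moreover have "rep ?s (v\<lparr>reg := (reg v)(x := vmem v (exp_val e (reg v)))\<rparr>)"
    using r assms(2) unfolding rep_def reg_ok_def by auto
  ultimately show "\<exists>q s' v'. exec M B W (vload x e) s q s' \<and> rep s' v' \<and> cost v' = cost v + q \<and> Q v'"
    using assms(4) by (metis add_0_right vstate.select_convs(1) vstate.update_convs(3) vstate.surjective)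
qed

lemma wp_vstore:
  assumes "exp_ok e" "exp_ok f" "exp_val e (reg v) < vsize" "exp_val f (reg v) < W"
    "Q (v\<lparr>vmem := (vmem v)(exp_val e (reg v) := exp_val f (reg v))\<rparr>)"
  shows "wp (vstore e f) Q v"
  unfolding wp_def
proof (intro allI impI)
  fix s assume r: "rep s v"
  let ?a = "exp_val e (reg v)" and ?b = "exp_val f (reg v)"
  let ?v = "v\<lparr>vmem := (vmem v)(?a := ?b)\<rparr>"
  have e: "exp_val e (regs s) = ?a" "exp_val f (regs s) = ?b"
    by (rule exp_val_cong[OF assms(1)] exp_val_cong[OF assms(2)]; use repD[OF r] in auto)+
  have "\<exists>s'. exec M B W (vstore e f) s 0 s' \<and> rep s' ?v"
  proof (cases "?a < 4")
    case True
    have A: "exec M B W (Assign x f) s 0 (s\<lparr>regs := (regs s)(x := ?b)\<rparr>)" for x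
      using exec.Assign[of f s W M B x] e assms(4) by simp
    from True have "?a = 0 \<or> ?a = 1 \<or> ?a = 2 \<or> ?a = 3" by arith
    then have "exec M B W (vstore e f) s 0 (s\<lparr>regs := (regs s)(100 + ?a := ?b)\<rparr>)"
      unfolding vstore_def using A[of 100] A[of 101] A[of 102] A[of 103] e
      by (elim disjE) (simp_all add: exec.CondTrue exec.CondFalse)
    moreover have "rep (s\<lparr>regs := (regs s)(100 + ?a := ?b)\<rparr>) ?v"
      using r assms(4) True unfolding rep_def by auto
    ultimately show ?thesis by blast
  next
    case False
    let ?s = "s\<lparr>mem := (mem s)(B + (?a - 4) := ?b)\<rparr>"
    have "exec M B W (Store (Reg 1 \<oplus> (e \<ominus> Const 4)) f) s 0 ?s"
      using exec.Store[of "Reg 1 \<oplus> (e \<ominus> Const 4)" s M f W B] False assms(3,4) M_ge e repD(3)[OF r] by simp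
    then have "exec M B W (vstore e f) s 0 ?s" unfolding vstore_def using False e by (simp add: exec.CondFalse)
    \<comment> \<open>The cached block occupies the offsets below \<open>B\<close> and the virtual
      cells those from \<open>B\<close> on, so updating one leaves the other intact.\<close>
    moreover have ne: "i mod B \<noteq> B + j" for i j using mod_less_divisor[of B i] B_pos by linarith
    have "rep ?s ?v"
      using r False ne[of _ "?a - 4"] unfolding rep_def by (auto simp del: diff_add_assoc2 add_diff_assoc)
    ultimately show ?thesis by blast
  qed
  then show "\<exists>q s' v'. exec M B W (vstore e f) s q s' \<and> rep s' v' \<and> cost v' = cost v + q \<and> Q v'"
    using assms(5) by (metis add_0_right vstate.select_convs(1) vstate.update_convs(4) vstate.surjective)
qed

lemma block_arith:
  fixes i :: nat
  shows "(b * B \<le> i \<and> i < b * B + B) \<longleftrightarrow> i div B = b"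
    and "i - (i div B) * B = i mod B" "(i div B) * B + i mod B = i"
proof -
  show "(b * B \<le> i \<and> i < b * B + B) \<longleftrightarrow> i div B = b"
  proof
    assume "b * B \<le> i \<and> i < b * B + B"
    then have "i = b * B + (i - b * B)" "i - b * B < B" by auto
    then show "i div B = b" using B_pos
      by (metis add.right_neutral div_less div_mult_self3 not_one_le_zero)
  next
    assume "i div B = b"
    then show "b * B \<le> i \<and> i < b * B + B"
      using B_pos dividend_less_div_times[of B i] div_times_less_eq_dividend[of i B] by (auto simp: add.commute)
  qed
qed (simp_all add: minus_div_mult_eq_mod)

lemma wp_switch:
  assumes "exp_ok e" "exp_val e (reg v) div B < W" "Q (touch (exp_val e (reg v)) v)"
  shows "wp (switch e) Q v"
  unfolding wp_def
proof (intro allI impI)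
  fix s assume r: "rep s v"
  let ?a = "exp_val e (reg v)"
  have e: "exp_val e rs = ?a" if "rs = regs s" for rs unfolding that
    by (rule exp_val_cong[OF assms(1)]) (use repD[OF r] in auto)
  note rr = repD(2,3)[OF r]
  show "\<exists>q s' v'. exec M B W (switch e) s q s' \<and> rep s' v' \<and> cost v' = cost v + q \<and> Q v'"
  proof (cases "?a div B = cached v")
    case True
    then have "touch ?a v = v" by (simp add: touch_def)
    moreover have "exec M B W (switch e) s 0 s"
      unfolding switch_def using True e[OF refl] rr by (auto intro!: exec.CondTrue exec.Skip)
    ultimately show ?thesis using assms(3) r by (metis add_0_right)
  next
    case False
    let ?c = "cached v" and ?b = "?a div B"
    define s1 where "s1 = s\<lparr>disk := (\<lambda>i. if ?c * B \<le> i \<and> i < ?c * B + B then mem s (0 + (i - ?c * B)) else disk s i)\<rparr>"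
    define s2 where "s2 = s1\<lparr>mem := (\<lambda>i. if 0 \<le> i \<and> i < 0 + B then disk s1 (?b * B + (i - 0)) else mem s1 i)\<rparr>"
    define s3 where "s3 = s2\<lparr>regs := (regs s2)(3 := ?b)\<rparr>"
    have x1: "exec M B W (WriteBlock (Reg 3) (Const 0)) s 1 s1"
      unfolding s1_def using rr M_ge by (intro exec.WriteBlock) auto
    have x2: "exec M B W (ReadBlock (e \<oslash> Reg 1) (Const 0)) s1 1 s2"
      unfolding s2_def using rr M_ge e[of "regs s1"] by (intro exec.ReadBlock) (auto simp: s1_def)
    have x3: "exec M B W (Assign 3 (e \<oslash> Reg 1)) s2 0 s3"
      using exec.Assign[of "e \<oslash> Reg 1" s2 W M B 3] rr e[of "regs s2"] assms(2)
      by (simp add: s3_def s2_def s1_def)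
    have x123: "exec M B W (switch e) s (1 + (1 + 0)) s3"
      unfolding switch_def using False e[OF refl] rr
      by (intro exec.CondFalse exec.Seq[OF x1] exec.Seq[OF x2] x3) auto
    \<comment> \<open>After the write-back, external memory equals \<open>store\<close> everywhere,
      so any block can be read in without changing the view.\<close>
    have d1: "disk s1 i = store v i" for i
      using repD(8)[OF r, of i] block_arith(1)[of ?c i] block_arith(2)[of i] by (auto simp: s1_def)
    have m: "i mod B < B" for i using B_pos by auto
    have "store v i = (if i div B = ?b then mem s3 (i mod B) else disk s3 i)" for i
    proof (cases "i div B = ?b")
      case True
      then have "mem s3 (i mod B) = disk s1 i"
        using m[of i] block_arith(3)[of i] by (simp add: s3_def s2_def)
      then show ?thesis using True d1 by simp
    next
      case False
      then show ?thesis using d1 by (simp add: s3_def s2_def)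
    qed
    moreover have "mem s3 (B + j - 4) = mem s (B + j - 4)" if "4 \<le> j" for j
      using that by (auto simp: s3_def s2_def s1_def)
    moreover have "regs s3 = (regs s)(3 := ?b)" by (simp add: s3_def s2_def s1_def)
    ultimately have "rep s3 (touch ?a v)"
      using r unfolding rep_def by simp
    with x123 show ?thesis using assms(3) False by (intro exI[of _ "1 + (1 + 0)"] exI[of _ s3] exI[of _ "touch ?a v"]) (simp add: touch_def)
  qed
qed

lemma wp_cell_load:
  assumes "exp_ok e" "reg_ok x" "exp_val e (reg v) div B = cached v" "Q (v\<lparr>reg := (reg v)(x := store v (exp_val e (reg v)))\<rparr>)"
  shows "wp (Load x (e \<odot> Reg 1)) Q v"
  unfolding wp_def
proof (intro allI impI)
  fix s assume r: "rep s v"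
  have e: "exp_val e (regs s) = exp_val e (reg v)"
    by (rule exp_val_cong[OF assms(1)]) (use repD[OF r] in auto)
  let ?a = "exp_val e (reg v)"
  have l: "?a mod B < M" using mod_less_divisor[of B ?a] B_pos M_ge by linarith
  have "exec M B W (Load x (e \<odot> Reg 1)) s 0 (s\<lparr>regs := (regs s)(x := store v ?a)\<rparr>)"
    using exec.Load[where e="e \<odot> Reg 1" and s=s and M=M and x=x] e l repD(3)[OF r] repD(8)[OF r, of ?a] assms(3) by simp
  moreover have "rep (s\<lparr>regs := (regs s)(x := store v ?a)\<rparr>) (v\<lparr>reg := (reg v)(x := store v ?a)\<rparr>)"
    using r assms(2) unfolding rep_def reg_ok_def by auto
  ultimately show "\<exists>q s' v'. exec M B W (Load x (e \<odot> Reg 1)) s q s' \<and> rep s' v' \<and> cost v' = cost v + q \<and> Q v'"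
    using assms(4) by (metis add_0_right vstate.select_convs(1) vstate.update_convs(3) vstate.surjective)
qed

lemma wp_cell_store:
  assumes "exp_ok e" "exp_ok f" "exp_val e (reg v) div B = cached v" "exp_val f (reg v) < W"
    "Q (v\<lparr>store := (store v)(exp_val e (reg v) := exp_val f (reg v))\<rparr>)"
  shows "wp (Store (e \<odot> Reg 1) f) Q v"
  unfolding wp_def
proof (intro allI impI)
  fix s assume r: "rep s v"
  let ?a = "exp_val e (reg v)" and ?b = "exp_val f (reg v)"
  have e: "exp_val e (regs s) = ?a" "exp_val f (regs s) = ?b"
    by (rule exp_val_cong[OF assms(1)] exp_val_cong[OF assms(2)]; use repD[OF r] in auto)+
  have lB: "?a mod B < B" using B_pos by simp
  have l: "?a mod B < M" using lB M_ge by linarith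
  let ?s = "s\<lparr>mem := (mem s)(?a mod B := ?b)\<rparr>"
  have "exec M B W (Store (e \<odot> Reg 1) f) s 0 ?s"
    using exec.Store[of "e \<odot> Reg 1" s M f W B] e l repD(3)[OF r] assms(4) by simp
  moreover have "i mod B = ?a mod B \<longleftrightarrow> i = ?a" if "i div B = cached v" for i
    using that assms(3) block_arith(3)[of i] block_arith(3)[of ?a] by metis
  then have "rep ?s (v\<lparr>store := (store v)(?a := ?b)\<rparr>)"
    using r lB assms(3) unfolding rep_def by auto
  ultimately show "\<exists>q s' v'. exec M B W (Store (e \<odot> Reg 1) f) s q s' \<and> rep s' v' \<and> cost v' = cost v + q \<and> Q v'"
    using assms(5) by (metis add_0_right vstate.select_convs(1) vstate.update_convs(5) vstate.surjective)
qed

lemma wp_cell_read: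
  assumes "exp_ok e" "reg_ok x" "exp_val e (reg v) div B < W"
    "Q ((touch (exp_val e (reg v)) v)\<lparr>reg := (reg v)(x := store v (exp_val e (reg v)))\<rparr>)"
  shows "wp (cell_read x e) Q v"
  unfolding cell_read_def using assms by (intro wp_Seq wp_switch wp_cell_load) simp_all

lemma wp_cell_write:
  assumes "exp_ok e" "exp_ok f" "exp_val e (reg v) div B < W" "exp_val f (reg v) < W"
    "Q ((touch (exp_val e (reg v)) v)\<lparr>store := (store v)(exp_val e (reg v) := exp_val f (reg v))\<rparr>)"
  shows "wp (cell_write e f) Q v"
  unfolding cell_write_def using assms by (intro wp_Seq wp_switch wp_cell_store) simp_all

text \<open>Potential of a sequential access at address \<open>a\<close>: an access that raises \<open>a\<close> by one is paid by
  the growth of the potential, while accesses elsewhere that evict the block cost at most 2 more each time.\<close>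

definition credit :: "nat \<Rightarrow> vstate \<Rightarrow> nat" where
  "credit a v = 4 * (a div B) + (if cached v = a div B then 2 else 0)"

lemma credit_bounds: "4 * (a div B) \<le> credit a v" "credit a v \<le> 4 * (a div B) + 2"
  by (auto simp: credit_def)

end

section \<open>Windows and scans\<close>

definition emit :: "exp \<Rightarrow> prog" where
  "emit e = cell_write (Reg 9 \<oplus> Reg 21) e ;; Assign 21 (Reg 21 \<oplus> Const 1)"

text \<open>Cells past the end of the array are filled with 0. The elements to be sorted are
  positive, so such a cell never exceeds the last output of a merge.\<close>

definition loadwin :: prog where
  "loadwin = For 22 (Reg 4)
     (Cond (Less (Reg 25 \<oplus> Reg 22) (Reg 7 \<oplus> Reg 8)) (cell_read 23 (Reg 25 \<oplus> Reg 22)) (Assign 23 (Const 0)) ;;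
      vstore (Reg 24 \<oplus> Reg 22) (Reg 23))"

definition get :: prog where
  "get = Cond (Equal (Reg 10 \<odot> Reg 4) (Const 0))
       (Assign 24 (Const 0) ;; Assign 25 (Reg 7 \<oplus> Reg 10) ;; loadwin) Skip ;;
     vload 20 (Reg 10 \<odot> Reg 4)"

definition scan :: "prog \<Rightarrow> prog" where
  "scan p = For 10 (Reg 8) (get ;; p)"

text \<open>\<open>U\<close> is the scale of all sizes: fields of records stay below
  \<open>X \<le> U\<close>, so records of five fields stay below \<open>U ^ 5\<close>, and array
  addresses are kept within a constant multiple of it. The sixth factor in \<open>UW\<close> absorbs
  the constants.\<close>

locale buffered = machine +
  fixes w K U :: nat
  assumes w_pos: "1 \<le> w" and w_le: "w \<le> B" and K_ge: "2 \<le> K" and fit: "K * (w + 1) \<le> 4 + M - B"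
    and wU: "w \<le> U" and KU: "K \<le> U" and U10: "10 \<le> U" and UW: "U ^ 6 \<le> W"
begin

text \<open>Neighbouring powers are a factor of 10 apart, so \<open>linarith\<close> can compare
  sums of lower powers with \<open>W\<close> without nonlinear reasoning.\<close>

lemma U_bounds: "10 * U ^ 5 \<le> W" "10 * U ^ 4 \<le> U ^ 5" "10 * U ^ 3 \<le> U ^ 4" "10 * U ^ 2 \<le> U ^ 3" "10 * U \<le> U ^ 2"
proof -
  have *: "10 * U ^ k \<le> U ^ Suc k" for k using mult_le_mono1[OF U10, of "U ^ k"] by simp
  show "10 * U ^ 5 \<le> W" using *[of 5] UW by simp
  show "10 * U ^ 4 \<le> U ^ 5" "10 * U ^ 3 \<le> U ^ 4" "10 * U ^ 2 \<le> U ^ 3" "10 * U \<le> U ^ 2"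
    using *[of 4] *[of 3] *[of 2] *[of 1] by (simp_all add: eval_nat_numeral)
qed

lemma small: "x \<le> 9 * U ^ 5 \<Longrightarrow> x < W"
  using U_bounds(1-5) U10 by linarith

lemma W_pos: "0 < W" using small[of 0] by simp

lemma fit': "2 * w + 2 \<le> vsize"
  using fit mult_le_mono1[OF K_ge, of "w + 1"] by simp

lemma div_less_W: "x \<le> 9 * U ^ 5 \<Longrightarrow> x div B < W"
  using small[of "x div B"] div_le_dividend[of x B] by linarith

lemma credit_mono: "credit a v \<le> credit (Suc a) v"
  unfolding credit_def by (auto simp: div_Suc)

text \<open>A window of \<open>w \<le> B\<close> cells crosses at most one block boundary. The 6
  consists of 4 for this step of the potential and at most 2 for the block that is cached at the
  end.\<close>

lemma wp_loadwin:
  assumes rg4: "reg v 4 = w" and slot: "reg v 24 + w \<le> vsize" and a: "reg v 25 \<le> 2 * U ^ 5"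
    and dW: "\<And>i. reg v 25 \<le> i \<Longrightarrow> i < reg v 7 + reg v 8 \<Longrightarrow> i < reg v 25 + w \<Longrightarrow> store v i < W"
    and Q: "\<And>v'. (\<forall>x. x \<noteq> 22 \<longrightarrow> x \<noteq> 23 \<longrightarrow> reg v' x = reg v x) \<Longrightarrow> store v' = store v \<Longrightarrow>
      (\<forall>j<w. vmem v' (reg v 24 + j) = (if reg v 25 + j < reg v 7 + reg v 8 then store v (reg v 25 + j) else 0)) \<Longrightarrow>
      (\<forall>x. x < reg v 24 \<or> reg v 24 + w \<le> x \<longrightarrow> vmem v' x = vmem v x) \<Longrightarrow>
      cost v' \<le> cost v + 6 \<Longrightarrow> Q v'"
  shows "wp loadwin Q v"
proof -
  define s where "s = reg v 24"
  define b where "b = reg v 25"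
  define e where "e = reg v 7 + reg v 8"
  let ?J = "\<lambda>k u. reg u 22 = k \<and> (\<forall>x. x \<noteq> 22 \<longrightarrow> x \<noteq> 23 \<longrightarrow> reg u x = reg v x) \<and> store u = store v \<and>
      (\<forall>j<k. vmem u (s + j) = (if b + j < e then store v (b + j) else 0)) \<and>
      (\<forall>x. x < s \<or> s + k \<le> x \<longrightarrow> vmem u x = vmem v x) \<and>
      cost u + 4 * (b div B) \<le> cost v + credit (b + k) u"
  show ?thesis unfolding loadwin_def
  proof (rule wp_For[where n = w and I = ?J])
    show "w < W" using small[of w] wU U_bounds by linarith
    show "0 < W" by (rule W_pos)
    show "?J 0 (v\<lparr>reg := (reg v)(22 := 0)\<rparr>)"
      using credit_bounds(1)[of b v] by (simp add: credit_def)
    show "reg u 22 = k \<and> exp_val (Reg 4) (reg u) = w" if "?J k u" "k \<le> w" for k u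
      using that rg4 by simp
  next
    fix k u assume J: "?J k u" and k: "k < w"
    have r: "reg u 24 = s" "reg u 25 = b" "reg u 7 + reg u 8 = e" "reg u 22 = k"
      using J by (auto simp: s_def b_def e_def)
    have bk: "b + k \<le> 9 * U ^ 5" using a k wU U_bounds(1-5) unfolding b_def by linarith
    have P: "wp (vstore (Reg 24 \<oplus> Reg 22) (Reg 23)) (\<lambda>v'. reg v' 22 = k \<and> ?J (Suc k) (v'\<lparr>reg := (reg v')(22 := Suc k)\<rparr>)) u'"
      if "\<forall>x. x \<noteq> 23 \<longrightarrow> reg u' x = reg u x" "reg u' 23 = (if b + k < e then store v (b + k) else 0)"
        "store u' = store v" "vmem u' = vmem u" "cost u' + 4 * (b div B) \<le> cost v + credit (b + Suc k) u'" for u'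
    proof (rule wp_vstore)
      show "exp_val (Reg 24 \<oplus> Reg 22) (reg u') < vsize" using that(1) r slot k s_def by simp
      show "exp_val (Reg 23) (reg u') < W" using that(2) dW[of "b + k"] k W_pos by (simp add: b_def e_def)
      show "reg (u'\<lparr>vmem := (vmem u')(exp_val (Reg 24 \<oplus> Reg 22) (reg u') := exp_val (Reg 23) (reg u'))\<rparr>) 22 = k \<and>
        ?J (Suc k) (u'\<lparr>vmem := (vmem u')(exp_val (Reg 24 \<oplus> Reg 22) (reg u') := exp_val (Reg 23) (reg u'))\<rparr>
          \<lparr>reg := (reg (u'\<lparr>vmem := (vmem u')(exp_val (Reg 24 \<oplus> Reg 22) (reg u') := exp_val (Reg 23) (reg u'))\<rparr>))(22 := Suc k)\<rparr>)"
        using that J r by (auto simp: less_Suc_eq credit_def)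
    qed simp_all
    show "wp (Cond (Less (Reg 25 \<oplus> Reg 22) (Reg 7 \<oplus> Reg 8)) (cell_read 23 (Reg 25 \<oplus> Reg 22)) (Assign 23 (Const 0)) ;;
      vstore (Reg 24 \<oplus> Reg 22) (Reg 23)) (\<lambda>v'. reg v' 22 = k \<and> ?J (Suc k) (v'\<lparr>reg := (reg v')(22 := Suc k)\<rparr>)) u"
    proof (rule wp_Seq, rule wp_Cond)
      assume t: "test_val (Less (Reg 25 \<oplus> Reg 22) (Reg 7 \<oplus> Reg 8)) (reg u)"
      have c: "cost u + 4 * (b div B) \<le> cost v + credit (b + k) u" using J by simp
      \<comment> \<open>If the block is not cached, its two IOs are covered by the increase of the
        credit: by 2 if the next address lies in the same block, by 4 otherwise.\<close>
      have "cost (touch (b + k) u) + 4 * (b div B) \<le> cost v + credit (Suc (b + k)) (touch (b + k) u)"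
        using c unfolding credit_def touch_def by (auto simp: div_Suc)
      then show "wp (cell_read 23 (Reg 25 \<oplus> Reg 22)) (wp (vstore (Reg 24 \<oplus> Reg 22) (Reg 23))
          (\<lambda>v'. reg v' 22 = k \<and> ?J (Suc k) (v'\<lparr>reg := (reg v')(22 := Suc k)\<rparr>))) u"
        using t r J bk by (intro wp_cell_read P div_less_W) (auto simp: reg_ok_def credit_def)
    next
      assume t: "\<not> test_val (Less (Reg 25 \<oplus> Reg 22) (Reg 7 \<oplus> Reg 8)) (reg u)"
      have "cost u + 4 * (b div B) \<le> cost v + credit (Suc (b + k)) u"
        using J credit_mono[of "b + k" u] by linarith
      then show "wp (Assign 23 (Const 0)) (wp (vstore (Reg 24 \<oplus> Reg 22) (Reg 23))
          (\<lambda>v'. reg v' 22 = k \<and> ?J (Suc k) (v'\<lparr>reg := (reg v')(22 := Suc k)\<rparr>))) u"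
        using t r J W_pos by (intro wp_Assign P) (auto simp: reg_ok_def credit_def)
    qed simp
  next
    fix u assume J: "?J w u"
    have "(b + w) div B \<le> b div B + 1"
      using div_le_mono[OF add_left_mono[OF w_le], of b B] B_pos by simp
    then have "credit (b + w) u \<le> 4 * (b div B) + 6"
      using credit_bounds(2)[of "b + w" u] by linarith
    then have "cost u \<le> cost v + 6" using J by linarith
    then show "Q u" using J by (intro Q) (auto simp: s_def b_def e_def)
  qed (simp_all add: reg_ok_def)
qed

text \<open>\<open>ys\<close> has been written from \<open>dst\<close> on, and apart from an account \<open>z\<close> the cost is covered by the
  potential.\<close>

definition writing :: "nat \<Rightarrow> nat \<Rightarrow> (nat \<Rightarrow> nat) \<Rightarrow> nat list \<Rightarrow> vstate \<Rightarrow> bool" where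
  "writing dst z old ys v \<longleftrightarrow> reg v 9 = dst \<and> reg v 21 = length ys \<and>
     (\<forall>i. store v i = (if dst \<le> i \<and> i < dst + length ys then ys ! (i - dst) else old i)) \<and>
     cost v + 4 * (dst div B) \<le> z + credit (dst + length ys) v"

lemma writing_reg: "writing dst z old ys v \<Longrightarrow> r 9 = reg v 9 \<Longrightarrow> r 21 = reg v 21 \<Longrightarrow> writing dst z old ys (v\<lparr>reg := r\<rparr>)"
  by (simp add: writing_def credit_def)

lemma writing_vmem [simp]: "writing dst z old ys (v\<lparr>vmem := m\<rparr>) = writing dst z old ys v"
  by (simp add: writing_def credit_def)

lemma writing_mono: "writing dst z old ys v \<Longrightarrow> z \<le> z' \<Longrightarrow> writing dst z' old ys v"
  by (auto simp: writing_def)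

text \<open>Access to another array costs at most 6 and may evict the block at the write position,
  which forfeits at most 2 units of credit; hence the 8.\<close>

lemma writing_foreign:
  assumes "writing dst z old ys v" "reg v' 9 = reg v 9" "reg v' 21 = reg v 21" "store v' = store v" "cost v' \<le> cost v + 6"
  shows "writing dst (z + 8) old ys v'"
  using assms credit_bounds(2)[of "dst + length ys" v] credit_bounds(1)[of "dst + length ys" v'] unfolding writing_def by simp

lemma writing_regs: "writing dst z old ys v \<Longrightarrow> reg v 9 = dst \<and> reg v 21 = length ys"
  by (simp add: writing_def)

lemma writing_init: "reg v 9 = dst \<Longrightarrow> reg v 21 = 0 \<Longrightarrow> writing dst (cost v) (store v) [] v"
  using credit_bounds(1)[of dst v] by (simp add: writing_def)

lemma writing_store: "writing dst z old ys v \<Longrightarrow> \<not> (dst \<le> i \<and> i < dst + length ys) \<Longrightarrow> store v i = old i"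
  "writing dst z old ys v \<Longrightarrow> i < length ys \<Longrightarrow> store v (dst + i) = ys ! i"
  by (auto simp: writing_def)

text \<open>The 6 is 4 for a start that is not aligned to a block and 2 for the credit of the block
  at the write position.\<close>

lemma writing_cost: "writing dst z old ys v \<Longrightarrow> cost v \<le> z + 4 * (length ys div B) + 6"
proof -
  assume e: "writing dst z old ys v"
  have "(dst + length ys) div B \<le> dst div B + length ys div B + 1"
  proof -
    have "dst mod B + length ys mod B < 2 * B"
      using mod_less_divisor[of B dst] mod_less_divisor[of B "length ys"] B_pos by linarith
    then have "(dst mod B + length ys mod B) div B < 2" by (rule less_mult_imp_div_less)
    then show ?thesis by (simp add: div_add1_eq[of dst])
  qed
  then show ?thesis using e credit_bounds(2)[of "dst + length ys" v] unfolding writing_def by linarith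
qed

lemma wp_emit:
  assumes "writing dst z old ys v" "exp_ok e" "exp_val e (reg v) < W" "dst + length ys \<le> 8 * U ^ 5"
    and Q: "\<And>v'. writing dst z old (ys @ [exp_val e (reg v)]) v' \<Longrightarrow> reg v' = (reg v)(21 := Suc (length ys)) \<Longrightarrow>
      vmem v' = vmem v \<Longrightarrow> Q v'"
  shows "wp (emit e) Q v"
  unfolding emit_def
proof (rule wp_Seq, rule wp_cell_write)
  let ?x = "exp_val e (reg v)"
  have r: "reg v 9 = dst" "reg v 21 = length ys" using assms(1) by (auto simp: writing_def)
  show "exp_val (Reg 9 \<oplus> Reg 21) (reg v) div B < W" using div_less_W[of "dst + length ys"] assms(4) r by simp
  have c: "cost v + 4 * (dst div B) \<le> z + credit (dst + length ys) v" using assms(1) by (simp add: writing_def)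
  have c2: "cost (touch (dst + length ys) v) + 4 * (dst div B) \<le> z + credit (Suc (dst + length ys)) (touch (dst + length ys) v)"
    using c unfolding credit_def touch_def by (auto simp: div_Suc)
  have W: "Suc (length ys) < W" using small[of "Suc (length ys)"] assms(4) U_bounds U10 by linarith
  show "wp (Assign 21 (Reg 21 \<oplus> Const 1)) Q (touch (exp_val (Reg 9 \<oplus> Reg 21) (reg v)) v
     \<lparr>store := (store v)(exp_val (Reg 9 \<oplus> Reg 21) (reg v) := ?x)\<rparr>)"
  proof (rule wp_Assign, goal_cases)
    case 4
    have d: "(store v)(dst + length ys := ?x) = (\<lambda>i. if dst \<le> i \<and> i < dst + length (ys @ [?x])
      then (ys @ [?x]) ! (i - dst) else old i)"
      using assms(1) by (auto simp: writing_def nth_append fun_eq_iff less_diff_conv2)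
    show ?case
      by (rule Q) (use c2 r in \<open>simp_all add: writing_def credit_def d\<close>)
  qed (use r W in \<open>simp_all add: reg_ok_def\<close>)
qed (use assms in simp_all)

text \<open>\<open>k - k mod w\<close> is the start of the aligned window that contains position
  \<open>k\<close>. Cells past the end of \<open>xs\<close> are left open.\<close>

definition win :: "nat list \<Rightarrow> nat \<Rightarrow> (nat \<Rightarrow> nat) \<Rightarrow> bool" where
  "win xs k m \<longleftrightarrow> (\<forall>j<w. k - k mod w + j < length xs \<longrightarrow> m j = xs ! (k - k mod w + j))"

lemma wp_get:
  assumes writing: "writing dst z old ys v" and r: "reg v 4 = w" "reg v 7 = a" "reg v 8 = length xs" "reg v 10 = k"
    and k: "k < length xs" and aU: "a + length xs \<le> 2 * U ^ 5"
    and src: "\<And>i. i < length xs \<Longrightarrow> store v (a + i) = xs ! i" and xsW: "\<And>x. x \<in> set xs \<Longrightarrow> x < W"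
    and wn: "k mod w \<noteq> 0 \<Longrightarrow> win xs k (vmem v)"
    and Q: "\<And>v'. writing dst (if k mod w = 0 then z + 8 else z) old ys v' \<Longrightarrow>
      (\<forall>x. x \<notin> {20,22,23,24,25} \<longrightarrow> reg v' x = reg v x) \<Longrightarrow> (\<forall>x\<ge>w. vmem v' x = vmem v x) \<Longrightarrow>
      win xs k (vmem v') \<Longrightarrow> reg v' 20 = xs ! k \<Longrightarrow> Q v'"
  shows "wp get Q v"
  unfolding get_def
proof (rule wp_Seq, rule wp_Cond)
  have kw: "k mod w < w" using w_pos by simp
  then have kv: "k mod w < vsize" using fit' by linarith
  have kk: "k - k mod w + k mod w = k" by simp
  { assume t: "test_val (Equal (Reg 10 \<odot> Reg 4) (Const 0)) (reg v)"
    then have k0: "k mod w = 0" using r by simp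
    show "wp (Assign 24 (Const 0) ;; Assign 25 (Reg 7 \<oplus> Reg 10) ;; loadwin) (wp (vload 20 (Reg 10 \<odot> Reg 4)) Q) v"
    proof (intro wp_Seq wp_Assign, goal_cases)
      case 3 then show ?case using W_pos by simp
    next
      case 6 then show ?case using r k aU by (simp add: small)
    next
      case 7
      show ?case
      proof (rule wp_loadwin, goal_cases)
        case 2 then show ?case using fit' by simp
      next
        case 3 then show ?case using r aU k by simp
      next
        case (4 i)
        then have "store v i = xs ! (i - a)" "i - a < length xs" using src[of "i - a"] r by auto
        then show ?case using xsW nth_mem by auto
      next
        case (5 u)
        have w1: "win xs k (vmem u)" using 5 r src k0 by (auto simp: win_def add.assoc)
        have x0: "vmem u 0 = xs ! k" using w1 k0 k w_pos unfolding win_def by (auto dest!: spec[of _ 0])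
        have r1: "\<forall>x. x \<notin> {20,22,23,24,25} \<longrightarrow> reg u x = reg v x" using 5(1) by auto
        have E1: "writing dst (z + 8) old ys u" by (rule writing_foreign[OF writing]) (use 5 in simp_all)
        show ?case
          apply (rule wp_vload)
             apply (use r1 kv r in \<open>simp_all add: reg_ok_def\<close>)[3]
          apply (rule Q)
              apply (rule writing_reg, use E1 k0 in simp)
               apply (use k0 5(4) r1 r w1 x0 in auto)
          done
      qed (use r in simp_all)
    qed (simp_all add: reg_ok_def)
  }
  { assume t: "\<not> test_val (Equal (Reg 10 \<odot> Reg 4) (Const 0)) (reg v)"
    then have k0: "k mod w \<noteq> 0" using r by simp
    note w1 = wn[OF k0]
    then have "vmem v (k mod w) = xs ! k" using k kw kk unfolding win_def by metis
    then show "wp Skip (wp (vload 20 (Reg 10 \<odot> Reg 4)) Q) v"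
      apply (intro wp_Skip wp_vload)
         apply (use kv r in \<open>simp_all add: reg_ok_def\<close>)[3]
      apply (rule Q)
          apply (use writing k0 r w1 in \<open>auto intro!: writing_reg\<close>)
      done
  }
qed simp

text \<open>\<open>I\<close> relates the number of elements read to the output so far and to the
  private state of the body. A body may keep data in the cells from \<open>w\<close> on, since the
  scan overwrites only those below; \<open>stab\<close> demands that \<open>I\<close> ignores the
  registers and the window of the scan. \<open>disj\<close> keeps the output away from input that is
  still to be read.\<close>

lemma wp_scan:
  fixes I :: "nat \<Rightarrow> nat list \<Rightarrow> (nat \<Rightarrow> nat) \<Rightarrow> (nat \<Rightarrow> nat) \<Rightarrow> bool"
  assumes r: "reg v 4 = w" "reg v 7 = a" "reg v 8 = length xs"
    and aU: "a + length xs \<le> 2 * U ^ 5"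
    and xsW: "\<And>x. x \<in> set xs \<Longrightarrow> x < W"
    and src: "\<And>i. i < length xs \<Longrightarrow> old (a + i) = xs ! i"
    and disj: "\<And>i j. i < length xs \<Longrightarrow> j < cap \<Longrightarrow> a + i \<noteq> dst + j"
    and E0: "writing dst z old ys0 v"
    and I0: "I 0 ys0 (reg v) (vmem v)"
    and stab: "\<And>k ys r m r' m'. I k ys r m \<Longrightarrow> \<forall>x. x \<notin> {10,20,22,23,24,25} \<longrightarrow> r' x = r x \<Longrightarrow>
       \<forall>x\<ge>w. m' x = m x \<Longrightarrow> I k ys r' m'"
    and cap: "\<And>k ys r m. I k ys r m \<Longrightarrow> k \<le> length xs \<Longrightarrow> length ys \<le> cap"
    and body: "\<And>k ys u z'. k < length xs \<Longrightarrow> I k ys (reg u) (vmem u) \<Longrightarrow> writing dst z' old ys u \<Longrightarrow>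
       reg u 20 = xs ! k \<Longrightarrow> reg u 10 = k \<Longrightarrow> \<forall>x<20. x \<noteq> 10 \<longrightarrow> reg u x = reg v x \<Longrightarrow>
       wp p (\<lambda>u'. \<exists>ys'. I (Suc k) ys' (reg u') (vmem u') \<and> writing dst z' old ys' u' \<and>
          (\<forall>x<20. reg u' x = reg u x) \<and> (\<forall>x<w. vmem u' x = vmem u x)) u"
    and Q: "\<And>v' ys. I (length xs) ys (reg v') (vmem v') \<Longrightarrow> writing dst (z + 8 * (length xs div w + 1)) old ys v' \<Longrightarrow>
       \<forall>x<20. x \<noteq> 10 \<longrightarrow> reg v' x = reg v x \<Longrightarrow> Q v'"
  shows "wp (scan p) Q v"
  unfolding scan_def
\<comment> \<open>\<open>(k + w - 1) div w\<close> is the number of windows loaded for the first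
  \<open>k\<close> elements; each is charged 8 by \<open>writing_foreign\<close>.\<close>
proof (rule wp_For[where n = "length xs" and I = "\<lambda>k u. reg u 10 = k \<and> (\<forall>x<20. x \<noteq> 10 \<longrightarrow> reg u x = reg v x) \<and>
    (k mod w \<noteq> 0 \<longrightarrow> win xs k (vmem u)) \<and>
    (\<exists>ys. I k ys (reg u) (vmem u) \<and> writing dst (z + 8 * ((k + w - 1) div w)) old ys u)"], goal_cases)
  case 3 show ?case using aU by (simp add: small)
next
  case 4 show ?case by (rule W_pos)
next
  case 5
  have "I 0 ys0 ((reg v)(10 := 0)) (vmem v)" by (rule stab[OF I0]) auto
  moreover have "(0 + w - 1) div w = 0" using w_pos by simp
  ultimately show ?case using E0 by (auto intro!: exI[of _ ys0] writing_reg simp del: One_nat_def)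
next
  case (6 k u)
  then show ?case using r by simp
next
  case (7 k u)
  then obtain ys where I: "I k ys (reg u) (vmem u)" and E1: "writing dst (z + 8 * ((k + w - 1) div w)) old ys u" by auto
  have rs: "\<forall>x<20. x \<noteq> 10 \<longrightarrow> reg u x = reg v x" "reg u 10 = k" and wn: "k mod w \<noteq> 0 \<Longrightarrow> win xs k (vmem u)"
    using 7(1) by auto
  have k: "k < length xs" by fact
  have c: "(if k mod w = 0 then z + 8 * ((k + w - 1) div w) + 8 else z + 8 * ((k + w - 1) div w)) \<le> z + 8 * ((Suc k + w - 1) div w)"
  proof (cases "k mod w = 0")
    case True
    then obtain q where q: "k = w * q" by auto
    have "(k + w - 1) div w = q"
      by (rule div_nat_eqI) (use w_pos q in \<open>auto simp: mult.commute\<close>)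
    moreover have "(Suc k + w - 1) div w = q + 1" using w_pos q by simp
    ultimately show ?thesis using True by simp
  next
    case False
    then show ?thesis using div_le_mono[of "k + w - 1" "Suc k + w - 1" w] by simp
  qed
  show ?case
  proof (rule wp_Seq, rule wp_get[where a = a and xs = xs and k = k, OF E1], goal_cases)
    case (7 i)
    have "a + i \<noteq> dst + j" if "j < length ys" for j using disj[OF 7] cap[OF I] k that by auto
    then have "\<not> (dst \<le> a + i \<and> a + i < dst + length ys)"
      by (metis le_add_diff_inverse nat_add_left_cancel_less)
    then show ?case using writing_store(1)[OF E1] src[OF 7] by simp
  next
    case (10 u')
    have I2: "I k ys (reg u') (vmem u')" by (rule stab[OF I]) (use 10 in auto)
    have E2: "writing dst (z + 8 * ((Suc k + w - 1) div w)) old ys u'" by (rule writing_mono[OF 10(1) c])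
    have kk: "reg u' 10 = k" using 10 rs by auto
    have "wp p (\<lambda>v''. \<exists>ys'. I (Suc k) ys' (reg v'') (vmem v'') \<and> writing dst (z + 8 * ((Suc k + w - 1) div w)) old ys' v'' \<and>
          (\<forall>x<20. reg v'' x = reg u' x) \<and> (\<forall>x<w. vmem v'' x = vmem u' x)) u'"
      by (rule body[OF k I2 E2 10(5) kk]) (use 10(2) rs in auto)
    then show ?case
    proof (rule wp_mono, goal_cases)
      case (1 u2)
      then obtain ys' where *: "I (Suc k) ys' (reg u2) (vmem u2)" "writing dst (z + 8 * ((Suc k + w - 1) div w)) old ys' u2"
        "\<forall>x<20. reg u2 x = reg u' x" "\<forall>x<w. vmem u2 x = vmem u' x" by blast
      have i: "I (Suc k) ys' ((reg u2)(10 := Suc k)) (vmem u2)" by (rule stab[OF *(1)]) auto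
      have wi: "win xs (Suc k) (vmem u2)" if "Suc k mod w \<noteq> 0"
      proof -
        have "Suc k - Suc k mod w = k - k mod w" using that by (simp add: mod_Suc split: if_splits)
        then show ?thesis using 10(4) *(4) unfolding win_def by simp
      qed
      have "writing dst (z + 8 * ((Suc k + w - 1) div w)) old ys' (u2\<lparr>reg := (reg u2)(10 := Suc k)\<rparr>)"
        by (rule writing_reg[OF *(2)]) auto
      then show ?case using i wi *(3) kk 10(2) rs by auto
    qed
  qed (use rs r k aU xsW wn in auto)
next
  case (8 u)
  then obtain ys where I: "I (length xs) ys (reg u) (vmem u)"
    and E1: "writing dst (z + 8 * ((length xs + w - 1) div w)) old ys u" by auto
  have "(length xs + w - 1) div w \<le> length xs div w + 1"
    using div_le_mono[of "length xs + w - 1" "length xs + w" w] w_pos by simp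
  then show ?case using 8 by (intro Q[OF I] writing_mono[OF E1]) auto
qed (use r in \<open>simp_all add: reg_ok_def\<close>)

end

section \<open>Multiway merge sort\<close>

definition swap_areas :: prog where
  "swap_areas = Assign 23 (Reg 7) ;; Assign 7 (Reg 9) ;; Assign 9 (Reg 23)"

text \<open>The elements are distinct and positive, so the next output of a merge is the least value in
  the windows above the last output, held in register 41: no position within a window has to be
  maintained, and a window is exhausted once it has no value above the last output.\<close>

definition probe :: prog where
  "probe = Assign 45 (Const 0) ;; For 47 (Reg 4)
     (vload 43 (Reg 46 \<otimes> Reg 4 \<oplus> Reg 47) ;; Cond (Less (Reg 41) (Reg 43)) (Assign 45 (Const 1)) Skip)"

text \<open>A window is reloaded only when none of its values exceeds the last output: an earlier
  reload would discard values that are still to be written.\<close>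

definition refill :: prog where
  "refill = For 46 (Reg 5)
     (vload 44 (Reg 5 \<otimes> Reg 4 \<oplus> Reg 46) ;;
      Cond (Conj (Less (Reg 44) (Reg 8)) (Less (Reg 44) (Reg 42 \<oplus> (Reg 46 \<oplus> Const 1) \<otimes> Reg 40)))
        (probe ;;
         Cond (Equal (Reg 45) (Const 0))
           (Assign 24 (Reg 46 \<otimes> Reg 4) ;; Assign 25 (Reg 7 \<oplus> Reg 44) ;; loadwin ;;
            vstore (Reg 5 \<otimes> Reg 4 \<oplus> Reg 46) (Reg 44 \<oplus> Reg 4))
           Skip)
        Skip)"

text \<open>As elements are positive, 0 in register 43 can stand for the absence of a candidate; the
  inner negations express that there is none yet or that the current one is larger.\<close>

definition select :: prog where
  "select = Assign 43 (Const 0) ;; For 47 (Reg 5 \<otimes> Reg 4)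
     (vload 44 (Reg 47) ;;
      Cond (Conj (Less (Reg 41) (Reg 44)) (Neg (Conj (Neg (Equal (Reg 43) (Const 0))) (Neg (Less (Reg 44) (Reg 43))))))
        (Assign 43 (Reg 44)) Skip)"

definition clear_windows :: prog where
  "clear_windows = For 46 (Reg 5 \<otimes> Reg 4) (vstore (Reg 46) (Const 0)) ;;
     For 46 (Reg 5) (vstore (Reg 5 \<otimes> Reg 4 \<oplus> Reg 46) (Reg 42 \<oplus> Reg 46 \<otimes> Reg 40))"

definition merge_group :: prog where
  "merge_group = Assign 42 (Reg 21) ;; clear_windows ;; Assign 41 (Const 0) ;;
     While (Conj (Less (Reg 21) (Reg 8)) (Less (Reg 21) (Reg 42 \<oplus> Reg 5 \<otimes> Reg 40)))
       (refill ;; select ;; emit (Reg 43) ;; Assign 41 (Reg 43))"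

definition merge_pass :: prog where
  "merge_pass = Assign 21 (Const 0) ;; While (Less (Reg 21) (Reg 8)) merge_group ;;
     swap_areas ;; Assign 40 (Reg 40 \<otimes> Reg 5)"

text \<open>The first pass is unconditional because the initial runs, single windows, are unsorted
  inside; even an array shorter than a window has to be merged once.\<close>

definition sort_prog :: prog where
  "sort_prog = Assign 40 (Reg 4) ;; merge_pass ;; While (Less (Reg 40) (Reg 8)) merge_pass"

text \<open>Functional model of a merge pass, used with \<open>k = K * L\<close>. Going through sets
  loses nothing, because the arrays to be sorted have no duplicates.\<close>

function merged :: "nat \<Rightarrow> nat list \<Rightarrow> nat list" where
  "merged k xs = (if xs = [] \<or> k = 0 then [] else sorted_list_of_set (set (take k xs)) @ merged k (drop k xs))"
  by auto
termination by (relation "measure (length \<circ> snd)") auto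

declare merged.simps [simp del]

lemma set_merged: "0 < k \<Longrightarrow> set (merged k xs) = set xs"
proof (induction k xs rule: merged.induct)
  case (1 k xs)
  show ?case
  proof (cases "xs = []")
    case False
    have "set xs = set (take k xs) \<union> set (drop k xs)" by (metis append_take_drop_id set_append)
    then show ?thesis using 1 False by (subst merged.simps) simp
  qed (simp add: merged.simps)
qed

lemma length_merged: "0 < k \<Longrightarrow> distinct xs \<Longrightarrow> length (merged k xs) = length xs"
proof (induction k xs rule: merged.induct)
  case (1 k xs)
  show ?case
  proof (cases "xs = []")
    case False
    have "length (sorted_list_of_set (set (take k xs))) = min (length xs) k"
      using 1(3) by (simp add: distinct_card)
    then show ?thesis using 1 False by (subst merged.simps) (simp add: distinct_drop)
  qed (simp add: merged.simps)
qed

lemma distinct_merged: "0 < k \<Longrightarrow> distinct xs \<Longrightarrow> distinct (merged k xs)"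
  by (metis card_distinct distinct_card length_merged set_merged)

lemma merged_ordered:
  "0 < k \<Longrightarrow> distinct xs \<Longrightarrow> i < j \<Longrightarrow> j < length xs \<Longrightarrow> i div k = j div k \<Longrightarrow> merged k xs ! i < merged k xs ! j"
proof (induction k xs arbitrary: i j rule: merged.induct)
  case (1 k xs)
  let ?l = "sorted_list_of_set (set (take k xs))"
  have ne: "xs \<noteq> []" using 1(5) by auto
  then have m: "merged k xs = ?l @ merged k (drop k xs)" using 1(2) by (subst merged.simps) simp
  have l: "length ?l = min (length xs) k" using 1(3) by (simp add: distinct_card)
  show ?case
  proof (cases "j < k")
    case True
    then have "j < length ?l" using l 1(5) by simp
    moreover have "sorted_wrt (<) ?l" by (rule strict_sorted_list_of_set)
    ultimately show ?thesis using 1(4) m by (simp add: nth_append sorted_wrt_nth_less)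
  next
    case False
    then have "0 < j div k" using 1(2) by (simp add: div_greater_zero_iff)
    then have ik: "k \<le> i" using 1(6) by (metis div_less less_nat_zero_code not_le)
    have lk: "length ?l = k" using l False 1(5) by simp
    have "(i - k) div k = (j - k) div k" using 1(2,6) ik False by (simp add: le_div_geq)
    then have "merged k (drop k xs) ! (i - k) < merged k (drop k xs) ! (j - k)"
      using 1 ne ik False by (intro 1(1)) (auto simp: distinct_drop)
    then show ?thesis using m lk ik False by (simp add: nth_append)
  qed
qed

lemma merged_sorted:
  assumes "length xs \<le> k" shows "merged k xs = sorted_list_of_set (set xs)"
  using assms by (cases "xs = []"; cases "k = 0") (simp_all add: merged.simps)

text \<open>A merge knows its place in the output only through the last value written. This turns
  exceeding that value into having an index of at least \<open>t\<close>; for \<open>t = 0\<close>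
  the value is 0.\<close>

lemma strict_sorted_next:
  assumes "sorted_wrt (<) (l :: nat list)" "t < length l" "x \<in> set l" "(if t = 0 then 0 else l ! (t - 1)) < x"
  shows "l ! t \<le> x"
proof -
  from assms(3) obtain u where u: "u < length l" "l ! u = x" by (auto simp: in_set_conv_nth)
  have "t \<le> u"
  proof (rule ccontr)
    assume "\<not> t \<le> u"
    then have "u \<le> t - 1" "t \<noteq> 0" by auto
    then have "l ! u \<le> l ! (t - 1)"
    proof (cases "u = t - 1")
      case False
      then have "l ! u < l ! (t - 1)"
        using \<open>u \<le> t - 1\<close> assms(2) by (intro sorted_wrt_nth_less[OF assms(1)]) auto
      then show ?thesis by simp
    qed simp
    with u assms(4) \<open>t \<noteq> 0\<close> show False by simp
  qed
  then show ?thesis using u assms(1,2) sorted_wrt_nth_less[of "(<)" l t u] by (cases "t = u") auto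
qed

lemma cell_index: "r < (K::nat) \<Longrightarrow> j < w \<Longrightarrow> r * w + j < K * w"
proof -
  assume "r < K" "j < w"
  then have "r * w + j < (r + 1) * w" "(r + 1) * w \<le> K * w" by (simp, intro mult_le_mono1) simp
  then show ?thesis by linarith
qed

section \<open>Filling the windows and finding the least value above the last output\<close>

context buffered
begin

definition same :: "vstate \<Rightarrow> vstate \<Rightarrow> bool" where
  "same v u \<longleftrightarrow> cost u = cost v \<and> cached u = cached v \<and> store u = store v \<and> vmem u = vmem v"

lemma writing_same: "writing dst z old ys v \<Longrightarrow> same v u \<Longrightarrow> reg u 9 = reg v 9 \<Longrightarrow> reg u 21 = reg v 21 \<Longrightarrow> writing dst z old ys u"
  by (simp add: writing_def same_def credit_def)

lemma Kw: "K * w + K \<le> vsize" using fit by simp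

lemma wp_probe:
  assumes r: "reg v 4 = w" "reg v 46 < K"
    and Q: "\<And>u. same v u \<Longrightarrow> \<forall>x. x \<notin> {43, 45, 47} \<longrightarrow> reg u x = reg v x \<Longrightarrow>
      reg u 45 = (if \<exists>j<w. reg v 41 < vmem v (reg v 46 * w + j) then 1 else 0) \<Longrightarrow> Q u"
  shows "wp probe Q v"
  unfolding probe_def
proof (rule wp_Seq, rule wp_Assign)
  let ?J = "\<lambda>k u. reg u 47 = k \<and> same v u \<and> (\<forall>x. x \<notin> {43, 45, 47} \<longrightarrow> reg u x = reg v x) \<and>
      reg u 45 = (if \<exists>j<k. reg v 41 < vmem v (reg v 46 * w + j) then 1 else 0)"
  show "wp (For 47 (Reg 4) (vload 43 (Reg 46 \<otimes> Reg 4 \<oplus> Reg 47) ;; Cond (Less (Reg 41) (Reg 43)) (Assign 45 (Const 1)) Skip)) Q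
    (v\<lparr>reg := (reg v)(45 := exp_val (Const 0) (reg v))\<rparr>)"
  proof (rule wp_For[where n = w and I = ?J], goal_cases)
    case 3 show ?case using small[of w] wU U_bounds by linarith
  next
    case 4 show ?case by (rule W_pos)
  next
    case 5 show ?case by (simp add: same_def)
  next
    case (6 k u) then show ?case using r by simp
  next
    case (7 k u)
    have c: "reg v 46 * w + k < vsize" using cell_index[OF r(2) 7(2)] Kw by linarith
    have W1: "Suc 0 < W" using small[of 1] U_bounds U10 by simp
    show ?case
      by (intro wp_Seq wp_vload wp_Cond wp_Assign wp_Skip; use 7 r c W1 in \<open>auto simp: reg_ok_def same_def less_Suc_eq\<close>)
  next
    case (8 u) then show ?case by (intro Q) auto
  qed (simp_all add: reg_ok_def)
qed (use W_pos in \<open>simp_all add: reg_ok_def\<close>)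

definition least_above :: "(nat \<Rightarrow> nat) \<Rightarrow> nat \<Rightarrow> nat \<Rightarrow> nat \<Rightarrow> bool" where
  "least_above m l k b \<longleftrightarrow> (b = 0 \<and> (\<forall>c<k. m c \<le> l)) \<or>
     (l < b \<and> (\<exists>c<k. m c = b) \<and> (\<forall>c<k. l < m c \<longrightarrow> b \<le> m c))"

lemma least_above_take:
  "least_above m l k b \<Longrightarrow> l < m k \<Longrightarrow> b = 0 \<or> m k < b \<Longrightarrow> least_above m l (Suc k) (m k)"
  unfolding least_above_def by (auto simp: less_Suc_eq)

lemma least_above_skip:
  "least_above m l k b \<Longrightarrow> m k \<le> l \<or> b \<noteq> 0 \<and> b \<le> m k \<Longrightarrow> least_above m l (Suc k) b"
  unfolding least_above_def by (auto simp: less_Suc_eq)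

lemma wp_select:
  assumes r: "reg v 4 = w" "reg v 5 = K" and mW: "\<And>c. c < K * w \<Longrightarrow> vmem v c < W"
    and Q: "\<And>u. same v u \<Longrightarrow> \<forall>x. x \<notin> {43, 44, 47} \<longrightarrow> reg u x = reg v x \<Longrightarrow>
      least_above (vmem v) (reg v 41) (K * w) (reg u 43) \<Longrightarrow> Q u"
  shows "wp select Q v"
  unfolding select_def
proof (rule wp_Seq, rule wp_Assign)
  let ?J = "\<lambda>k u. reg u 47 = k \<and> same v u \<and> (\<forall>x. x \<notin> {43, 44, 47} \<longrightarrow> reg u x = reg v x) \<and>
      least_above (vmem v) (reg v 41) k (reg u 43)"
  have KW: "K * w \<le> U ^ 2" using KU wU by (simp add: power2_eq_square mult_le_mono)
  show "wp (For 47 (Reg 5 \<otimes> Reg 4) (vload 44 (Reg 47) ;;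
      Cond (Conj (Less (Reg 41) (Reg 44)) (Neg (Conj (Neg (Equal (Reg 43) (Const 0))) (Neg (Less (Reg 44) (Reg 43))))))
        (Assign 43 (Reg 44)) Skip)) Q
    (v\<lparr>reg := (reg v)(43 := exp_val (Const 0) (reg v))\<rparr>)"
  proof (rule wp_For[where n = "K * w" and I = ?J], goal_cases)
    case 3 show ?case using small[of "K * w"] KW U_bounds by linarith
  next
    case 4 show ?case by (rule W_pos)
  next
    case 5 show ?case by (simp add: same_def least_above_def)
  next
    case (6 k u) then show ?case using r by simp
  next
    case (7 k u)
    have c: "k < vsize" using 7(2) Kw by linarith
    have q: "reg u 47 = k" "same v u" "\<forall>x. x \<notin> {43, 44, 47} \<longrightarrow> reg u x = reg v x"
      and la: "least_above (vmem v) (reg v 41) k (reg u 43)" using 7 by auto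
    have sv: "vmem u = vmem v" using q by (simp add: same_def)
    show ?case
    proof (rule wp_Seq, rule wp_vload, goal_cases)
      case 4
      show ?case
      proof (rule wp_Cond, goal_cases)
        case 2
        then have "least_above (vmem v) (reg v 41) (Suc k) (vmem v k)"
          using q sv by (intro least_above_take[OF la]) auto
        then show ?case
          using q sv mW[OF 7(2)] by (intro wp_Assign) (auto simp: reg_ok_def same_def)
      next
        case 3
        then have "least_above (vmem v) (reg v 41) (Suc k) (reg u 43)"
          using q sv by (intro least_above_skip[OF la]) auto
        then show ?case
          using q sv by (intro wp_Skip) (auto simp: reg_ok_def same_def)
      qed simp
    qed (use q c in \<open>auto simp: reg_ok_def\<close>)
  next
    case (8 u) then show ?case by (intro Q) auto
  qed (simp_all add: reg_ok_def)
qed (use W_pos in \<open>simp_all add: reg_ok_def\<close>)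

lemma wp_clear_windows:
  assumes r: "reg v 4 = w" "reg v 5 = K" "reg v 42 = g" "reg v 40 = L" and gU: "g \<le> U" "L \<le> U"
    and Q: "\<And>u. cost u = cost v \<Longrightarrow> cached u = cached v \<Longrightarrow> store u = store v \<Longrightarrow> \<forall>x. x \<noteq> 46 \<longrightarrow> reg u x = reg v x \<Longrightarrow>
      \<forall>c<K * w. vmem u c = 0 \<Longrightarrow> \<forall>i<K. vmem u (K * w + i) = g + i * L \<Longrightarrow> Q u"
  shows "wp clear_windows Q v"
  unfolding clear_windows_def
proof (rule wp_Seq)
  let ?J = "\<lambda>k u. reg u 46 = k \<and> cost u = cost v \<and> cached u = cached v \<and> store u = store v \<and> (\<forall>x. x \<noteq> 46 \<longrightarrow> reg u x = reg v x) \<and>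
    (\<forall>c<k. vmem u c = 0)"
  let ?J2 = "\<lambda>k u. reg u 46 = k \<and> cost u = cost v \<and> cached u = cached v \<and> store u = store v \<and> (\<forall>x. x \<noteq> 46 \<longrightarrow> reg u x = reg v x) \<and>
    (\<forall>c<K * w. vmem u c = 0) \<and> (\<forall>i<k. vmem u (K * w + i) = g + i * L)"
  have KW: "K * w \<le> U ^ 2" using KU wU by (simp add: power2_eq_square mult_le_mono)
  show "wp (For 46 (Reg 5 \<otimes> Reg 4) (vstore (Reg 46) (Const 0)))
    (wp (For 46 (Reg 5) (vstore (Reg 5 \<otimes> Reg 4 \<oplus> Reg 46) (Reg 42 \<oplus> Reg 46 \<otimes> Reg 40))) Q) v"
  proof (rule wp_For[where n = "K * w" and I = ?J], goal_cases)
    case 3 show ?case using small[of "K * w"] KW U_bounds by linarith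
  next
    case 4 show ?case by (rule W_pos)
  next
    case (6 k u) then show ?case using r by simp
  next
    case (7 k u)
    then show ?case using Kw W_pos by (intro wp_vstore) (auto simp: less_Suc_eq)
  next
    case (8 v2)
    show ?case
    proof (rule wp_For[where n = K and I = ?J2], goal_cases)
      case 3 show ?case using small[of K] KU U_bounds by linarith
    next
      case 4 show ?case by (rule W_pos)
    next
      case 5 show ?case using 8 by simp
    next
      case (6 k u) then show ?case using r by simp
    next
      case (7 k u)
      have "k * L \<le> U ^ 2" using 7(2) KU gU by (simp add: power2_eq_square mult_le_mono)
      then have "g + k * L < W" using small[of "g + k * L"] gU U_bounds by linarith
      then show ?case using 7 Kw r by (intro wp_vstore) (auto simp: less_Suc_eq)
    next
      case (8 u) then show ?case by (intro Q) auto
    qed (simp_all add: reg_ok_def)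
  qed (simp_all add: reg_ok_def)
qed

text \<open>Virtual memory contains window \<open>r\<close> from \<open>r * w\<close> on and, at \<open>K * w + r\<close>, the position up to which run \<open>r\<close>
  has been loaded.\<close>

definition window_inv :: "nat list \<Rightarrow> nat \<Rightarrow> nat \<Rightarrow> nat \<Rightarrow> nat \<Rightarrow> (nat \<Rightarrow> nat) \<Rightarrow> bool" where
  "window_inv xs g L lst r m \<longleftrightarrow> (let s = g + r * L; p = m (K * w + r) in
     s \<le> p \<and> p \<le> s + L \<and> w dvd p - s \<and>
     (\<forall>j<w. m (r * w + j) = (if p \<noteq> s \<and> p - w + j < length xs then xs ! (p - w + j) else 0)) \<and>
     (\<forall>i. s \<le> i \<and> i + w < p \<and> i < length xs \<longrightarrow> xs ! i \<le> lst) \<and>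
     (\<forall>i. p \<le> i \<and> i < s + L \<and> i < length xs \<longrightarrow> lst < xs ! i))"

text \<open>What a refill guarantees before a selection: a run whose window offers nothing above
  \<open>lst\<close> has nothing left to load either.\<close>

definition ready :: "nat list \<Rightarrow> nat \<Rightarrow> nat \<Rightarrow> nat \<Rightarrow> nat \<Rightarrow> (nat \<Rightarrow> nat) \<Rightarrow> bool" where
  "ready xs g L lst r m \<longleftrightarrow> (\<exists>j<w. lst < m (r * w + j)) \<or>
     \<not> (m (K * w + r) < g + r * L + L \<and> m (K * w + r) < length xs)"

text \<open>The start indices of the windows loaded so far, where all runs before \<open>g\<close>
  count as processed. Its cardinality is the number of loads; as its members are multiples of
  \<open>w\<close>, it is at most \<open>length xs div w + 1\<close>.\<close>

definition loaded :: "nat list \<Rightarrow> nat \<Rightarrow> nat \<Rightarrow> (nat \<Rightarrow> nat) \<Rightarrow> nat set" where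
  "loaded xs g L m = {i. i < length xs \<and> w dvd i \<and> (i < g \<or> (\<exists>r<K. g + r * L \<le> i \<and> i < m (K * w + r)))}"

lemma finite_loaded [simp]: "finite (loaded xs g L m)"
  by (rule finite_subset[of _ "{..<length xs}"]) (auto simp: loaded_def)

lemma window_inv_cong:
  "window_inv xs g L lst r m \<Longrightarrow> (\<And>j. j < w \<Longrightarrow> m' (r * w + j) = m (r * w + j)) \<Longrightarrow> m' (K * w + r) = m (K * w + r) \<Longrightarrow>
    window_inv xs g L lst r m'"
  by (simp add: window_inv_def Let_def)

lemma ready_cong:
  "ready xs g L lst r m \<Longrightarrow> (\<And>j. j < w \<Longrightarrow> m' (r * w + j) = m (r * w + j)) \<Longrightarrow> m' (K * w + r) = m (K * w + r) \<Longrightarrow>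
    ready xs g L lst r m'"
  unfolding ready_def by auto

lemma run_disjoint:
  fixes g :: nat
  assumes "g + r * L \<le> i" "i < g + r * L + L" "g + r' * L \<le> i" "i < g + r' * L + L"
  shows "r = r'"
proof -
  have "(i - g) div L = q" if "g + q * L \<le> i" "i < g + q * L + L" for q
    by (rule div_nat_eqI) (use that in \<open>auto simp: mult.commute\<close>)
  then show ?thesis using assms by metis
qed

text \<open>Each reload adds a new start index to \<open>loaded\<close>, which pays 8 for it: at
  most 6 IOs, and at most 2 units of credit lost at the write position.\<close>

lemma wp_refill:
  assumes r: "reg v 4 = w" "reg v 5 = K" "reg v 7 = a" "reg v 8 = length xs" "reg v 40 = L" "reg v 41 = lst" "reg v 42 = g"
    and bnd: "a + length xs \<le> 2 * U ^ 5" "length xs \<le> U"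
    and src: "\<And>i. i < length xs \<Longrightarrow> store v (a + i) = xs ! i" and xsW: "\<And>x. x \<in> set xs \<Longrightarrow> x < W"
    and dv: "w dvd g" "w dvd L"
    and runs: "\<And>r. r < K \<Longrightarrow> window_inv xs g L lst r (vmem v)"
    and E0: "writing dst (z + 8 * card (loaded xs g L (vmem v))) old ys v"
    and Q: "\<And>u. (\<And>r. r < K \<Longrightarrow> window_inv xs g L lst r (vmem u)) \<Longrightarrow> (\<And>r. r < K \<Longrightarrow> ready xs g L lst r (vmem u)) \<Longrightarrow>
      writing dst (z + 8 * card (loaded xs g L (vmem u))) old ys u \<Longrightarrow>
      \<forall>x. x \<notin> {22, 23, 24, 25, 43, 44, 45, 46, 47} \<longrightarrow> reg u x = reg v x \<Longrightarrow> Q u"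
  shows "wp refill Q v"
  unfolding refill_def
proof (rule wp_For[where n = K and I = "\<lambda>k u. reg u 46 = k \<and>
     (\<forall>x. x \<notin> {22, 23, 24, 25, 43, 44, 45, 46, 47} \<longrightarrow> reg u x = reg v x) \<and> store u = store v \<and>
     (\<forall>r<K. window_inv xs g L lst r (vmem u)) \<and> (\<forall>r<k. ready xs g L lst r (vmem u)) \<and>
     writing dst (z + 8 * card (loaded xs g L (vmem u))) old ys u"], goal_cases)
  case 3 show ?case using small[of K] KU U_bounds by linarith
next
  case 4 show ?case by (rule W_pos)
next
  case 5 show ?case using runs E0 by (auto intro: writing_reg)
next
  case (6 k u) then show ?case using r by simp
next
  case (7 k u)
  let ?J = "\<lambda>k u. reg u 46 = k \<and>
     (\<forall>x. x \<notin> {22, 23, 24, 25, 43, 44, 45, 46, 47} \<longrightarrow> reg u x = reg v x) \<and> store u = store v \<and>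
     (\<forall>r<K. window_inv xs g L lst r (vmem u)) \<and> (\<forall>r<k. ready xs g L lst r (vmem u)) \<and>
     writing dst (z + 8 * card (loaded xs g L (vmem u))) old ys u"
  let ?P = "\<lambda>u. reg u 46 = k \<and> ?J (Suc k) (u\<lparr>reg := (reg u)(46 := Suc k)\<rparr>)"
  have J: "?J k u" and k: "k < K" using 7 by auto
  have rs: "reg u 4 = w" "reg u 5 = K" "reg u 7 = a" "reg u 8 = length xs" "reg u 40 = L" "reg u 41 = lst" "reg u 42 = g" "reg u 46 = k"
    using J r by auto
  define p where "p = vmem u (K * w + k)"
  have skip: "?P u2" if "same u u2" "\<forall>x. x \<notin> {43, 44, 45, 47} \<longrightarrow> reg u2 x = reg u x"
    "ready xs g L lst k (vmem u)" for u2
  proof -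
    have e: "writing dst (z + 8 * card (loaded xs g L (vmem u))) old ys (u2\<lparr>reg := (reg u2)(46 := Suc k)\<rparr>)"
      by (rule writing_reg, rule writing_same[of _ _ _ _ u]) (use J that in auto)
    then show ?thesis using J that by (auto simp: same_def less_Suc_eq)
  qed
  have wr: "window_inv xs g L lst k (vmem u)" using J k by auto
  show ?case
  proof (rule wp_Seq, rule wp_vload, goal_cases)
    case 3 show ?case using rs k Kw by simp
  next
    case 4
    let ?u = "u\<lparr>reg := (reg u)(44 := vmem u (exp_val (Reg 5 \<otimes> Reg 4 \<oplus> Reg 46) (reg u)))\<rparr>"
    have p44: "reg ?u 44 = p" using rs by (simp add: p_def)
    show ?case
    proof (rule wp_Cond, goal_cases)
      case 2
      then have pl: "p < length xs" "p < g + k * L + L" using p44 rs by (auto simp: algebra_simps)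
      show ?case
      proof (rule wp_Seq, rule wp_probe, goal_cases)
        case (3 u1)
        have u1: "vmem u1 = vmem u" "cost u1 = cost u" "cached u1 = cached u" "store u1 = store u" "\<forall>x. x \<notin> {43, 44, 45, 47} \<longrightarrow> reg u1 x = reg u x" "reg u1 44 = p"
          using 3 p44 by (auto simp: same_def)
        show ?case
        proof (rule wp_Cond, goal_cases)
          case 2
          then have nr: "\<forall>j<w. vmem u (k * w + j) \<le> lst" using 3 rs by (auto simp: same_def split: if_splits)
          have kw: "k * w + w \<le> K * w" using k by (metis Suc_leI add.commute mult_Suc mult_le_mono1)
          have kU: "k * w \<le> U ^ 2" using k KU wU by (simp add: power2_eq_square mult_le_mono)
          have W1: "k * w < W" using small[of "k * w"] kU U_bounds by linarith
          have W2: "a + p < W" "p + w < W" using small[of "a + p"] small[of "p + w"] bnd pl wU U_bounds by linarith+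
          show ?case
          proof (rule wp_Seq, rule wp_Assign, goal_cases)
            case 3 then show ?case using u1 rs W1 by simp
          next
            case 4
            show ?case
            proof (rule wp_Seq, rule wp_Assign, goal_cases)
              case 3 then show ?case using u1 rs W2 by simp
            next
              case 4
              show ?case
              proof (rule wp_Seq, rule wp_loadwin, goal_cases)
                case 2 then show ?case using u1 rs kw Kw by simp
              next
                case 3 then show ?case using u1 rs bnd pl by simp
              next
                case (4 i)
                then have "store u i = xs ! (i - a)" "i - a < length xs" using src[of "i - a"] u1 rs J by auto
                then show ?case using xsW u1 by simp
              next
                case (5 u2)
                have q: "store u2 = store u" "reg u2 46 = k" "reg u2 44 = p" "reg u2 4 = w" "reg u2 5 = K"
                  "\<forall>x. x \<notin> {22, 23, 24, 25, 43, 44, 45, 46, 47} \<longrightarrow> reg u2 x = reg u x"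
                  using 5(1,2) u1 rs by auto
                have m1: "vmem u2 (k * w + j) = (if p + j < length xs then xs ! (p + j) else 0)" if "j < w" for j
                  using 5(3) that u1 rs src[of "p + j"] J by (simp add: add.assoc)
                have m2: "vmem u2 c = vmem u c" if "c < k * w \<or> k * w + w \<le> c" for c
                  using 5(4) that u1(1,5) rs(1,8) by auto
                have c2: "cost u2 \<le> cost u + 6" using 5(5) u1 by simp
                let ?m = "(vmem u2)(K * w + k := p + w)"
                have oth1: "?m (r' * w + j) = vmem u (r' * w + j)" if "r' < K" "r' \<noteq> k" "j < w" for r' j
                proof -
                  have "r' * w + j < K * w" by (rule cell_index) (use that in auto)
                  moreover have "r' * w + j < k * w \<or> k * w + w \<le> r' * w + j"
                  proof (cases "r' < k")
                    case True then show ?thesis using cell_index[of r' k j w] that by simp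
                  next
                    case False
                    then have "Suc k * w \<le> r' * w" using that by (intro mult_le_mono1) auto
                    then show ?thesis by simp
                  qed
                  ultimately show ?thesis using m2 by simp
                qed
                have oth2: "?m (K * w + r') = vmem u (K * w + r')" if "r' < K" "r' \<noteq> k" for r'
                  using that m2 kw by simp
                have own: "?m (k * w + j) = (if p + j < length xs then xs ! (p + j) else 0)" if "j < w" for j
                  using m1[OF that] cell_index[OF k that] by simp
                have wk: "g + k * L \<le> p" "p \<le> g + k * L + L" "w dvd p - (g + k * L)"
                  "\<And>j. j < w \<Longrightarrow> vmem u (k * w + j) = (if p \<noteq> g + k * L \<and> p - w + j < length xs then xs ! (p - w + j) else 0)"
                  "\<And>i. g + k * L \<le> i \<Longrightarrow> i + w < p \<Longrightarrow> i < length xs \<Longrightarrow> xs ! i \<le> lst"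
                  "\<And>i. p \<le> i \<Longrightarrow> i < g + k * L + L \<Longrightarrow> i < length xs \<Longrightarrow> lst < xs ! i"
                  using wr unfolding window_inv_def Let_def p_def by auto
                \<comment> \<open>Relative to the start of the run, both \<open>p\<close> and the
                  end of the run are multiples of \<open>w\<close>, so a whole window fits in
                  between.\<close>
                have "w dvd L - (p - (g + k * L))" by (rule dvd_diff_nat[OF dv(2) wk(3)])
                moreover have "L - (p - (g + k * L)) = (g + k * L + L) - p" using wk(1) by simp
                ultimately have "w dvd (g + k * L + L) - p" by metis
                then have pw: "p + w \<le> g + k * L + L" using pl(2) dvd_imp_le[of w "(g + k * L + L) - p"] by linarith
                \<comment> \<open>Elements before the current window are covered by the invariant,
                  those inside it by \<open>nr\<close>.\<close>
                have old: "xs ! i \<le> lst" if i: "g + k * L \<le> i" "i < p" "i < length xs" for i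
                proof (cases "i + w < p")
                  case True then show ?thesis using wk(5) i by simp
                next
                  case False
                  have "w \<le> p - (g + k * L)" using wk(3) i by (intro dvd_imp_le) auto
                  then have "xs ! i = vmem u (k * w + (i - (p - w)))"
                    using wk(4)[of "i - (p - w)"] i False by auto
                  moreover have "i - (p - w) < w" using i False by linarith
                  ultimately show ?thesis using nr by metis
                qed
                have "w dvd (p - (g + k * L)) + w" using wk(3) by simp
                then have "w dvd (p + w) - (g + k * L)" using wk(1) by simp
                then have newk: "window_inv xs g L lst k ?m"
                  unfolding window_inv_def Let_def using wk pw old own w_pos by auto
                have wr': "window_inv xs g L lst r' ?m" if "r' < K" for r'
                proof (cases "r' = k")
                  case False
                  show ?thesis by (rule window_inv_cong[where m = "vmem u"]) (use J that False oth1 oth2 in auto)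
                qed (use newk in simp)
                \<comment> \<open>Elements from \<open>p\<close> on still exceed \<open>lst\<close>,
                  so the first cell of the new window makes the run ready.\<close>
                have rdk: "ready xs g L lst k ?m"
                  unfolding ready_def using own[of 0] w_pos pl wk(6)[of p]
                  by (intro disjI1 exI[of _ 0]) (simp del: fun_upd_apply)
                have rd': "ready xs g L lst r' ?m" if "r' < Suc k" for r'
                proof (cases "r' = k")
                  case False
                  show ?thesis by (rule ready_cong[where m = "vmem u"]) (use J k that False oth1 oth2 in auto)
                qed (use rdk in simp)
                have "w dvd g + k * L + (p - (g + k * L))" using dv wk(3) by simp
                then have wp: "w dvd p" using wk(1) by simp
                \<comment> \<open>Runs are disjoint, so only run \<open>k\<close> could have counted
                  \<open>p\<close>, and that run has been loaded exactly up to
                  \<open>p\<close>.\<close>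
                have "p \<notin> loaded xs g L (vmem u)"
                proof
                  assume "p \<in> loaded xs g L (vmem u)"
                  then obtain r' where r': "r' < K" "g + r' * L \<le> p" "p < vmem u (K * w + r')"
                    using wk(1) unfolding loaded_def by auto
                  moreover have "vmem u (K * w + r') \<le> g + r' * L + L" using J r'(1) unfolding window_inv_def Let_def by auto
                  ultimately have "r' = k" using run_disjoint[of g r' L p k] wk(1) pl by auto
                  then show False using r' p_def by simp
                qed
                moreover have "insert p (loaded xs g L (vmem u)) \<subseteq> loaded xs g L ?m"
                proof
                  fix i assume i: "i \<in> insert p (loaded xs g L (vmem u))"
                  show "i \<in> loaded xs g L ?m"
                  proof (cases "i < g")
                    case True then show ?thesis using i wk(1) unfolding loaded_def by auto
                  next
                    case False
                    show ?thesis
                    proof (cases "i = p")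
                      case True
                      have "p < ?m (K * w + k)" using w_pos by simp
                      then show ?thesis using True pl wp k wk(1) unfolding loaded_def by blast
                    next
                      case ne: False
                      then obtain r' where r': "r' < K" "g + r' * L \<le> i" "i < vmem u (K * w + r')" "i < length xs" "w dvd i"
                        using i False unfolding loaded_def by auto
                      have "i < ?m (K * w + r')" using r' oth2[of r'] p_def by (cases "r' = k") auto
                      then show ?thesis using r' unfolding loaded_def by blast
                    qed
                  qed
                qed
                ultimately have "Suc (card (loaded xs g L (vmem u))) \<le> card (loaded xs g L ?m)"
                  by (metis card_insert_disjoint card_mono finite_loaded)
                moreover have "writing dst (z + 8 * card (loaded xs g L (vmem u)) + 8) old ys u2"
                  by (rule writing_foreign[of _ _ _ _ u]) (use J q c2 in auto)
                ultimately have E2: "writing dst (z + 8 * card (loaded xs g L ?m)) old ys u2"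
                  by (elim writing_mono) simp
                have E3: "writing dst (z + 8 * card (loaded xs g L ?m)) old ys (u2\<lparr>vmem := ?m, reg := (reg u2)(46 := Suc k)\<rparr>)"
                  by (rule writing_reg) (use E2 in simp_all)
                show ?case
                proof (rule wp_vstore, goal_cases)
                  case 5
                  have "exp_val (Reg 5 \<otimes> Reg 4 \<oplus> Reg 46) (reg u2) = K * w + k" "exp_val (Reg 44 \<oplus> Reg 4) (reg u2) = p + w"
                    using q by simp_all
                  then show ?case using q J wr' rd' E3 by simp
                qed (use q W2 k Kw in simp_all)
              qed (use u1 rs in simp_all)
            qed (simp_all add: reg_ok_def)
          qed (simp_all add: reg_ok_def)
        next
          case 3
          then have "ready xs g L lst k (vmem u)"
            using \<open>reg u1 45 = _\<close> rs unfolding ready_def by (auto split: if_splits)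
          then show ?case by (intro wp_Skip skip) (use u1 in \<open>auto simp: same_def\<close>)
        qed simp
      qed (use rs k in simp_all)
    next
      case 3
      then have "ready xs g L lst k (vmem u)"
        using rs unfolding ready_def by (auto simp: algebra_simps)
      then show ?case by (intro wp_Skip skip) (auto simp: same_def)
    qed simp
  qed (simp_all add: reg_ok_def)
next
  case (8 u) then show ?case by (intro Q) auto
qed (simp_all add: reg_ok_def)

end

lemma set_take_drop: "set (take k (drop g xs)) = {xs ! i |i. g \<le> i \<and> i < g + k \<and> i < length xs}"
proof -
  have "x \<in> set (take k (drop g xs)) \<longleftrightarrow> (\<exists>i. g \<le> i \<and> i < g + k \<and> i < length xs \<and> x = xs ! i)" for x
  proof
    assume "x \<in> set (take k (drop g xs))"
    then obtain j where "j < length (take k (drop g xs))" "take k (drop g xs) ! j = x"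
      by (auto simp only: in_set_conv_nth)
    then show "\<exists>i. g \<le> i \<and> i < g + k \<and> i < length xs \<and> x = xs ! i"
      by (intro exI[of _ "g + j"]) auto
  next
    assume "\<exists>i. g \<le> i \<and> i < g + k \<and> i < length xs \<and> x = xs ! i"
    then obtain i where i: "g \<le> i" "i < g + k" "i < length xs" "x = xs ! i" by blast
    then have "i - g < length (take k (drop g xs))" "take k (drop g xs) ! (i - g) = x" by auto
    then show "x \<in> set (take k (drop g xs))" by (metis nth_mem)
  qed
  then show ?thesis by auto
qed

section \<open>Correctness of a selection, of a merge pass, and of the sort\<close>

context buffered
begin

text \<open>Only the order between windows matters to the merge, as a window is searched as a whole.
  Hence the runs of the first pass can be single, unsorted windows.\<close>

definition window_sorted :: "nat \<Rightarrow> nat list \<Rightarrow> bool" where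
  "window_sorted L xs \<longleftrightarrow> (\<forall>i j. i < j \<longrightarrow> j < length xs \<longrightarrow> i div L = j div L \<longrightarrow> i div w < j div w \<longrightarrow> xs ! i < xs ! j)"

text \<open>Each unfinished run shows some value above \<open>lst\<close>, and whatever it has not
  yet loaded is larger than that value, because windows of a run are ordered among each other. The
  least value above \<open>lst\<close> in the windows is therefore the least remaining element of
  the whole group, which is \<open>l ! t\<close>.\<close>

lemma selected:
  assumes dv: "w dvd g" "w dvd L" "L dvd g" and L: "0 < L"
    and ws: "window_sorted L xs"
    and runs: "\<And>r. r < K \<Longrightarrow> window_inv xs g L lst r m" and rd: "\<And>r. r < K \<Longrightarrow> ready xs g L lst r m"
    and la: "least_above m lst (K * w) b"
    and l: "l = sorted_list_of_set (set (take (K * L) (drop g xs)))" and t: "t < length l"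
    and lst: "lst = (if t = 0 then 0 else l ! (t - 1))" and pos: "\<And>x. x \<in> set xs \<Longrightarrow> 0 < x"
  shows "b = l ! t \<and> (\<forall>r<K. window_inv xs g L b r m)"
proof -
  have sl: "set l = {xs ! i |i. g \<le> i \<and> i < g + K * L \<and> i < length xs}" by (simp add: l set_take_drop)
  have sw: "sorted_wrt (<) l" unfolding l by (rule strict_sorted_list_of_set)
  have wr: "g + r * L \<le> m (K * w + r)" "m (K * w + r) \<le> g + r * L + L" "w dvd m (K * w + r) - (g + r * L)"
    "\<And>j. j < w \<Longrightarrow> m (r * w + j) =
        (if m (K * w + r) \<noteq> g + r * L \<and> m (K * w + r) - w + j < length xs then xs ! (m (K * w + r) - w + j) else 0)"
    "\<And>i. g + r * L \<le> i \<Longrightarrow> i + w < m (K * w + r) \<Longrightarrow> i < length xs \<Longrightarrow> xs ! i \<le> lst"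
    "\<And>i. m (K * w + r) \<le> i \<Longrightarrow> i < g + r * L + L \<Longrightarrow> i < length xs \<Longrightarrow> lst < xs ! i" if "r < K" for r
    using runs[OF that] unfolding window_inv_def Let_def by blast+
  have KL: "g + r * L + L \<le> g + K * L" if "r < K" for r
    using mult_le_mono1[of "Suc r" K L] that by simp
  have cell: "\<exists>i. g + r * L \<le> i \<and> i < m (K * w + r) \<and> m (K * w + r) \<le> i + w \<and> i < length xs \<and> m (r * w + j) = xs ! i"
    if "r < K" "j < w" "m (r * w + j) \<noteq> 0" for r j
  proof -
    have ne: "m (K * w + r) \<noteq> g + r * L" "m (K * w + r) - w + j < length xs" "m (r * w + j) = xs ! (m (K * w + r) - w + j)"
      using wr(4)[OF that(1,2)] that(3) by (auto split: if_splits)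
    have "w \<le> m (K * w + r) - (g + r * L)"
      using ne(1) wr(1,3)[OF that(1)] by (intro dvd_imp_le) auto
    then show ?thesis using ne that(2) by (intro exI[of _ "m (K * w + r) - w + j"]) auto
  qed
  \<comment> \<open>An element not yet loaded lies in a later window of its run than the element
    above \<open>lst\<close> that \<open>ready\<close> provides; so \<open>ws\<close> makes it
    larger than that element, which in turn is at least \<open>b\<close>.\<close>
  have later: "b < xs ! i" if lat: "r < K" "m (K * w + r) \<le> i" "i < g + r * L + L" "i < length xs" for r i
  proof -
    let ?p = "m (K * w + r)"
    have "?p < g + r * L + L" "?p < length xs" using lat by auto
    then obtain j where j: "j < w" "lst < m (r * w + j)" using rd[OF lat(1)] unfolding ready_def by auto
    then obtain i' where i': "g + r * L \<le> i'" "i' < ?p" "?p \<le> i' + w" "i' < length xs" "m (r * w + j) = xs ! i'"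
      using cell[OF lat(1) j(1)] by auto
    obtain q where q: "g = L * q" using dv(3) by auto
    have dL: "x div L = q + r" if "g + r * L \<le> x" "x < g + r * L + L" for x
      by (rule div_nat_eqI) (use that q in \<open>auto simp: algebra_simps\<close>)
    have "w dvd g + r * L + (?p - (g + r * L))" using dv wr(3)[OF lat(1)] by simp
    then obtain c where c: "?p = w * c" using wr(1)[OF lat(1)] by auto
    have "i' div w < c" using i'(2) c by (simp add: less_mult_imp_div_less mult.commute)
    moreover have "c \<le> i div w" using lat(2) c w_pos by (simp add: less_eq_div_iff_mult_less_eq mult.commute)
    ultimately have "i' div w < i div w" by simp
    moreover have "i' div L = i div L" using dL[of i'] dL[of i] i' lat wr(2)[OF lat(1)] by simp
    ultimately have "xs ! i' < xs ! i" using ws i' lat unfolding window_sorted_def by (meson less_le_trans)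
    moreover have "b \<le> m (r * w + j)"
      using la j cell_index[OF lat(1) j(1)] unfolding least_above_def by auto
    ultimately show ?thesis using i'(5) by simp
  qed
  \<comment> \<open>An element above \<open>lst\<close> is either not loaded yet, so that
    \<open>later\<close> applies, or visible in the current window, because the invariant puts all
    earlier windows at or below \<open>lst\<close>.\<close>
  have le: "b \<le> x \<and> b \<noteq> 0" if x: "x \<in> set l" "lst < x" for x
  proof -
    from x(1) obtain i where i: "g \<le> i" "i < g + K * L" "i < length xs" "x = xs ! i" unfolding sl by blast
    define r where "r = (i - g) div L"
    have "i - g < K * L" using i by linarith
    then have r: "r < K" unfolding r_def by (simp add: less_mult_imp_div_less)
    have "r * L \<le> i - g" "i - g < r * L + L"
      using div_times_less_eq_dividend[of "i - g" L] dividend_less_div_times[OF L, of "i - g"] unfolding r_def by auto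
    then have ir: "g + r * L \<le> i" "i < g + r * L + L" using i(1) by auto
    let ?p = "m (K * w + r)"
    have "\<exists>c<K * w. lst < m c \<and> m c \<le> x"
    proof (cases "?p \<le> i")
      case True
      then have "?p < g + r * L + L" "?p < length xs" using ir i by auto
      then obtain j where j: "j < w" "lst < m (r * w + j)" using rd[OF r] unfolding ready_def by auto
      have "b < xs ! i" by (rule later[OF r True ir(2) i(3)])
      moreover have "b = 0 \<longrightarrow> False" using la j cell_index[OF r j(1)] unfolding least_above_def by auto
      ultimately show ?thesis using la i(4) unfolding least_above_def by auto
    next
      case False
      have "\<not> i + w < ?p" using wr(5)[OF r ir(1)] i x(2) by auto
      then have j: "i - (?p - w) < w" "?p - w + (i - (?p - w)) = i" using False by auto
      have "?p \<noteq> g + r * L" using False ir by auto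
      then have "m (r * w + (i - (?p - w))) = xs ! i" using wr(4)[OF r j(1)] j(2) i(3) by simp
      then show ?thesis using cell_index[OF r j(1)] x i(4) by (intro exI[of _ "r * w + (i - (?p - w))"]) auto
    qed
    then obtain c where "c < K * w" "lst < m c" "m c \<le> x" by blast
    then show ?thesis using la unfolding least_above_def by auto
  qed
  have lt: "l ! t \<in> set l" using t by simp
  then have lpos: "0 < l ! t" using sl pos by auto
  have "lst < l ! t"
    using lst lpos sorted_wrt_nth_less[OF sw, of "t - 1" t] t by auto
  from le[OF lt this] have b1: "b \<le> l ! t" "b \<noteq> 0" by auto
  have lb: "lst < b" using la b1 unfolding least_above_def by auto
  from la b1 obtain c where c: "c < K * w" "m c = b" unfolding least_above_def by auto
  have "c div w < K" using c(1) by (simp add: less_mult_imp_div_less)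
  moreover have "c mod w < w" "c div w * w + c mod w = c" using w_pos by auto
  ultimately obtain i where i: "g + c div w * L \<le> i" "i < m (K * w + c div w)" "i < length xs" "b = xs ! i"
    using cell[of "c div w" "c mod w"] c b1(2) by auto
  then have "b \<in> set l" unfolding sl using KL[OF \<open>c div w < K\<close>] wr(2)[OF \<open>c div w < K\<close>]
    by (auto intro!: exI[of _ i])
  then have "l ! t \<le> b" using lb lst by (intro strict_sorted_next[OF sw t]) auto
  then have bt: "b = l ! t" using b1 by simp
  \<comment> \<open>Raising the last output from \<open>lst\<close> to \<open>b\<close> keeps the
    invariant: \<open>later\<close> is its last clause, and the others only get weaker.\<close>
  have "window_inv xs g L b r m" if r: "r < K" for r
    unfolding window_inv_def Let_def
    using wr(1-4)[OF r] wr(5)[OF r] later[OF r] lb by (meson less_imp_le order_trans)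
  then show ?thesis using bt by blast
qed

lemma wp_merge_group:
  assumes r: "reg v 4 = w" "reg v 5 = K" "reg v 7 = a" "reg v 8 = length xs" "reg v 40 = L"
    and bnd: "a + length xs \<le> 2 * U ^ 5" "dst + length xs \<le> 8 * U ^ 5" "length xs \<le> U" "L \<le> U" "0 < L"
    and src: "\<And>i. i < length xs \<Longrightarrow> old (a + i) = xs ! i" and xsW: "\<And>x. x \<in> set xs \<Longrightarrow> x < W"
    and pos: "\<And>x. x \<in> set xs \<Longrightarrow> 0 < x" and dis: "distinct xs"
    and disj: "\<And>i j. i < length xs \<Longrightarrow> j < length xs \<Longrightarrow> a + i \<noteq> dst + j"
    and dv: "w dvd g" "w dvd L" "L dvd g" and ws: "window_sorted L xs"
    and g: "g = length ys0" "g < length xs"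
    and E0: "writing dst (z + 8 * card {i. i < length xs \<and> w dvd i \<and> i < g}) old ys0 v"
    and Q: "\<And>u. writing dst (z + 8 * card {i. i < length xs \<and> w dvd i \<and> i < g + K * L}) old
        (ys0 @ sorted_list_of_set (set (take (K * L) (drop g xs)))) u \<Longrightarrow>
      \<forall>x. x \<notin> {21, 22, 23, 24, 25, 41, 42, 43, 44, 45, 46, 47} \<longrightarrow> reg u x = reg v x \<Longrightarrow> Q u"
  shows "wp merge_group Q v"
  unfolding merge_group_def
proof (rule wp_Seq, rule wp_Assign, goal_cases)
  case 3
  have "length ys0 < W" using small[of "length ys0"] g bnd U_bounds by linarith
  then show ?case using writing_regs[OF E0] by simp
next
  case 4
  define l where "l = sorted_list_of_set (set (take (K * L) (drop g xs)))"
  have ll: "length l = min (K * L) (length xs - g)"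
    unfolding l_def using dis by (simp add: distinct_card distinct_take distinct_drop)
  have sl: "set l = {xs ! i |i. g \<le> i \<and> i < g + K * L \<and> i < length xs}" by (simp add: l_def set_take_drop)
  let ?R = "\<lambda>u. \<forall>x. x \<notin> {21, 22, 23, 24, 25, 41, 42, 43, 44, 45, 46, 47} \<longrightarrow> reg u x = reg v x"
  let ?J = "\<lambda>t u. t \<le> length l \<and> reg u 41 = (if t = 0 then 0 else l ! (t - 1)) \<and> reg u 42 = g \<and> ?R u \<and>
     (\<forall>r<K. window_inv xs g L (reg u 41) r (vmem u)) \<and>
     writing dst (z + 8 * card (loaded xs g L (vmem u))) old (ys0 @ take t l) u"
  have srcE: "store u (a + i) = xs ! i" if "i < length xs" "writing dst z' old ys u" "length ys \<le> length xs" for u i ys z'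
  proof -
    have "a + i \<noteq> dst + j" if "j < length ys" for j using disj[of i j] that \<open>i < _\<close> \<open>length ys \<le> _\<close> by auto
    then have "\<not> (dst \<le> a + i \<and> a + i < dst + length ys)"
      by (metis le_add_diff_inverse nat_add_left_cancel_less)
    then show ?thesis using writing_store(1)[OF that(2)] src[OF that(1)] by simp
  qed
  show ?case
  proof (rule wp_Seq, rule wp_clear_windows[where g = g and L = L], goal_cases)
    case 3 then show ?case using writing_regs[OF E0] g by simp
  next
    case (7 u)
    show ?case
    proof (rule wp_Seq, rule wp_Assign, goal_cases)
      case 3 show ?case using W_pos by simp
    next
      case 4
      let ?u = "u\<lparr>reg := (reg u)(41 := exp_val (Const 0) (reg u))\<rparr>"
      have ld: "loaded xs g L (vmem u) = {i. i < length xs \<and> w dvd i \<and> i < g}"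
        using 7(6) unfolding loaded_def by auto
      have "window_inv xs g L 0 r (vmem u)" if "r < K" for r
        unfolding window_inv_def Let_def using 7(5,6) that cell_index[OF that] pos nth_mem by fastforce
      moreover have "writing dst (z + 8 * card (loaded xs g L (vmem u))) old (ys0 @ take 0 l) ?u"
        using E0 7(1-4) unfolding ld by (simp add: writing_def credit_def)
      ultimately have init: "?J 0 ?u"
        using 7(4) writing_regs[OF E0] g by auto
      show ?case
      proof (rule wp_While[where I = "\<lambda>u. \<exists>t. ?J t u" and f = "\<lambda>u. length xs - reg u 21"], goal_cases)
        case 2 then show ?case using init by blast
      next
        case (3 u)
        then obtain t where J: "?J t u" by blast
        have tt: "t \<le> length l" using J by simp
        have Eu: "writing dst (z + 8 * card (loaded xs g L (vmem u))) old (ys0 @ take t l) u" using J by simp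
        have r21: "reg u 21 = g + t" "reg u 9 = dst" using writing_regs[OF Eu] g tt by auto
        have rs: "reg u 4 = w" "reg u 5 = K" "reg u 7 = a" "reg u 8 = length xs" "reg u 40 = L" "reg u 42 = g"
          using J r by auto
        have tl: "t < length l" using 3(2) rs r21 unfolding ll by auto
        have gl: "length (ys0 @ take t l) \<le> length xs" using ll tl g by auto
        show ?case
        proof (rule wp_Seq, rule wp_refill[where a = a and xs = xs and L = L and lst = "reg u 41" and g = g and z = z and old = old and ys = "ys0 @ take t l" and dst = dst], goal_cases)
          case (10 i) then show ?case using srcE[OF _ Eu gl] by simp
        next
          case (14 r) then show ?case using J by blast
        next
          case 15 show ?case by (rule Eu)
        next
          case (16 u1)
          have rs1: "reg u1 4 = w" "reg u1 5 = K" "reg u1 41 = reg u 41" "reg u1 42 = g" "?R u1" "reg u1 8 = length xs" "reg u1 21 = g + t"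
            using 16(4) J rs r21 by auto
          have mW: "vmem u1 c < W" if "c < K * w" for c
          proof -
            have "c div w < K" using that by (simp add: less_mult_imp_div_less)
            moreover have "c mod w < w" "c div w * w + c mod w = c" using w_pos by auto
            ultimately have "vmem u1 c = 0 \<or> (\<exists>i<length xs. vmem u1 c = xs ! i)"
              using 16(1)[of "c div w"] unfolding window_inv_def Let_def by (metis (full_types))
            then show ?thesis using W_pos xsW nth_mem by auto
          qed
          show ?case
          proof (rule wp_Seq, rule wp_select, goal_cases)
            case 3 then show ?case using mW by simp
          next
            case (4 u2)
            have sel: "reg u2 43 = l ! t \<and> (\<forall>r<K. window_inv xs g L (reg u2 43) r (vmem u1))"
              by (rule selected[OF dv bnd(5) ws 16(1,2) _ l_def tl _ pos])
                 (use 4 rs1 J in auto)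
            have v2: "vmem u2 = vmem u1" using 4(1) by (simp add: same_def)
            have E2: "writing dst (z + 8 * card (loaded xs g L (vmem u1))) old (ys0 @ take t l) u2"
              by (rule writing_same[OF 16(3) 4(1)]) (use 4(2) in auto)
            have "l ! t \<in> set l" using tl by simp
            then have bW: "l ! t < W" using xsW nth_mem unfolding sl by auto
            have rs2: "reg u2 4 = w" "reg u2 42 = g" "?R u2" "reg u2 8 = length xs" "reg u2 21 = g + t"
              using 4(2) rs1 by auto
            show ?case
            proof (rule wp_Seq, rule wp_emit[OF E2], goal_cases)
              case 3
              show ?case using gl bnd by linarith
            next
              case (4 u3)
              have tk: "take (Suc t) l = take t l @ [l ! t]" using tl by (simp add: take_Suc_conv_app_nth)
              show ?case
              proof (rule wp_Assign, goal_cases)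
                case 3 then show ?case using 4 sel bW by simp
              next
                case fin: 4
                let ?u3 = "u3\<lparr>reg := (reg u3)(41 := exp_val (Reg 43) (reg u3))\<rparr>"
                have "?J (Suc t) ?u3"
                  using tl 4 sel rs2 v2 tk by (auto intro: writing_reg)
                moreover have "length xs - reg ?u3 21 < length xs - reg u 21"
                  using 4(2) r21 gl tl ll g by auto
                ultimately show ?case by blast
              qed (simp_all add: reg_ok_def)
            qed (use sel bW in simp_all)
          qed (use rs1 in simp_all)
        qed (use rs bnd dv xsW in simp_all)
      next
        case (4 u)
        then obtain t where J: "?J t u" by blast
        have Eu: "writing dst (z + 8 * card (loaded xs g L (vmem u))) old (ys0 @ take t l) u" using J by simp
        have r21: "reg u 21 = g + t" using writing_regs[OF Eu] g J by auto
        have rs: "reg u 5 = K" "reg u 8 = length xs" "reg u 40 = L" "reg u 42 = g" using J r by auto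
        have "t = length l" using 4(2) J r21 rs g unfolding ll by auto
        then have t: "take t l = l" by simp
        have "loaded xs g L (vmem u) \<subseteq> {i. i < length xs \<and> w dvd i \<and> i < g + K * L}"
        proof
          fix i assume i: "i \<in> loaded xs g L (vmem u)"
          have "i < g + K * L" if "r < K" "i < vmem u (K * w + r)" for r
          proof -
            have "vmem u (K * w + r) \<le> g + r * L + L" using J that(1) unfolding window_inv_def Let_def by auto
            moreover have "r * L + L \<le> K * L" using mult_le_mono1[of "Suc r" K L] that(1) by simp
            ultimately show ?thesis using that(2) by linarith
          qed
          then show "i \<in> {i. i < length xs \<and> w dvd i \<and> i < g + K * L}" using i unfolding loaded_def by auto
        qed
        then have "card (loaded xs g L (vmem u)) \<le> card {i. i < length xs \<and> w dvd i \<and> i < g + K * L}"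
          by (intro card_mono) (auto intro: finite_subset[of _ "{..<length xs}"])
        then have "writing dst (z + 8 * card {i. i < length xs \<and> w dvd i \<and> i < g + K * L}) old (ys0 @ l) u"
          using writing_mono[OF Eu] t by simp
        then show ?case by (rule Q[folded l_def]) (use J in auto)
      qed simp
    qed (simp_all add: reg_ok_def)
  qed (use r g bnd in simp_all)
qed (simp_all add: reg_ok_def)

lemma card_multiples: "card {i. i < n \<and> w dvd i \<and> i < g} \<le> n div w + 1"
proof -
  have "{i. i < n \<and> w dvd i \<and> i < g} \<subseteq> (\<lambda>q. w * q) ` {..n div w}"
  proof
    fix i assume "i \<in> {i. i < n \<and> w dvd i \<and> i < g}"
    then obtain q where q: "i = w * q" "i < n" by auto
    then have "q \<le> n div w" using w_pos by (simp add: less_eq_div_iff_mult_less_eq mult.commute)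
    then show "i \<in> (\<lambda>q. w * q) ` {..n div w}" using q by auto
  qed
  then have "card {i. i < n \<and> w dvd i \<and> i < g} \<le> card {..n div w}"
    by (intro surj_card_le) auto
  then show ?thesis by simp
qed

lemma wp_swap_areas:
  assumes "reg v 7 < W" "reg v 9 < W" "Q (v\<lparr>reg := (reg v)(23 := reg v 7, 7 := reg v 9, 9 := reg v 7)\<rparr>)"
  shows "wp swap_areas Q v"
  unfolding swap_areas_def
  by (intro wp_Seq wp_Assign; use assms in \<open>simp add: reg_ok_def\<close>)

text \<open>At most \<open>n div w + 1\<close> windows are loaded at 8 each, and writing costs at
  most \<open>4 * (n div B) + 6\<close>. With \<open>w \<le> B\<close> the sum is within 14 per
  window.\<close>

lemma wp_merge_pass:
  assumes r: "reg v 4 = w" "reg v 5 = K" "reg v 7 = a" "reg v 8 = length xs" "reg v 9 = dst" "reg v 40 = L"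
    and bnd: "a + length xs \<le> 2 * U ^ 5" "dst + length xs \<le> 2 * U ^ 5" "length xs \<le> U" "L \<le> U" "0 < L"
    and src: "\<And>i. i < length xs \<Longrightarrow> store v (a + i) = xs ! i" and xsW: "\<And>x. x \<in> set xs \<Longrightarrow> x < W"
    and pos: "\<And>x. x \<in> set xs \<Longrightarrow> 0 < x" and dis: "distinct xs"
    and disj: "\<And>i j. i < length xs \<Longrightarrow> j < length xs \<Longrightarrow> a + i \<noteq> dst + j"
    and dv: "w dvd L" and ws: "window_sorted L xs"
    and Q: "\<And>u. reg u 7 = dst \<Longrightarrow> reg u 9 = a \<Longrightarrow> reg u 40 = L * K \<Longrightarrow>
      \<forall>x<20. x \<noteq> 7 \<longrightarrow> x \<noteq> 9 \<longrightarrow> reg u x = reg v x \<Longrightarrow>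
      \<forall>i<length xs. store u (dst + i) = merged (K * L) xs ! i \<Longrightarrow>
      \<forall>i. \<not> (dst \<le> i \<and> i < dst + length xs) \<longrightarrow> store u i = store v i \<Longrightarrow>
      cost u \<le> cost v + 14 * (length xs div w + 1) \<Longrightarrow> Q u"
  shows "wp merge_pass Q v"
  unfolding merge_pass_def
proof (rule wp_Seq, rule wp_Assign, goal_cases)
  case 3 show ?case using W_pos by simp
next
  case 4
  let ?n = "length xs" and ?S = "\<lambda>g. {i. i < length xs \<and> w dvd i \<and> i < g}"
  let ?R = "\<lambda>u. \<forall>x. x \<notin> {21, 22, 23, 24, 25, 41, 42, 43, 44, 45, 46, 47} \<longrightarrow> reg u x = reg v x"
  let ?J = "\<lambda>ys u. ?R u \<and> writing dst (cost v + 8 * card (?S (length ys))) (store v) ys u \<and>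
     (\<exists>q. length ys = min (q * (K * L)) ?n) \<and> ys @ merged (K * L) (drop (length ys) xs) = merged (K * L) xs"
  have KL: "0 < K * L" using bnd(5) K_ge by simp
  have LK: "L * K \<le> U ^ 2" using bnd(4) KU by (simp add: power2_eq_square mult_le_mono)
  show ?case
  proof (rule wp_Seq, rule wp_While[where I = "\<lambda>u. \<exists>ys. ?J ys u" and f = "\<lambda>u. ?n - reg u 21"], goal_cases)
    case 2
    have "?J [] (v\<lparr>reg := (reg v)(21 := exp_val (Const 0) (reg v))\<rparr>)"
      using r(5) credit_bounds(1)[of dst v] by (auto simp: writing_def credit_def intro!: exI[of _ 0])
    then show ?case by blast
  next
    case (3 u)
    then obtain ys where J: "?J ys u" by blast
    then obtain q where q: "length ys = min (q * (K * L)) ?n" by blast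
    have Eu: "writing dst (cost v + 8 * card (?S (length ys))) (store v) ys u" using J by blast
    have lt: "length ys < ?n" using 3(2) writing_regs[OF Eu] J r by simp
    then have g: "length ys = q * (K * L)" using q by linarith
    let ?l = "sorted_list_of_set (set (take (K * L) (drop (length ys) xs)))"
    have ll: "length ?l = min (K * L) (?n - length ys)"
      using dis by (simp add: distinct_card distinct_take distinct_drop)
    show ?case
    proof (rule wp_merge_group[where xs = xs and g = "length ys" and a = a and L = L, OF _ _ _ _ _ _ _ _ _ _ _ _ _ _ _ _ _ _ _ _ _ Eu], goal_cases)
      case (22 u2)
      let ?ys = "ys @ ?l"
      have len: "length ?ys = min (Suc q * (K * L)) ?n" using ll g lt by simp
      have eqS: "?S (length ys + K * L) = ?S (length ?ys)" using ll lt by auto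
      have dr: "drop (length ?ys) xs = drop (K * L) (drop (length ys) xs)"
        using ll lt by (cases "K * L \<le> ?n - length ys") (auto simp: add.commute)
      have "drop (length ys) xs \<noteq> []" using lt by simp
      then have m: "merged (K * L) (drop (length ys) xs) = ?l @ merged (K * L) (drop (length ?ys) xs)"
        unfolding dr using KL by (subst merged.simps) simp
      have "?J ?ys u2"
      proof (intro conjI)
        show "?R u2" using 22(2) J by auto
        show "writing dst (cost v + 8 * card (?S (length ?ys))) (store v) ?ys u2" using 22(1) unfolding eqS .
        show "\<exists>q. length ?ys = min (q * (K * L)) ?n" using len by blast
        show "?ys @ merged (K * L) (drop (length ?ys) xs) = merged (K * L) xs"
          using J m by (metis append.assoc)
      qed
      moreover have "?n - reg u2 21 < ?n - reg u 21"
      proof -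
        have "0 < length ?l" using ll lt KL by simp
        then have "length ys < length ?ys" by simp
        moreover have "reg u2 21 = length ?ys" "reg u 21 = length ys" using writing_regs[OF 22(1)] writing_regs[OF Eu] by auto
        ultimately show ?thesis using lt by linarith
      qed
      ultimately show ?case by blast
    qed (use r J bnd src xsW pos dis disj dv ws g lt in simp_all)
  next
    case (4 u)
    then obtain ys where J: "?J ys u" by blast
    have Eu: "writing dst (cost v + 8 * card (?S (length ys))) (store v) ys u" using J by blast
    have "length ys = ?n" using 4(2) writing_regs[OF Eu] J r by auto
    then have ys: "ys = merged (K * L) xs" using J by (simp add: merged.simps)
    have rs: "reg u 7 = a" "reg u 9 = dst" "reg u 40 = L" "reg u 5 = K" using J r by auto
    have W: "a < W" "dst < W" "L * K < W"
      using small[of a] small[of dst] small[of "L * K"] LK bnd U_bounds by linarith+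
    have "?n div B \<le> ?n div w" using w_le w_pos by (simp add: div_le_mono2)
    then have c: "cost u \<le> cost v + 14 * (?n div w + 1)"
      using writing_cost[OF Eu] card_multiples[of ?n "length ys"] \<open>length ys = ?n\<close> by (simp add: add_mult_distrib2) 
    show ?case
    proof (rule wp_Seq, rule wp_swap_areas, goal_cases)
      case 3
      show ?case
      proof (rule wp_Assign, goal_cases)
        case 4
        show ?case
        proof (rule Q, goal_cases)
          case 4 then show ?case using J by auto
        next
          case 5 then show ?case using writing_store(2)[OF Eu] ys \<open>length ys = ?n\<close> by simp
        next
          case 6 then show ?case using writing_store(1)[OF Eu] \<open>length ys = ?n\<close> by simp
        qed (use rs c in simp_all)
      qed (use rs W in \<open>simp_all add: reg_ok_def\<close>)
    qed (use rs W in simp_all)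
  qed simp
qed (simp_all add: reg_ok_def)

lemma window_sorted_w: "window_sorted w xs"
  by (simp add: window_sorted_def)

lemma window_sorted_merged: "0 < k \<Longrightarrow> distinct xs \<Longrightarrow> window_sorted k (merged k xs)"
  unfolding window_sorted_def using merged_ordered length_merged by metis

text \<open>After \<open>j\<close> passes the runs have length \<open>w * K ^ j\<close>, so the
  first hypothesis on \<open>P\<close> says that \<open>P\<close> bounds the number of passes. The
  areas swap in every pass, so the result may end up in either of them.\<close>

lemma wp_sort:
  fixes P :: nat
  assumes r: "reg v 4 = w" "reg v 5 = K" "reg v 7 = a" "reg v 8 = length xs" "reg v 9 = dst"
    and bnd: "a + length xs \<le> 2 * U ^ 5" "dst + length xs \<le> 2 * U ^ 5" "length xs \<le> U"
    and src: "\<And>i. i < length xs \<Longrightarrow> store v (a + i) = xs ! i" and xsW: "\<And>x. x \<in> set xs \<Longrightarrow> x < W"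
    and pos: "\<And>x. x \<in> set xs \<Longrightarrow> 0 < x" and dis: "distinct xs"
    and disj: "\<And>i j. i < length xs \<Longrightarrow> j < length xs \<Longrightarrow> a + i \<noteq> dst + j"
    and P: "\<And>j. w * K ^ j < length xs \<Longrightarrow> Suc j \<le> P" "1 \<le> P"
    and Q: "\<And>u. reg u 7 = a \<and> reg u 9 = dst \<or> reg u 7 = dst \<and> reg u 9 = a \<Longrightarrow>
      \<forall>x<20. x \<noteq> 7 \<longrightarrow> x \<noteq> 9 \<longrightarrow> reg u x = reg v x \<Longrightarrow>
      \<forall>i<length xs. store u (reg u 7 + i) = sorted_list_of_set (set xs) ! i \<Longrightarrow>
      \<forall>i. \<not> (a \<le> i \<and> i < a + length xs) \<longrightarrow> \<not> (dst \<le> i \<and> i < dst + length xs) \<longrightarrow> store u i = store v i \<Longrightarrow>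
      cost u \<le> cost v + P * (14 * (length xs div w + 1)) \<Longrightarrow> Q u"
  shows "wp sort_prog Q v"
  unfolding sort_prog_def
proof (rule wp_Seq, rule wp_Assign, goal_cases)
  case 3 then show ?case using small[of w] wU U_bounds r by simp
next
  case 4
  let ?n = "length xs"
  let ?c = "14 * (?n div w + 1)"
  let ?Z = "\<lambda>j L zs u. 1 \<le> j \<and> L = w * K ^ j \<and> j \<le> P \<and> reg u 40 = L \<and>
     (reg u 7 = a \<and> reg u 9 = dst \<or> reg u 7 = dst \<and> reg u 9 = a) \<and>
     (\<forall>x<20. x \<noteq> 7 \<longrightarrow> x \<noteq> 9 \<longrightarrow> reg u x = reg v x) \<and>
     length zs = ?n \<and> set zs = set xs \<and> distinct zs \<and> window_sorted L zs \<and> (?n \<le> L \<longrightarrow> zs = sorted_list_of_set (set xs)) \<and>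
     (\<forall>i<?n. store u (reg u 7 + i) = zs ! i) \<and>
     (\<forall>i. \<not> (a \<le> i \<and> i < a + ?n) \<longrightarrow> \<not> (dst \<le> i \<and> i < dst + ?n) \<longrightarrow> store u i = store v i) \<and>
     cost u \<le> cost v + j * ?c"
  have step: "merged (K * L) zs = sorted_list_of_set (set xs)"
    if "?n \<le> K * L" "length zs = ?n" "set zs = set xs" for L zs
    using merged_sorted[of zs "K * L"] that by simp
  show ?case
  proof (rule wp_Seq, rule wp_merge_pass[where xs = xs and a = a and dst = dst and L = w], goal_cases)
    case (19 u)
    have Kw: "0 < K * w" using K_ge w_pos by simp
    have init: "?Z 1 (w * K ^ 1) (merged (K * w) xs) u"
      using 19 P(2) set_merged[OF Kw] length_merged[OF Kw dis] distinct_merged[OF Kw dis]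
        window_sorted_merged[OF Kw dis] step[of w xs]
      by (auto simp: mult.commute)
    show ?case
    proof (rule wp_While[where I = "\<lambda>u. \<exists>j L zs. ?Z j L zs u" and f = "\<lambda>u. ?n - reg u 40"], goal_cases)
      case 2 show ?case using init by blast
    next
      case (3 u)
      then obtain j L zs where Z: "?Z j L zs u" by blast
      have r8: "reg u 8 = ?n" "reg u 4 = w" "reg u 5 = K" using Z r by auto
      have lt: "L < ?n" using 3(2) Z r8 by simp
      have L0: "0 < L" using Z w_pos K_ge by auto
      have KL: "0 < K * L" using L0 K_ge by simp
      have dz: "distinct zs" "length zs = ?n" "set zs = set xs" using Z by auto
      let ?a = "reg u 7" and ?o = "reg u 9"
      show ?case
      proof (rule wp_merge_pass[where xs = zs and a = ?a and dst = ?o and L = L], goal_cases)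
        case (19 u2)
        have "Suc j \<le> P" using P(1)[of j] Z lt by simp
        moreover have "cost u2 \<le> cost v + Suc j * ?c" using 19(7) Z by simp
        moreover have "store u2 i = store v i"
          if "\<not> (a \<le> i \<and> i < a + ?n)" "\<not> (dst \<le> i \<and> i < dst + ?n)" for i
          using that 19(6) Z by auto
        ultimately have "?Z (Suc j) (L * K) (merged (K * L) zs) u2"
          using 19(1-5) Z set_merged[OF KL, of zs] length_merged[OF KL dz(1)] distinct_merged[OF KL dz(1)]
            window_sorted_merged[OF KL dz(1)] step[of L zs]
          by (auto simp: mult.commute mult.left_commute)
        moreover have "?n - reg u2 40 < ?n - reg u 40"
        proof -
          have "L * 2 \<le> L * K" using K_ge by simp
          then have "L < L * K" using L0 by linarith
          moreover have "reg u2 40 = L * K" "reg u 40 = L" using 19(3) Z by simp_all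
          ultimately show ?thesis using lt by linarith
        qed
        ultimately show ?case by blast
      next
        case (16 i j)
        then show ?case using Z disj by metis
      qed (use Z r8 bnd lt L0 xsW pos in auto)
    next
      case (4 u)
      then obtain j L zs where Z: "?Z j L zs u" by blast
      have "?n \<le> L" using 4(2) Z r by auto
      moreover have "j * ?c \<le> P * ?c" using Z by (intro mult_le_mono1) simp
      then have "cost u \<le> cost v + P * ?c" using Z by linarith
      ultimately show ?case using Z by (intro Q) auto
    qed simp
  qed (use r bnd src xsW pos dis disj wU w_pos window_sorted_w in simp_all)
qed (simp_all add: reg_ok_def)

end

section \<open>Joins by sorting\<close>

text \<open>Records are numbers in base \<open>X\<close>: as long as all fields but the leading one
  are below \<open>X\<close>, comparing numbers means comparing the fields lexicographically.
  Sorting by several keys thus becomes sorting of numbers.\<close>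

definition pack :: "nat \<Rightarrow> nat \<Rightarrow> nat \<Rightarrow> nat" where
  "pack X a b = a * X + b"

lemma pack_div [simp]: "b < X \<Longrightarrow> pack X a b div X = a"
  by (simp add: pack_def)

lemma pack_mod [simp]: "b < X \<Longrightarrow> pack X a b mod X = b"
  by (simp add: pack_def)

lemma pack_eq: "b < X \<Longrightarrow> b' < X \<Longrightarrow> pack X a b = pack X a' b' \<longleftrightarrow> a = a' \<and> b = b'"
  by (metis pack_div pack_mod)

lemma pack_bound: "a < Y \<Longrightarrow> b < X \<Longrightarrow> pack X a b < Y * X"
  using cell_index[of a Y b X] by (simp add: pack_def)

lemma pack_less: "b < X \<Longrightarrow> b' < X \<Longrightarrow> pack X a b < pack X a' b' \<longleftrightarrow> a < a' \<or> a = a' \<and> b < b'"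
proof -
  have *: "pack X a b < pack X a' b'" if "a < a'" "b < X" for a b a' b'
    using cell_index[OF that] unfolding pack_def by linarith
  show "b < X \<Longrightarrow> b' < X \<Longrightarrow> ?thesis"
    using *[of a a' b b'] *[of a' a b' b] by (cases a a' rule: linorder_cases) (auto simp: pack_def)
qed

lemma pack_le: "b < X \<Longrightarrow> b' < X \<Longrightarrow> pack X a b \<le> pack X a' b' \<longleftrightarrow> a < a' \<or> a = a' \<and> b \<le> b'"
  using pack_less[of b' X b a' a] by (auto simp: not_less[symmetric])

lemma pack_mod2: "pos < X \<Longrightarrow> d < X \<Longrightarrow> pack X (pack X g pos) d mod (X * X) = pack X pos d"
  using pack_bound[of pos X d X] by (simp add: pack_def add_mult_distrib mult.assoc add.assoc)

abbreviation packE :: "exp \<Rightarrow> exp \<Rightarrow> exp" where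
  "packE e f \<equiv> e \<otimes> Reg 6 \<oplus> f"

text \<open>The records of a join are, from the most significant part, key, position, kind, and label.
  Kinds: 0 a parent that is absent from the result, 1 a child, 2 a parent that also enters the result. A parent at
  depth \<open>d\<close> has key \<open>d + h\<close>, so that a child follows its parent among the records with its own depth
  as key. Linking attaches to a child the label of the last parent in sorted order, ranking replaces
  the pair of labels by its rank.\<close>

definition kindf :: "nat \<Rightarrow> nat \<Rightarrow> nat" where
  "kindf X x = (x div X) mod X"

text \<open>The default 0 stands for a missing parent and cannot be mistaken for a name, because
  names start from 1.\<close>

definition lastlab :: "nat \<Rightarrow> nat set \<Rightarrow> nat" where
  "lastlab X S = (let P = {p \<in> S. kindf X p \<noteq> 1} in if P = {} then 0 else Max P mod X)"

text \<open>The leading fields of the result, kind, parent label and own label, make records to be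
  identified adjacent after sorting; position and depth follow. The subtraction undoes the shift of
  a parent's key: \<open>kindf X x - 1\<close> is 0 for a child and 1 for a parent of kind
  2.\<close>

definition linkf :: "nat \<Rightarrow> nat \<Rightarrow> nat set \<Rightarrow> nat \<Rightarrow> nat" where
  "linkf X h T x = pack X (pack X (pack X (pack X (kindf X x) (lastlab X {y \<in> T. y \<le> x})) (x mod X)) (x div X div X mod X))
     (x div X div X div X - h * (kindf X x - 1))"

text \<open>Position and depth become the leading fields, so that the last sort restores document
  order; the other three fields are replaced by their dense rank, counted from 1.\<close>

definition rankf :: "nat \<Rightarrow> nat set \<Rightarrow> nat \<Rightarrow> nat" where
  "rankf X S y = pack X (y mod (X * X)) (card ((\<lambda>z. z div X div X) ` {z \<in> S. z \<le> y}))"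

definition linked :: "nat \<Rightarrow> nat \<Rightarrow> nat set \<Rightarrow> nat set" where
  "linked X h T = linkf X h T ` {x \<in> T. kindf X x \<noteq> 0}"

definition ranked :: "nat \<Rightarrow> nat set \<Rightarrow> nat set" where
  "ranked X S = rankf X S ` S"

definition link :: prog where
  "link = Assign 32 ((Reg 20 \<oslash> Reg 6) \<odot> Reg 6) ;;
     Cond (Equal (Reg 32) (Const 1)) Skip (Assign 30 (Reg 20 \<odot> Reg 6)) ;;
     Cond (Equal (Reg 32) (Const 0)) Skip
       (emit (packE (packE (packE (packE (Reg 32) (Reg 30)) (Reg 20 \<odot> Reg 6)) (Reg 20 \<oslash> Reg 6 \<oslash> Reg 6 \<odot> Reg 6))
          (Reg 20 \<oslash> Reg 6 \<oslash> Reg 6 \<oslash> Reg 6 \<ominus> Reg 11 \<otimes> (Reg 32 \<ominus> Const 1))))"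

definition rank :: prog where
  "rank = Cond (Equal (Reg 30) (Reg 20 \<oslash> Reg 6 \<oslash> Reg 6)) Skip
       (Assign 30 (Reg 20 \<oslash> Reg 6 \<oslash> Reg 6) ;; Assign 31 (Reg 31 \<oplus> Const 1)) ;;
     emit (packE (Reg 20 \<odot> (Reg 6 \<otimes> Reg 6)) (Reg 31))"

definition stage :: "prog \<Rightarrow> prog" where
  "stage p = Assign 21 (Const 0) ;; Assign 30 (Const 0) ;; Assign 31 (Const 0) ;; scan p ;;
     Assign 8 (Reg 21) ;; swap_areas"

text \<open>The three sorts serve different orders: by key and position, so that children follow
  their parents; by kind and labels, so that equal pairs become adjacent; and by position, to return
  to document order.\<close>

definition join :: prog where
  "join = sort_prog ;; stage link ;; sort_prog ;; stage rank ;; sort_prog"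

text \<open>In a strictly sorted array the prefix read by a scan is a lower set. This allows
  \<open>linkf\<close> and \<open>rankf\<close> to depend on the set of records only, not on places
  in the array.\<close>

lemma set_take_sorted:
  assumes "sorted_wrt (<) (xs :: nat list)" "i < length xs"
  shows "set (take (Suc i) xs) = {y \<in> set xs. y \<le> xs ! i}"
proof -
  have "xs ! j \<le> xs ! i" if "j \<le> i" for j
    using sorted_wrt_nth_less[OF assms(1), of j i] that assms(2) by (cases "j = i") auto
  moreover have "j \<le> i" if "xs ! j \<le> xs ! i" "j < length xs" for j
    using sorted_wrt_nth_less[OF assms(1), of i j] that by (meson leD leI)
  moreover have "y \<in> set (take (Suc i) xs) \<longleftrightarrow> (\<exists>j\<le>i. j < length xs \<and> xs ! j = y)" for y
    using assms(2) by (auto simp: in_set_conv_nth less_Suc_eq_le)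
  ultimately show ?thesis by (auto simp: in_set_conv_nth) blast
qed

lemma concat_filter_map:
  "concat (map (\<lambda>k. if c (xs ! k) then [g (xs ! k)] else []) [0..<length xs]) = map g (filter c xs)"
proof -
  have "concat (map (\<lambda>x. if c x then [g x] else []) xs) = map g (filter c xs)" by (induction xs) auto
  moreover have "map (\<lambda>k. if c (xs ! k) then [g (xs ! k)] else []) [0..<length xs]
      = map (\<lambda>x. if c x then [g x] else []) (map ((!) xs) [0..<length xs])" by simp
  ultimately show ?thesis by (metis map_nth)
qed

lemma lastlab_insert:
  assumes "finite S" "\<And>y. y \<in> S \<Longrightarrow> y < x"
  shows "lastlab X (insert x S) = (if kindf X x = 1 then lastlab X S else x mod X)"
proof -
  have "{p \<in> insert x S. kindf X p \<noteq> 1} = (if kindf X x = 1 then {p \<in> S. kindf X p \<noteq> 1} else insert x {p \<in> S. kindf X p \<noteq> 1})"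
    by auto
  moreover have "Max (insert x {p \<in> S. kindf X p \<noteq> 1}) = x"
    by (rule Max_eqI) (use assms in \<open>auto intro: less_imp_le\<close>)
  ultimately show ?thesis unfolding lastlab_def by (auto simp: Let_def)
qed

lemma lastlab_less: "0 < X \<Longrightarrow> lastlab X S < X"
  by (simp add: lastlab_def Let_def)

section \<open>The linking and ranking scans, and the join composed of them\<close>

context buffered
begin

text \<open>Bodies that emit at most one number per element, so that the output is no longer than
  the input. The initial \<open>ys0\<close> lets two scans write one array, which the ascent uses
  for parents and children.\<close>

lemma wp_scan_out:
  fixes St :: "nat \<Rightarrow> (nat \<Rightarrow> nat) \<Rightarrow> (nat \<Rightarrow> nat) \<Rightarrow> bool" and G :: "nat \<Rightarrow> nat list"
  assumes r: "reg v 4 = w" "reg v 7 = a" "reg v 8 = length xs"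
    and aU: "a + length xs \<le> 2 * U ^ 5" and oU: "dst + cap \<le> 2 * U ^ 5"
    and xsW: "\<And>x. x \<in> set xs \<Longrightarrow> x < W"
    and src: "\<And>i. i < length xs \<Longrightarrow> old (a + i) = xs ! i"
    and disj: "\<And>i j. i < length xs \<Longrightarrow> j < cap \<Longrightarrow> a + i \<noteq> dst + j"
    and E0: "writing dst z old ys0 v" and S0: "St 0 (reg v) (vmem v)"
    and G: "\<And>k. length (G k) \<le> 1" and cap: "length ys0 + length xs \<le> cap"
    and stab: "\<And>k r m r' m'. St k r m \<Longrightarrow> \<forall>x. x \<notin> {10,20,21,22,23,24,25} \<longrightarrow> r' x = r x \<Longrightarrow>
       \<forall>x\<ge>w. m' x = m x \<Longrightarrow> St k r' m'"
    and body: "\<And>k u z'. k < length xs \<Longrightarrow> St k (reg u) (vmem u) \<Longrightarrow>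
       writing dst z' old (ys0 @ concat (map G [0..<k])) u \<Longrightarrow>
       dst + length (ys0 @ concat (map G [0..<k])) \<le> 8 * U ^ 5 \<Longrightarrow>
       reg u 20 = xs ! k \<Longrightarrow> reg u 10 = k \<Longrightarrow> \<forall>x<20. x \<noteq> 10 \<longrightarrow> reg u x = reg v x \<Longrightarrow>
       wp p (\<lambda>u'. St (Suc k) (reg u') (vmem u') \<and> writing dst z' old ((ys0 @ concat (map G [0..<k])) @ G k) u' \<and>
          (\<forall>x<20. reg u' x = reg u x) \<and> (\<forall>x<w. vmem u' x = vmem u x)) u"
    and Q: "\<And>v'. St (length xs) (reg v') (vmem v') \<Longrightarrow>
       writing dst (z + 8 * (length xs div w + 1)) old (ys0 @ concat (map G [0..<length xs])) v' \<Longrightarrow>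
       \<forall>x<20. x \<noteq> 10 \<longrightarrow> reg v' x = reg v x \<Longrightarrow> Q v'"
  shows "wp (scan p) Q v"
proof -
  have len: "length (ys0 @ concat (map G [0..<k])) \<le> length ys0 + k" for k
  proof (induction k)
    case (Suc k) then show ?case using G[of k] by simp
  qed simp
  show ?thesis
  proof (rule wp_scan[where a = a and xs = xs and cap = cap and old = old and dst = dst and z = z and ?ys0.0 = ys0 and
      I = "\<lambda>k ys r m. ys = ys0 @ concat (map G [0..<k]) \<and> St k r m"], goal_cases)
    case (10 k ys r m r' m')
    then show ?case using stab[of k r m r' m'] by auto
  next
    case (11 k ys r m)
    then show ?case using len[of k] cap by simp
  next
    case (12 k ys u z')
    have "dst + length (ys0 @ concat (map G [0..<k])) \<le> 8 * U ^ 5" using len[of k] cap 12(1) oU by linarith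
    with 12 show ?case
      by (intro wp_mono[OF body[of k u z']]) auto
  next
    case (13 v' ys) then show ?case using Q by auto
  qed (use assms in auto)
qed

lemma wp_stage:
  fixes St :: "nat \<Rightarrow> (nat \<Rightarrow> nat) \<Rightarrow> (nat \<Rightarrow> nat) \<Rightarrow> bool" and G :: "nat \<Rightarrow> nat list"
  assumes r: "reg v 4 = w" "reg v 7 = a" "reg v 8 = length xs" "reg v 9 = dst"
    and aU: "a + length xs \<le> 2 * U ^ 5" and oU: "dst + length xs \<le> 2 * U ^ 5"
    and xsW: "\<And>x. x \<in> set xs \<Longrightarrow> x < W"
    and src: "\<And>i. i < length xs \<Longrightarrow> store v (a + i) = xs ! i"
    and disj: "\<And>i j. i < length xs \<Longrightarrow> j < length xs \<Longrightarrow> a + i \<noteq> dst + j"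
    and G: "\<And>k. length (G k) \<le> 1"
    and S0: "\<And>r m. r 30 = 0 \<Longrightarrow> r 31 = 0 \<Longrightarrow> \<forall>x<20. r x = reg v x \<Longrightarrow> St 0 r m"
    and stab: "\<And>k r m r' m'. St k r m \<Longrightarrow> \<forall>x. x \<notin> {10,20,21,22,23,24,25} \<longrightarrow> r' x = r x \<Longrightarrow>
       \<forall>x\<ge>w. m' x = m x \<Longrightarrow> St k r' m'"
    and body: "\<And>k u z'. k < length xs \<Longrightarrow> St k (reg u) (vmem u) \<Longrightarrow>
       writing dst z' (store v) (concat (map G [0..<k])) u \<Longrightarrow>
       dst + length (concat (map G [0..<k])) \<le> 8 * U ^ 5 \<Longrightarrow>
       reg u 20 = xs ! k \<Longrightarrow> reg u 10 = k \<Longrightarrow> \<forall>x<20. x \<noteq> 10 \<longrightarrow> reg u x = reg v x \<Longrightarrow>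
       wp p (\<lambda>u'. St (Suc k) (reg u') (vmem u') \<and> writing dst z' (store v) (concat (map G [0..<k]) @ G k) u' \<and>
          (\<forall>x<20. reg u' x = reg u x) \<and> (\<forall>x<w. vmem u' x = vmem u x)) u"
    and Q: "\<And>u ys. ys = concat (map G [0..<length xs]) \<Longrightarrow> length ys \<le> length xs \<Longrightarrow>
       reg u 7 = dst \<Longrightarrow> reg u 9 = a \<Longrightarrow> reg u 8 = length ys \<Longrightarrow>
       \<forall>x<20. x \<notin> {7, 8, 9, 10} \<longrightarrow> reg u x = reg v x \<Longrightarrow>
       \<exists>r m. St (length xs) r m \<and> reg u 30 = r 30 \<and> reg u 31 = r 31 \<Longrightarrow>
       \<forall>i<length ys. store u (dst + i) = ys ! i \<Longrightarrow>
       \<forall>i. \<not> (dst \<le> i \<and> i < dst + length xs) \<longrightarrow> store u i = store v i \<Longrightarrow>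
       cost u \<le> cost v + 18 * (length xs div w + 1) \<Longrightarrow> Q u"
  shows "wp (stage p) Q v"
  unfolding stage_def
proof (intro wp_Seq wp_Assign, goal_cases)
  case 3 show ?case using W_pos by simp
next
  case 6 show ?case using W_pos by simp
next
  case 9 show ?case using W_pos by simp
next
  case 10
  let ?v = "v\<lparr>reg := (reg v)(21 := exp_val (Const 0) (reg v)),
       reg := (reg (v\<lparr>reg := (reg v)(21 := exp_val (Const 0) (reg v))\<rparr>))(30 := exp_val (Const 0) (reg (v\<lparr>reg := (reg v)(21 := exp_val (Const 0) (reg v))\<rparr>)))\<rparr>"
  have len: "length (concat (map G [0..<k])) \<le> k" for k
  proof (induction k)
    case (Suc k) then show ?case using G[of k] by simp
  qed simp
  show ?case
  proof (rule wp_scan_out[where a = a and xs = xs and cap = "length xs" and old = "store v" and dst = dst and z = "cost v" and ?ys0.0 = "[]" and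
      St = St and G = G], goal_cases)
    case 9
    then show ?case using writing_init[of v dst] r credit_bounds(1)[of dst v] by (simp add: writing_def credit_def)
  next
    case 10 show ?case by (rule S0) auto
  next
    case (13 k r m r' m') then show ?case by (rule stab)
  next
    case (14 k u z')
    then show ?case using body[of k u z'] by auto
  next
    case (15 u)
    let ?ys = "concat (map G [0..<length xs])"
    have Eu: "writing dst (cost v + 8 * (length xs div w + 1)) (store v) ?ys u" using 15 by simp
    have rs: "reg u 7 = a" "reg u 9 = dst" "reg u 21 = length ?ys" using 15 r writing_regs[OF Eu] by auto
    have W: "a < W" "dst < W" "length ?ys < W"
      using small[of a] small[of dst] small[of "length ?ys"] len[of "length xs"] aU oU by linarith+
    have "length ?ys div B \<le> length xs div w"
      using div_le_mono[OF len[of "length xs"], of B] w_le w_pos div_le_mono2[of w B "length xs"] by linarith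
    then have c: "cost u \<le> cost v + 18 * (length xs div w + 1)" using writing_cost[OF Eu] by (simp add: add_mult_distrib2)
    show ?case
    proof (rule wp_Seq, rule wp_Assign, goal_cases)
      case 3 then show ?case using rs W by simp
    next
      case 4
      show ?case
      proof (rule wp_swap_areas, goal_cases)
        case 3
        show ?case
        proof (rule Q[OF refl], goal_cases)
          case 5 then show ?case using 15 by auto
        next
          case 6 show ?case
            by (rule exI[of _ "reg u"], rule exI[of _ "vmem u"]) (use 15(1) in simp)
        next
          case 7 then show ?case using writing_store(2)[OF Eu] by simp
        next
          case 8
          then show ?case using writing_store(1)[OF Eu] len[of "length xs"] by auto
        qed (use rs len c in \<open>simp_all del: length_concat\<close>)
      qed (use rs W in simp_all)
    qed (simp_all add: reg_ok_def)
  qed (use r aU oU xsW src disj G in simp_all)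
qed (simp_all add: reg_ok_def)

text \<open>\<open>P\<close> is enough merge passes for \<open>n\<close> elements; the first
  conjunct accounts for the unconditional first pass.\<close>

definition passes :: "nat \<Rightarrow> nat \<Rightarrow> bool" where
  "passes P n \<longleftrightarrow> 1 \<le> P \<and> (\<forall>j. w * K ^ j < n \<longrightarrow> Suc j \<le> P)"

lemma passes_mono: "passes P n \<Longrightarrow> m \<le> n \<Longrightarrow> passes P m"
  unfolding passes_def by (meson less_le_trans)

lemma X5: "X \<le> U \<Longrightarrow> x < X * X * X * X * X \<Longrightarrow> x < W"
proof -
  assume "X \<le> U" "x < X * X * X * X * X"
  moreover have "X ^ 5 \<le> U ^ 5" using \<open>X \<le> U\<close> by (rule power_mono) simp
  ultimately show ?thesis by (intro small) (simp add: eval_nat_numeral)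
qed

lemma linkf_bound:
  assumes "0 < X" "x < X * X * X * X"
  shows "linkf X h T x < X * X * X * X * X"
proof -
  have "x div X < X * X * X" "x div X div X < X * X" "x div X div X div X < X"
    using assms by (simp_all add: less_mult_imp_div_less mult.assoc)
  then have "x div X div X div X - h * (kindf X x - 1) < X" by linarith
  then show ?thesis unfolding linkf_def
    using assms(1) by (intro pack_bound lastlab_less) (auto simp: kindf_def)
qed

lemma wp_stage_link:
  assumes r: "reg v 4 = w" "reg v 7 = a" "reg v 8 = length zs" "reg v 9 = dst" "reg v 6 = X" "reg v 11 = h"
    and aU: "a + length zs \<le> 2 * U ^ 5" and oU: "dst + length zs \<le> 2 * U ^ 5"
    and X: "0 < X" "X \<le> U" and zsX: "\<And>x. x \<in> set zs \<Longrightarrow> x < X * X * X * X"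
    and srt: "sorted_wrt (<) zs"
    and src: "\<And>i. i < length zs \<Longrightarrow> store v (a + i) = zs ! i"
    and disj: "\<And>i j. i < length zs \<Longrightarrow> j < length zs \<Longrightarrow> a + i \<noteq> dst + j"
    and Q: "\<And>u ys. ys = map (linkf X h (set zs)) (filter (\<lambda>x. kindf X x \<noteq> 0) zs) \<Longrightarrow> length ys \<le> length zs \<Longrightarrow>
       reg u 7 = dst \<Longrightarrow> reg u 9 = a \<Longrightarrow> reg u 8 = length ys \<Longrightarrow>
       \<forall>x<20. x \<notin> {7, 8, 9, 10} \<longrightarrow> reg u x = reg v x \<Longrightarrow>
       \<forall>i<length ys. store u (dst + i) = ys ! i \<Longrightarrow>
       \<forall>i. \<not> (dst \<le> i \<and> i < dst + length zs) \<longrightarrow> store u i = store v i \<Longrightarrow>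
       cost u \<le> cost v + 18 * (length zs div w + 1) \<Longrightarrow> Q u"
  shows "wp (stage link) Q v"
proof (rule wp_stage[where xs = zs and a = a and dst = dst and
    G = "\<lambda>k. if kindf X (zs ! k) \<noteq> 0 then [linkf X h (set zs) (zs ! k)] else []" and
    St = "\<lambda>k r m. r 30 = lastlab X (set (take k zs))"], goal_cases)
  case (7 x)
  have "X * X * X * X * 1 \<le> X * X * X * X * X" using X by (intro mult_le_mono2) simp
  then show ?case using zsX[OF 7] X5[OF X(2), of x] by linarith
next
  case (11 r m) then show ?case by (simp add: lastlab_def)
next
  case (13 k u z')
  let ?x = "zs ! k" and ?os = "concat (map (\<lambda>k. if kindf X (zs ! k) \<noteq> 0 then [linkf X h (set zs) (zs ! k)] else []) [0..<k])"
  let ?l = "lastlab X (set (take (Suc k) zs))"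
  have x: "?x < X * X * X * X" using zsX 13(1) by simp
  have rs: "reg u 6 = X" "reg u 11 = h" "reg u 20 = ?x" "reg u 30 = lastlab X (set (take k zs))"
    using 13 r by auto
  have st: "set (take (Suc k) zs) = {y \<in> set zs. y \<le> ?x}" by (rule set_take_sorted[OF srt 13(1)])
  have ll: "?l = (if kindf X ?x = 1 then lastlab X (set (take k zs)) else ?x mod X)"
  proof -
    have "set (take (Suc k) zs) = insert ?x (set (take k zs))" using 13(1) by (simp add: take_Suc_conv_app_nth)
    moreover have "y < ?x" if "y \<in> set (take k zs)" for y
      using that 13(1) sorted_wrt_nth_less[OF srt, of _ k] by (auto simp: in_set_conv_nth)
    ultimately show ?thesis using lastlab_insert[of "set (take k zs)" ?x X] by simp
  qed
  have kx: "kindf X ?x < W" "?x mod X < W"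
  proof -
    have "y mod X < W" for y using mod_less_divisor[OF X(1), of y] small[of "y mod X"] X(2) U_bounds by linarith
    then show "kindf X ?x < W" "?x mod X < W" by (simp_all add: kindf_def)
  qed
  have lW: "linkf X h (set zs) ?x < W" by (rule X5[OF X(2) linkf_bound[OF X(1) x]])
  have fin: "wp (Cond (Equal (Reg 32) (Const 0)) Skip
       (emit (packE (packE (packE (packE (Reg 32) (Reg 30)) (Reg 20 \<odot> Reg 6)) (Reg 20 \<oslash> Reg 6 \<oslash> Reg 6 \<odot> Reg 6))
          (Reg 20 \<oslash> Reg 6 \<oslash> Reg 6 \<oslash> Reg 6 \<ominus> Reg 11 \<otimes> (Reg 32 \<ominus> Const 1)))))
     (\<lambda>u'. reg u' 30 = ?l \<and> writing dst z' (store v) (?os @ (if kindf X ?x \<noteq> 0 then [linkf X h (set zs) ?x] else [])) u' \<and>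
        (\<forall>x<20. reg u' x = reg u x) \<and> (\<forall>x<w. vmem u' x = vmem u x)) u2"
    if u2: "reg u2 32 = kindf X ?x" "reg u2 30 = ?l" "\<forall>x. x \<notin> {30, 32} \<longrightarrow> reg u2 x = reg u x" "writing dst z' (store v) ?os u2" "vmem u2 = vmem u" for u2
  proof (rule wp_Cond, goal_cases)
    case 2 then show ?case using u2 by (intro wp_Skip) auto
  next
    case 3
    have rs2: "reg u2 6 = X" "reg u2 11 = h" "reg u2 20 = ?x" using u2 rs by auto
    have ev: "exp_val (packE (packE (packE (packE (Reg 32) (Reg 30)) (Reg 20 \<odot> Reg 6)) (Reg 20 \<oslash> Reg 6 \<oslash> Reg 6 \<odot> Reg 6))
          (Reg 20 \<oslash> Reg 6 \<oslash> Reg 6 \<oslash> Reg 6 \<ominus> Reg 11 \<otimes> (Reg 32 \<ominus> Const 1))) (reg u2) = linkf X h (set zs) ?x"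
      using rs2 u2 st by (simp add: linkf_def pack_def)
    show ?case
      by (rule wp_emit[OF u2(4)], unfold ev) (use 3 u2 lW 13(4) in auto)
  qed simp
  show ?case
    unfolding link_def
  proof (rule wp_Seq, rule wp_Assign, goal_cases)
    case 3 then show ?case using rs kx by (simp add: kindf_def)
  next
    case 4
    show ?case
    proof (rule wp_Seq, rule wp_Cond, goal_cases)
      case 2
      then show ?case using rs ll 13(3) by (intro wp_Skip fin) (auto simp: kindf_def intro: writing_reg)
    next
      case 3
      then show ?case using rs ll 13(3) kx by (intro wp_Assign fin) (auto simp: kindf_def reg_ok_def intro: writing_reg)
    qed simp
  qed (simp_all add: reg_ok_def)
next
  case (14 u ys)
  have "ys = map (linkf X h (set zs)) (filter (\<lambda>x. kindf X x \<noteq> 0) zs)"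
    unfolding 14(1) by (rule concat_filter_map)
  then show ?case by (rule Q) (use 14 in simp_all)
qed (use r aU oU src disj in \<open>simp_all\<close>)

lemma card_group_insert:
  fixes f :: "nat \<Rightarrow> nat"
  assumes "finite S" "\<And>y. y \<in> S \<Longrightarrow> f y \<le> f x"
  shows "card (f ` insert x S) = (if f x \<in> f ` S then card (f ` S) else Suc (card (f ` S)))"
  using assms by (simp add: insert_absorb)

text \<open>A new group is recognised by comparing with the previous element. The initial 0 in
  register 30 differs from every group, because \<open>zs0\<close> makes the leading fields
  positive; so the first element opens group 1.\<close>

lemma wp_stage_rank:
  assumes r: "reg v 4 = w" "reg v 7 = a" "reg v 8 = length zs" "reg v 9 = dst" "reg v 6 = X"
    and aU: "a + length zs \<le> 2 * U ^ 5" and oU: "dst + length zs \<le> 2 * U ^ 5"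
    and X: "0 < X" "X \<le> U" and zsX: "\<And>x. x \<in> set zs \<Longrightarrow> x < X * X * X * X * X"
    and zs0: "\<And>x. x \<in> set zs \<Longrightarrow> 0 < x div X div X" and lenX: "length zs < X"
    and srt: "sorted_wrt (<) zs"
    and src: "\<And>i. i < length zs \<Longrightarrow> store v (a + i) = zs ! i"
    and disj: "\<And>i j. i < length zs \<Longrightarrow> j < length zs \<Longrightarrow> a + i \<noteq> dst + j"
    and Q: "\<And>u ys. ys = map (rankf X (set zs)) zs \<Longrightarrow>
       reg u 7 = dst \<Longrightarrow> reg u 9 = a \<Longrightarrow> reg u 8 = length ys \<Longrightarrow>
       \<forall>x<20. x \<notin> {7, 8, 9, 10} \<longrightarrow> reg u x = reg v x \<Longrightarrow>
       \<forall>i<length ys. store u (dst + i) = ys ! i \<Longrightarrow>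
       \<forall>i. \<not> (dst \<le> i \<and> i < dst + length zs) \<longrightarrow> store u i = store v i \<Longrightarrow>
       cost u \<le> cost v + 18 * (length zs div w + 1) \<Longrightarrow> Q u"
  shows "wp (stage rank) Q v"
proof -
  let ?g = "\<lambda>z. z div X div X"
  show ?thesis
  proof (rule wp_stage[where xs = zs and a = a and dst = dst and G = "\<lambda>k. [rankf X (set zs) (zs ! k)]" and
    St = "\<lambda>k r m. r 31 = card (?g ` set (take k zs)) \<and> r 30 = (if k = 0 then 0 else ?g (zs ! (k - 1)))"], goal_cases)
    case (7 x)
    then show ?case using X5[OF X(2) zsX[OF 7]] by simp
  next
    case (13 k u z')
    let ?x = "zs ! k" and ?os = "concat (map (\<lambda>k. [rankf X (set zs) (zs ! k)]) [0..<k])"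
    have rs: "reg u 6 = X" "reg u 20 = ?x" "reg u 31 = card (?g ` set (take k zs))"
        "reg u 30 = (if k = 0 then 0 else ?g (zs ! (k - 1)))"
      using 13 r by auto
    have xin: "?x \<in> set zs" using 13(1) by simp
    have mono: "?g y \<le> ?g z" if "y \<le> z" for y z using that by (intro div_le_mono)
    have prev: "y \<le> zs ! (k - 1)" if "y \<in> set (take k zs)" "k \<noteq> 0" for y
    proof -
      from that obtain j where j: "j < k" "y = zs ! j" using 13(1) by (auto simp: in_set_conv_nth)
      show ?thesis
      proof (cases "j = k - 1")
        case False
        then have "zs ! j < zs ! (k - 1)" using j 13(1) by (intro sorted_wrt_nth_less[OF srt]) auto
        then show ?thesis using j by simp
      qed (use j in simp)
    qed
    have pin: "zs ! (k - 1) \<in> set (take k zs)" if "k \<noteq> 0"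
      using that 13(1) by (auto simp: in_set_conv_nth intro!: exI[of _ "k - 1"])
    have lt: "y < ?x" if "y \<in> set (take k zs)" for y
      using that 13(1) sorted_wrt_nth_less[OF srt, of _ k] by (auto simp: in_set_conv_nth)
    \<comment> \<open>In a sorted array, a group that has occurred before is the group of the
      element immediately before.\<close>
    have eqg: "?g ?x \<in> ?g ` set (take k zs) \<longleftrightarrow> reg u 30 = ?g ?x"
    proof (cases "k = 0")
      case True then show ?thesis using rs zs0[OF xin] by auto
    next
      case False
      show ?thesis
      proof
        assume "?g ?x \<in> ?g ` set (take k zs)"
        then obtain y where y: "y \<in> set (take k zs)" "?g y = ?g ?x" by auto
        have "?g (zs ! (k - 1)) \<le> ?g ?x" using lt[OF pin[OF False]] by (intro mono) simp
        moreover have "?g y \<le> ?g (zs ! (k - 1))" by (intro mono prev[OF y(1) False])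
        ultimately show "reg u 30 = ?g ?x" using y rs False by simp
      next
        assume "reg u 30 = ?g ?x"
        then show "?g ?x \<in> ?g ` set (take k zs)"
          using rs False by (intro image_eqI[OF _ pin[OF False]]) simp
      qed
    qed
    have st: "set (take (Suc k) zs) = {y \<in> set zs. y \<le> ?x}" by (rule set_take_sorted[OF srt 13(1)])
    have ins: "set (take (Suc k) zs) = insert ?x (set (take k zs))" using 13(1) by (simp add: take_Suc_conv_app_nth)
    have cs: "card (?g ` set (take (Suc k) zs)) = (if reg u 30 = ?g ?x then card (?g ` set (take k zs)) else Suc (card (?g ` set (take k zs))))"
      unfolding ins using card_group_insert[of "set (take k zs)" ?g ?x] mono[OF less_imp_le[OF lt]] eqg by simp
    have cle: "card (?g ` set (take (Suc k) zs)) \<le> length zs"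
      using card_image_le[of "set (take (Suc k) zs)" ?g] card_length[of "take (Suc k) zs"] by simp
    then have cX: "card (?g ` set (take (Suc k) zs)) < X" using lenX by simp
    have rk: "rankf X (set zs) ?x = pack X (?x mod (X * X)) (card (?g ` set (take (Suc k) zs)))"
      unfolding rankf_def st ..
    have "rankf X (set zs) ?x < X * X * X" unfolding rk using cX X(1) by (intro pack_bound) auto
    moreover have "X * X * X * 1 * 1 \<le> X * X * X * X * X" using X by (intro mult_le_mono) auto
    ultimately have "rankf X (set zs) ?x < X * X * X * X * X" by linarith
    then have rW: "rankf X (set zs) ?x < W" by (rule X5[OF X(2)])
    have gW: "?g ?x < W" using X5[OF X(2) zsX[OF xin]] div_le_dividend[of ?x X] div_le_dividend[of "?x div X" X] by linarith
    have cW: "card (?g ` set (take (Suc k) zs)) < W" using cX small[of "card (?g ` set (take (Suc k) zs))"] X(2) U_bounds by linarith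
    have fin: "wp (emit (packE (Reg 20 \<odot> (Reg 6 \<otimes> Reg 6)) (Reg 31)))
       (\<lambda>u'. (reg u' 31 = card (?g ` set (take (Suc k) zs)) \<and> reg u' 30 = (if Suc k = 0 then 0 else ?g (zs ! (Suc k - 1)))) \<and>
        writing dst z' (store v) (?os @ [rankf X (set zs) ?x]) u' \<and>
        (\<forall>x<20. reg u' x = reg u x) \<and> (\<forall>x<w. vmem u' x = vmem u x)) u2"
      if u2: "reg u2 31 = card (?g ` set (take (Suc k) zs))" "reg u2 30 = ?g ?x" "\<forall>x. x \<notin> {30, 31} \<longrightarrow> reg u2 x = reg u x"
        "writing dst z' (store v) ?os u2" "vmem u2 = vmem u" for u2
    proof -
      have rs2: "reg u2 6 = X" "reg u2 20 = ?x" using u2 rs by auto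
      have ev: "exp_val (packE (Reg 20 \<odot> (Reg 6 \<otimes> Reg 6)) (Reg 31)) (reg u2) = rankf X (set zs) ?x"
        using rs2 u2 rk by (simp add: pack_def)
      show ?thesis
        by (rule wp_emit[OF u2(4)], unfold ev) (use u2 rW 13(4) in auto)
    qed
    show ?case
      unfolding rank_def
    proof (rule wp_Seq, rule wp_Cond, goal_cases)
      case 2
      then have "reg u 30 = ?g ?x" using rs by simp
      then show ?case using rs cs 13(3) by (intro wp_Skip fin) auto
    next
      case 3
      then have "reg u 30 \<noteq> ?g ?x" using rs by simp
      then show ?case using rs cs 13(3) gW cW
        by (intro wp_Seq wp_Assign fin) (auto simp: reg_ok_def intro!: writing_reg)
    qed simp
  next
    case (14 u ys)
    have "ys = map (rankf X (set zs)) zs"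
      using 14(1) concat_filter_map[of "\<lambda>x. True" zs "rankf X (set zs)"] by simp
    then show ?case by (rule Q) (use 14 in simp_all)
  qed (use r aU oU src disj in \<open>simp_all\<close>)
qed

text \<open>State between the stages of a join started in \<open>v\<close>: the array lies in one of
  two areas, left open since sorting may end in either. It may have shrunk, so frame and costs refer
  to the initial length bound \<open>n\<close>.\<close>

definition holds :: "nat list \<Rightarrow> nat \<Rightarrow> nat \<Rightarrow> nat \<Rightarrow> nat \<Rightarrow> vstate \<Rightarrow> vstate \<Rightarrow> bool" where
  "holds xs a dst n c v u \<longleftrightarrow> (reg u 7 = a \<and> reg u 9 = dst \<or> reg u 7 = dst \<and> reg u 9 = a) \<and>
     length xs \<le> n \<and> reg u 8 = length xs \<and> (\<forall>x<20. x \<notin> {7, 8, 9, 10} \<longrightarrow> reg u x = reg v x) \<and>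
     (\<forall>i<length xs. store u (reg u 7 + i) = xs ! i) \<and>
     (\<forall>i. \<not> (a \<le> i \<and> i < a + n) \<longrightarrow> \<not> (dst \<le> i \<and> i < dst + n) \<longrightarrow> store u i = store v i) \<and>
     cost u \<le> cost v + c"

definition areas :: "nat \<Rightarrow> nat \<Rightarrow> nat \<Rightarrow> bool" where
  "areas a dst n \<longleftrightarrow> (a + n \<le> dst \<or> dst + n \<le> a) \<and> a + n \<le> 2 * U ^ 5 \<and> dst + n \<le> 2 * U ^ 5"

lemma areas_holds:
  assumes "areas a dst n" "holds xs a dst n c v u"
  shows "i < length xs \<Longrightarrow> j < length xs \<Longrightarrow> reg u 7 + i \<noteq> reg u 9 + j"
    "reg u 7 + length xs \<le> 2 * U ^ 5" "reg u 9 + length xs \<le> 2 * U ^ 5"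
  using assms unfolding areas_def holds_def by auto

lemma wp_sort_holds:
  assumes H: "holds xs a dst n c v u" and ar: "areas a dst n" and r: "reg v 4 = w" "reg v 5 = K"
    and xs: "\<And>x. x \<in> set xs \<Longrightarrow> 0 < x \<and> x < W" "distinct xs" "length xs \<le> U" and P: "passes P n"
    and Q: "\<And>u. holds (sorted_list_of_set (set xs)) a dst n (c + P * (14 * (n div w + 1))) v u \<Longrightarrow> Q u"
  shows "wp sort_prog Q u"
proof (rule wp_sort[where xs = xs and a = "reg u 7" and dst = "reg u 9" and P = P], goal_cases)
  case (13 i j) then show ?case by (rule areas_holds(1)[OF ar H])
next
  case (14 j)
  then show ?case using P H unfolding passes_def holds_def by (meson less_le_trans)
next
  case (16 u2)
  have len: "length (sorted_list_of_set (set xs)) = length xs" using xs(2) by (simp add: distinct_card)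
  have cH: "cost u \<le> cost v + c" using H by (simp add: holds_def)
  have "length xs div w \<le> n div w" using H by (intro div_le_mono) (simp add: holds_def)
  then have "P * (14 * (length xs div w + 1)) \<le> P * (14 * (n div w + 1))" by (intro mult_le_mono2) simp
  then have c: "cost u2 \<le> cost v + (c + P * (14 * (n div w + 1)))" using 16(5) cH by linarith
  have n: "length xs \<le> n" using H by (simp add: holds_def)
  have fr: "store u2 i = store v i" if "\<not> (a \<le> i \<and> i < a + n)" "\<not> (dst \<le> i \<and> i < dst + n)" for i
  proof -
    have "\<not> (reg u 7 \<le> i \<and> i < reg u 7 + length xs) \<and> \<not> (reg u 9 \<le> i \<and> i < reg u 9 + length xs)"
      using H that n unfolding holds_def by auto
    then have "store u2 i = store u i" using 16(4) by blast
    also have "store u i = store v i" using H that unfolding holds_def by blast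
    finally show ?thesis .
  qed
  have reg: "(reg u2 7 = a \<and> reg u2 9 = dst \<or> reg u2 7 = dst \<and> reg u2 9 = a)" using 16(1) H unfolding holds_def by auto
  have rs: "\<forall>x<20. x \<notin> {7, 8, 9, 10} \<longrightarrow> reg u2 x = reg v x" "reg u2 8 = length xs" using 16(2) H unfolding holds_def by auto
  show ?case by (rule Q) (use reg rs fr c len n 16(3) in \<open>auto simp: holds_def simp del: length_sorted_list_of_set\<close>)
qed (use H r xs P areas_holds(2,3)[OF ar H] in \<open>auto simp: holds_def passes_def\<close>)

lemma holds_stage:
  assumes H: "holds xs a dst n c v u" and len: "length ys \<le> length xs"
    and u: "reg u2 7 = reg u 9" "reg u2 9 = reg u 7" "reg u2 8 = length ys"
       "\<forall>x<20. x \<notin> {7, 8, 9, 10} \<longrightarrow> reg u2 x = reg u x"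
       "\<forall>i<length ys. store u2 (reg u 9 + i) = ys ! i"
       "\<forall>i. \<not> (reg u 9 \<le> i \<and> i < reg u 9 + length xs) \<longrightarrow> store u2 i = store u i"
       "cost u2 \<le> cost u + 18 * (length xs div w + 1)"
  shows "holds ys a dst n (c + 18 * (n div w + 1)) v u2"
proof -
  have n: "length xs \<le> n" using H by (simp add: holds_def)
  have "length xs div w \<le> n div w" by (rule div_le_mono[OF n])
  then have "18 * (length xs div w + 1) \<le> 18 * (n div w + 1)" by simp
  moreover have cH: "cost u \<le> cost v + c" using H by (simp add: holds_def)
  ultimately have c: "cost u2 \<le> cost v + (c + 18 * (n div w + 1))" using u(7) cH by linarith
  have fr: "store u2 i = store v i" if "\<not> (a \<le> i \<and> i < a + n)" "\<not> (dst \<le> i \<and> i < dst + n)" for i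
  proof -
    have "\<not> (reg u 9 \<le> i \<and> i < reg u 9 + length xs)"
      using H that n unfolding holds_def by auto
    then have "store u2 i = store u i" using u(6) by blast
    also have "store u i = store v i" using H that unfolding holds_def by blast
    finally show ?thesis .
  qed
  show ?thesis unfolding holds_def using fr c u H len n by (auto simp: holds_def)
qed

lemma wp_link_holds:
  assumes H: "holds zs a dst n c v u" and ar: "areas a dst n" and r: "reg v 4 = w" "reg v 6 = X" "reg v 11 = h"
    and X: "0 < X" "X \<le> U" and zs: "\<And>x. x \<in> set zs \<Longrightarrow> x < X * X * X * X" "sorted_wrt (<) zs"
    and Q: "\<And>u. holds (map (linkf X h (set zs)) (filter (\<lambda>x. kindf X x \<noteq> 0) zs)) a dst n (c + 18 * (n div w + 1)) v u \<Longrightarrow> Q u"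
  shows "wp (stage link) Q u"
proof (rule wp_stage_link[where zs = zs and a = "reg u 7" and dst = "reg u 9" and X = X and h = h], goal_cases)
  case (14 i j) then show ?case by (rule areas_holds(1)[OF ar H])
next
  case (15 u2 ys)
  show ?case by (rule Q, rule holds_stage[OF H]) (use 15 in simp_all)
qed (use H r X zs areas_holds(2,3)[OF ar H] in \<open>auto simp: holds_def\<close>)

lemma wp_rank_holds:
  assumes H: "holds zs a dst n c v u" and ar: "areas a dst n" and r: "reg v 4 = w" "reg v 6 = X"
    and X: "0 < X" "X \<le> U" "length zs < X"
    and zs: "\<And>x. x \<in> set zs \<Longrightarrow> x < X * X * X * X * X \<and> 0 < x div X div X" "sorted_wrt (<) zs"
    and Q: "\<And>u. holds (map (rankf X (set zs)) zs) a dst n (c + 18 * (n div w + 1)) v u \<Longrightarrow> Q u"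
  shows "wp (stage rank) Q u"
proof (rule wp_stage_rank[where zs = zs and a = "reg u 7" and dst = "reg u 9" and X = X], goal_cases)
  case (15 i j) then show ?case by (rule areas_holds(1)[OF ar H])
next
  case (16 u2 ys)
  show ?case by (rule Q, rule holds_stage[OF H]) (use 16 in simp_all)
qed (use H r X zs areas_holds(2,3)[OF ar H] in \<open>auto simp: holds_def\<close>)

text \<open>\<open>inj1\<close> and \<open>inj2\<close> keep the intermediate arrays free of
  duplicates, as sorting requires, and \<open>lpos\<close> makes the groups of the ranking
  positive.\<close>

lemma wp_join_holds:
  assumes H: "holds xs a dst n c v u" and ar: "areas a dst n"
    and r: "reg v 4 = w" "reg v 5 = K" "reg v 6 = X" "reg v 11 = h"
    and bnd: "length xs < X" "X \<le> U"
    and xsX: "\<And>x. x \<in> set xs \<Longrightarrow> x < X * X * X * X \<and> 0 < x" and dis: "distinct xs"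
    and P: "passes P n"
    and inj1: "inj_on (linkf X h (set xs)) {x \<in> set xs. kindf X x \<noteq> 0}"
    and lpos: "\<And>x. x \<in> linked X h (set xs) \<Longrightarrow> 0 < x div X div X"
    and inj2: "inj_on (rankf X (linked X h (set xs))) (linked X h (set xs))"
    and Q: "\<And>u. holds (sorted_list_of_set (ranked X (linked X h (set xs)))) a dst n (c + P * (78 * (n div w + 1))) v u \<Longrightarrow> Q u"
  shows "wp join Q u"
proof -
  let ?T = "set xs" and ?q = "n div w + 1" and ?L = "linked X h (set xs)"
  have X0: "0 < X" using bnd(1) by simp
  have le: "X * X * X * X * 1 \<le> X * X * X * X * X" "X * X * X * 1 * 1 \<le> X * X * X * X * X"
    using X0 by (intro mult_le_mono; simp)+
  have xsW: "x < W" if "x \<in> set xs" for x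
    using xsX[OF that] le X5[OF bnd(2), of x] by linarith
  define zs where "zs = sorted_list_of_set ?T"
  have lz: "length zs = length xs" unfolding zs_def using dis by (simp add: distinct_card)
  have sz: "set zs = ?T" by (simp add: zs_def)
  define ys where "ys = map (linkf X h ?T) (filter (\<lambda>x. kindf X x \<noteq> 0) zs)"
  have sy: "set ys = ?L" by (auto simp: ys_def linked_def sz)
  have dy: "distinct ys" using inj1 by (auto simp: ys_def distinct_map sz zs_def intro: inj_on_subset)
  have ly: "length ys \<le> length xs" using lz by (simp add: ys_def) (metis length_filter_le)
  have lyX: "x < X * X * X * X * X" if "x \<in> set ys" for x
    using that xsX linkf_bound[OF X0] by (auto simp: ys_def sz)
  define ts where "ts = sorted_list_of_set ?L"
  have fL: "finite ?L" using sy by (metis finite_set)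
  have lt: "length ts = length ys" using dy sy by (metis distinct_card length_sorted_list_of_set ts_def)
  have st: "set ts = ?L" using fL by (simp add: ts_def)
  define us where "us = map (rankf X ?L) ts"
  have su: "set us = ranked X ?L" by (simp add: us_def ranked_def st)
  have du: "distinct us" using inj2 st by (simp add: us_def distinct_map ts_def)
  have uX: "0 < x \<and> x < W" if "x \<in> set us" for x
  proof -
    from that obtain y where y: "y \<in> ?L" "x = rankf X ?L y" using st by (auto simp: us_def)
    let ?C = "(\<lambda>z. z div X div X) ` {z \<in> ?L. z \<le> y}"
    have f: "finite {z \<in> ?L. z \<le> y}" using fL by simp
    have "?C \<noteq> {}" using y(1) by blast
    then have c0: "card ?C \<noteq> 0" using f by simp
    have "card ?C \<le> card ?L"
      using card_image_le[OF f, of "\<lambda>z. z div X div X"] card_mono[OF fL, of "{z \<in> ?L. z \<le> y}"] by auto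
    moreover have "card ?L \<le> length xs" using ly card_length[of ys] sy by simp
    ultimately have cX: "card ?C < X" using bnd(1) by linarith
    have "x < X * X * X" unfolding y(2) rankf_def using cX X0 by (intro pack_bound) auto
    then have "x < X * X * X * X * X" using le(2) by linarith
    then have "x < W" by (rule X5[OF bnd(2)])
    then show ?thesis using c0 unfolding y(2) rankf_def pack_def by linarith
  qed
  have P18: "18 * ?q \<le> P * (18 * ?q)" using P by (simp add: passes_def)
  have nU: "length xs \<le> U" using bnd by simp
  show ?thesis unfolding join_def
  proof (rule wp_Seq, rule wp_sort_holds[OF H ar r(1,2) _ dis nU P], goal_cases)
    case (1 x) then show ?case using xsX xsW by simp
  next
    case (2 u1)
    show ?case
    proof (rule wp_Seq, rule wp_link_holds[OF 2[folded zs_def] ar r(1,3,4) X0 bnd(2)], goal_cases)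
      case (1 x) then show ?case using xsX sz by simp
    next
      case 2 show ?case unfolding zs_def by (rule strict_sorted_list_of_set)
    next
      case (3 u2)
      show ?case
      proof (rule wp_Seq, rule wp_sort_holds[OF 3[unfolded sz, folded ys_def] ar r(1,2) _ dy _ P], goal_cases)
        case (1 x)
        have "0 < x div X div X" using 1 sy lpos by simp
        then have "0 < x" by (cases "x = 0") auto
        then show ?case using X5[OF bnd(2) lyX[OF 1]] by simp
      next
        case 2 show ?case using ly nU by simp
      next
        case (3 u3)
        show ?case
        proof (rule wp_Seq, rule wp_rank_holds[OF 3[unfolded sy, folded ts_def] ar r(1,3) X0 bnd(2)], goal_cases)
          case 1 show ?case using lt ly bnd by simp
        next
          case (2 x) then show ?case using lyX sy st lpos by simp
        next
          case 3 show ?case unfolding ts_def by (rule strict_sorted_list_of_set)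
        next
          case (4 u4)
          show ?case
          proof (rule wp_sort_holds[OF 4[unfolded st, folded us_def] ar r(1,2) uX du _ P], goal_cases)
            case 2 show ?case using lt ly nU by (simp add: us_def)
          next
            case (3 u5)
            show ?case
            proof (rule Q)
              \<comment> \<open>Three sorts at \<open>14 * P\<close> and two scans at 18, the latter
                charged to \<open>P \<ge> 1\<close> as well: 42 + 36 = 78.\<close>
              have "c + P * (14 * ?q) + 18 * ?q + P * (14 * ?q) + 18 * ?q + P * (14 * ?q) \<le> c + P * (78 * ?q)"
                using P18 by (simp add: algebra_simps)
              then show "holds (sorted_list_of_set (ranked X ?L)) a dst n (c + P * (78 * ?q)) v u5"
                using 3 su unfolding holds_def by simp
            qed
          qed
        qed
      qed
    qed
  qed
qed

end

section \<open>Contraction of a forest\<close>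

definition node_rec :: "nat \<Rightarrow> nat \<Rightarrow> nat \<Rightarrow> nat \<Rightarrow> nat" where
  "node_rec X i d c = pack X (pack X i d) c"

definition join_rec :: "nat \<Rightarrow> nat \<Rightarrow> nat \<Rightarrow> nat \<Rightarrow> nat \<Rightarrow> nat" where
  "join_rec X key i kd l = pack X (pack X (pack X key i) kd) l"

definition link_rec :: "nat \<Rightarrow> nat \<Rightarrow> nat \<Rightarrow> nat \<Rightarrow> nat \<Rightarrow> nat \<Rightarrow> nat" where
  "link_rec X kd lp l i d = pack X (pack X (pack X (pack X kd lp) l) i) d"

text \<open>Nodes are numbered in document order, \<open>D\<close> is the depth and \<open>path\<close> the sequence of labels from
  a node up to the root.\<close>

locale forest =
  fixes N X :: nat and D :: "nat \<Rightarrow> nat" and path :: "nat \<Rightarrow> nat list"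
  assumes length_path: "\<And>i. i < N \<Longrightarrow> length (path i) = Suc (D i)"
    and D_less: "\<And>i. i < N \<Longrightarrow> D i < N" and X_ge: "2 * N + 2 < X"
    and anc: "\<And>i h. i < N \<Longrightarrow> 1 \<le> h \<Longrightarrow> h \<le> D i \<Longrightarrow>
      \<exists>j<i. D j + h = D i \<and> path j = drop h (path i) \<and> (\<forall>j'<i. D j' + h = D i \<longrightarrow> j' \<le> j)"
begin

text \<open>Names start from 1 because 0 marks a missing ancestor, and stay below \<open>X\<close>
  to fit into one field of a record.\<close>

definition named :: "nat set \<Rightarrow> (nat \<Rightarrow> 'a) \<Rightarrow> (nat \<Rightarrow> nat) \<Rightarrow> bool" where
  "named V f nm \<longleftrightarrow> (\<forall>i\<in>V. 1 \<le> nm i \<and> nm i < X) \<and> (\<forall>i\<in>V. \<forall>j\<in>V. nm i = nm j \<longleftrightarrow> f i = f j)"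

definition table :: "nat set \<Rightarrow> (nat \<Rightarrow> nat) \<Rightarrow> nat set" where
  "table V nm = (\<lambda>i. node_rec X i (D i) (nm i)) ` V"

definition jset :: "nat \<Rightarrow> nat \<Rightarrow> nat set \<Rightarrow> nat set \<Rightarrow> (nat \<Rightarrow> nat) \<Rightarrow> nat set" where
  "jset h kd VP VC lb = (\<lambda>i. join_rec X (D i + h) i kd (lb i)) ` VP \<union> (\<lambda>i. join_rec X (D i) i 1 (lb i)) ` VC"

lemma join_rec_fields:
  assumes "key < X" "i < X" "kd < X" "l < X"
  shows "join_rec X key i kd l mod X = l" "kindf X (join_rec X key i kd l) = kd"
    "join_rec X key i kd l div X div X mod X = i" "join_rec X key i kd l div X div X div X = key"
    "join_rec X key i kd l < X * X * X * X"
  using assms by (auto simp: join_rec_def kindf_def intro!: pack_bound)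

lemma join_rec_le:
  assumes "i < X" "kd < X" "l < X" "i' < X" "kd' < X" "l' < X" "i \<noteq> i'"
  shows "join_rec X key i kd l \<le> join_rec X key' i' kd' l' \<longleftrightarrow> key < key' \<or> key = key' \<and> i < i'"
  using assms by (auto simp: join_rec_def pack_le pack_less pack_eq)

lemma node_rec_fields:
  assumes "i < X" "d < X" "c < X"
  shows "node_rec X i d c mod X = c" "node_rec X i d c div X mod X = d" "node_rec X i d c div X div X = i"
    "node_rec X i d c < X * X * X"
  using assms by (auto simp: node_rec_def intro!: pack_bound)

lemma N_less: "i < N \<Longrightarrow> i < X" "i < N \<Longrightarrow> D i < X" "i < N \<Longrightarrow> h \<le> N \<Longrightarrow> D i + h < X"
  using D_less[of i] X_ge by linarith+

lemma inj_table:
  assumes "V \<subseteq> {..<N}" "\<And>i. i \<in> V \<Longrightarrow> nm i < X"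
  shows "inj_on (\<lambda>i. node_rec X i (D i) (nm i)) V"
proof (rule inj_onI)
  fix i j assume "i \<in> V" "j \<in> V" "node_rec X i (D i) (nm i) = node_rec X j (D j) (nm j)"
  then show "i = j" using node_rec_fields(3)[of i "D i" "nm i"] node_rec_fields(3)[of j "D j" "nm j"] assms N_less by auto
qed

text \<open>Of the parent records preceding a child, those with depth less than
  \<open>D i - h\<close> have a smaller key, and among those with key \<open>D i\<close> the
  position decides; so the last one is the \<open>h\<close>-th ancestor. For \<open>D i < h\<close>
  there is none, since parent keys are at least \<open>h\<close>. Ranking then gives equal names
  exactly to equal triples of kind, ancestor label and own label.\<close>

lemma join_spec:
  assumes VP: "VP \<subseteq> {..<N}" and VC: "VC \<subseteq> {..<N}" and disj: "VP \<inter> VC = {}" and kd: "kd = 0 \<or> kd = 2"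
    and h: "1 \<le> h" "h \<le> N" and lb: "\<And>i. i \<in> VP \<union> VC \<Longrightarrow> 1 \<le> lb i \<and> lb i < X"
    and par: "\<And>i. i \<in> VC \<Longrightarrow> h \<le> D i \<Longrightarrow> ancestor i \<in> VP \<and> ancestor i < i \<and> D (ancestor i) + h = D i \<and>
      (\<forall>j\<in>VP. j < i \<longrightarrow> D j + h = D i \<longrightarrow> j \<le> ancestor i)"
  defines "T \<equiv> jset h kd VP VC lb"
  defines "V \<equiv> VC \<union> (if kd = 2 then VP else {})"
  defines "lp \<equiv> \<lambda>i. if i \<in> VC then (if h \<le> D i then lb (ancestor i) else 0) else lb i"
  shows "\<exists>c. ranked X (linked X h T) = table V c \<and> (\<forall>i\<in>V. 1 \<le> c i \<and> c i < X) \<and>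
      (\<forall>i\<in>V. \<forall>j\<in>V. c i = c j \<longleftrightarrow> (i \<in> VC \<longleftrightarrow> j \<in> VC) \<and> lp i = lp j \<and> lb i = lb j)"
    and "inj_on (linkf X h T) {x \<in> T. kindf X x \<noteq> 0}"
    and "\<And>x. x \<in> linked X h T \<Longrightarrow> 0 < x div X div X"
    and "inj_on (rankf X (linked X h T)) (linked X h T)"
    and "\<And>x. x \<in> T \<Longrightarrow> x < X * X * X * X \<and> 0 < x"
proof -
  have fin: "finite VP" "finite VC" using VP VC finite_subset by blast+
  have kdX: "kd < X" "1 < X" "0 < X" using kd X_ge by auto
  have iN: "i < N" if "i \<in> VP \<union> VC" for i using that VP VC by auto
  let ?p = "\<lambda>i. join_rec X (D i + h) i kd (lb i)" and ?c = "\<lambda>i. join_rec X (D i) i 1 (lb i)"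
  have T: "T = ?p ` VP \<union> ?c ` VC" by (simp add: T_def jset_def)
  have fp: "?p i mod X = lb i" "kindf X (?p i) = kd" "?p i div X div X mod X = i" "?p i div X div X div X = D i + h" "?p i < X * X * X * X"
    if "i \<in> VP" for i
    using join_rec_fields[of "D i + h" i kd "lb i"] N_less[OF iN[of i]] h that lb[of i] kdX by auto
  have fc: "?c i mod X = lb i" "kindf X (?c i) = 1" "?c i div X div X mod X = i" "?c i div X div X div X = D i" "?c i < X * X * X * X"
    if "i \<in> VC" for i
    using join_rec_fields[of "D i" i 1 "lb i"] N_less[OF iN[of i]] that lb[of i] kdX by auto
  have pp: "?p i \<le> ?p j \<longleftrightarrow> D i < D j \<or> D i = D j \<and> i < j" if "i \<in> VP" "j \<in> VP" "i \<noteq> j" for i j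
    using join_rec_le[of i kd "lb i" j kd "lb j" "D i + h" "D j + h"] that lb N_less[OF iN] kdX by auto
  have pc: "?p i \<le> ?c j \<longleftrightarrow> D i + h < D j \<or> D i + h = D j \<and> i < j" if "i \<in> VP" "j \<in> VC" for i j
  proof -
    have "i \<noteq> j" using that disj by blast
    then show ?thesis
      using join_rec_le[of i kd "lb i" j 1 "lb j" "D i + h" "D j"] that lb N_less[OF iN] kdX by auto
  qed
  show xT: "\<And>x. x \<in> T \<Longrightarrow> x < X * X * X * X \<and> 0 < x"
  proof -
    fix x assume x: "x \<in> T"
    then have "0 < x mod X" using fp(1) fc(1) lb unfolding T by fastforce
    then have "0 < x" by (cases "x = 0") auto
    then show "x < X * X * X * X \<and> 0 < x" using x fp(5) fc(5) unfolding T by auto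
  qed
  have PS: "{p \<in> {y \<in> T. y \<le> x}. kindf X p \<noteq> 1} = {?p j |j. j \<in> VP \<and> ?p j \<le> x}" for x
    using fp(2) fc(2) kd unfolding T by auto
  have finPS: "finite {?p j |j. j \<in> VP \<and> ?p j \<le> x}" for x using fin by simp
  have ll_c: "lastlab X {y \<in> T. y \<le> ?c i} = (if h \<le> D i then lb (ancestor i) else 0)" if i: "i \<in> VC" for i
  proof (cases "h \<le> D i")
    case True
    note p = par[OF i True]
    have "?p (ancestor i) \<le> ?c i" using p pc[of "ancestor i" i] i by simp
    then have pin: "?p (ancestor i) \<in> {?p j |j. j \<in> VP \<and> ?p j \<le> ?c i}" using p by blast
    have "Max {?p j |j. j \<in> VP \<and> ?p j \<le> ?c i} = ?p (ancestor i)"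
    proof (rule Max_eqI[OF finPS])
      show "?p (ancestor i) \<in> {?p j |j. j \<in> VP \<and> ?p j \<le> ?c i}" by (rule pin)
      fix y assume "y \<in> {?p j |j. j \<in> VP \<and> ?p j \<le> ?c i}"
      then obtain j where j: "y = ?p j" "j \<in> VP" "?p j \<le> ?c i" by auto
      then have "D j + h < D i \<or> D j + h = D i \<and> j < i" using pc[OF j(2) i] by simp
      then have "j = ancestor i \<or> D j < D (ancestor i) \<or> D j = D (ancestor i) \<and> j < ancestor i" using p j(2) by fastforce
      then show "y \<le> ?p (ancestor i)" using pp[OF j(2), of "ancestor i"] p j(1) by auto
    qed
    moreover have "{?p j |j. j \<in> VP \<and> ?p j \<le> ?c i} \<noteq> {}" using pin by blast
    ultimately have "lastlab X {y \<in> T. y \<le> ?c i} = ?p (ancestor i) mod X"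
      unfolding lastlab_def PS Let_def by (simp only: if_False)
    then show ?thesis using True p fp(1)[of "ancestor i"] by simp
  next
    case False
    then have "{?p j |j. j \<in> VP \<and> ?p j \<le> ?c i} = {}" using pc[OF _ i] by auto
    then show ?thesis using False unfolding lastlab_def PS Let_def by simp
  qed
  \<comment> \<open>A parent record is itself the last parent up to its own place, so its label
    appears twice in the linked record.\<close>
  have ll_p: "lastlab X {y \<in> T. y \<le> ?p i} = lb i" if i: "i \<in> VP" for i
  proof -
    have m: "?p i \<in> {?p j |j. j \<in> VP \<and> ?p j \<le> ?p i}" using i by auto
    have "Max {?p j |j. j \<in> VP \<and> ?p j \<le> ?p i} = ?p i"
      by (rule Max_eqI[OF finPS _ m]) auto
    moreover have "{?p j |j. j \<in> VP \<and> ?p j \<le> ?p i} \<noteq> {}" using m by blast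
    ultimately have "lastlab X {y \<in> T. y \<le> ?p i} = ?p i mod X"
      unfolding lastlab_def PS Let_def by (simp only: if_False)
    then show ?thesis using fp(1)[OF i] by simp
  qed
  define kk where "kk = (\<lambda>i. if i \<in> VC then 1 else 2 :: nat)"
  define R where "R = (\<lambda>i. link_rec X (kk i) (lp i) (lb i) i (D i))"
  define e where "e = (\<lambda>i. if i \<in> VC then ?c i else ?p i)"
  have VN: "i < N" "i < X" "D i < X" "lb i < X" "1 \<le> lb i" "kk i < X" if "i \<in> V" for i
    using that iN[of i] N_less[of i] lb[of i] X_ge unfolding V_def kk_def by (auto split: if_splits)
  have lpX: "lp i < X" if "i \<in> V" for i
    using that lb[of i] lb[of "ancestor i"] par[of i] kdX unfolding V_def lp_def by (auto split: if_splits)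
  have Tk: "{x \<in> T. kindf X x \<noteq> 0} = e ` V"
  proof -
    have "i \<notin> VC" if "i \<in> VP" for i using that disj by auto
    then show ?thesis using fp(2) fc(2) kd unfolding T V_def e_def by (auto split: if_splits)
  qed
  have le: "linkf X h T (e i) = R i" if i: "i \<in> V" for i
  proof (cases "i \<in> VC")
    case True
    then show ?thesis unfolding linkf_def R_def link_rec_def e_def kk_def lp_def
      using fc[OF True] ll_c[OF True] by simp
  next
    case False
    then have iP: "i \<in> VP" "kd = 2" using i unfolding V_def by (auto split: if_splits)
    then show ?thesis unfolding linkf_def R_def link_rec_def e_def kk_def lp_def
      using fp[OF iP(1)] ll_p[OF iP(1)] False by simp
  qed
  have L: "linked X h T = R ` V"
    unfolding linked_def Tk using le by (auto simp: image_iff)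
  have R1: "R i mod (X * X) = pack X i (D i)" "R i div X div X = pack X (pack X (kk i) (lp i)) (lb i)" if "i \<in> V" for i
    using VN[OF that] by (simp_all add: R_def link_rec_def pack_mod2)
  have Rpos: "R i div X mod X = i" if "i \<in> V" for i using VN[OF that] by (simp add: R_def link_rec_def)
  have injR: "inj_on R V"
  proof (rule inj_onI)
    fix i j assume ij: "i \<in> V" "j \<in> V" "R i = R j"
    have "i = R i div X mod X" by (rule Rpos[OF ij(1), symmetric])
    also have "\<dots> = R j div X mod X" by (simp only: ij(3))
    also have "\<dots> = j" by (rule Rpos[OF ij(2)])
    finally show "i = j" .
  qed
  show "inj_on (linkf X h T) {x \<in> T. kindf X x \<noteq> 0}"
    unfolding Tk
  proof (rule inj_onI)
    fix x y assume "x \<in> e ` V" "y \<in> e ` V" and eq: "linkf X h T x = linkf X h T y"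
    then obtain i j where ij: "i \<in> V" "x = e i" "j \<in> V" "y = e j" by blast
    have "R i = R j" using eq unfolding ij(2,4) le[OF ij(1)] le[OF ij(3)] .
    then have "i = j" by (rule inj_onD[OF injR _ ij(1,3)])
    then show "x = y" using ij by simp
  qed
  show "\<And>x. x \<in> linked X h T \<Longrightarrow> 0 < x div X div X"
  proof -
    fix x assume "x \<in> linked X h T"
    then obtain i where i: "i \<in> V" "x = R i" unfolding L by auto
    then show "0 < x div X div X" using R1(2)[OF i(1)] VN(5)[OF i(1)] by (simp add: pack_def)
  qed
  let ?g = "\<lambda>z. z div X div X"
  define c where "c = (\<lambda>i. card (?g ` {z \<in> R ` V. z \<le> R i}))"
  have finV: "finite V" "card V \<le> N"
  proof -
    have "V \<subseteq> {..<N}" using VN(1) by auto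
    then show "finite V" "card V \<le> N" using finite_subset card_mono[of "{..<N}" V] by auto
  qed
  have rk: "rankf X (linked X h T) (R i) = node_rec X i (D i) (c i)" if "i \<in> V" for i
    unfolding rankf_def L R1(1)[OF that] node_rec_def c_def ..
  have cb: "1 \<le> c i \<and> c i < X" if i: "i \<in> V" for i
  proof -
    have f: "finite (?g ` {z \<in> R ` V. z \<le> R i})" using finV by simp
    moreover have "?g ` {z \<in> R ` V. z \<le> R i} \<noteq> {}" using i by blast
    ultimately have "c i \<noteq> 0" unfolding c_def by simp
    moreover have "c i \<le> card (?g ` R ` V)" unfolding c_def using finV by (intro card_mono) auto
    moreover have "card (?g ` R ` V) \<le> N" using card_image_le[of "R ` V" ?g] card_image_le[of V R] finV by simp
    ultimately show ?thesis using X_ge by simp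
  qed
  show "inj_on (rankf X (linked X h T)) (linked X h T)"
  proof (rule inj_onI)
    fix x y assume "x \<in> linked X h T" "y \<in> linked X h T" and e: "rankf X (linked X h T) x = rankf X (linked X h T) y"
    then obtain i j where ij: "i \<in> V" "x = R i" "j \<in> V" "y = R j" unfolding L by auto
    have "node_rec X i (D i) (c i) = node_rec X j (D j) (c j)"
      using e unfolding ij(2,4) rk[OF ij(1)] rk[OF ij(3)] .
    then have "node_rec X i (D i) (c i) div X div X = node_rec X j (D j) (c j) div X div X" by (simp only:)
    then have "i = j"
      using node_rec_fields(3)[of i "D i" "c i"] node_rec_fields(3)[of j "D j" "c j"] VN[OF ij(1)] VN[OF ij(3)] cb[OF ij(1)] cb[OF ij(3)]
      by (simp only:)
    then show "x = y" using ij by simp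
  qed
  have geq: "?g (R i) = ?g (R j) \<longleftrightarrow> (i \<in> VC \<longleftrightarrow> j \<in> VC) \<and> lp i = lp j \<and> lb i = lb j" if "i \<in> V" "j \<in> V" for i j
    unfolding R1(2)[OF that(1)] R1(2)[OF that(2)]
    using VN[OF that(1)] VN[OF that(2)] lpX[OF that(1)] lpX[OF that(2)]
    by (simp add: pack_eq) (auto simp: kk_def)
  have mono: "?g y \<le> ?g z" if "y \<le> z" for y z using that by (intro div_le_mono)
  \<comment> \<open>Dense ranks: as groups are monotone in the records, the set of groups up to
    \<open>R j\<close> is larger than that up to \<open>R i\<close> exactly if the two groups
    differ.\<close>
  have clt: "c i = c j \<longleftrightarrow> ?g (R i) = ?g (R j)" if ij: "i \<in> V" "j \<in> V" "R i \<le> R j" for i j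
  proof
    assume "?g (R i) = ?g (R j)"
    have "?g ` {z \<in> R ` V. z \<le> R i} = ?g ` {z \<in> R ` V. z \<le> R j}"
    proof
      show "?g ` {z \<in> R ` V. z \<le> R j} \<subseteq> ?g ` {z \<in> R ` V. z \<le> R i}"
      proof
        fix q assume "q \<in> ?g ` {z \<in> R ` V. z \<le> R j}"
        then obtain z where z: "z \<in> R ` V" "z \<le> R j" "q = ?g z" by auto
        show "q \<in> ?g ` {z \<in> R ` V. z \<le> R i}"
        proof (cases "z \<le> R i")
          case False
          then have "?g z = ?g (R i)" using mono[of "R i" z] mono[OF z(2)] \<open>?g (R i) = ?g (R j)\<close> by simp
          then show ?thesis using z ij by auto
        qed (use z in auto)
      qed
    qed (use ij in auto)
    then show "c i = c j" by (simp add: c_def)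
  next
    assume e: "c i = c j"
    show "?g (R i) = ?g (R j)"
    proof (rule ccontr)
      assume ne: "?g (R i) \<noteq> ?g (R j)"
      have "?g (R j) \<notin> ?g ` {z \<in> R ` V. z \<le> R i}"
        using ne mono[OF ij(3)] mono by fastforce
      moreover have "?g (R j) \<in> ?g ` {z \<in> R ` V. z \<le> R j}" using ij by blast
      ultimately have "?g ` {z \<in> R ` V. z \<le> R i} \<subset> ?g ` {z \<in> R ` V. z \<le> R j}" using ij(3) by auto
      then have "c i < c j" unfolding c_def using finV by (intro psubset_card_mono) auto
      then show False using e by simp
    qed
  qed
  have ceq: "c i = c j \<longleftrightarrow> (i \<in> VC \<longleftrightarrow> j \<in> VC) \<and> lp i = lp j \<and> lb i = lb j" if "i \<in> V" "j \<in> V" for i j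
    using clt[of i j] clt[of j i] geq[OF that] that by (cases "R i \<le> R j") auto
  have "ranked X (linked X h T) = table V c"
    unfolding ranked_def table_def using rk by (auto simp: L image_iff)
  then show "\<exists>c. ranked X (linked X h T) = table V c \<and> (\<forall>i\<in>V. 1 \<le> c i \<and> c i < X) \<and>
      (\<forall>i\<in>V. \<forall>j\<in>V. c i = c j \<longleftrightarrow> (i \<in> VC \<longleftrightarrow> j \<in> VC) \<and> lp i = lp j \<and> lb i = lb j)"
    using cb ceq by blast
qed

section \<open>Residue classes of depths, and one step of descent and of ascent\<close>

definition level :: "nat \<Rightarrow> nat \<Rightarrow> nat set" where
  "level h s = {i. i < N \<and> D i mod h = s}"

definition ancestor :: "nat \<Rightarrow> nat \<Rightarrow> nat" where
  "ancestor h i = (SOME j. j < i \<and> D j + h = D i \<and> path j = drop h (path i) \<and> (\<forall>j'<i. D j' + h = D i \<longrightarrow> j' \<le> j))"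

lemma ancestor: "i < N \<Longrightarrow> 1 \<le> h \<Longrightarrow> h \<le> D i \<Longrightarrow>
  ancestor h i < i \<and> D (ancestor h i) + h = D i \<and> path (ancestor h i) = drop h (path i) \<and> (\<forall>j'<i. D j' + h = D i \<longrightarrow> j' \<le> ancestor h i)"
  unfolding ancestor_def by (rule someI_ex) (use anc[of i h] in blast)

lemma level_sub: "level h s \<subseteq> {..<N}" by (auto simp: level_def)

lemma level_finite [simp]: "finite (level h s)" by (rule finite_subset[OF level_sub]) simp

lemma level_split:
  assumes "1 \<le> h" "s < h" "s' = s \<or> s' = s + h"
  shows "level (2 * h) s' = {i \<in> level h s. D i mod (2 * h) = s'}" "s' mod h = s" "s' < 2 * h"
proof -
  have m: "x mod (2 * h) mod h = x mod h" for x :: nat by (simp add: mod_mod_cancel)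
  show s: "s' mod h = s" "s' < 2 * h" using assms by auto
  have "D i mod h = s" if "D i mod (2 * h) = s'" for i using m[of "D i"] that s by simp
  then show "level (2 * h) s' = {i \<in> level h s. D i mod (2 * h) = s'}" by (auto simp: level_def)
qed

lemma level_two:
  assumes "1 \<le> h" "s < h" "i \<in> level h s"
  shows "D i mod (2 * h) = s \<or> D i mod (2 * h) = s + h"
proof -
  have "D i mod (2 * h) mod h = s" using assms by (simp add: mod_mod_cancel level_def)
  moreover have "D i mod (2 * h) < 2 * h" using assms by simp
  moreover have "x mod h = (if x < h then x else x - h)" if "x < 2 * h" for x
  proof (cases "x < h")
    case False
    then have "x mod h = (x - h) mod h" by (simp add: le_mod_geq)
    also have "\<dots> = x - h" using that False by (intro mod_less) simp
    finally show ?thesis using False by simp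
  qed simp
  ultimately show ?thesis by (auto split: if_splits)
qed

lemma shift_mod:
  fixes d :: nat
  assumes "1 \<le> h"
  shows "(d + h) mod h = d mod h" "(d + h) mod (2 * h) \<noteq> d mod (2 * h)"
proof -
  show "(d + h) mod h = d mod h" by simp
  show "(d + h) mod (2 * h) \<noteq> d mod (2 * h)"
  proof
    assume "(d + h) mod (2 * h) = d mod (2 * h)"
    then have "2 * h dvd (d + h) - d" by (metis mod_eq_dvd_iff_nat le_add1)
    then show False using assms by (auto dest: dvd_imp_le)
  qed
qed

text \<open>Going up by \<open>h\<close> keeps the residue modulo \<open>h\<close> but switches
  between the two possible residues modulo \<open>2 * h\<close>. Hence kept nodes have their
  \<open>h\<close>-th ancestors among the dropped ones and vice versa.\<close>

lemma ancestor_level: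
  assumes h: "1 \<le> h" and i: "i \<in> level h s" "h \<le> D i"
  shows "ancestor h i \<in> level h s" "D (ancestor h i) mod (2 * h) \<noteq> D i mod (2 * h)"
proof -
  have iN: "i < N" using i by (simp add: level_def)
  note p = ancestor[OF iN h i(2)]
  have d: "D i = D (ancestor h i) + h" using p by simp
  have "D i mod h = D (ancestor h i) mod h" unfolding d by (rule shift_mod(1)[OF h])
  moreover have "ancestor h i < N" using p iN by linarith
  ultimately show "ancestor h i \<in> level h s" using i by (simp add: level_def)
  show "D (ancestor h i) mod (2 * h) \<noteq> D i mod (2 * h)" unfolding d using shift_mod(2)[OF h, of "D (ancestor h i)"] by metis
qed

lemma path_split: "i < N \<Longrightarrow> D i < h \<longleftrightarrow> drop h (path i) = []"
  using length_path[of i] by auto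

text \<open>Compares the names of ancestors, with 0 for paths of at most \<open>h\<close> labels.
  The function \<open>f\<close> is \<open>take h\<close> on the way down and the identity on the way
  up and in the base case; that only \<open>[]\<close> is mapped to \<open>[]\<close> separates the
  default 0 from proper names.\<close>

lemma lp_eq:
  assumes nm: "\<And>i j. i \<in> VP \<Longrightarrow> j \<in> VP \<Longrightarrow> nm i = nm j \<longleftrightarrow> f (path i) = f (path j)" "\<And>i. i \<in> VP \<Longrightarrow> 1 \<le> nm i"
    and f: "f [] = []" "\<And>xs. f xs = [] \<longleftrightarrow> xs = []"
    and h: "1 \<le> h" and ij: "i < N" "j < N" "h \<le> D i \<Longrightarrow> ancestor h i \<in> VP" "h \<le> D j \<Longrightarrow> ancestor h j \<in> VP"
  shows "(if h \<le> D i then nm (ancestor h i) else 0) = (if h \<le> D j then nm (ancestor h j) else (0 :: nat)) \<longleftrightarrow>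
    f (drop h (path i)) = f (drop h (path j))"
proof -
  have *: "h \<le> D i \<Longrightarrow> path (ancestor h i) = drop h (path i)" "h \<le> D j \<Longrightarrow> path (ancestor h j) = drop h (path j)"
    using ancestor[of i h] ancestor[of j h] ij h by auto
  have s: "h \<le> D i \<longleftrightarrow> drop h (path i) \<noteq> []" "h \<le> D j \<longleftrightarrow> drop h (path j) \<noteq> []"
    using path_split[of i h] path_split[of j h] ij by auto
  have pos: "h \<le> D i \<Longrightarrow> nm (ancestor h i) \<noteq> 0" "h \<le> D j \<Longrightarrow> nm (ancestor h j) \<noteq> 0"
    using nm(2)[of "ancestor h i"] nm(2)[of "ancestor h j"] ij(3,4) by auto
  consider "h \<le> D i" "h \<le> D j" | "h \<le> D i" "\<not> h \<le> D j" | "\<not> h \<le> D i" "h \<le> D j" | "\<not> h \<le> D i" "\<not> h \<le> D j"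
    by blast
  then show ?thesis
  proof cases
    case 1 then show ?thesis using nm(1)[OF ij(3,4)] * by simp
  next
    case 2 then show ?thesis using pos s f by (metis (full_types))
  next
    case 3 then show ?thesis using pos s f by (metis (full_types))
  next
    case 4 then show ?thesis using s f(1) by simp
  qed
qed

text \<open>Kept nodes are the children of the join and dropped ones its parents of kind 0. Own name
  and ancestor name determine the two halves of the next \<open>2 * h\<close> labels.\<close>

lemma down_step:
  assumes h: "1 \<le> h" "h \<le> N" "s < h" "s' = s \<or> s' = s + h"
    and nm: "named (level h s) (\<lambda>i. take h (path i)) nm"
  defines "T \<equiv> jset h 0 (level h s - level (2 * h) s') (level (2 * h) s') nm"
  shows "\<exists>c. ranked X (linked X h T) = table (level (2 * h) s') c \<and> named (level (2 * h) s') (\<lambda>i. take (2 * h) (path i)) c"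
    and "inj_on (linkf X h T) {x \<in> T. kindf X x \<noteq> 0}"
    and "\<And>x. x \<in> linked X h T \<Longrightarrow> 0 < x div X div X"
    and "inj_on (rankf X (linked X h T)) (linked X h T)"
    and "\<And>x. x \<in> T \<Longrightarrow> x < X * X * X * X \<and> 0 < x"
proof -
  let ?S = "level (2 * h) s'" and ?V = "level h s"
  note sp = level_split[OF h(1,3,4)]
  have SV: "?S \<subseteq> ?V" using sp(1) by auto
  have par: "ancestor h i \<in> ?V - ?S \<and> ancestor h i < i \<and> D (ancestor h i) + h = D i \<and>
      (\<forall>j\<in>?V - ?S. j < i \<longrightarrow> D j + h = D i \<longrightarrow> j \<le> ancestor h i)" if i: "i \<in> ?S" "h \<le> D i" for i
  proof -
    have iV: "i \<in> ?V" using i SV by auto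
    then have iN: "i < N" by (simp add: level_def)
    show ?thesis using ancestor[OF iN h(1) i(2)] ancestor_level[OF h(1) iV i(2)] i(1) unfolding sp(1) by auto
  qed
  have lb: "1 \<le> nm i \<and> nm i < X" if "i \<in> (?V - ?S) \<union> ?S" for i
    using nm that SV unfolding named_def by auto
  note J = join_spec[of "?V - ?S" ?S 0 h nm "ancestor h", folded T_def, OF _ _ _ _ h(1,2) lb par]
  have pre: "?V - ?S \<subseteq> {..<N}" "?S \<subseteq> {..<N}" "(?V - ?S) \<inter> ?S = {}" "0 = (0::nat) \<or> 0 = (2 :: nat)"
    using level_sub by auto
  show "inj_on (linkf X h T) {x \<in> T. kindf X x \<noteq> 0}"
    "\<And>x. x \<in> linked X h T \<Longrightarrow> 0 < x div X div X"
    "inj_on (rankf X (linked X h T)) (linked X h T)"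
    "\<And>x. x \<in> T \<Longrightarrow> x < X * X * X * X \<and> 0 < x"
    using J(2-5)[OF pre] by blast+
  from J(1)[OF pre] obtain c where c: "ranked X (linked X h T) = table ?S c" "\<forall>i\<in>?S. 1 \<le> c i \<and> c i < X"
    "\<forall>i\<in>?S. \<forall>j\<in>?S. c i = c j \<longleftrightarrow> (if h \<le> D i then nm (ancestor h i) else 0) = (if h \<le> D j then nm (ancestor h j) else 0) \<and> nm i = nm j"
    by auto
  have "c i = c j \<longleftrightarrow> take (2 * h) (path i) = take (2 * h) (path j)" if ij: "i \<in> ?S" "j \<in> ?S" for i j
  proof -
    have ijV: "i \<in> ?V" "j \<in> ?V" "i < N" "j < N" using ij SV by (auto simp: level_def)
    have "(if h \<le> D i then nm (ancestor h i) else 0) = (if h \<le> D j then nm (ancestor h j) else 0) \<longleftrightarrow>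
      take h (drop h (path i)) = take h (drop h (path j))"
      by (rule lp_eq[where VP = ?V]) (use nm h ijV ancestor_level[OF h(1)] in \<open>auto simp: named_def\<close>)
    moreover have "nm i = nm j \<longleftrightarrow> take h (path i) = take h (path j)" using nm ijV by (auto simp: named_def)
    moreover have "take (2 * h) (path i) = take (2 * h) (path j) \<longleftrightarrow> take h (path i) = take h (path j) \<and> take h (drop h (path i)) = take h (drop h (path j))"
    proof -
      have t: "take (2 * h) xs = take h xs @ take h (drop h xs)" for xs :: "nat list" by (simp add: mult_2 take_add)
      have "take h (take (2 * h) xs) = take h xs" "drop h (take (2 * h) xs) = take h (drop h xs)" for xs :: "nat list"
        using h by (auto simp: drop_take mult_2)
      then show ?thesis using t by metis
    qed
    ultimately show ?thesis using c(3) ij by blast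
  qed
  then show "\<exists>c. ranked X (linked X h T) = table ?S c \<and> named ?S (\<lambda>i. take (2 * h) (path i)) c"
    using c(1,2) unfolding named_def by blast
qed

text \<open>Roles are reversed: kept nodes are parents of kind 2 carrying their classes, dropped
  nodes are children. As only two residues occur, the \<open>h\<close>-th ancestor of a dropped node
  was kept, so its class and the node's own name determine the full path.\<close>

lemma up_step:
  assumes h: "1 \<le> h" "h \<le> N" "s < h" "s' = s \<or> s' = s + h"
    and nm: "named (level h s) (\<lambda>i. take h (path i)) nm" and cls: "named (level (2 * h) s') path cls"
  defines "T \<equiv> jset h 2 (level (2 * h) s') (level h s - level (2 * h) s') (\<lambda>i. if i \<in> level (2 * h) s' then cls i else nm i)"
  shows "\<exists>c. ranked X (linked X h T) = table (level h s) c \<and> named (level h s) path c"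
    and "inj_on (linkf X h T) {x \<in> T. kindf X x \<noteq> 0}"
    and "\<And>x. x \<in> linked X h T \<Longrightarrow> 0 < x div X div X"
    and "inj_on (rankf X (linked X h T)) (linked X h T)"
    and "\<And>x. x \<in> T \<Longrightarrow> x < X * X * X * X \<and> 0 < x"
proof -
  let ?S = "level (2 * h) s'" and ?V = "level h s"
  let ?lb = "\<lambda>i. if i \<in> ?S then cls i else nm i"
  note sp = level_split[OF h(1,3,4)]
  have SV: "?S \<subseteq> ?V" using sp(1) by auto
  have paS: "ancestor h i \<in> ?S" if i: "i \<in> ?V - ?S" "h \<le> D i" for i
  proof -
    have "D (ancestor h i) mod (2 * h) = s'"
      using ancestor_level[OF h(1) _ i(2), of s] i level_two[OF h(1,3), of i] level_two[OF h(1,3), of "ancestor h i"] h(4)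
      unfolding sp(1) by auto
    then show ?thesis using ancestor_level(1)[OF h(1) _ i(2), of s] i unfolding sp(1) by auto
  qed
  have par: "ancestor h i \<in> ?S \<and> ancestor h i < i \<and> D (ancestor h i) + h = D i \<and>
      (\<forall>j\<in>?S. j < i \<longrightarrow> D j + h = D i \<longrightarrow> j \<le> ancestor h i)" if i: "i \<in> ?V - ?S" "h \<le> D i" for i
  proof -
    have iN: "i < N" using i by (simp add: level_def)
    show ?thesis using ancestor[OF iN h(1) i(2)] paS[OF i] by auto
  qed
  have lb: "1 \<le> ?lb i \<and> ?lb i < X" if "i \<in> ?S \<union> (?V - ?S)" for i
    using nm cls that SV unfolding named_def by auto
  note J = join_spec[of ?S "?V - ?S" 2 h ?lb "ancestor h", folded T_def, OF _ _ _ _ h(1,2) lb par]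
  have pre: "?S \<subseteq> {..<N}" "?V - ?S \<subseteq> {..<N}" "?S \<inter> (?V - ?S) = {}" "2 = (0::nat) \<or> 2 = (2 :: nat)"
    using level_sub by auto
  show "inj_on (linkf X h T) {x \<in> T. kindf X x \<noteq> 0}"
    "\<And>x. x \<in> linked X h T \<Longrightarrow> 0 < x div X div X"
    "inj_on (rankf X (linked X h T)) (linked X h T)"
    "\<And>x. x \<in> T \<Longrightarrow> x < X * X * X * X \<and> 0 < x"
    using J(2-5)[OF pre] by blast+
  have V: "(?V - ?S) \<union> (if 2 = (2::nat) then ?S else {}) = ?V" using SV by auto
  from J(1)[OF pre, unfolded V] obtain c where c: "ranked X (linked X h T) = table ?V c" "\<forall>i\<in>?V. 1 \<le> c i \<and> c i < X"
    "\<forall>i\<in>?V. \<forall>j\<in>?V. c i = c j \<longleftrightarrow> (i \<in> ?V - ?S \<longleftrightarrow> j \<in> ?V - ?S) \<and>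
      (if i \<in> ?V - ?S then (if h \<le> D i then ?lb (ancestor h i) else 0) else ?lb i) =
      (if j \<in> ?V - ?S then (if h \<le> D j then ?lb (ancestor h j) else 0) else ?lb j) \<and> ?lb i = ?lb j"
    by blast
  have "c i = c j \<longleftrightarrow> path i = path j" if ij: "i \<in> ?V" "j \<in> ?V" for i j
  proof -
    have ijN: "i < N" "j < N" using ij by (auto simp: level_def)
    have len: "path i = path j \<Longrightarrow> D i = D j" using length_path[OF ijN(1)] length_path[OF ijN(2)] by auto
    consider "i \<in> ?S" "j \<in> ?S" | "i \<in> ?V - ?S" "j \<in> ?V - ?S" | "(i \<in> ?S) \<noteq> (j \<in> ?S)" using ij by blast
    then show ?thesis
    proof cases
      case 1
      then show ?thesis using c(3) ij cls unfolding named_def by simp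
    next
      case 2
      have "(if h \<le> D i then ?lb (ancestor h i) else 0) = (if h \<le> D j then ?lb (ancestor h j) else 0) \<longleftrightarrow>
        drop h (path i) = drop h (path j)"
        by (rule lp_eq[where VP = ?S and f = "\<lambda>x. x"]) (use cls h ijN paS 2 in \<open>auto simp: named_def\<close>)
      moreover have "nm i = nm j \<longleftrightarrow> take h (path i) = take h (path j)" using nm ij by (auto simp: named_def)
      moreover have "path i = path j \<longleftrightarrow> take h (path i) = take h (path j) \<and> drop h (path i) = drop h (path j)"
        by (metis append_take_drop_id)
      ultimately show ?thesis using c(3) ij 2 by auto
    next
      \<comment> \<open>One node is kept and the other dropped. Different kinds give different
        names, rightly so, because the depths differ modulo \<open>2 * h\<close> and the paths thus
        in length.\<close>
      case 3
      then have "D i \<noteq> D j" using ij unfolding sp(1) by auto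
      then have "path i \<noteq> path j" using len by auto
      moreover have "c i \<noteq> c j" using c(3) ij 3 by blast
      ultimately show ?thesis by simp
    qed
  qed
  then show "\<exists>c. ranked X (linked X h T) = table ?V c \<and> named ?V path c"
    using c(1,2) unfolding named_def by blast
qed

text \<open>The position is the leading field of a row, so the sorted table is in document
  order.\<close>

lemma table_list:
  assumes V: "V \<subseteq> {..<N}" and nm: "\<And>i. i \<in> V \<Longrightarrow> nm i < X"
  shows "sorted_list_of_set (table V nm) = map (\<lambda>i. node_rec X i (D i) (nm i)) (sorted_list_of_set V)"
proof (rule strict_sorted_equal)
  have fV: "finite V" using V finite_subset by blast
  have lt: "node_rec X i (D i) (nm i) < node_rec X j (D j) (nm j)"
    if "i \<in> set (sorted_list_of_set V)" "j \<in> set (sorted_list_of_set V)" "i < j" for i j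
  proof -
    have "i < N" "j < N" "nm i < X" "nm j < X" using that V fV nm by auto
    then show ?thesis using that(3) N_less[of i] N_less[of j] by (simp add: node_rec_def pack_less)
  qed
  have "sorted_wrt (\<lambda>i j. node_rec X i (D i) (nm i) < node_rec X j (D j) (nm j)) (sorted_list_of_set V)"
    by (rule sorted_wrt_mono_rel[OF lt strict_sorted_list_of_set])
  then show "sorted_wrt (<) (map (\<lambda>i. node_rec X i (D i) (nm i)) (sorted_list_of_set V))"
    by (simp add: sorted_wrt_map)
  show "set (sorted_list_of_set (table V nm)) = set (map (\<lambda>i. node_rec X i (D i) (nm i)) (sorted_list_of_set V))"
    using fV by (simp add: table_def)
qed (rule strict_sorted_list_of_set)

lemma card_table: "V \<subseteq> {..<N} \<Longrightarrow> (\<And>i. i \<in> V \<Longrightarrow> nm i < X) \<Longrightarrow> card (table V nm) = card V"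
  unfolding table_def by (rule card_image[OF inj_table])

lemma table_fields:
  assumes "x \<in> table V nm" "V \<subseteq> {..<N}" "\<And>i. i \<in> V \<Longrightarrow> nm i < X"
  obtains i where "i \<in> V" "x = node_rec X i (D i) (nm i)" "x mod X = nm i" "x div X mod X = D i" "x div X div X = i" "x < X * X * X"
proof -
  from assms(1) obtain i where i: "i \<in> V" "x = node_rec X i (D i) (nm i)" unfolding table_def by auto
  then show ?thesis using that[OF i] node_rec_fields[of i "D i" "nm i"] N_less[of i] assms(2,3) by auto
qed

end

section \<open>Passes over the table of nodes\<close>

abbreviation depE :: exp where "depE \<equiv> Reg 20 \<oslash> Reg 6 \<odot> Reg 6"
abbreviation posE :: exp where "posE \<equiv> Reg 20 \<oslash> Reg 6 \<oslash> Reg 6"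
abbreviation labE :: exp where "labE \<equiv> Reg 20 \<odot> Reg 6"
abbreviation in_half :: test where "in_half \<equiv> Equal (depE \<odot> (Const 2 \<otimes> Reg 11)) (Reg 12)"

definition copy_count :: prog where
  "copy_count = Cond in_half (Assign 30 (Reg 30 \<oplus> Const 1)) Skip ;; emit (Reg 20)"

definition split :: prog where
  "split = Cond in_half (emit (packE (packE (packE depE posE) (Const 1)) labE))
     (emit (packE (packE (packE (depE \<oplus> Reg 11) posE) (Const 0)) labE))"

definition parents :: prog where
  "parents = emit (packE (packE (packE (depE \<oplus> Reg 11) posE) (Const 2)) labE)"

definition children :: prog where
  "children = Cond in_half Skip (emit (packE (packE (packE depE posE) (Const 1)) labE))"

text \<open>Quadratic search without IOs other than those of the scan. Cell \<open>w + j\<close>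
  remembers depth, parent class, name and class of the \<open>j\<close>-th node. The first loop
  keeps the last earlier node at the depth of the parent; the second looks for an earlier node with
  equal key and otherwise leaves the fresh class \<open>k + 1\<close>. At most \<open>w\<close>
  nodes are handled, so this history fits behind the scan window.\<close>

definition base :: prog where
  "base = Assign 34 (Const 0) ;;
     For 36 (Reg 10) (vload 37 (Reg 4 \<oplus> Reg 36) ;;
       Cond (Equal (Reg 37 \<oslash> Reg 6 \<oslash> Reg 6 \<oslash> Reg 6 \<oplus> Reg 11) depE) (Assign 34 (Reg 37 \<odot> Reg 6)) Skip) ;;
     Assign 35 (Reg 10 \<oplus> Const 1) ;;
     For 36 (Reg 10) (vload 37 (Reg 4 \<oplus> Reg 36) ;;
       Cond (Equal (Reg 37 \<oslash> Reg 6) (packE (packE depE (Reg 34)) labE)) (Assign 35 (Reg 37 \<odot> Reg 6)) Skip) ;;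
     vstore (Reg 4 \<oplus> Reg 10) (packE (packE (packE depE (Reg 34)) labE) (Reg 35)) ;;
     emit (packE (Reg 20 \<oslash> Reg 6) (Reg 35))"

text \<open>\<open>ZU\<close> provides for areas numbered up to \<open>N + 5\<close>, enough because
  level numbers stay below \<open>N\<close>. An area of \<open>2 * N\<close> cells holds all tags of
  the input, and also the concatenation written on the way up.\<close>

locale contraction = buffered M B W w K U + forest N X D path
  for M B W w K U N X :: nat and D :: "nat \<Rightarrow> nat" and path :: "nat \<Rightarrow> nat list" +
  fixes Z P :: nat
  assumes NZ: "2 * N \<le> Z" "1 \<le> N" and XU: "X \<le> U" and ZU: "(N + 6) * Z \<le> 2 * U ^ 5" and passN: "passes P N"
begin

lemma X_pos: "0 < X" "1 < X" "2 < X" using X_ge NZ by auto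

lemma X3: "x < X * X * X \<Longrightarrow> x < W" and X4: "x < X * X * X * X \<Longrightarrow> x < W"
proof -
  have "X * X * X * 1 * 1 \<le> X * X * X * X * X" "X * X * X * X * 1 \<le> X * X * X * X * X"
    using X_pos by (intro mult_le_mono; simp)+
  then show "x < X * X * X \<Longrightarrow> x < W" "x < X * X * X * X \<Longrightarrow> x < W" using X5[OF XU, of x] by linarith+
qed

lemma slot_bound: "p \<le> N + 5 \<Longrightarrow> i \<le> Z \<Longrightarrow> p * Z + i \<le> 2 * U ^ 5"
proof -
  assume "p \<le> N + 5" "i \<le> Z"
  then have "p * Z + i \<le> (N + 5) * Z + Z" by (intro add_mono mult_le_mono1)
  then show ?thesis using ZU by (simp add: add_mult_distrib)
qed

lemma slot_neq: "p \<noteq> q \<Longrightarrow> i < Z \<Longrightarrow> j < Z \<Longrightarrow> p * Z + i \<noteq> q * Z + j"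
  using pack_eq[of i Z j p q] by (auto simp: pack_def)

lemma slot_areas: "p \<noteq> q \<Longrightarrow> p \<le> N + 5 \<Longrightarrow> q \<le> N + 5 \<Longrightarrow> n \<le> Z \<Longrightarrow> areas (p * Z) (q * Z) n"
proof -
  assume a: "p \<noteq> q" "p \<le> N + 5" "q \<le> N + 5" "n \<le> Z"
  have *: "x * Z + n \<le> y * Z" if "x < y" for x y
  proof -
    have "Suc x * Z \<le> y * Z" using that by (intro mult_le_mono1) simp
    then show ?thesis using a(4) by simp
  qed
  show ?thesis unfolding areas_def using a slot_bound[of p n] slot_bound[of q n] *[of p q] *[of q p]
    by (cases "p < q") auto
qed

definition rows :: "nat set \<Rightarrow> (nat \<Rightarrow> nat) \<Rightarrow> nat list" where
  "rows V nm = sorted_list_of_set (table V nm)"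

lemma rows:
  assumes "V \<subseteq> {..<N}" "named V f nm"
  shows "length (rows V nm) = card V" "set (rows V nm) = table V nm" "distinct (rows V nm)"
    "rows V nm = map (\<lambda>i. node_rec X i (D i) (nm i)) (sorted_list_of_set V)" "card V \<le> N"
    "\<And>x. x \<in> set (rows V nm) \<Longrightarrow> x < X * X * X"
proof -
  have f: "finite V" using assms(1) finite_subset by blast
  have nm: "\<And>i. i \<in> V \<Longrightarrow> nm i < X" using assms(2) by (auto simp: named_def)
  have ft: "finite (table V nm)" using f by (simp add: table_def)
  show "length (rows V nm) = card V" using card_table[OF assms(1) nm] by (simp add: rows_def)
  show s: "set (rows V nm) = table V nm" using ft by (simp add: rows_def)
  show "distinct (rows V nm)" by (simp add: rows_def)
  show "rows V nm = map (\<lambda>i. node_rec X i (D i) (nm i)) (sorted_list_of_set V)"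
    unfolding rows_def by (rule table_list[OF assms(1) nm])
  show "card V \<le> N" using card_mono[OF _ assms(1)] by simp
  show "x < X * X * X" if "x \<in> set (rows V nm)" for x
  proof -
    have "x \<in> table V nm" using that s by simp
    then show ?thesis by (rule table_fields[OF _ assms(1) nm])
  qed
qed

section \<open>The scans of a level: copying, splitting, parents and children\<close>

lemma wp_copy_count:
  assumes r: "reg v 4 = w" "reg v 6 = X" "reg v 7 = a" "reg v 8 = length xs" "reg v 9 = dst" "reg v 11 = h" "reg v 12 = s"
    and ar: "areas a dst (length xs)" and len: "length xs \<le> N" and xsW: "\<And>x. x \<in> set xs \<Longrightarrow> x < W"
    and src: "\<And>i. i < length xs \<Longrightarrow> store v (a + i) = xs ! i"
    and Q: "\<And>u. reg u 7 = dst \<Longrightarrow> reg u 9 = a \<Longrightarrow> reg u 8 = length xs \<Longrightarrow>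
       \<forall>x<20. x \<notin> {7, 8, 9, 10} \<longrightarrow> reg u x = reg v x \<Longrightarrow>
       reg u 30 = length (filter (\<lambda>x. x div X mod X mod (2 * h) = s) xs) \<Longrightarrow>
       \<forall>i<length xs. store u (dst + i) = xs ! i \<Longrightarrow>
       \<forall>i. \<not> (dst \<le> i \<and> i < dst + length xs) \<longrightarrow> store u i = store v i \<Longrightarrow>
       cost u \<le> cost v + 18 * (length xs div w + 1) \<Longrightarrow> Q u"
  shows "wp (stage copy_count) Q v"
proof (rule wp_stage[where xs = xs and a = a and dst = dst and G = "\<lambda>k. if True then [xs ! k] else []" and
    St = "\<lambda>k r m. r 30 = length (filter (\<lambda>x. x div X mod X mod (2 * h) = s) (take k xs))"], goal_cases)
  case (5) then show ?case using ar by (simp add: areas_def)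
next
  case (6) then show ?case using ar by (simp add: areas_def)
next
  case (9 i j) then show ?case using ar by (auto simp: areas_def)
next
  case (13 k u z')
  have xW: "xs ! k < W" using xsW 13(1) by simp
  let ?f = "\<lambda>k. length (filter (\<lambda>x. x div X mod X mod (2 * h) = s) (take k xs))"
  have "?f (Suc k) \<le> length (take (Suc k) xs)" by (rule length_filter_le)
  then have cW: "?f (Suc k) < W" using 13(1) len small[of "?f (Suc k)"] XU X_ge U_bounds by simp
  have st: "?f (Suc k) = (if xs ! k div X mod X mod (2 * h) = s then Suc (?f k) else ?f k)"
    using 13(1) by (simp add: take_Suc_conv_app_nth)
  have rs: "reg u 6 = X" "reg u 11 = h" "reg u 12 = s" "reg u 30 = ?f k" "reg u 20 = xs ! k" using 13 r by auto
  have fin: "wp (emit (Reg 20)) (\<lambda>u'. reg u' 30 = ?f (Suc k) \<and>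
      writing dst z' (store v) (concat (map (\<lambda>k. if True then [xs ! k] else []) [0..<k]) @ (if True then [xs ! k] else [])) u' \<and>
      (\<forall>x<20. reg u' x = reg u x) \<and> (\<forall>x<w. vmem u' x = vmem u x)) u2"
    if u2: "reg u2 30 = ?f (Suc k)" "\<forall>x. x \<noteq> 30 \<longrightarrow> reg u2 x = reg u x" "vmem u2 = vmem u"
      "writing dst z' (store v) (concat (map (\<lambda>k. if True then [xs ! k] else []) [0..<k])) u2" for u2
    by (rule wp_emit[OF u2(4)]) (use u2 rs xW 13(4) in auto)
  show ?case unfolding copy_count_def
  proof (rule wp_Seq, rule wp_Cond, goal_cases)
    case 2
    then have "?f (Suc k) = Suc (?f k)" using rs st by simp
    then show ?case using rs cW 13(3) by (intro wp_Assign fin) (auto simp: reg_ok_def intro!: writing_reg)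
  next
    case 3
    then have "?f (Suc k) = ?f k" using rs st by simp
    then show ?case using rs 13(3) by (intro wp_Skip fin) auto
  qed simp
next
  case (14 u ys)
  have "ys = xs" unfolding 14(1) using concat_filter_map[of "\<lambda>x. True" xs "\<lambda>x. x"] by simp
  then show ?case using 14 by (intro Q) auto
qed (use r xsW src in simp_all)

definition splitf :: "nat \<Rightarrow> nat \<Rightarrow> nat \<Rightarrow> nat" where
  "splitf h s x = (if x div X mod X mod (2 * h) = s then join_rec X (x div X mod X) (x div X div X) 1 (x mod X)
     else join_rec X (x div X mod X + h) (x div X div X) 0 (x mod X))"

lemma wp_split:
  assumes r: "reg v 4 = w" "reg v 6 = X" "reg v 7 = a" "reg v 8 = length xs" "reg v 9 = dst" "reg v 11 = h" "reg v 12 = s"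
    and ar: "areas a dst (length xs)" and xsW: "\<And>x. x \<in> set xs \<Longrightarrow> x < W" "\<And>x. x \<in> set xs \<Longrightarrow> splitf h s x < W"
    and src: "\<And>i. i < length xs \<Longrightarrow> store v (a + i) = xs ! i"
    and Q: "\<And>u. reg u 7 = dst \<Longrightarrow> reg u 9 = a \<Longrightarrow> reg u 8 = length xs \<Longrightarrow>
       \<forall>x<20. x \<notin> {7, 8, 9, 10} \<longrightarrow> reg u x = reg v x \<Longrightarrow>
       \<forall>i<length xs. store u (dst + i) = map (splitf h s) xs ! i \<Longrightarrow>
       \<forall>i. \<not> (dst \<le> i \<and> i < dst + length xs) \<longrightarrow> store u i = store v i \<Longrightarrow>
       cost u \<le> cost v + 18 * (length xs div w + 1) \<Longrightarrow> Q u"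
  shows "wp (stage split) Q v"
proof (rule wp_stage[where xs = xs and a = a and dst = dst and G = "\<lambda>k. if True then [splitf h s (xs ! k)] else []" and
    St = "\<lambda>k r m. True"], goal_cases)
  case (5) then show ?case using ar by (simp add: areas_def)
next
  case (6) then show ?case using ar by (simp add: areas_def)
next
  case (9 i j) then show ?case using ar by (auto simp: areas_def)
next
  case (13 k u z')
  have xW: "splitf h s (xs ! k) < W" using xsW 13(1) by simp
  have rs: "reg u 6 = X" "reg u 11 = h" "reg u 12 = s" "reg u 20 = xs ! k" using 13 r by auto
  show ?case unfolding split_def
  proof (rule wp_Cond, goal_cases)
    case 2 then show ?case
      by (intro wp_emit[OF 13(3)]) (use rs xW 13(4) in \<open>auto simp: splitf_def join_rec_def pack_def\<close>)
  next
    case 3 then show ?case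
      by (intro wp_emit[OF 13(3)]) (use rs xW 13(4) in \<open>auto simp: splitf_def join_rec_def pack_def\<close>)
  qed simp
next
  case (14 u ys)
  have "ys = map (splitf h s) xs" unfolding 14(1) using concat_filter_map[of "\<lambda>x. True" xs "splitf h s"] by simp
  then show ?case using 14 by (intro Q) auto
qed (use r xsW src in simp_all)

definition parentf :: "nat \<Rightarrow> nat \<Rightarrow> nat" where
  "parentf h x = join_rec X (x div X mod X + h) (x div X div X) 2 (x mod X)"

definition childf :: "nat \<Rightarrow> nat" where
  "childf x = join_rec X (x div X mod X) (x div X div X) 1 (x mod X)"

lemma wp_parents:
  assumes r: "reg v 4 = w" "reg v 6 = X" "reg v 7 = a" "reg v 8 = length xs" "reg v 11 = h"
    and bnd: "a + length xs \<le> 2 * U ^ 5" "dst + cap \<le> 2 * U ^ 5" "length ys0 + length xs \<le> cap"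
    and disj: "\<And>i j. i < length xs \<Longrightarrow> j < cap \<Longrightarrow> a + i \<noteq> dst + j"
    and xsW: "\<And>x. x \<in> set xs \<Longrightarrow> x < W" "\<And>x. x \<in> set xs \<Longrightarrow> parentf h x < W"
    and src: "\<And>i. i < length xs \<Longrightarrow> old (a + i) = xs ! i" and E0: "writing dst z old ys0 v"
    and Q: "\<And>u. writing dst (z + 8 * (length xs div w + 1)) old (ys0 @ map (parentf h) xs) u \<Longrightarrow>
       \<forall>x<20. x \<noteq> 10 \<longrightarrow> reg u x = reg v x \<Longrightarrow> Q u"
  shows "wp (scan parents) Q v"
proof (rule wp_scan_out[where xs = xs and a = a and dst = dst and cap = cap and old = old and z = z and ?ys0.0 = ys0 and
    G = "\<lambda>k. if True then [parentf h (xs ! k)] else []" and St = "\<lambda>k r m. True"], goal_cases)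
  case (14 k u z')
  have xW: "parentf h (xs ! k) < W" using xsW 14(1) by simp
  have rs: "reg u 6 = X" "reg u 11 = h" "reg u 20 = xs ! k" using 14 r by auto
  show ?case unfolding parents_def
    by (rule wp_emit[OF 14(3)]) (use rs xW 14(4) in \<open>auto simp: parentf_def join_rec_def pack_def\<close>)
next
  case (15 u)
  then show ?case using concat_filter_map[of "\<lambda>x. True" xs "parentf h"] by (intro Q) auto
qed (use r bnd disj xsW src E0 in simp_all)

lemma wp_children:
  assumes r: "reg v 4 = w" "reg v 6 = X" "reg v 7 = a" "reg v 8 = length xs" "reg v 11 = h" "reg v 12 = s"
    and bnd: "a + length xs \<le> 2 * U ^ 5" "dst + cap \<le> 2 * U ^ 5" "length ys0 + length xs \<le> cap"
    and disj: "\<And>i j. i < length xs \<Longrightarrow> j < cap \<Longrightarrow> a + i \<noteq> dst + j"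
    and xsW: "\<And>x. x \<in> set xs \<Longrightarrow> x < W" "\<And>x. x \<in> set xs \<Longrightarrow> childf x < W"
    and src: "\<And>i. i < length xs \<Longrightarrow> old (a + i) = xs ! i" and E0: "writing dst z old ys0 v"
    and Q: "\<And>u. writing dst (z + 8 * (length xs div w + 1)) old
        (ys0 @ map childf (filter (\<lambda>x. x div X mod X mod (2 * h) \<noteq> s) xs)) u \<Longrightarrow>
       \<forall>x<20. x \<noteq> 10 \<longrightarrow> reg u x = reg v x \<Longrightarrow> Q u"
  shows "wp (scan children) Q v"
proof (rule wp_scan_out[where xs = xs and a = a and dst = dst and cap = cap and old = old and z = z and ?ys0.0 = ys0 and
    G = "\<lambda>k. if xs ! k div X mod X mod (2 * h) \<noteq> s then [childf (xs ! k)] else []" and St = "\<lambda>k r m. True"], goal_cases)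
  case (14 k u z')
  have xW: "childf (xs ! k) < W" using xsW 14(1) by simp
  have rs: "reg u 6 = X" "reg u 11 = h" "reg u 12 = s" "reg u 20 = xs ! k" using 14 r by auto
  show ?case unfolding children_def
  proof (rule wp_Cond, goal_cases)
    case 2 then show ?case using rs 14(3) by (intro wp_Skip) auto
  next
    case 3 then show ?case
      by (intro wp_emit[OF 14(3)]) (use rs xW 14(4) in \<open>auto simp: childf_def join_rec_def pack_def\<close>)
  qed simp
next
  case (15 u)
  then show ?case using concat_filter_map[of "\<lambda>x. x div X mod X mod (2 * h) \<noteq> s" xs childf] by (intro Q) auto
qed (use r bnd disj xsW src E0 in simp_all)

text \<open>The number of the first node with the same path, counted from 1. This is the fresh
  number that \<open>base\<close> assigns at that node.\<close>

definition cls :: "nat set \<Rightarrow> nat \<Rightarrow> nat" where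
  "cls V i = Suc (LEAST j. path (sorted_list_of_set V ! j) = path i)"

definition parent_cls :: "nat set \<Rightarrow> nat \<Rightarrow> nat \<Rightarrow> nat" where
  "parent_cls V h i = (if h \<le> D i then cls V (ancestor h i) else 0)"

text \<open>The depth is stored so that the search for the parent can read it from the history. It
  does not spoil the comparison of keys, since equal paths have equal lengths.\<close>

definition key :: "nat set \<Rightarrow> nat \<Rightarrow> (nat \<Rightarrow> nat) \<Rightarrow> nat \<Rightarrow> nat" where
  "key V h nm i = pack X (pack X (D i) (parent_cls V h i)) (nm i)"

lemma cls_facts:
  assumes "V \<subseteq> {..<N}"
  shows "k < card V \<Longrightarrow> cls V (sorted_list_of_set V ! k) \<le> Suc k"
    and "i \<in> V \<Longrightarrow> 1 \<le> cls V i \<and> cls V i \<le> card V"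
    and "i \<in> V \<Longrightarrow> j \<in> V \<Longrightarrow> cls V i = cls V j \<longleftrightarrow> path i = path j"
proof -
  have f: "finite V" using assms finite_subset by blast
  let ?vs = "sorted_list_of_set V"
  show 1: "cls V (?vs ! k) \<le> Suc k" if "k < card V" for k
    unfolding cls_def by (simp add: Least_le)
  have at: "path (?vs ! (cls V i - 1)) = path i \<and> (\<exists>k<card V. ?vs ! k = i)" if "i \<in> V" for i
  proof -
    from that obtain k where k: "k < card V" "?vs ! k = i"
      using f by (metis in_set_conv_nth length_sorted_list_of_set set_sorted_list_of_set)
    have "path (?vs ! (LEAST j. path (?vs ! j) = path i)) = path i" by (rule LeastI[of _ k]) (simp add: k)
    then show ?thesis using k by (auto simp: cls_def)
  qed
  show "1 \<le> cls V i \<and> cls V i \<le> card V" if i: "i \<in> V" for i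
  proof -
    obtain k where "k < card V" "?vs ! k = i" using at[OF i] by blast
    then have "cls V i \<le> Suc k" using 1[of k] by simp
    then show ?thesis using \<open>k < card V\<close> by (simp add: cls_def)
  qed
  show "cls V i = cls V j \<longleftrightarrow> path i = path j" if "i \<in> V" "j \<in> V" for i j
  proof
    assume "cls V i = cls V j"
    then show "path i = path j" using at[OF that(1)] at[OF that(2)] by metis
  qed (simp add: cls_def)
qed

lemma wp_base:
  assumes r: "reg v 4 = w" "reg v 6 = X" "reg v 7 = a" "reg v 8 = card V" "reg v 9 = dst" "reg v 11 = h"
    and ar: "areas a dst (card V)" and V: "V = level h s" and h: "1 \<le> h" and nm: "named V (\<lambda>i. take h (path i)) nm"
    and nw: "card V \<le> w"
    and src: "\<And>i. i < card V \<Longrightarrow> store v (a + i) = rows V nm ! i"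
    and Q: "\<And>u. reg u 7 = dst \<Longrightarrow> reg u 9 = a \<Longrightarrow> reg u 8 = card V \<Longrightarrow>
       \<forall>x<20. x \<notin> {7, 8, 9, 10} \<longrightarrow> reg u x = reg v x \<Longrightarrow>
       \<forall>i<card V. store u (dst + i) = rows V (cls V) ! i \<Longrightarrow> named V path (cls V) \<Longrightarrow>
       \<forall>i. \<not> (dst \<le> i \<and> i < dst + card V) \<longrightarrow> store u i = store v i \<Longrightarrow>
       cost u \<le> cost v + 18 * (card V div w + 1) \<Longrightarrow> Q u"
  shows "wp (stage base) Q v"
proof -
  have VN: "V \<subseteq> {..<N}" unfolding V by (rule level_sub)
  have f: "finite V" unfolding V by simp
  define vs where "vs = sorted_list_of_set V"
  have lv: "length vs = card V" "set vs = V" using f by (auto simp: vs_def)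
  have srt: "sorted_wrt (<) vs" unfolding vs_def by (rule strict_sorted_list_of_set)
  define xs where "xs = rows V nm"
  note R = rows[OF VN nm, folded xs_def]
  have xk: "xs ! k = node_rec X (vs ! k) (D (vs ! k)) (nm (vs ! k))" if "k < card V" for k
    using that lv R(4) by (simp add: vs_def)
  have cN: "card V < X" using R(5) X_ge by simp
  note cf = cls_facts[OF VN]
  have nmX: "1 \<le> nm i \<and> nm i < X" if "i \<in> V" for i using nm that by (simp add: named_def)
  have clX: "1 \<le> cls V i \<and> cls V i < X" if "i \<in> V" for i using cf(2)[OF that] cN by simp
  have DX: "i < N \<and> i < X \<and> D i < X" if "i \<in> V" for i using that VN N_less[of i] by auto
  have paV: "ancestor h i \<in> V" if "i \<in> V" "h \<le> D i" for i using ancestor_level(1)[OF h] that unfolding V by blast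
  have pclsX: "parent_cls V h i < X" if "i \<in> V" for i using paV[OF that] clX X_pos by (auto simp: parent_cls_def)
  have named: "named V path (cls V)" using clX cf(3) by (auto simp: named_def)
  have keyeq: "key V h nm i = key V h nm j \<longleftrightarrow> path i = path j" if ij: "i \<in> V" "j \<in> V" for i j
  proof -
    have "parent_cls V h i = parent_cls V h j \<longleftrightarrow> drop h (path i) = drop h (path j)"
      unfolding parent_cls_def
      by (rule lp_eq[where VP = V and f = "\<lambda>x. x"]) (use cf clX h ij DX paV in auto)
    moreover have "nm i = nm j \<longleftrightarrow> take h (path i) = take h (path j)" using nm ij by (auto simp: named_def)
    moreover have "path i = path j \<longleftrightarrow> take h (path i) = take h (path j) \<and> drop h (path i) = drop h (path j)"
      by (metis append_take_drop_id)
    moreover have "D i = D j" if "path i = path j"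
      using length_path[of i] length_path[of j] that ij DX by auto
    moreover have "key V h nm i = key V h nm j \<longleftrightarrow> D i = D j \<and> parent_cls V h i = parent_cls V h j \<and> nm i = nm j"
      using nmX pclsX ij by (simp add: key_def pack_eq)
    ultimately show ?thesis by blast
  qed
  let ?hist = "\<lambda>i. pack X (key V h nm i) (cls V i)"
  have histX: "?hist i < X * X * X * X" if "i \<in> V" for i
    unfolding key_def using that nmX pclsX clX DX by (intro pack_bound) auto
  show ?thesis
  proof (rule wp_stage[where xs = xs and a = a and dst = dst and
      G = "\<lambda>k. if True then [node_rec X (vs ! k) (D (vs ! k)) (cls V (vs ! k))] else []" and
      St = "\<lambda>k r m. \<forall>j<k. m (w + j) = ?hist (vs ! j)"], goal_cases)
    case 5 then show ?case using ar R(1) by (simp add: areas_def)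
  next
    case 6 then show ?case using ar R(1) by (simp add: areas_def)
  next
    case (7 x) then show ?case using R(6) X3 by simp
  next
    case (9 i j) then show ?case using ar R(1) by (auto simp: areas_def)
  next
    case (13 k u z')
    define i where "i = vs ! k"
    have k: "k < card V" using 13(1) R(1) by simp
    have iV: "i \<in> V" using k lv i_def nth_mem by metis
    have vsV: "vs ! j \<in> V" if "j < card V" for j using that lv nth_mem by metis
    have x: "reg u 20 = node_rec X i (D i) (nm i)" using 13(5) xk[OF k] i_def by simp
    have rs: "reg u 4 = w" "reg u 6 = X" "reg u 11 = h" "reg u 10 = k" using 13 r by auto
    note af = node_rec_fields[of i "D i" "nm i"]
    have fl: "reg u 20 mod X = nm i" "reg u 20 div X mod X = D i" "reg u 20 div X = pack X i (D i)"
      using af nmX[OF iV] DX[OF iV] unfolding x by (simp_all add: node_rec_def)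
    have hist: "\<forall>j<k. vmem u (w + j) = ?hist (vs ! j)" by (rule 13(2))
    have kW: "Suc k < W" "k < W" using k nw wU U_bounds small[of "Suc k"] by linarith+
    have wk: "w + k < vsize" using k nw fit' by linarith
    have small_cl: "cls V j < W" if "j \<in> V" for j using clX[OF that] small[of "cls V j"] XU U_bounds by linarith
    have hf: "?hist j div X div X div X = D j" "?hist j mod X = cls V j" "?hist j div X = key V h nm j" if "j \<in> V" for j
      using nmX[OF that] pclsX[OF that] clX[OF that] by (simp_all add: key_def)
    let ?os = "concat (map (\<lambda>k. if True then [node_rec X (vs ! k) (D (vs ! k)) (cls V (vs ! k))] else []) [0..<k])"
    let ?J1 = "\<lambda>j u1. reg u1 36 = j \<and> (\<forall>x. x \<notin> {34, 35, 36, 37} \<longrightarrow> reg u1 x = reg u x) \<and> vmem u1 = vmem u \<and> writing dst z' (store v) ?os u1 \<and>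
       ((\<forall>j'<j. D (vs ! j') + h \<noteq> D i) \<and> reg u1 34 = 0 \<or>
        (\<exists>j'<j. D (vs ! j') + h = D i \<and> reg u1 34 = cls V (vs ! j') \<and> (\<forall>j''. j' < j'' \<longrightarrow> j'' < j \<longrightarrow> D (vs ! j'') + h \<noteq> D i)))"
    let ?J2 = "\<lambda>j u1. reg u1 36 = j \<and> (\<forall>x. x \<notin> {34, 35, 36, 37} \<longrightarrow> reg u1 x = reg u x) \<and> vmem u1 = vmem u \<and> writing dst z' (store v) ?os u1 \<and>
       reg u1 34 = parent_cls V h i \<and>
       ((\<forall>j'<j. key V h nm (vs ! j') \<noteq> key V h nm i) \<and> reg u1 35 = Suc k \<or>
        (\<exists>j'<j. key V h nm (vs ! j') = key V h nm i \<and> reg u1 35 = cls V (vs ! j')))"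
    \<comment> \<open>\<open>ancestor h i\<close> is the last among all earlier nodes at depth
      \<open>D i - h\<close> and belongs to \<open>V\<close>; so it is also the last hit of the
      search, which visits only \<open>V\<close>.\<close>
    have end1: "reg u1 34 = parent_cls V h i" if J: "?J1 k u1" for u1
    proof (cases "h \<le> D i")
      case True
      have iN: "i < N" using DX[OF iV] by simp
      note p = ancestor[OF iN h True]
      obtain jp where jp: "jp < card V" "vs ! jp = ancestor h i" using paV[OF iV True] lv by (metis in_set_conv_nth)
      have jpk: "jp < k"
      proof (rule ccontr)
        assume "\<not> jp < k"
        then have "vs ! k \<le> vs ! jp" using sorted_wrt_nth_less[OF srt, of k jp] jp lv by (cases "k = jp") auto
        then show False using p jp i_def by simp
      qed
      have dp: "D (vs ! jp) + h = D i" using p jp by simp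
      then obtain j' where j': "j' < k" "D (vs ! j') + h = D i" "reg u1 34 = cls V (vs ! j')"
        "\<And>j''. j' < j'' \<Longrightarrow> j'' < k \<Longrightarrow> D (vs ! j'') + h \<noteq> D i" using J jpk by blast
      have "vs ! j' < i" using sorted_wrt_nth_less[OF srt, of j' k] j' k lv i_def by simp
      then have "vs ! j' \<le> ancestor h i" using p j'(2) by blast
      moreover have "jp \<le> j'" using j'(4)[of jp] jpk dp by (meson not_le)
      then have "ancestor h i \<le> vs ! j'"
        using sorted_wrt_nth_less[OF srt, of jp j'] jp j'(1) k lv by (cases "jp = j'") auto
      ultimately show ?thesis using j'(3) True by (simp add: parent_cls_def)
    next
      case False
      then have "\<forall>j'<k. D (vs ! j') + h \<noteq> D i" by simp
      then show ?thesis using J False unfolding parent_cls_def by auto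
    qed
    \<comment> \<open>Equal keys mean equal paths, so a hit yields the right class. Without a hit,
      \<open>k\<close> is the first index with this path and the fresh number stands.\<close>
    have end2: "reg u1 35 = cls V i" if J: "?J2 k u1" for u1
    proof (cases "\<exists>j'<k. key V h nm (vs ! j') = key V h nm i")
      case True
      then obtain j' where j': "j' < k" "key V h nm (vs ! j') = key V h nm i" "reg u1 35 = cls V (vs ! j')"
        using J by blast
      then show ?thesis using keyeq[of "vs ! j'" i] cf(3)[of "vs ! j'" i] vsV[of j'] iV k by simp
    next
      case False
      then have e: "reg u1 35 = Suc k" using J by blast
      have no: "path (vs ! j') \<noteq> path i" if "j' < k" for j'
        using False that keyeq[of "vs ! j'" i] vsV[of j'] iV k by auto
      have "(LEAST j. path (vs ! j) = path i) = k"
        by (rule Least_equality) (use no i_def not_le in auto)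
      then show ?thesis using e by (simp add: cls_def vs_def)
    qed
    have fin: "wp (vstore (Reg 4 \<oplus> Reg 10) (packE (packE (packE depE (Reg 34)) labE) (Reg 35)) ;;
       emit (packE (Reg 20 \<oslash> Reg 6) (Reg 35))) (\<lambda>u'. (\<forall>j<Suc k. vmem u' (w + j) = ?hist (vs ! j)) \<and>
        writing dst z' (store v) (?os @ (if True then [node_rec X (vs ! k) (D (vs ! k)) (cls V (vs ! k))] else [])) u' \<and>
        (\<forall>x<20. reg u' x = reg u x) \<and> (\<forall>x<w. vmem u' x = vmem u x)) u1" if J: "?J2 k u1" for u1
    proof -
      have q: "reg u1 4 = w" "reg u1 10 = k" "reg u1 6 = X" "reg u1 20 = reg u 20" "reg u1 34 = parent_cls V h i" "reg u1 35 = cls V i"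
        using J rs end2[OF J] by auto
      have Eu: "writing dst z' (store v) ?os u1" using J by simp
      have ev: "exp_val (packE (packE (packE depE (Reg 34)) labE) (Reg 35)) (reg u1) = ?hist i"
        using q fl by (simp add: key_def pack_def)
      have ev2: "exp_val (packE (Reg 20 \<oslash> Reg 6) (Reg 35)) (reg u1) = node_rec X i (D i) (cls V i)"
        using q fl by (simp add: node_rec_def pack_def)
      have aW: "node_rec X i (D i) (cls V i) < W"
        using node_rec_fields(4)[of i "D i" "cls V i"] DX[OF iV] clX[OF iV] X3 by blast
      show ?thesis
      proof (rule wp_Seq, rule wp_vstore, goal_cases)
        case 3 show ?case using q wk by simp
      next
        case 4 show ?case unfolding ev by (rule X4[OF histX[OF iV]])
      next
        case 5
        show ?case unfolding ev
        proof (rule wp_emit[of dst z' "store v" ?os], goal_cases)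
          case 1 show ?case using Eu by simp
        next
          case 3 show ?case using aW ev2 by simp
        next
          case 4 show ?case using 13(4) by simp
        next
          case (5 u2)
          then show ?case using ev2 q hist J i_def by (auto simp: less_Suc_eq)
        qed simp
      qed simp_all
    qed
    have loop2: "wp (For 36 (Reg 10) (vload 37 (Reg 4 \<oplus> Reg 36) ;;
       Cond (Equal (Reg 37 \<oslash> Reg 6) (packE (packE depE (Reg 34)) labE)) (Assign 35 (Reg 37 \<odot> Reg 6)) Skip)) Q' u1"
      if J: "?J2 0 (u1\<lparr>reg := (reg u1)(36 := 0)\<rparr>)" and Q': "\<And>u1. ?J2 k u1 \<Longrightarrow> Q' u1" for Q' u1
    proof (rule wp_For[where n = k and I = ?J2], goal_cases)
      case 3 show ?case by (rule kW(2))
    next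
      case 4 show ?case by (rule W_pos)
    next
      case 5 show ?case by (rule J)
    next
      case (6 j u2) then show ?case using rs by simp
    next
      case (7 j u2)
      have q: "reg u2 4 = w" "reg u2 6 = X" "reg u2 20 = reg u 20" "reg u2 34 = parent_cls V h i" "reg u2 36 = j"
        "vmem u2 = vmem u" "\<forall>x. x \<notin> {34, 35, 36, 37} \<longrightarrow> reg u2 x = reg u x" using 7(1) rs by auto
      have Eu: "writing dst z' (store v) ?os u2" using 7(1) by blast
      have jV: "vs ! j \<in> V" using vsV 7(2) k by simp
      have hj: "vmem u2 (w + j) = ?hist (vs ! j)" using hist 7(2) q by simp
      have kv: "exp_val (packE (packE depE (Reg 34)) labE) (reg u2) = key V h nm i"
        using q fl by (simp add: key_def pack_def)
      have dj: "(\<forall>j'<j. key V h nm (vs ! j') \<noteq> key V h nm i) \<and> reg u2 35 = Suc k \<or>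
        (\<exists>j'<j. key V h nm (vs ! j') = key V h nm i \<and> reg u2 35 = cls V (vs ! j'))" using 7(1) by blast
      let ?u = "u2\<lparr>reg := (reg u2)(37 := ?hist (vs ! j))\<rparr>"
      have kv': "exp_val (packE (packE depE (Reg 34)) labE) (reg ?u) = key V h nm i" using kv by simp
      have hv: "exp_val (Reg 37 \<oslash> Reg 6) (reg ?u) = key V h nm (vs ! j)" using q hf[OF jV] by simp
      show ?case
      proof (rule wp_Seq, rule wp_vload, goal_cases)
        case 3 show ?case using q 7(2) wk by simp
      next
        case 4
        have eu: "u2\<lparr>reg := (reg u2)(37 := vmem u2 (exp_val (Reg 4 \<oplus> Reg 36) (reg u2)))\<rparr> = ?u" using q hj by simp
        show ?case unfolding eu
        proof (rule wp_Cond, goal_cases)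
          case 2
          then have kk: "key V h nm (vs ! j) = key V h nm i" using hv kv' by (simp del: exp_val.simps)
          show ?case
          proof (rule wp_Assign, goal_cases)
            case 3 show ?case using q hf[OF jV] small_cl[OF jV] by simp
          next
            case 4
            have "writing dst z' (store v) ?os (?u\<lparr>reg := (reg ?u)(35 := exp_val (Reg 37 \<odot> Reg 6) (reg ?u), 36 := Suc j)\<rparr>)"
              by (rule writing_reg, rule writing_reg[OF Eu]) auto
            then show ?case using q hf[OF jV] kk by auto
          qed (simp_all add: reg_ok_def)
        next
          case 3
          then have kk: "key V h nm (vs ! j) \<noteq> key V h nm i" using hv kv' by (simp del: exp_val.simps)
          have "writing dst z' (store v) ?os (?u\<lparr>reg := (reg ?u)(36 := Suc j)\<rparr>)"
            by (rule writing_reg, rule writing_reg[OF Eu]) auto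
          moreover have "(\<forall>j'<Suc j. key V h nm (vs ! j') \<noteq> key V h nm i) \<and> reg u2 35 = Suc k \<or>
            (\<exists>j'<Suc j. key V h nm (vs ! j') = key V h nm i \<and> reg u2 35 = cls V (vs ! j'))"
            using dj kk less_Suc_eq by metis
          ultimately show ?case using q by (intro wp_Skip) simp
        qed simp
      qed (simp_all add: reg_ok_def)
    next
      case (8 u2) then show ?case by (rule Q')
    qed (simp_all add: reg_ok_def)
    have loop1: "wp (For 36 (Reg 10) (vload 37 (Reg 4 \<oplus> Reg 36) ;;
       Cond (Equal (Reg 37 \<oslash> Reg 6 \<oslash> Reg 6 \<oslash> Reg 6 \<oplus> Reg 11) depE) (Assign 34 (Reg 37 \<odot> Reg 6)) Skip)) Q' u1"
      if J: "?J1 0 (u1\<lparr>reg := (reg u1)(36 := 0)\<rparr>)" and Q': "\<And>u1. ?J1 k u1 \<Longrightarrow> Q' u1" for Q' u1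
    proof (rule wp_For[where n = k and I = ?J1], goal_cases)
      case 3 show ?case by (rule kW(2))
    next
      case 4 show ?case by (rule W_pos)
    next
      case 5 show ?case by (rule J)
    next
      case (6 j u2) then show ?case using rs by simp
    next
      case (7 j u2)
      have q: "reg u2 4 = w" "reg u2 6 = X" "reg u2 20 = reg u 20" "reg u2 36 = j" "reg u2 11 = h"
        "vmem u2 = vmem u" "\<forall>x. x \<notin> {34, 35, 36, 37} \<longrightarrow> reg u2 x = reg u x" using 7(1) rs by auto
      have Eu: "writing dst z' (store v) ?os u2" using 7(1) by blast
      have jV: "vs ! j \<in> V" using vsV 7(2) k by simp
      have hj: "vmem u2 (w + j) = ?hist (vs ! j)" using hist 7(2) q by simp
      have dj: "(\<forall>j'<j. D (vs ! j') + h \<noteq> D i) \<and> reg u2 34 = 0 \<or>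
        (\<exists>j'<j. D (vs ! j') + h = D i \<and> reg u2 34 = cls V (vs ! j') \<and> (\<forall>j''. j' < j'' \<longrightarrow> j'' < j \<longrightarrow> D (vs ! j'') + h \<noteq> D i))"
        using 7(1) by blast
      let ?u = "u2\<lparr>reg := (reg u2)(37 := ?hist (vs ! j))\<rparr>"
      have hv: "test_val (Equal (Reg 37 \<oslash> Reg 6 \<oslash> Reg 6 \<oslash> Reg 6 \<oplus> Reg 11) depE) (reg ?u) \<longleftrightarrow> D (vs ! j) + h = D i"
        using q hf[OF jV] fl by simp
      show ?case
      proof (rule wp_Seq, rule wp_vload, goal_cases)
        case 3 show ?case using q 7(2) wk by simp
      next
        case 4
        have eu: "u2\<lparr>reg := (reg u2)(37 := vmem u2 (exp_val (Reg 4 \<oplus> Reg 36) (reg u2)))\<rparr> = ?u" using q hj by simp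
        show ?case unfolding eu
        proof (rule wp_Cond, goal_cases)
          case 2
          then have kk: "D (vs ! j) + h = D i" unfolding hv .
          show ?case
          proof (rule wp_Assign, goal_cases)
            case 3 show ?case using q hf[OF jV] small_cl[OF jV] by simp
          next
            case 4
            have "writing dst z' (store v) ?os (?u\<lparr>reg := (reg ?u)(34 := exp_val (Reg 37 \<odot> Reg 6) (reg ?u), 36 := Suc j)\<rparr>)"
              by (rule writing_reg, rule writing_reg[OF Eu]) auto
            moreover have "\<exists>j'<Suc j. D (vs ! j') + h = D i \<and> cls V (vs ! j) = cls V (vs ! j') \<and>
               (\<forall>j''. j' < j'' \<longrightarrow> j'' < Suc j \<longrightarrow> D (vs ! j'') + h \<noteq> D i)"
              by (rule exI[of _ j]) (use kk in auto)
            ultimately show ?case using q hf[OF jV] by simp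
          qed (simp_all add: reg_ok_def)
        next
          case 3
          then have kk: "D (vs ! j) + h \<noteq> D i" unfolding hv .
          have "writing dst z' (store v) ?os (?u\<lparr>reg := (reg ?u)(36 := Suc j)\<rparr>)"
            by (rule writing_reg, rule writing_reg[OF Eu]) auto
          moreover have "(\<forall>j'<Suc j. D (vs ! j') + h \<noteq> D i) \<and> reg u2 34 = 0 \<or>
            (\<exists>j'<Suc j. D (vs ! j') + h = D i \<and> reg u2 34 = cls V (vs ! j') \<and> (\<forall>j''. j' < j'' \<longrightarrow> j'' < Suc j \<longrightarrow> D (vs ! j'') + h \<noteq> D i))"
            using dj kk less_Suc_eq by (metis (no_types, lifting))
          ultimately show ?case using q by (intro wp_Skip) simp
        qed simp
      qed (simp_all add: reg_ok_def)
    next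
      case (8 u2) then show ?case by (rule Q')
    qed (simp_all add: reg_ok_def)
    show ?case unfolding base_def
    proof (rule wp_Seq, rule wp_Assign, goal_cases)
      case 3 show ?case using W_pos by simp
    next
      case 4
      show ?case
      proof (rule wp_Seq, rule loop1, goal_cases)
        case 1 show ?case using 13(3) by (auto intro!: writing_reg)
      next
        case (2 u1)
        note p1 = end1[OF 2]
        show ?case
        proof (rule wp_Seq, rule wp_Assign, goal_cases)
          case 3 show ?case using 2 rs kW by simp
        next
          case 4
          show ?case
          proof (rule wp_Seq, rule loop2, goal_cases)
            case 1 show ?case using 2 p1 rs by (auto intro!: writing_reg)
          next
            case (2 u2) then show ?case by (rule fin)
          qed
        qed (simp_all add: reg_ok_def)
      qed
    qed (simp_all add: reg_ok_def)
  next
    case (14 u ys)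
    have "ys = map (\<lambda>k. node_rec X (vs ! k) (D (vs ! k)) (cls V (vs ! k))) [0..<length xs]"
      unfolding 14(1) by simp
    also have "\<dots> = map (\<lambda>i. node_rec X i (D i) (cls V i)) vs"
      by (rule nth_equalityI) (use R(1) lv in auto)
    also have "\<dots> = rows V (cls V)" using rows(4)[OF VN named] by (simp add: vs_def)
    finally have ys: "ys = rows V (cls V)" .
    have "length ys = card V" unfolding ys by (rule rows(1)[OF VN named])
    then show ?case using 14 named ys R(1) by (intro Q) auto
  qed (use r src R(1) in \<open>simp_all add: xs_def\<close>)
qed

end

section \<open>Descent and ascent\<close>

abbreviation regionE :: exp where "regionE \<equiv> (Const 4 \<oplus> Reg 13) \<otimes> Reg 14"
abbreviation headerE :: exp where "headerE \<equiv> Const 3 \<otimes> Reg 14 \<oplus> Reg 13"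

text \<open>One scan both saves the table for the ascent and counts the nodes whose depth keeps the
  residue modulo \<open>2 * h\<close>. If these are more than half, the residue is raised by
  \<open>h\<close> to select the others.\<close>

definition down_body :: prog where
  "down_body = Assign 9 regionE ;; stage copy_count ;; cell_write headerE (Reg 8) ;;
     Cond (Less (Reg 8) (Const 2 \<otimes> Reg 30)) (Assign 12 (Reg 12 \<oplus> Reg 11)) Skip ;;
     Assign 9 (Reg 14) ;; stage split ;; Assign 9 (Const 2 \<otimes> Reg 14) ;; join ;;
     Assign 11 (Reg 11 \<oplus> Reg 11) ;; Assign 13 (Reg 13 \<oplus> Const 1)"

text \<open>Parents come from the current array, children from the saved table of the level. The
  residue in register 12 is reduced only after the scans, since \<open>in_half\<close> needs it
  modulo \<open>2 * h\<close> to tell kept from dropped nodes.\<close>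

definition up_body :: prog where
  "up_body = Assign 13 (Reg 13 \<ominus> Const 1) ;; Assign 11 (Reg 11 \<oslash> Const 2) ;; Assign 21 (Const 0) ;;
     scan parents ;; Assign 15 (Reg 7) ;; Assign 7 regionE ;; cell_read 8 headerE ;; scan children ;;
     Assign 8 (Reg 21) ;; Assign 7 (Reg 9) ;; Assign 9 (Reg 15) ;; Assign 12 (Reg 12 \<odot> Reg 11) ;; join"

context contraction
begin

text \<open>External memory is divided into areas of \<open>Z\<close> cells: area 0 holds the input, 1 and 2 are work
  areas, 3 holds the sizes of the levels and \<open>4 + j\<close> the table of level \<open>j\<close>.\<close>

definition params :: "vstate \<Rightarrow> bool" where
  "params u \<longleftrightarrow> reg u 4 = w \<and> reg u 5 = K \<and> reg u 6 = X \<and> reg u 14 = Z"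

definition at_work :: "nat list \<Rightarrow> vstate \<Rightarrow> bool" where
  "at_work xs u \<longleftrightarrow> (reg u 7 = 1 * Z \<and> reg u 9 = 2 * Z \<or> reg u 7 = 2 * Z \<and> reg u 9 = 1 * Z) \<and> reg u 8 = length xs \<and>
     (\<forall>i<length xs. store u (reg u 7 + i) = xs ! i)"

text \<open>The last two conjuncts are recorded for the ascent: \<open>2 ^ j \<le> N\<close> bounds
  the addresses used at level \<open>j\<close>, and \<open>w < card ...\<close> allows rounding to
  be absorbed.\<close>

definition saved :: "nat \<Rightarrow> nat \<Rightarrow> (nat \<Rightarrow> nat) \<Rightarrow> bool" where
  "saved j s d \<longleftrightarrow> (\<exists>nm. named (level (2 ^ j) s) (\<lambda>i. take (2 ^ j) (path i)) nm \<and> d (3 * Z + j) = card (level (2 ^ j) s) \<and>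
     (\<forall>i<card (level (2 ^ j) s). d ((4 + j) * Z + i) = rows (level (2 ^ j) s) nm ! i)) \<and>
     2 ^ j \<le> N \<and> w < card (level (2 ^ j) s)"

text \<open>The residues of all earlier levels are remainders of the current one, so register 12
  alone determines the history of choices.\<close>

definition stored :: "nat \<Rightarrow> nat \<Rightarrow> (nat \<Rightarrow> nat) \<Rightarrow> bool" where
  "stored lev s d \<longleftrightarrow> (\<forall>j<lev. saved j (s mod 2 ^ j) d \<and>
     2 * card (level (2 ^ Suc j) (s mod 2 ^ Suc j)) \<le> card (level (2 ^ j) (s mod 2 ^ j)))"

text \<open>Descending from a level to the next at least halves the number of nodes, so the cost of a level
  is paid by the decrease of \<open>464 * P * card (level (2 ^ lev) s)\<close>; likewise for its growth on the way up.\<close>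

definition down_inv :: "nat \<Rightarrow> nat \<Rightarrow> nat \<Rightarrow> vstate \<Rightarrow> bool" where
  "down_inv C lev s u \<longleftrightarrow> (\<exists>nm. named (level (2 ^ lev) s) (\<lambda>i. take (2 ^ lev) (path i)) nm \<and> at_work (rows (level (2 ^ lev) s) nm) u) \<and>
     params u \<and> reg u 11 = 2 ^ lev \<and> reg u 12 = s \<and> reg u 13 = lev \<and> s < 2 ^ lev \<and>
     2 ^ lev * card (level (2 ^ lev) s) \<le> N \<and> stored lev s (store u) \<and> w * cost u + 464 * P * card (level (2 ^ lev) s) \<le> C"

definition up_inv :: "nat \<Rightarrow> nat \<Rightarrow> nat \<Rightarrow> vstate \<Rightarrow> bool" where
  "up_inv C lev s u \<longleftrightarrow> (\<exists>c. named (level (2 ^ lev) s) path c \<and> at_work (rows (level (2 ^ lev) s) c) u) \<and>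
     params u \<and> reg u 11 = 2 ^ lev \<and> reg u 12 = s \<and> reg u 13 = lev \<and> s < 2 ^ lev \<and>
     stored lev s (store u) \<and> w * cost u \<le> C + 464 * P * card (level (2 ^ lev) s)"

lemma slot_out: "q \<noteq> p \<Longrightarrow> i < Z \<Longrightarrow> n \<le> Z \<Longrightarrow> \<not> (p * Z \<le> q * Z + i \<and> q * Z + i < p * Z + n)"
proof
  assume a: "q \<noteq> p" "i < Z" "n \<le> Z" "p * Z \<le> q * Z + i \<and> q * Z + i < p * Z + n"
  then have "q * Z + i = p * Z + (q * Z + i - p * Z)" "q * Z + i - p * Z < Z" by auto
  then show False using slot_neq[OF a(1,2), of "q * Z + i - p * Z"] by metis
qed

lemma saved_cong:
  assumes "saved j s d" "\<And>i q. i < Z \<Longrightarrow> q = 3 \<and> i = j \<or> q = 4 + j \<Longrightarrow> d' (q * Z + i) = d (q * Z + i)"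
  shows "saved j s d'"
proof -
  have "2 ^ j \<le> N" using assms(1) by (simp add: saved_def)
  then have "j < N" using less_exp[of j] by linarith
  then have j: "j < Z" using NZ by linarith
  have "card (level (2 ^ j) s) \<le> N" using card_mono[OF _ level_sub, of "2 ^ j" s] by simp
  then have "i < Z" if "i < card (level (2 ^ j) s)" for i using that NZ by linarith
  then show ?thesis using assms(1) assms(2)[of j 3] assms(2)[of _ "4 + j"] j unfolding saved_def by metis
qed

lemma halves:
  assumes "1 \<le> h" "s < h"
  shows "card (level h s) = card (level (2 * h) s) + card (level (2 * h) (s + h))"
proof -
  have "level h s = level (2 * h) s \<union> level (2 * h) (s + h)"
    using level_split(1)[OF assms, of s] level_split(1)[OF assms, of "s + h"] level_two[OF assms] by auto
  moreover have "level (2 * h) s \<inter> level (2 * h) (s + h) = {}" using assms by (auto simp: level_def)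
  ultimately show ?thesis by (simp add: card_Un_disjoint)
qed

lemma splitf_node_rec:
  assumes "i < N" "nm i < X"
  shows "splitf h s' (node_rec X i (D i) (nm i)) =
    (if D i mod (2 * h) = s' then join_rec X (D i) i 1 (nm i) else join_rec X (D i + h) i 0 (nm i))"
    and "parentf h (node_rec X i (D i) (nm i)) = join_rec X (D i + h) i 2 (nm i)"
    and "childf (node_rec X i (D i) (nm i)) = join_rec X (D i) i 1 (nm i)"
  using node_rec_fields[of i "D i" "nm i"] N_less[OF assms(1)] assms(2) by (auto simp: splitf_def parentf_def childf_def)

lemma filter_rows:
  assumes V: "V \<subseteq> {..<N}" "named V f nm"
  shows "set (filter (\<lambda>x. c (x div X mod X)) (rows V nm)) = table {i \<in> V. c (D i)} nm"
    "length (filter (\<lambda>x. c (x div X mod X)) (rows V nm)) = card {i \<in> V. c (D i)}"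
proof -
  note R = rows[OF V]
  have nm: "\<And>i. i \<in> V \<Longrightarrow> nm i < X" using V(2) by (auto simp: named_def)
  have fl: "node_rec X i (D i) (nm i) div X mod X = D i" if "i \<in> V" for i
    using node_rec_fields(2)[of i "D i" "nm i"] N_less[of i] that V nm by auto
  show *: "set (filter (\<lambda>x. c (x div X mod X)) (rows V nm)) = table {i \<in> V. c (D i)} nm"
    using fl by (auto simp: R(2) table_def)
  have "length (filter (\<lambda>x. c (x div X mod X)) (rows V nm)) = card (set (filter (\<lambda>x. c (x div X mod X)) (rows V nm)))"
  proof -
    have "distinct (filter (\<lambda>x. c (x div X mod X)) (rows V nm))" using R(3) by simp
    then show ?thesis by (rule distinct_card[symmetric])
  qed
  also have "\<dots> = card {i \<in> V. c (D i)}" unfolding * using V nm by (intro card_table) auto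
  finally show "length (filter (\<lambda>x. c (x div X mod X)) (rows V nm)) = card {i \<in> V. c (D i)}" .
qed

lemma distinct_map_pos:
  assumes "distinct xs" "\<And>x. x \<in> set xs \<Longrightarrow> f x div X div X mod X = x div X div X"
    "inj_on (\<lambda>x. x div X div X) (set xs)"
  shows "distinct (map f xs)"
proof -
  have "inj_on f (set xs)"
  proof (rule inj_onI)
    fix x y assume "x \<in> set xs" "y \<in> set xs" "f x = f y"
    then show "x = y" using assms(2)[of x] assms(2)[of y] inj_onD[OF assms(3), of x y] by metis
  qed
  then show ?thesis using assms(1) by (simp add: distinct_map)
qed

lemma inj_pos: "V \<subseteq> {..<N} \<Longrightarrow> named V f nm \<Longrightarrow> inj_on (\<lambda>x. x div X div X) (table V nm)"
proof (rule inj_onI)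
  fix x y assume a: "V \<subseteq> {..<N}" "named V f nm" "x \<in> table V nm" "y \<in> table V nm" "x div X div X = y div X div X"
  have nm: "\<And>i. i \<in> V \<Longrightarrow> nm i < X" using a(2) by (auto simp: named_def)
  obtain i where i: "x = node_rec X i (D i) (nm i)" "x div X div X = i" by (rule table_fields[OF a(3,1) nm])
  obtain j where j: "y = node_rec X j (D j) (nm j)" "y div X div X = j" by (rule table_fields[OF a(4,1) nm])
  show "x = y" using i j a(5) by simp
qed

lemma pow_mod: "j \<le> lev \<Longrightarrow> s' mod 2 ^ lev = s \<Longrightarrow> s' mod 2 ^ j = s mod (2 ^ j :: nat)"
  by (metis le_imp_power_dvd mod_mod_cancel)

text \<open>\<open>w < n\<close> absorbs the rounding: \<open>w * (n div w + 1) \<le> 2 * n\<close>,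
  so a round costs at most \<open>232 * P * n\<close> after scaling by \<open>w\<close>. Since
  \<open>n \<le> 2 * (n - m)\<close>, the decrease from \<open>n\<close> to \<open>m\<close> nodes
  pays for it at the rate 464.\<close>

lemma cost_round:
  assumes c: "c \<le> c0 + 116 * P * (n div w + 1)" and wn: "w < n" and m: "2 * m \<le> n"
  shows "w * c + 464 * P * m \<le> w * c0 + 464 * P * n" "w * c \<le> w * c0 + 464 * P * (n - m)"
proof -
  have "w * (n div w) \<le> n" by simp
  moreover have "w * (n div w + 1) = w * (n div w) + w" by (simp add: algebra_simps)
  ultimately have "w * (n div w + 1) \<le> 2 * n" using wn by linarith
  then have "116 * P * (w * (n div w + 1)) \<le> 116 * P * (2 * n)" by (rule mult_le_mono2)
  moreover have "w * c \<le> w * (c0 + 116 * P * (n div w + 1))" by (rule mult_le_mono2[OF c])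
  moreover have "w * (c0 + 116 * P * (n div w + 1)) = w * c0 + 116 * P * (w * (n div w + 1))" by (simp add: algebra_simps)
  moreover have "116 * P * (2 * n) = 232 * P * n" by simp
  ultimately have wc: "w * c \<le> w * c0 + 232 * P * n" by linarith
  have "232 * P * (2 * m) \<le> 232 * P * n" by (rule mult_le_mono2[OF m])
  moreover have "232 * P * (2 * m) = 464 * P * m" by simp
  moreover have "464 * P * n = 232 * P * n + 232 * P * n" by simp
  ultimately show "w * c + 464 * P * m \<le> w * c0 + 464 * P * n" using wc by linarith
  then show "w * c \<le> w * c0 + 464 * P * (n - m)" by (simp add: diff_mult_distrib2)
qed

lemma wp_down:
  assumes D0: "down_inv C lev s u0" and wn: "w < card (level (2 ^ lev) s)"
  shows "wp down_body (\<lambda>u. \<exists>s'. down_inv C (Suc lev) s' u \<and> reg u 8 < reg u0 8) u0"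
proof -
  define h where "h = (2 :: nat) ^ lev"
  define V where "V = level h s"
  define n where "n = card V"
  from D0 obtain nm where nm: "named V (\<lambda>i. take h (path i)) nm" and at0: "at_work (rows V nm) u0"
    unfolding down_inv_def h_def V_def by blast
  have c0: "reg u0 4 = w" "reg u0 5 = K" "reg u0 6 = X" "reg u0 14 = Z" "reg u0 11 = h" "reg u0 12 = s" "reg u0 13 = lev"
    and sh: "s < h" and hn: "h * n \<le> N" and st0: "stored lev s (store u0)" and cost0: "w * cost u0 + 464 * P * n \<le> C"
    using D0 unfolding down_inv_def params_def h_def V_def n_def by auto
  have wn': "w < n" using wn by (simp add: n_def V_def h_def)
  have h1: "1 \<le> h" by (simp add: h_def)
  \<comment> \<open>More than \<open>w \<ge> 1\<close> nodes are left, so the invariant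
    \<open>h * n \<le> N\<close> bounds even the next stride \<open>2 * h\<close> by
    \<open>N\<close>.\<close>
  have "h * 2 \<le> h * n" using wn' w_pos by (intro mult_le_mono2) linarith
  then have h2N: "2 * h \<le> N" using hn by linarith
  then have hN: "h \<le> N" by simp
  have lh: "lev < h" unfolding h_def by simp
  then have lN: "lev < N" "lev < Z" using h2N NZ by linarith+
  have VN: "V \<subseteq> {..<N}" unfolding V_def by (rule level_sub)
  define xs where "xs = rows V nm"
  note R = rows[OF VN nm, folded xs_def n_def]
  have nZ: "n \<le> Z" "n < X" "n \<le> U" using R(5) NZ X_ge XU by linarith+
  have nmX: "\<And>i. i \<in> V \<Longrightarrow> nm i < X" using nm by (auto simp: named_def)
  define p where "p = (if reg u0 7 = 1 * Z then 1 else 2 :: nat)"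
  have p: "p = 1 \<or> p = 2" "reg u0 7 = p * Z" "reg u0 8 = n" "\<forall>i<n. store u0 (p * Z + i) = xs ! i"
    using at0 R(1) unfolding p_def at_work_def xs_def by auto
  define cnt where "cnt = card (level (2 * h) s)"
  define s' where "s' = (if n < 2 * cnt then s + h else s)"
  define S where "S = level (2 * h) s'"
  have s'c: "s' = s \<or> s' = s + h" by (simp add: s'_def)
  note sp = level_split[OF h1 sh s'c, folded V_def S_def]
  have hv: "n = cnt + card (level (2 * h) (s + h))" using halves[OF h1 sh] by (simp add: n_def V_def cnt_def)
  have half: "2 * card S \<le> n"
  proof (cases "n < 2 * cnt")
    case True
    then have "card S = n - cnt" unfolding S_def s'_def using hv by simp
    then show ?thesis using True by simp
  next
    case False
    then have "card S = cnt" unfolding S_def s'_def cnt_def by simp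
    then show ?thesis using False by simp
  qed
  have cntf: "length (filter (\<lambda>x. x div X mod X mod (2 * h) = s) xs) = cnt"
    using filter_rows(2)[OF VN nm, of "\<lambda>d. d mod (2 * h) = s"] level_split(1)[OF h1 sh, of s]
    by (simp add: xs_def cnt_def V_def)
  have cntN: "cnt \<le> n" using hv by simp
  have SV: "S \<subseteq> V" using sp(1) by auto
  let ?T = "jset h 0 (V - S) S nm"
  let ?zs = "map (splitf h s') xs"
  note DS = down_step[OF h1 hN sh s'c nm[unfolded V_def], folded V_def S_def]
  have spf: "splitf h s' (node_rec X i (D i) (nm i)) = (if i \<in> S then join_rec X (D i) i 1 (nm i) else join_rec X (D i + h) i 0 (nm i))"
    if "i \<in> V" for i
    using splitf_node_rec(1)[of i nm h s'] that VN nmX sp(1) by auto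
  have zsT: "set ?zs = ?T"
  proof -
    have "set ?zs = (\<lambda>i. splitf h s' (node_rec X i (D i) (nm i))) ` V" using R(2) by (simp add: table_def image_image)
    also have "\<dots> = ?T" using spf SV unfolding jset_def by (auto simp: image_iff)
    finally show ?thesis .
  qed
  have dz: "distinct ?zs"
  proof (rule distinct_map_pos[OF R(3)])
    show "inj_on (\<lambda>x. x div X div X) (set xs)" using inj_pos[OF VN nm] R(2) by simp
    fix x assume "x \<in> set xs"
    then have "x \<in> table V nm" using R(2) by simp
    then obtain i where i: "i \<in> V" "x = node_rec X i (D i) (nm i)" "x div X div X = i"
      by (rule table_fields[OF _ VN nmX])
    have iN: "i < N" using i(1) VN by auto
    have "join_rec X (D i) i 1 (nm i) div X div X mod X = i"
      by (rule join_rec_fields(3)) (use N_less[OF iN] X_pos nmX[OF i(1)] in simp_all)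
    moreover have "join_rec X (D i + h) i 0 (nm i) div X div X mod X = i"
      by (rule join_rec_fields(3)) (use N_less[OF iN] hN X_pos nmX[OF i(1)] in simp_all)
    ultimately show "splitf h s' x div X div X mod X = x div X div X"
      unfolding i(3) unfolding i(2) spf[OF i(1)] by (simp split: if_split)
  qed
  have zW: "x < W" if "x \<in> set ?zs" for x using DS(5)[of x] that X4 unfolding zsT by blast
  have xW: "x < W" if "x \<in> set xs" for x using R(6)[OF that] by (rule X3)
  have lp: "4 + lev \<le> N + 5" "4 + lev \<noteq> p" "p \<le> N + 5" using lN p(1) NZ by auto
  have sW: "q * Z < W" if "q \<le> N + 5" for q
    using slot_bound[OF that, of 0] by (intro small) simp
  define q where "q = n div w + 1"
  have fpas: "passes P n" using passes_mono[OF passN R(5)] .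
  have fin: "wp (Assign 11 (Reg 11 \<oplus> Reg 11) ;; Assign 13 (Reg 13 \<oplus> Const 1))
      (\<lambda>u. \<exists>s'. down_inv C (Suc lev) s' u \<and> reg u 8 < reg u0 8) u9"
    if H: "holds (sorted_list_of_set (ranked X (linked X h (set ?zs)))) (1 * Z) (2 * Z) n (P * (78 * q)) u8 u9"
      and u8: "reg u8 4 = w" "reg u8 5 = K" "reg u8 6 = X" "reg u8 14 = Z" "reg u8 11 = h" "reg u8 12 = s'" "reg u8 13 = lev"
      and c8: "cost u8 \<le> cost u0 + 38 * q"
      and d8: "store u8 (3 * Z + lev) = n" "\<forall>i<n. store u8 ((4 + lev) * Z + i) = xs ! i"
        "\<And>i q. i < Z \<Longrightarrow> 3 \<le> q \<Longrightarrow> q \<noteq> 4 + lev \<Longrightarrow> q * Z + i \<noteq> 3 * Z + lev \<Longrightarrow> store u8 (q * Z + i) = store u0 (q * Z + i)" for u8 u9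
  proof -
    from DS(1) obtain c where c: "ranked X (linked X h ?T) = table S c" "named S (\<lambda>i. take (2 * h) (path i)) c" by blast
    have SN: "S \<subseteq> {..<N}" using SV VN by auto
    note RS = rows[OF SN c(2)]
    have H': "holds (rows S c) (1 * Z) (2 * Z) n (P * (78 * q)) u8 u9" using H unfolding zsT c(1) rows_def .
    have r9: "reg u9 4 = w" "reg u9 5 = K" "reg u9 6 = X" "reg u9 14 = Z" "reg u9 11 = h" "reg u9 12 = s'" "reg u9 13 = lev" "reg u9 8 = card S"
      "reg u9 7 = 1 * Z \<and> reg u9 9 = 2 * Z \<or> reg u9 7 = 2 * Z \<and> reg u9 9 = 1 * Z" "\<forall>i<card S. store u9 (reg u9 7 + i) = rows S c ! i"
      using H' u8 RS(1) unfolding holds_def by auto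
    have dk9: "store u9 (q * Z + i) = store u8 (q * Z + i)" if "i < Z" "3 \<le> q" for q i
      using H' slot_out[of q 1 i n] slot_out[of q 2 i n] that nZ unfolding holds_def by auto
    \<comment> \<open>38 covers the two scans at 18 and the access to the header at 2; the join adds
      78.\<close>
    have co9: "cost u9 \<le> cost u0 + 116 * P * q"
    proof -
      have "38 * q \<le> P * (38 * q)" using passN by (simp only: passes_def) simp
      moreover have "cost u9 \<le> cost u8 + P * (78 * q)" using H' by (simp add: holds_def)
      moreover have "116 * P * q = P * (38 * q) + P * (78 * q)" by (simp add: algebra_simps)
      ultimately show ?thesis using c8 by linarith
    qed
    have hW: "h + h < W" "Suc lev < W"
    proof -
      have "h + h \<le> U" "Suc lev \<le> U" using h2N lN X_ge XU by linarith+
      then show "h + h < W" "Suc lev < W" using small[of "h + h"] small[of "Suc lev"] U_bounds by linarith+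
    qed
    let ?u = "u9\<lparr>reg := (reg u9)(11 := h + h, 13 := Suc lev)\<rparr>"
    have s'm: "s' mod 2 ^ lev = s" using sp(2) by (simp add: h_def)
    have st: "stored (Suc lev) s' (store u9)"
      unfolding stored_def
    proof (intro allI impI)
      fix j assume j: "j < Suc lev"
      show "saved j (s' mod 2 ^ j) (store u9) \<and> 2 * card (level (2 ^ Suc j) (s' mod 2 ^ Suc j)) \<le> card (level (2 ^ j) (s' mod 2 ^ j))"
      proof (cases "j = lev")
        case True
        have "saved lev s (store u9)" unfolding saved_def
        proof (intro conjI exI[of _ nm])
          show "store u9 (3 * Z + lev) = card (level (2 ^ lev) s)"
            using dk9[of lev 3] lN d8(1) by (simp add: n_def V_def h_def)
          show "\<forall>i<card (level (2 ^ lev) s). store u9 ((4 + lev) * Z + i) = rows (level (2 ^ lev) s) nm ! i"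
            using dk9[of _ "4 + lev"] d8(2) nZ by (auto simp: n_def V_def h_def xs_def)
        qed (use nm hN wn in \<open>simp_all add: V_def h_def\<close>)
        moreover have "s' mod 2 ^ Suc lev = s'" using sp(3) by (simp add: h_def)
        ultimately show ?thesis using True half s'm by (simp add: n_def S_def V_def h_def)
      next
        case False
        then have jl: "j < lev" using j by simp
        have "saved j (s mod 2 ^ j) (store u0)" using st0 jl by (simp add: stored_def)
        then have "saved j (s mod 2 ^ j) (store u9)"
        proof (rule saved_cong)
          fix i q assume iq: "i < Z" "q = 3 \<and> i = j \<or> q = 4 + j"
          have "q * Z + i \<noteq> 3 * Z + lev" using iq jl slot_neq[of q 3 i lev] lN by auto
          then show "store u9 (q * Z + i) = store u0 (q * Z + i)" using dk9[of i q] d8(3)[of i q] iq jl by auto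
        qed
        moreover have "s' mod 2 ^ j = s mod 2 ^ j" "s' mod 2 ^ Suc j = s mod 2 ^ Suc j"
          using pow_mod[of j lev s' s] pow_mod[of "Suc j" lev s' s] jl s'm by auto
        ultimately show ?thesis using st0 jl by (simp add: stored_def)
      qed
    qed
    have "down_inv C (Suc lev) s' ?u"
      unfolding down_inv_def
    proof (intro conjI exI[of _ c])
      have e: "2 ^ Suc lev = 2 * h" "level (2 * h) s' = S" by (simp_all add: S_def h_def)
      show "named (level (2 ^ Suc lev) s') (\<lambda>i. take (2 ^ Suc lev) (path i)) c" unfolding e by (rule c(2))
      show "at_work (rows (level (2 ^ Suc lev) s') c) ?u" unfolding e at_work_def using r9 RS(1) by auto
      show "params ?u" using r9 by (simp add: params_def)
      show "reg ?u 11 = 2 ^ Suc lev" unfolding e by simp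
      show "2 ^ Suc lev * card (level (2 ^ Suc lev) s') \<le> N"
      proof -
        have "h * (2 * card S) \<le> h * n" by (rule mult_le_mono2[OF half])
        moreover have "h * (2 * card S) = 2 * h * card S" by simp
        ultimately show ?thesis unfolding e using hn by linarith
      qed
      show "s' < 2 ^ Suc lev" using sp(3) by (simp add: h_def)
      show "w * cost ?u + 464 * P * card (level (2 ^ Suc lev) s') \<le> C"
        unfolding e using cost_round(1)[OF co9[unfolded q_def] wn' half] cost0 by simp
    qed (use r9 st in simp_all)
    moreover have "reg ?u 8 < reg u0 8" using r9 p half wn' by simp
    ultimately show ?thesis
      using r9 hW by (intro wp_Seq wp_Assign) (auto simp: reg_ok_def)
  qed
  show ?thesis unfolding down_body_def
  proof (rule wp_Seq, rule wp_Assign, goal_cases)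
    case 3 show ?case using c0 sW[OF lp(1)] by simp
  next
    case 4
    show ?case
    proof (rule wp_Seq, rule wp_copy_count[where xs = xs and a = "p * Z" and dst = "(4 + lev) * Z" and h = h and s = s], goal_cases)
      case 8 show ?case using lp nZ R(1) by (intro slot_areas) auto
    next
      case (12 u2)
      have r2: "reg u2 4 = w" "reg u2 5 = K" "reg u2 6 = X" "reg u2 14 = Z" "reg u2 11 = h" "reg u2 12 = s" "reg u2 13 = lev"
        "reg u2 7 = (4 + lev) * Z" "reg u2 8 = n" "reg u2 30 = cnt"
        using 12 c0 R(1) cntf by auto
      have d2: "\<forall>i<n. store u2 ((4 + lev) * Z + i) = xs ! i"
        "\<forall>i. \<not> ((4 + lev) * Z \<le> i \<and> i < (4 + lev) * Z + n) \<longrightarrow> store u2 i = store u0 i"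
        using 12 R(1) by auto
      have co2: "cost u2 \<le> cost u0 + 18 * q" using 12 R(1) by (simp add: q_def)
      have hb: "3 * Z + lev \<le> 2 * U ^ 5" using slot_bound[of 3 lev] lN by simp
      have nW: "n < W" using small[of n] nZ U_bounds by linarith
      show ?case
      proof (rule wp_Seq, rule wp_cell_write, goal_cases)
        case 3 then show ?case using r2 hb by (simp add: div_less_W)
      next
        case 4 then show ?case using r2 nW by simp
      next
        case 5
        let ?u3 = "(touch (exp_val headerE (reg u2)) u2)\<lparr>store := (store u2)(exp_val headerE (reg u2) := exp_val (Reg 8) (reg u2))\<rparr>"
        have ev: "exp_val headerE (reg u2) = 3 * Z + lev" "exp_val (Reg 8) (reg u2) = n" using r2 by simp_all
        have co3: "cost ?u3 \<le> cost u0 + 20 * q" using co2 by (simp add: touch_def q_def)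
        have sW': "s + h < W"
        proof -
          have "s + h \<le> U" using sh h2N X_ge XU by linarith
          then show ?thesis using small[of "s + h"] U_bounds by linarith
        qed
        have rest: "wp (Assign 9 (Reg 14) ;; stage split ;; Assign 9 (Const 2 \<otimes> Reg 14) ;; join ;;
            Assign 11 (Reg 11 \<oplus> Reg 11) ;; Assign 13 (Reg 13 \<oplus> Const 1)) (\<lambda>u. \<exists>s'. down_inv C (Suc lev) s' u \<and> reg u 8 < reg u0 8) u4"
          if u4: "reg u4 12 = s'" "\<forall>x. x \<noteq> 12 \<longrightarrow> reg u4 x = reg u2 x" "cost u4 = cost ?u3" "store u4 = (store u2)(3 * Z + lev := n)" for u4
        proof (rule wp_Seq, rule wp_Assign, goal_cases)
          case 3 show ?case using u4 r2 sW[of 1] by simp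
        next
          case 4
          have d4: "\<forall>i<n. store u4 ((4 + lev) * Z + i) = xs ! i"
          proof (intro allI impI)
            fix i assume "i < n"
            then have "(4 + lev) * Z + i \<noteq> 3 * Z + lev" using nZ lN by (intro slot_neq) auto
            then show "store u4 ((4 + lev) * Z + i) = xs ! i" using u4 d2 \<open>i < n\<close> by simp
          qed
          show ?case
          proof (rule wp_Seq, rule wp_split[where xs = xs and a = "(4 + lev) * Z" and dst = "1 * Z" and h = h and s = s'], goal_cases)
            case 8 show ?case using lp nZ R(1) by (intro slot_areas) auto
          next
            case (12 u6)
            have r6: "reg u6 4 = w" "reg u6 5 = K" "reg u6 6 = X" "reg u6 14 = Z" "reg u6 11 = h" "reg u6 12 = s'" "reg u6 13 = lev"
              "reg u6 7 = 1 * Z" "reg u6 8 = n"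
              using 12 r2 u4 R(1) by auto
            have co6: "cost u6 \<le> cost u0 + 38 * q" using 12(7) co3 u4(3) R(1) by (simp add: q_def)
            have d6: "store u6 (q * Z + i) = store u4 (q * Z + i)" if "i < Z" "3 \<le> q" for q i
              using 12(6) slot_out[of q 1 i n] that nZ R(1) by auto
            show ?case
            proof (rule wp_Seq, rule wp_Assign, goal_cases)
              case 3 show ?case using r6 sW[of 2] by simp
            next
              case 4
              let ?u8 = "u6\<lparr>reg := (reg u6)(9 := exp_val (Const 2 \<otimes> Reg 14) (reg u6))\<rparr>"
              have H8: "holds ?zs (1 * Z) (2 * Z) n 0 ?u8 ?u8"
                using r6 12(5) R(1) by (auto simp: holds_def)
              show ?case
              proof (rule wp_Seq, rule wp_join_holds[OF H8, where X = X and h = h and P = P], goal_cases)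
                case 1 show ?case using slot_areas[of 1 2 n] nZ by simp
              next
                case (8 x) then show ?case unfolding zsT by (rule DS(5))
              next
                case 11 show ?case unfolding zsT by (rule DS(2))
              next
                case (12 x) then show ?case unfolding zsT by (rule DS(3))
              next
                case 13 show ?case unfolding zsT by (rule DS(4))
              next
                case (14 u9)
                have "holds (sorted_list_of_set (ranked X (linked X h (set ?zs)))) (1 * Z) (2 * Z) n (P * (78 * q)) ?u8 u9"
                  using 14 by (simp add: q_def)
                then show ?case
                proof (rule fin, goal_cases)
                  case 9 show ?case using d6[of lev 3] lN u4 by simp
                next
                  case 10 show ?case using d6[of _ "4 + lev"] d4 nZ by auto
                next
                  case (11 i q)
                  have "store u6 (q * Z + i) = store u2 (q * Z + i)" using d6[of i q] 11 u4 by simp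
                  also have "\<dots> = store u0 (q * Z + i)" using d2(2) slot_out[of q "4 + lev" i n] 11 nZ by auto
                  finally show ?case by simp
                qed (use r6 co6 in simp_all)
              qed (use r6 dz R(1) nZ XU fpas in simp_all)
            qed (simp_all add: reg_ok_def)
          qed (use u4 r2 R(1) xW zW d4 in simp_all)
        qed (simp_all add: reg_ok_def)
        show ?case
        proof (rule wp_Seq, rule wp_Cond, goal_cases)
          case 2
          then have "s' = s + h" using r2 by (simp add: s'_def)
          then show ?case using r2 sW' ev by (intro wp_Assign rest) (auto simp: reg_ok_def)
        next
          case 3
          then have "s' = s" using r2 by (simp add: s'_def)
          then show ?case using r2 ev by (intro wp_Skip rest) auto
        qed simp
      qed simp_all
    qed (use c0 p R xW in simp_all)
  qed (simp_all add: reg_ok_def)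
qed

lemma wp_up:
  assumes U0: "up_inv C (Suc lev) s' u0"
  shows "wp up_body (up_inv C lev (s' mod 2 ^ lev)) u0"
proof -
  define h where "h = (2 :: nat) ^ lev"
  define s where "s = s' mod h"
  define V where "V = level h s"
  define S where "S = level (2 * h) s'"
  define n where "n = card V"
  define m where "m = card S"
  have e2: "2 ^ Suc lev = 2 * h" by (simp add: h_def)
  from U0 obtain c where c: "named S path c" and at0: "at_work (rows S c) u0"
    unfolding up_inv_def e2 S_def by blast
  have r0: "reg u0 4 = w" "reg u0 5 = K" "reg u0 6 = X" "reg u0 14 = Z" "reg u0 11 = 2 * h" "reg u0 12 = s'" "reg u0 13 = Suc lev"
    and s2: "s' < 2 * h" and st0: "stored (Suc lev) s' (store u0)" and cost0: "w * cost u0 \<le> C + 464 * P * m"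
    using U0 unfolding up_inv_def params_def e2 S_def m_def by auto
  have h1: "1 \<le> h" by (simp add: h_def)
  have sh: "s < h" using h1 by (simp add: s_def)
  have s'c: "s' = s \<or> s' = s + h"
  proof (cases "s' < h")
    case True then show ?thesis by (simp add: s_def)
  next
    case False
    then have "s = s' - h" using s2 by (simp add: s_def le_mod_geq)
    then show ?thesis using False by simp
  qed
  note sp = level_split[OF h1 sh s'c, folded V_def S_def]
  have "saved lev s (store u0)" and half: "2 * m \<le> n"
    using st0 s2 unfolding stored_def h_def[symmetric] by (auto simp: s_def h_def m_def n_def S_def V_def)
  then obtain nm where nm: "named V (\<lambda>i. take h (path i)) nm" and hd: "store u0 (3 * Z + lev) = n"
    and reg: "\<forall>i<n. store u0 ((4 + lev) * Z + i) = rows V nm ! i" and hN: "h \<le> N" and wn: "w < n"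
    unfolding saved_def h_def[symmetric] V_def[symmetric] n_def[symmetric] by blast
  have lh: "lev < h" unfolding h_def by simp
  then have lN: "lev < N" "lev < Z" using hN NZ by linarith+
  have VN: "V \<subseteq> {..<N}" unfolding V_def by (rule level_sub)
  have SN: "S \<subseteq> {..<N}" unfolding S_def by (rule level_sub)
  define xs where "xs = rows V nm"
  define ys where "ys = rows S c"
  note R = rows[OF VN nm, folded xs_def n_def]
  note RS = rows[OF SN c, folded ys_def m_def]
  have nZ: "n \<le> Z" "n < X" "n \<le> U" "m + n \<le> Z" using R(5) NZ X_ge XU half by linarith+
  have nmX: "\<And>i. i \<in> V \<Longrightarrow> nm i < X" using nm by (auto simp: named_def)
  have cX: "\<And>i. i \<in> S \<Longrightarrow> c i < X" using c by (auto simp: named_def)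
  define p where "p = (if reg u0 7 = 1 * Z then 1 else 2 :: nat)"
  define dst where "dst = 3 - p"
  have p: "p = 1 \<and> dst = 2 \<or> p = 2 \<and> dst = 1" "reg u0 7 = p * Z" "reg u0 9 = dst * Z" "reg u0 8 = m" "\<forall>i<m. store u0 (p * Z + i) = ys ! i"
    using at0 RS(1) NZ unfolding p_def dst_def at_work_def ys_def by auto
  have po: "p \<noteq> dst" "4 + lev \<noteq> dst" "4 + lev \<noteq> p" "p \<le> N + 5" "dst \<le> N + 5" "4 + lev \<le> N + 5" "dst < 3" "p < 3" using p(1) lN NZ by auto
  have SV: "S \<subseteq> V" using sp(1) by auto
  let ?lb = "\<lambda>i. if i \<in> S then c i else nm i"
  let ?T = "jset h 2 S (V - S) ?lb"
  let ?fs = "filter (\<lambda>x. x div X mod X mod (2 * h) \<noteq> s') xs"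
  let ?zs = "map (parentf h) ys @ map childf ?fs"
  note US = up_step[OF h1 hN sh s'c nm[unfolded V_def] c[unfolded S_def], folded V_def S_def]
  have fsS: "set ?fs = table (V - S) nm"
  proof -
    have "{i \<in> V. D i mod (2 * h) \<noteq> s'} = V - S" using sp(1) by auto
    then show ?thesis using filter_rows(1)[OF VN nm, of "\<lambda>d. d mod (2 * h) \<noteq> s'"] by (simp only: xs_def)
  qed
  have fsl: "length ?fs = n - m"
  proof -
    have "{i \<in> V. D i mod (2 * h) \<noteq> s'} = V - S" using sp(1) by auto
    then have "length ?fs = card (V - S)"
      using filter_rows(2)[OF VN nm, of "\<lambda>d. d mod (2 * h) \<noteq> s'"] by (simp only: xs_def)
    also have "\<dots> = n - m" unfolding n_def m_def using SV finite_subset[OF SN] by (intro card_Diff_subset) auto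
    finally show ?thesis .
  qed
  have lzs: "length ?zs = n" using fsl RS(1) half by simp
  have zsT: "set ?zs = ?T"
  proof -
    have "set (map (parentf h) ys) = (\<lambda>i. join_rec X (D i + h) i 2 (?lb i)) ` S"
      using splitf_node_rec(2)[of _ c h] SN cX unfolding set_map RS(2) table_def image_image by (intro image_cong) auto
    moreover have "set (map childf ?fs) = (\<lambda>i. join_rec X (D i) i 1 (?lb i)) ` (V - S)"
      using splitf_node_rec(3)[of _ nm] VN nmX unfolding set_map fsS unfolding table_def image_image by (intro image_cong) auto
    ultimately show ?thesis unfolding jset_def set_append by (simp only:)
  qed
  have dzs: "distinct ?zs"
  proof -
    have pos: "parentf h x div X div X mod X = x div X div X" if x: "x \<in> table S c" for x
    proof -
      from x obtain i where i: "i \<in> S" "x = node_rec X i (D i) (c i)" "x div X div X = i" by (rule table_fields[OF _ SN cX])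
      have iN: "i < N" using i(1) SN by auto
      have "join_rec X (D i + h) i 2 (c i) div X div X mod X = i"
        by (rule join_rec_fields(3)) (use N_less[OF iN] hN X_pos cX[OF i(1)] in simp_all)
      then show ?thesis unfolding i(3) unfolding i(2) splitf_node_rec(2)[of i c h, OF iN cX[OF i(1)]] .
    qed
    have cpos: "childf x div X div X mod X = x div X div X" if x: "x \<in> table V nm" for x
    proof -
      from x obtain i where i: "i \<in> V" "x = node_rec X i (D i) (nm i)" "x div X div X = i" by (rule table_fields[OF _ VN nmX])
      have iN: "i < N" using i(1) VN by auto
      have "join_rec X (D i) i 1 (nm i) div X div X mod X = i"
        by (rule join_rec_fields(3)) (use N_less[OF iN] X_pos nmX[OF i(1)] in simp_all)
      then show ?thesis unfolding i(3) unfolding i(2) splitf_node_rec(3)[of i nm, OF iN nmX[OF i(1)]] .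
    qed
    \<comment> \<open>Distinctness is obtained by counting: records of different nodes differ in
      their position, so the set has as many elements as the list has entries.\<close>
    have "card ?T = n"
    proof -
      have jf: "join_rec X (D i + h) i 2 (?lb i) div X div X mod X = i" if "i \<in> S" for i
        by (rule join_rec_fields(3)) (use N_less[of i] hN X_pos cX[OF that] that SN in auto)
      have jf2: "join_rec X (D i) i 1 (?lb i) div X div X mod X = i" if "i \<in> V - S" for i
        by (rule join_rec_fields(3)) (use N_less[of i] hN X_pos nmX[of i] that VN in auto)
      have i1: "inj_on (\<lambda>i. join_rec X (D i + h) i 2 (?lb i)) S" by (rule inj_on_inverseI[where g = "\<lambda>x. x div X div X mod X"]) (rule jf)
      have i2: "inj_on (\<lambda>i. join_rec X (D i) i 1 (?lb i)) (V - S)" by (rule inj_on_inverseI[where g = "\<lambda>x. x div X div X mod X"]) (rule jf2)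
      have dj: "(\<lambda>i. join_rec X (D i + h) i 2 (?lb i)) ` S \<inter> (\<lambda>i. join_rec X (D i) i 1 (?lb i)) ` (V - S) = {}"
      proof (rule ccontr)
        assume "\<not> ?thesis"
        then obtain i j where ij: "i \<in> S" "j \<in> V - S" "join_rec X (D i + h) i 2 (?lb i) = join_rec X (D j) j 1 (?lb j)" by blast
        have "i = j" using jf[OF ij(1)] jf2[OF ij(2)] unfolding ij(3) by (rule trans[OF sym])
        then show False using ij by simp
      qed
      have "card ?T = card ((\<lambda>i. join_rec X (D i + h) i 2 (?lb i)) ` S) + card ((\<lambda>i. join_rec X (D i) i 1 (?lb i)) ` (V - S))"
        unfolding jset_def by (rule card_Un_disjoint[OF _ _ dj])
          (use finite_subset[OF SN] finite_subset[OF VN] in simp_all)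
      also have "\<dots> = card S + card (V - S)" unfolding card_image[OF i1] card_image[OF i2] ..
      also have "card (V - S) = n - m" unfolding n_def m_def using SV finite_subset[OF SN] by (intro card_Diff_subset) auto
      finally show ?thesis using half by (simp add: m_def)
    qed
    then show ?thesis using lzs zsT by (intro card_distinct) simp
  qed
  have zW: "x < W" if "x \<in> set ?zs" for x using US(5)[of x] that X4 unfolding zsT by blast
  have xW: "x < W" if "x \<in> set xs" for x using R(6)[OF that] by (rule X3)
  have yW: "x < W" if "x \<in> set ys" for x using RS(6)[OF that] by (rule X3)
  have chW: "childf x < W" if "x \<in> set xs" for x
  proof -
    from that have "x \<in> table V nm" using R(2) by simp
    then obtain i where i: "i \<in> V" "x = node_rec X i (D i) (nm i)" by (rule table_fields[OF _ VN nmX])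
    have iN: "i < N" using i(1) VN by auto
    show ?thesis unfolding i(2) splitf_node_rec(3)[of i nm, OF iN nmX[OF i(1)]]
      by (rule X4, rule join_rec_fields(5)) (use N_less[OF iN] X_pos nmX[OF i(1)] in simp_all)
  qed
  have sW: "q * Z < W" if "q \<le> N + 5" for q
    using slot_bound[OF that, of 0] by (intro small) simp
  define q where "q = n div w + 1"
  have mq: "m div w + 1 \<le> q" using half unfolding q_def by (simp add: div_le_mono)
  have fpas: "passes P n" using passes_mono[OF passN R(5)] .
  have hsW: "h < W" "s < W" "lev < W" "n < W"
  proof -
    have "h \<le> U" "s \<le> U" "lev \<le> U" using hN sh lN X_ge XU by linarith+
    then show "h < W" "s < W" "lev < W" "n < W" using small[of h] small[of s] small[of lev] small[of n] nZ(3) U_bounds by linarith+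
  qed
  have disj: "q1 * Z + i \<noteq> dst * Z + j" if "q1 \<noteq> dst" "i < n" "j < m + n" for q1 i j
    by (rule slot_neq) (use that nZ in auto)
  have ob: "dst * Z + (m + n) \<le> 2 * U ^ 5" "p * Z + m \<le> 2 * U ^ 5" "(4 + lev) * Z + n \<le> 2 * U ^ 5" "3 * Z + lev \<le> 2 * U ^ 5"
    using slot_bound[of dst "m + n"] slot_bound[of p m] slot_bound[of "4 + lev" n] slot_bound[of 3 lev] po nZ lN by auto
  show ?thesis unfolding up_body_def
  proof (intro wp_Seq wp_Assign, goal_cases)
    case 3 show ?case using r0 hsW by simp
  next
    case 6 show ?case using r0 hsW by simp
  next
    case 9 show ?case using W_pos by simp
  next
    case 10
    show ?case
    proof (rule wp_parents[where xs = ys and a = "p * Z" and dst = "dst * Z" and cap = "m + n" and ?ys0.0 = "[]" and old = "store u0" and z = "cost u0" and h = h], goal_cases)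
      case 6 show ?case using ob RS(1) by simp
    next
      case 7 show ?case by (rule ob)
    next
      case 9 then show ?case using disj[of p] po RS(1) half by auto
    next
      case (11 x) then show ?case using zW by simp
    next
      case 13 show ?case using p r0 credit_bounds(1)[of "dst * Z" u0] by (simp add: writing_def credit_def)
    next
      case (14 u2)
      let ?ps = "map (parentf h) ys"
      let ?z2 = "cost u0 + 8 * (m div w + 1)"
      have E2: "writing (dst * Z) ?z2 (store u0) ?ps u2" using 14(1) RS(1) by simp
      have r2: "reg u2 4 = w" "reg u2 5 = K" "reg u2 6 = X" "reg u2 14 = Z" "reg u2 11 = h" "reg u2 12 = s'" "reg u2 13 = lev"
        "reg u2 7 = p * Z" "reg u2 9 = dst * Z"
        using 14(2) r0 p by auto
      have d2: "store u2 (q * Z + i) = store u0 (q * Z + i)" if "q \<noteq> dst" "i < Z" for q i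
      proof (rule writing_store(1)[OF E2])
        show "\<not> (dst * Z \<le> q * Z + i \<and> q * Z + i < dst * Z + length ?ps)"
          using slot_out[of q dst i m] that nZ RS(1) by simp
      qed
      show ?case
      proof (rule wp_Seq, rule wp_Assign, goal_cases)
        case 3 show ?case using r2 sW[OF po(4)] by simp
      next
        case 4
        show ?case
        proof (rule wp_Seq, rule wp_Assign, goal_cases)
          case 3 show ?case using r2 sW[OF po(6)] by simp
        next
          case 4
          show ?case
          proof (rule wp_Seq, rule wp_cell_read, goal_cases)
            case 3 show ?case using r2 ob(4) by (simp add: div_less_W)
          next
            case 4
            let ?e = "exp_val headerE (reg (u2\<lparr>reg := (reg u2)(15 := exp_val (Reg 7) (reg u2)),
              reg := (reg (u2\<lparr>reg := (reg u2)(15 := exp_val (Reg 7) (reg u2))\<rparr>))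
                (7 := exp_val regionE (reg (u2\<lparr>reg := (reg u2)(15 := exp_val (Reg 7) (reg u2))\<rparr>)))\<rparr>))"
            have ev: "?e = 3 * Z + lev" using r2 by simp
            have hd2: "store u2 (3 * Z + lev) = n" using d2[of 3 lev] po(7) lN hd by simp
            define r3 where "r3 = (reg u2)(15 := p * Z, 7 := (4 + lev) * Z, 8 := n)"
            have E3: "writing (dst * Z) (?z2 + 8) (store u0) ?ps ((touch (3 * Z + lev) u2)\<lparr>reg := r3\<rparr>)"
              by (rule writing_foreign[OF E2]) (simp_all add: r3_def touch_def)
            have r3: "r3 4 = w" "r3 5 = K" "r3 6 = X" "r3 14 = Z" "r3 11 = h" "r3 12 = s'" "r3 13 = lev"
               "r3 7 = (4 + lev) * Z" "r3 8 = n" "r3 9 = dst * Z" "r3 15 = p * Z"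
              using r2 by (auto simp: r3_def)
            have eq: "(touch ?e (u2\<lparr>reg := (reg u2)(15 := exp_val (Reg 7) (reg u2)),
              reg := (reg (u2\<lparr>reg := (reg u2)(15 := exp_val (Reg 7) (reg u2))\<rparr>))
                (7 := exp_val regionE (reg (u2\<lparr>reg := (reg u2)(15 := exp_val (Reg 7) (reg u2))\<rparr>)))\<rparr>))
              \<lparr>reg := (reg (u2\<lparr>reg := (reg u2)(15 := exp_val (Reg 7) (reg u2)),
              reg := (reg (u2\<lparr>reg := (reg u2)(15 := exp_val (Reg 7) (reg u2))\<rparr>))
                (7 := exp_val regionE (reg (u2\<lparr>reg := (reg u2)(15 := exp_val (Reg 7) (reg u2))\<rparr>)))\<rparr>))
                (8 := store (u2\<lparr>reg := (reg u2)(15 := exp_val (Reg 7) (reg u2)),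
              reg := (reg (u2\<lparr>reg := (reg u2)(15 := exp_val (Reg 7) (reg u2))\<rparr>))
                (7 := exp_val regionE (reg (u2\<lparr>reg := (reg u2)(15 := exp_val (Reg 7) (reg u2))\<rparr>)))\<rparr>) ?e)\<rparr>
              = (touch (3 * Z + lev) u2)\<lparr>reg := r3\<rparr>"
              unfolding ev using r2 hd2 by (simp add: touch_def r3_def)
            show ?case unfolding eq
            proof (rule wp_Seq, rule wp_children[where xs = xs and a = "(4 + lev) * Z" and dst = "dst * Z" and cap = "m + n" and ?ys0.0 = ?ps and old = "store u0" and z = "?z2 + 8" and h = h and s = s'], goal_cases)
              case 7 show ?case using ob R(1) by simp
            next
              case 8 show ?case by (rule ob)
            next
              case 10 then show ?case using disj[of "4 + lev"] po R(1) by auto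
            next
              case (15 u5)
              have E5: "writing (dst * Z) (?z2 + 8 + 8 * q) (store u0) ?zs u5" using 15(1) R(1) by (simp add: q_def)
              have r5: "reg u5 4 = w" "reg u5 5 = K" "reg u5 6 = X" "reg u5 14 = Z" "reg u5 11 = h" "reg u5 12 = s'" "reg u5 13 = lev"
                "reg u5 9 = dst * Z" "reg u5 15 = p * Z" "reg u5 21 = n"
                using 15(2) r3 writing_regs[OF E5] lzs by auto
              have co5: "cost u5 \<le> cost u0 + 38 * q"
              proof -
                have "n div B \<le> n div w" using w_le w_pos by (simp add: div_le_mono2)
                then have "4 * (n div B) + 4 \<le> 4 * q" by (simp add: q_def)
                moreover have "cost u5 \<le> ?z2 + 8 + 8 * q + 4 * (n div B) + 6" using writing_cost[OF E5] lzs by simp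
                moreover have "1 \<le> q" by (simp add: q_def)
                moreover have "8 * (m div w + 1) \<le> 8 * q" by (rule mult_le_mono2[OF mq])
                ultimately show ?thesis by linarith
              qed
              show ?case
              proof (rule wp_Seq, rule wp_Assign, goal_cases)
                case 3 show ?case using r5 hsW by simp
              next
                case 4 show ?case
                proof (rule wp_Seq, rule wp_Assign, goal_cases)
                  case 3 show ?case using r5 sW[OF po(5)] by simp
                next
                  case 4 show ?case
                  proof (rule wp_Seq, rule wp_Assign, goal_cases)
                    case 3 show ?case using r5 sW[OF po(4)] by simp
                  next
                    case 4 show ?case
                    proof (rule wp_Seq, rule wp_Assign, goal_cases)
                      case 3 show ?case using r5 hsW by (simp add: s_def)
                    next
                      case 4
                      define r8 where "r8 = (reg u5)(8 := n, 7 := dst * Z, 9 := p * Z, 12 := s)"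
                      let ?u8 = "u5\<lparr>reg := r8\<rparr>"
                      have H8: "holds ?zs (dst * Z) (p * Z) n 0 ?u8 ?u8"
                        using writing_store(2)[OF E5] lzs by (simp add: holds_def r8_def)
                      have eq8: "u5\<lparr>reg := (reg u5)(8 := exp_val (Reg 21) (reg u5)),
                         reg := (reg (u5\<lparr>reg := (reg u5)(8 := exp_val (Reg 21) (reg u5))\<rparr>))
                           (7 := exp_val (Reg 9) (reg (u5\<lparr>reg := (reg u5)(8 := exp_val (Reg 21) (reg u5))\<rparr>)))\<rparr> =
                         u5\<lparr>reg := (reg u5)(8 := n, 7 := dst * Z)\<rparr>" using r5 by simp
                      have goal: "wp join (up_inv C lev (s' mod 2 ^ lev)) ?u8"
                      proof (rule wp_join_holds[OF H8, where X = X and h = h and P = P], goal_cases)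
                        case 1 show ?case using slot_areas[of dst p n] po nZ by simp
                      next
                        case (8 x) then show ?case unfolding zsT by (rule US(5))
                      next
                        case 11 show ?case unfolding zsT by (rule US(2))
                      next
                        case (12 x) then show ?case unfolding zsT by (rule US(3))
                      next
                        case 13 show ?case unfolding zsT by (rule US(4))
                      next
                        case (14 u9)
                        from US(1) obtain cc where cc: "ranked X (linked X h ?T) = table V cc" "named V path cc" by blast
                        note RV = rows[OF VN cc(2)]
                        have H9: "holds (rows V cc) (dst * Z) (p * Z) n (P * (78 * q)) ?u8 u9"
                          using 14 unfolding zsT cc(1) rows_def q_def by simp
                        have r9: "reg u9 4 = w" "reg u9 5 = K" "reg u9 6 = X" "reg u9 14 = Z" "reg u9 11 = h" "reg u9 12 = s" "reg u9 13 = lev"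
                          using H9 r5 unfolding holds_def r8_def by auto
                        have at9: "at_work (rows V cc) u9" using H9 p(1) unfolding holds_def at_work_def by auto
                        have dk9: "store u9 (q * Z + i) = store u0 (q * Z + i)" if "i < Z" "3 \<le> q" for q i
                        proof -
                          have "store u9 (q * Z + i) = store u5 (q * Z + i)"
                            using H9 slot_out[of q dst i n] slot_out[of q p i n] that nZ po unfolding holds_def by auto
                          also have "\<dots> = store u0 (q * Z + i)"
                          proof (rule writing_store(1)[OF E5])
                            show "\<not> (dst * Z \<le> q * Z + i \<and> q * Z + i < dst * Z + length ?zs)"
                              unfolding lzs using slot_out[of q dst i n] that nZ po by auto
                          qed
                          finally show ?thesis .
                        qed
                        have co9: "cost u9 \<le> cost u0 + 116 * P * q"
                        proof -
                          have "38 * q \<le> P * (38 * q)" using passN by (simp only: passes_def) simp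
                          moreover have "cost u9 \<le> cost u5 + P * (78 * q)" using H9 by (simp add: holds_def)
                          moreover have "116 * P * q = P * (38 * q) + P * (78 * q)" by (simp add: algebra_simps)
                          ultimately show ?thesis using co5 by linarith
                        qed
                        have st9: "stored lev s (store u9)"
                          unfolding stored_def
                        proof (intro allI impI)
                          fix j assume j: "j < lev"
                          have sm: "s' mod 2 ^ j = s mod 2 ^ j" "s' mod 2 ^ Suc j = s mod 2 ^ Suc j"
                            using pow_mod[of j lev s' s] pow_mod[of "Suc j" lev s' s] j by (auto simp: s_def h_def)
                          have "saved j (s' mod 2 ^ j) (store u0) \<and>
                            2 * card (level (2 ^ Suc j) (s' mod 2 ^ Suc j)) \<le> card (level (2 ^ j) (s' mod 2 ^ j))"
                            using st0 j unfolding stored_def by (meson less_SucI)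
                          note sj = this[unfolded sm]
                          have "saved j (s mod 2 ^ j) (store u9)"
                            by (rule saved_cong[OF conjunct1[OF sj]]) (use dk9 in auto)
                          then show "saved j (s mod 2 ^ j) (store u9) \<and>
                            2 * card (level (2 ^ Suc j) (s mod 2 ^ Suc j)) \<le> card (level (2 ^ j) (s mod 2 ^ j))"
                            using sj by blast
                        qed
                        have wc: "w * cost u9 \<le> C + 464 * P * n"
                        proof -
                          have "w * cost u9 + 464 * P * m \<le> w * cost u0 + 464 * P * n"
                            using cost_round(1)[OF co9[unfolded q_def] wn half] .
                          then have a: "w * cost u9 \<le> w * cost u0 + 464 * P * (n - m)"
                            using cost_round(2)[OF co9[unfolded q_def] wn half] by simp
                          have "464 * P * (n - m) + 464 * P * m = 464 * P * n"
                            using half by (simp add: add_mult_distrib2[symmetric])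
                          then show ?thesis using a cost0 by linarith
                        qed
                        have eqs: "s' mod 2 ^ lev = s" by (simp add: s_def h_def)
                        have "up_inv C lev s u9"
                          unfolding up_inv_def h_def[symmetric] V_def[symmetric] n_def[symmetric] params_def
                          using cc(2) at9 r9 st9 wc sh by blast
                        then show ?case unfolding eqs .
                      qed (use r5 dzs lzs nZ XU fpas in \<open>simp_all add: r8_def\<close>)
                      show ?case
                        using goal r5 by (simp add: r8_def s_def)
                    qed (simp_all add: reg_ok_def)
                  qed (simp_all add: reg_ok_def)
                qed (simp_all add: reg_ok_def)
              qed (simp_all add: reg_ok_def)
            qed (use r3 E3 lzs fsl R(1) RS(1) xW chW reg in \<open>simp_all add: xs_def[symmetric]\<close>)
          qed (simp_all add: reg_ok_def)
        qed (simp_all add: reg_ok_def)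
      qed (simp_all add: reg_ok_def)
    qed (use r0 p RS(1) yW in simp_all)
  qed (simp_all add: reg_ok_def)
qed

end

section \<open>Reading the tags and writing the classes\<close>

definition classes :: prog where
  "classes = emit labE"

definition core :: prog where
  "core = Assign 11 (Const 1) ;; Assign 12 (Const 0) ;; Assign 13 (Const 0) ;;
     While (Less (Reg 4) (Reg 8)) down_body ;; stage base ;;
     While (Less (Const 0) (Reg 13)) up_body ;; stage classes ;; Assign 0 (Reg 7)"

text \<open>The base \<open>X\<close> has to exceed every code, so it can only be fixed after a
  preliminary scan of the tags.\<close>

definition max_code :: prog where
  "max_code = Cond (Less (Reg 30) (Reg 20)) (Assign 30 (Reg 20)) Skip"

definition parse :: prog where
  "parse = Cond (Equal (Reg 20) (Const 0)) (Assign 30 (Reg 30 \<ominus> Const 1))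
     (emit (packE (packE (Reg 31) (Reg 30)) (Reg 20)) ;; Assign 31 (Reg 31 \<oplus> Const 1) ;; Assign 30 (Reg 30 \<oplus> Const 1))"

section \<open>The tag sequence as a stream of depths and document numbers\<close>

primrec parsed :: "nat \<Rightarrow> nat \<Rightarrow> nat \<Rightarrow> nat list \<Rightarrow> nat list" where
  "parsed X d i [] = []"
| "parsed X d i (x # xs) = (if x = 0 then parsed X (d - 1) i xs else node_rec X i d x # parsed X (Suc d) (Suc i) xs)"

primrec parse_state :: "nat list \<Rightarrow> nat \<Rightarrow> nat \<times> nat" where
  "parse_state xs 0 = (0, 0)"
| "parse_state xs (Suc k) = (let (d, i) = parse_state xs k in if xs ! k = 0 then (d - 1, i) else (Suc d, Suc i))"

lemma parse_state_le: "fst (parse_state xs k) \<le> k \<and> snd (parse_state xs k) \<le> k"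
  by (induction k) (auto simp: Let_def split: prod.splits)

definition parse_out :: "nat \<Rightarrow> nat list \<Rightarrow> nat \<Rightarrow> nat list" where
  "parse_out X xs k = (if xs ! k = 0 then [] else [node_rec X (snd (parse_state xs k)) (fst (parse_state xs k)) (xs ! k)])"

text \<open>Links the state of the scan, which is a function of the prefix already read, with
  \<open>parsed\<close>, which recurses over the remaining tags.\<close>

lemma parse_out_eq:
  "k \<le> length xs \<Longrightarrow> concat (map (parse_out X xs) [k..<length xs]) =
    parsed X (fst (parse_state xs k)) (snd (parse_state xs k)) (drop k xs)"
proof (induction "length xs - k" arbitrary: k)
  case (Suc m)
  then have k: "k < length xs" by simp
  have "concat (map (parse_out X xs) [k..<length xs]) = parse_out X xs k @ concat (map (parse_out X xs) [Suc k..<length xs])"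
    using k by (simp add: upt_conv_Cons)
  also have "concat (map (parse_out X xs) [Suc k..<length xs]) =
    parsed X (fst (parse_state xs (Suc k))) (snd (parse_state xs (Suc k))) (drop (Suc k) xs)"
    using Suc by (intro Suc.hyps(1)) auto
  finally have "concat (map (parse_out X xs) [k..<length xs]) = parse_out X xs k @
    parsed X (fst (parse_state xs (Suc k))) (snd (parse_state xs (Suc k))) (drop (Suc k) xs)" .
  also have "\<dots> = parsed X (fst (parse_state xs k)) (snd (parse_state xs k)) (drop k xs)"
    unfolding Cons_nth_drop_Suc[OF k, symmetric] by (cases "parse_state xs k") (simp add: parse_out_def)
  finally show ?case .
qed simp

definition max_prefix :: "nat list \<Rightarrow> nat \<Rightarrow> nat" where
  "max_prefix xs k = Max (insert 0 (set (take k xs)))"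

lemma max_prefix_Suc: "k < length xs \<Longrightarrow> max_prefix xs (Suc k) = (if max_prefix xs k < xs ! k then xs ! k else max_prefix xs k)"
proof -
  assume "k < length xs"
  then have "insert 0 (set (take (Suc k) xs)) = insert (xs ! k) (insert 0 (set (take k xs)))"
    by (auto simp: take_Suc_conv_app_nth)
  then have "max_prefix xs (Suc k) = max (xs ! k) (max_prefix xs k)"
    by (simp add: max_prefix_def del: insert_commute)
  then show ?thesis by (simp add: max_def)
qed

context buffered
begin

lemma wp_max_code:
  assumes r: "reg v 4 = w" "reg v 7 = a" "reg v 8 = length xs" "reg v 9 = dst"
    and ar: "areas a dst (length xs)" and xsW: "\<And>x. x \<in> set xs \<Longrightarrow> x < W"
    and src: "\<And>i. i < length xs \<Longrightarrow> store v (a + i) = xs ! i"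
    and Q: "\<And>u. \<forall>x<20. x \<notin> {7, 8, 9, 10} \<longrightarrow> reg u x = reg v x \<Longrightarrow>
       reg u 30 = Max (insert 0 (set xs)) \<Longrightarrow>
       \<forall>i. \<not> (dst \<le> i \<and> i < dst + length xs) \<longrightarrow> store u i = store v i \<Longrightarrow>
       cost u \<le> cost v + 18 * (length xs div w + 1) \<Longrightarrow> Q u"
  shows "wp (stage max_code) Q v"
proof (rule wp_stage[where xs = xs and a = a and dst = dst and G = "\<lambda>k. []" and
    St = "\<lambda>k r m. r 30 = max_prefix xs k"], goal_cases)
  case (5) then show ?case using ar by (simp add: areas_def)
next
  case (6) then show ?case using ar by (simp add: areas_def)
next
  case (9 i j) then show ?case using ar by (auto simp: areas_def)
next
  case (13 k u z')
  have xW: "xs ! k < W" using xsW 13(1) by simp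
  note st = max_prefix_Suc[OF 13(1)]
  show ?case unfolding max_code_def
  proof (rule wp_Cond, goal_cases)
    case 2
    then show ?case using 13 xW st by (intro wp_Assign) (auto simp: reg_ok_def intro!: writing_reg)
  next
    case 3
    then show ?case using 13 st by (intro wp_Skip) auto
  qed simp
next
  case (14 u ys)
  then show ?case by (intro Q) (auto simp: max_prefix_def)
qed (use r xsW src in \<open>simp_all add: max_prefix_def\<close>)

lemma wp_parse:
  assumes r: "reg v 4 = w" "reg v 6 = X" "reg v 7 = a" "reg v 8 = length xs" "reg v 9 = dst"
    and ar: "areas a dst (length xs)" and X: "X \<le> U" "length xs < X" "\<And>x. x \<in> set xs \<Longrightarrow> x < X"
    and src: "\<And>i. i < length xs \<Longrightarrow> store v (a + i) = xs ! i"
    and Q: "\<And>u ys. ys = parsed X 0 0 xs \<Longrightarrow> reg u 7 = dst \<Longrightarrow> reg u 8 = length ys \<Longrightarrow>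
       \<forall>x<20. x \<notin> {7, 8, 9, 10} \<longrightarrow> reg u x = reg v x \<Longrightarrow>
       \<forall>i<length ys. store u (dst + i) = ys ! i \<Longrightarrow>
       cost u \<le> cost v + 18 * (length xs div w + 1) \<Longrightarrow> Q u"
  shows "wp (stage parse) Q v"
proof (rule wp_stage[where xs = xs and a = a and dst = dst and G = "parse_out X xs" and
    St = "\<lambda>k r m. r 30 = fst (parse_state xs k) \<and> r 31 = snd (parse_state xs k)"], goal_cases)
  case (5) then show ?case using ar by (simp add: areas_def)
next
  case (6) then show ?case using ar by (simp add: areas_def)
next
  case (7 x) then have "x < U" using X(1,3) by (meson less_le_trans)
  then show ?case using small[of x] U_bounds by linarith
next
  case (9 i j) then show ?case using ar by (auto simp: areas_def)
next
  case (10 k) then show ?case by (simp add: parse_out_def)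
next
  case (13 k u z')
  obtain d i where di: "parse_state xs k = (d, i)" by (cases "parse_state xs k")
  have rs: "reg u 30 = d" "reg u 31 = i" "reg u 20 = xs ! k" "reg u 6 = X" using 13 di r by auto
  have b: "d \<le> k" "i \<le> k" using parse_state_le[of xs k] di by auto
  have W: "Suc d < W" "Suc i < W" "d - 1 < W"
    using b 13(1) X small[of "Suc d"] small[of "Suc i"] small[of "d - 1"] U_bounds by linarith+
  have dX: "d < X" "i < X" "xs ! k < X" using b 13(1) X by auto
  have "node_rec X i d (xs ! k) < X * X * X" unfolding node_rec_def using dX by (intro pack_bound)
  moreover have "X * X * X * 1 * 1 \<le> X * X * X * X * X" using dX by (intro mult_le_mono) auto
  ultimately have aW: "node_rec X i d (xs ! k) < W" by (intro X5[OF X(1)]) linarith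
  show ?case unfolding parse_def
  proof (rule wp_Cond, goal_cases)
    case 2
    then show ?case using 13 rs di W by (intro wp_Assign) (auto simp: reg_ok_def parse_out_def intro!: writing_reg)
  next
    case 3
    then have ne: "xs ! k \<noteq> 0" using rs by simp
    have ev: "exp_val (packE (packE (Reg 31) (Reg 30)) (Reg 20)) (reg u) = node_rec X i d (xs ! k)"
      using rs by (simp add: node_rec_def pack_def)
    show ?case
    proof (rule wp_Seq, rule wp_emit[OF 13(3)], goal_cases)
      case 2 show ?case unfolding ev by (rule aW)
    next
      case 3 show ?case by (rule 13(4))
    next
      case (4 u2)
      have r2: "reg u2 30 = d" "reg u2 31 = i" using 4(2) rs by auto
      show ?case
        by (intro wp_Seq wp_Assign) (use 4 r2 rs di W ne ev in \<open>auto simp: reg_ok_def parse_out_def intro!: writing_reg\<close>)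
    qed simp
  qed simp
next
  case (14 u ys)
  have "ys = parsed X 0 0 xs" using 14(1) parse_out_eq[of 0 xs X] by simp
  then show ?case by (rule Q) (use 14 in simp_all)
qed (use r src in simp_all)

end

section \<open>The complete algorithm on a parsed table\<close>

context contraction
begin

lemma stored_cong:
  assumes "stored lev s d" "\<And>i q. i < Z \<Longrightarrow> 3 \<le> q \<Longrightarrow> d' (q * Z + i) = d (q * Z + i)"
  shows "stored lev s d'"
  unfolding stored_def
proof (intro allI impI conjI)
  fix j assume j: "j < lev"
  show "saved j (s mod 2 ^ j) d'"
    by (rule saved_cong[of j _ d]) (use assms j in \<open>auto simp: stored_def\<close>)
  show "2 * card (level (2 ^ Suc j) (s mod 2 ^ Suc j)) \<le> card (level (2 ^ j) (s mod 2 ^ j))"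
    using assms(1) j unfolding stored_def by blast
qed

lemma wp_classes:
  assumes r: "reg v 4 = w" "reg v 6 = X" and at: "at_work xs v" and n: "length xs \<le> N"
    and xsX: "\<And>x. x \<in> set xs \<Longrightarrow> x < X * X * X"
    and Q: "\<And>u. reg u 7 \<le> 2 * Z \<Longrightarrow>
       \<forall>i<length xs. store u (reg u 7 + i) = xs ! i mod X \<Longrightarrow>
       cost u \<le> cost v + 18 * (length xs div w + 1) \<Longrightarrow> Q u"
  shows "wp (stage classes) Q v"
proof -
  have r2: "reg v 7 = 1 * Z \<and> reg v 9 = 2 * Z \<or> reg v 7 = 2 * Z \<and> reg v 9 = 1 * Z" "reg v 8 = length xs"
    "\<forall>i<length xs. store v (reg v 7 + i) = xs ! i" using at unfolding at_work_def by auto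
  have "areas (1 * Z) (2 * Z) (length xs)" "areas (2 * Z) (1 * Z) (length xs)"
    using n NZ slot_areas[of 1 2 "length xs"] slot_areas[of 2 1 "length xs"] by auto
  then have ar: "areas (reg v 7) (reg v 9) (length xs)" using r2(1) by auto
  show ?thesis
  proof (rule wp_stage[where xs = xs and a = "reg v 7" and dst = "reg v 9" and G = "\<lambda>k. if True then [xs ! k mod X] else []" and
      St = "\<lambda>k r m. True"], goal_cases)
    case (5) then show ?case using ar by (simp add: areas_def)
  next
    case (6) then show ?case using ar by (simp add: areas_def)
  next
    case (7 x) then show ?case by (rule X3[OF xsX])
  next
    case (9 i j) then show ?case using ar by (auto simp: areas_def)
  next
    case (13 k u z')
    have "xs ! k mod X < X" using X_pos by simp
    then have "xs ! k mod X < W" using XU small[of "xs ! k mod X"] U_bounds by linarith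
    then show ?case unfolding classes_def
      by (intro wp_emit[OF 13(3)]) (use 13 r in auto)
  next
    case (14 u ys)
    have "ys = map (\<lambda>x. x mod X) xs" unfolding 14(1) using concat_filter_map[of "\<lambda>x. True" xs "\<lambda>x. x mod X"] by simp
    then show ?case using 14 r2(1) by (intro Q) auto
  qed (use r r2 in simp_all)
qed

text \<open>946 = 464 + 464 + 18: descent, ascent and the final scan. The base case handles at most
  \<open>w\<close> nodes and costs at most 36 IOs; with 18 for rounding in the final scan this gives
  \<open>54 * w\<close>.\<close>

lemma wp_core:
  assumes pm: "params u0" and nm: "named {..<N} (\<lambda>i. take 1 (path i)) nm" and at0: "at_work (rows {..<N} nm) u0"
    and Q: "\<And>u c. named {..<N} path c \<Longrightarrow> \<forall>i<N. store u (reg u 0 + i) = c i \<Longrightarrow>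
      w * cost u \<le> w * cost u0 + 946 * P * N + 54 * w \<Longrightarrow> Q u"
  shows "wp core Q u0"
  unfolding core_def
proof (intro wp_Seq wp_Assign, goal_cases)
  case 3 show ?case using small[of 1] U_bounds U10 by simp
next
  case 6 show ?case using W_pos by simp
next
  case 9 show ?case using W_pos by simp
next
  case 10
  define C where "C = w * cost u0 + 464 * P * N"
  have l0: "level 1 0 = {..<N}" by (auto simp: level_def)
  let ?u = "u0\<lparr>reg := (reg u0)(11 := 1, 12 := 0, 13 := 0)\<rparr>"
  have init: "down_inv C 0 0 ?u"
    using nm at0 pm l0 unfolding down_inv_def C_def by (auto simp: params_def at_work_def stored_def)
  have P1: "1 \<le> P" using passN by (simp add: passes_def)
  have up: "wp (While (Less (Const 0) (Reg 13)) up_body ;; stage classes ;; Assign 0 (Reg 7)) Q u2"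
    if "up_inv (C + 36 * w) lev s u2" for lev s u2
  proof (rule wp_Seq, rule wp_While[where I = "\<lambda>u. \<exists>lev s. up_inv (C + 36 * w) lev s u" and f = "\<lambda>u. reg u 13"], goal_cases)
    case 2 show ?case using that by blast
  next
    case (3 v)
    then obtain lev s where v: "up_inv (C + 36 * w) lev s v" by blast
    then have "reg v 13 = lev" "0 < lev" using 3(2) by (auto simp: up_inv_def)
    then obtain l' where l': "lev = Suc l'" using gr0_conv_Suc by blast
    have "wp up_body (up_inv (C + 36 * w) l' (s mod 2 ^ l')) v" using v unfolding l' by (rule wp_up)
    then show ?case
    proof (rule wp_mono)
      fix v' assume "up_inv (C + 36 * w) l' (s mod 2 ^ l') v'"
      then show "(\<exists>lev s. up_inv (C + 36 * w) lev s v') \<and> reg v' 13 < reg v 13"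
        using \<open>reg v 13 = lev\<close> l' unfolding up_inv_def by auto
    qed
  next
    case (4 v)
    then obtain lev s where v: "up_inv (C + 36 * w) lev s v" by blast
    then have "lev = 0" "s = 0" using 4(2) by (auto simp: up_inv_def)
    then obtain c where c: "named {..<N} path c" "at_work (rows {..<N} c) v" "params v" and cv: "w * cost v \<le> C + 36 * w + 464 * P * N"
      using v l0 unfolding up_inv_def by auto
    note R = rows[OF subset_refl c(1)]
    have ri: "rows {..<N} c ! i mod X = c i" if "i < N" for i
    proof -
      have "sorted_list_of_set {..<N} = [0..<N]" by (simp add: lessThan_atLeast0)
      then have "rows {..<N} c ! i = node_rec X i (D i) (c i)" using R(4) that by simp
      then show ?thesis using node_rec_fields(1)[of i "D i" "c i"] N_less[OF that] c(1) that by (auto simp: named_def)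
    qed
    have lN: "length (rows {..<N} c) = N" using R(1) by simp
    show ?case
    proof (rule wp_Seq, rule wp_classes[OF _ _ c(2)], goal_cases)
      case (5 v2)
      have "v2\<lparr>reg := (reg v2)(0 := exp_val (Reg 7) (reg v2))\<rparr> = v2\<lparr>reg := (reg v2)(0 := reg v2 7)\<rparr>" by simp
      have co2: "w * cost v2 \<le> w * cost u0 + 946 * P * N + 54 * w"
      proof -
        have "w * (N div w) \<le> N" by simp
        moreover have "w * (18 * (N div w + 1)) = 18 * (w * (N div w)) + 18 * w" by (simp add: algebra_simps)
        moreover have "w * cost v2 \<le> w * (cost v + 18 * (N div w + 1))" using 5(3) lN by (intro mult_le_mono2) simp
        moreover have "w * (cost v + 18 * (N div w + 1)) = w * cost v + w * (18 * (N div w + 1))" by (simp add: algebra_simps)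
        moreover have "18 * N \<le> P * (18 * N)" using P1 by simp
        moreover have "946 * P * N = 464 * P * N + 464 * P * N + P * (18 * N)" by (simp add: algebra_simps)
        ultimately show ?thesis using cv unfolding C_def by linarith
      qed
      have "2 * Z + 0 \<le> 2 * U ^ 5" using slot_bound[of 2 0] NZ by simp
      then have "reg v2 7 < W" using 5(1) small[of "reg v2 7"] by linarith
      then show ?case
        by (intro wp_Assign Q[OF c(1)]) (use 5 ri lN co2 in \<open>auto simp: reg_ok_def\<close>)
    qed (use c(3) R(6) lN in \<open>auto simp: params_def\<close>)
  qed simp
  show ?case
  proof (rule wp_While[where I = "\<lambda>u. \<exists>lev s. down_inv C lev s u" and f = "\<lambda>u. reg u 8"], goal_cases)
    case 2 show ?case using init by auto
  next
    case (3 v)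
    then obtain lev s where v: "down_inv C lev s v" by blast
    then obtain nm where nm: "named (level (2 ^ lev) s) (\<lambda>i. take (2 ^ lev) (path i)) nm" "at_work (rows (level (2 ^ lev) s) nm) v"
      and r4: "reg v 4 = w" unfolding down_inv_def params_def by blast
    have "reg v 8 = card (level (2 ^ lev) s)" using nm(2) rows(1)[OF level_sub nm(1)] by (simp add: at_work_def)
    then have "w < card (level (2 ^ lev) s)" using 3(2) r4 by simp
    from wp_down[OF v this] show ?case by (rule wp_mono) blast
  next
    case (4 v)
    then obtain lev s where v: "down_inv C lev s v" by blast
    define V where "V = level (2 ^ lev) s"
    from v obtain nm where nm: "named V (\<lambda>i. take (2 ^ lev) (path i)) nm" "at_work (rows V nm) v" and pv: "params v"
      and rv: "reg v 11 = 2 ^ lev" "reg v 12 = s" "reg v 13 = lev" "s < 2 ^ lev" and st: "stored lev s (store v)"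
      and cv: "w * cost v + 464 * P * card V \<le> C" unfolding down_inv_def V_def by blast
    have VN: "V \<subseteq> {..<N}" unfolding V_def by (rule level_sub)
    note R = rows[OF VN nm(1)]
    have r8: "reg v 8 = card V" using nm(2) R(1) by (simp add: at_work_def)
    then have Vw: "card V \<le> w" using 4(2) pv by (simp add: params_def)
    have r79: "reg v 7 = 1 * Z \<and> reg v 9 = 2 * Z \<or> reg v 7 = 2 * Z \<and> reg v 9 = 1 * Z"
      "\<forall>i<card V. store v (reg v 7 + i) = rows V nm ! i" using nm(2) R(1) unfolding at_work_def by auto
    have VZ: "card V \<le> Z" using R(5) NZ by simp
    have "areas (1 * Z) (2 * Z) (card V)" "areas (2 * Z) (1 * Z) (card V)"
      using VZ NZ slot_areas[of 1 2 "card V"] slot_areas[of 2 1 "card V"] by auto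
    then have ar: "areas (reg v 7) (reg v 9) (card V)" using r79(1) by auto
    show ?case
    proof (rule wp_Seq, rule wp_base[where V = V and a = "reg v 7" and dst = "reg v 9" and h = "2 ^ lev" and s = s and nm = nm], goal_cases)
      case (13 u2)
      note RC = rows[OF VN 13(6)]
      have at2: "at_work (rows V (cls V)) u2" unfolding at_work_def using 13 r79(1) RC(1) by auto
      have dk2: "store u2 (q * Z + i) = store v (q * Z + i)" if "i < Z" "3 \<le> q" for q i
        using 13(7) slot_out[of q 1 i "card V"] slot_out[of q 2 i "card V"] that VZ r79(1) by auto
      have st2: "stored lev s (store u2)" by (rule stored_cong[OF st dk2])
      have "card V div w \<le> 1" using Vw w_pos div_le_mono[OF Vw, of w] by simp
      then have "cost u2 \<le> cost v + 36" using 13(8) by simp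
      then have "w * cost u2 \<le> w * (cost v + 36)" by (rule mult_le_mono2)
      then have c2: "w * cost u2 \<le> C + 36 * w + 464 * P * card V" using cv by (simp add: algebra_simps)
      have "up_inv (C + 36 * w) lev s u2"
        unfolding up_inv_def V_def[symmetric] using 13(4,6) at2 st2 c2 pv rv by (auto simp: params_def)
      then show ?case by (rule up)
    qed (use pv rv r8 ar nm Vw r79 in \<open>simp_all add: params_def V_def\<close>)
  qed simp
qed (simp_all add: reg_ok_def)

end

section \<open>XML documents\<close>

abbreviation lexless :: "nat list \<Rightarrow> nat list \<Rightarrow> bool" where
  "lexless p q \<equiv> (p, q) \<in> lexord less_than"

text \<open>\<open>doc_order\<close> of a list of siblings whose first has child index
  \<open>k\<close>; the variable offset is what induction over the siblings needs.\<close>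

definition forest_order :: "nat \<Rightarrow> xml list \<Rightarrow> nat list list" where
  "forest_order k us = concat (map2 (\<lambda>i ps. map ((#) i) ps) [k..<k + length us] (map doc_order us))"

lemma forest_order_simps:
  "forest_order k [] = []"
  "forest_order k (u # us) = map ((#) k) (doc_order u) @ forest_order (Suc k) us"
  by (simp_all add: forest_order_def upt_conv_Cons del: upt_Suc)

lemma doc_order_Node: "doc_order (Node a ts) = [] # forest_order 0 ts"
  by (simp add: forest_order_def)

declare doc_order.simps [simp del]

lemma forest_order_head:
  "p \<in> set (forest_order k us) \<Longrightarrow> \<exists>i q. p = i # q \<and> k \<le> i \<and> i < k + length us \<and> q \<in> set (doc_order (us ! (i - k)))"
proof (induction us arbitrary: k)
  case (Cons u us)
  then consider q where "p = k # q" "q \<in> set (doc_order u)" | "p \<in> set (forest_order (Suc k) us)"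
    by (auto simp: forest_order_simps)
  then show ?case
  proof cases
    case 1 then show ?thesis by auto
  next
    case 2
    then obtain i q where "p = i # q" "Suc k \<le> i" "i < Suc k + length us" "q \<in> set (doc_order (us ! (i - Suc k)))"
      using Cons.IH by blast
    moreover then have "(u # us) ! (i - k) = us ! (i - Suc k)" by (simp add: nth_Cons' Suc_diff_le)
    ultimately show ?thesis by auto
  qed
qed (simp add: forest_order_simps)

lemma forest_order_mem:
  "k \<le> i \<Longrightarrow> i < k + length us \<Longrightarrow> q \<in> set (doc_order (us ! (i - k))) \<Longrightarrow> i # q \<in> set (forest_order k us)"
proof (induction us arbitrary: k)
  case (Cons u us)
  show ?case
  proof (cases "i = k")
    case False
    then have "(u # us) ! (i - k) = us ! (i - Suc k)" using Cons.prems by (simp add: nth_Cons' Suc_diff_le)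
    then show ?thesis using Cons.IH[of "Suc k"] Cons.prems False by (simp add: forest_order_simps)
  qed (use Cons.prems in \<open>simp add: forest_order_simps\<close>)
qed simp

lemma Nil_in_doc: "[] \<in> set (doc_order t)"
  by (cases t) (simp add: doc_order_Node)

lemma doc_prefix: "p @ q \<in> set (doc_order t) \<Longrightarrow> p \<in> set (doc_order t)"
proof (induction p arbitrary: t)
  case Nil then show ?case by (simp add: Nil_in_doc)
next
  case (Cons i p)
  obtain a ts where t: "t = Node a ts" by (cases t)
  have "i # p @ q \<in> set (forest_order 0 ts)" using Cons.prems t by (simp add: doc_order_Node)
  then obtain "i < length ts" "p @ q \<in> set (doc_order (ts ! i))" using forest_order_head by fastforce
  then show ?case using Cons.IH forest_order_mem[of 0 i ts p] t by (simp add: doc_order_Node)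
qed

lemma doc_sorted: "sorted_wrt lexless (doc_order t)"
proof (induction t)
  case (Node a ts)
  have "sorted_wrt lexless (forest_order k us)" if "set us \<subseteq> set ts" for k us
    using that
  proof (induction us arbitrary: k)
    case (Cons u us)
    have "lexless p q" if p: "p \<in> (#) k ` set (doc_order u)" and q: "q \<in> set (forest_order (Suc k) us)" for p q
      using p forest_order_head[OF q] by auto
    moreover have "sorted_wrt lexless (map ((#) k) (doc_order u))"
      using Node.IH[of u] Cons.prems by (simp add: sorted_wrt_map)
    ultimately show ?case using Cons by (auto simp: forest_order_simps sorted_wrt_append)
  qed (simp add: forest_order_simps)
  moreover have "lexless [] p" if "p \<in> set (forest_order 0 ts)" for p
    using forest_order_head[OF that] by auto
  ultimately show ?case by (simp add: doc_order_Node)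
qed

lemma lexless_irrefl: "\<not> lexless p p"
  by (rule lexord_irreflexive) simp

lemma lexless_trans: "lexless p q \<Longrightarrow> lexless q r \<Longrightarrow> lexless p r"
  by (rule lexord_trans) (auto intro: trans_less_than)

lemma doc_nth_lex: "i < j \<Longrightarrow> j < length (doc_order t) \<Longrightarrow> lexless (doc_order t ! i) (doc_order t ! j)"
  using sorted_wrt_nth_less[OF doc_sorted] by blast

lemma distinct_doc: "distinct (doc_order t)"
proof -
  have "doc_order t ! i \<noteq> doc_order t ! j" if "i < j" "j < length (doc_order t)" for i j
    using doc_nth_lex[OF that] lexless_irrefl by metis
  then show ?thesis unfolding distinct_conv_nth by (metis linorder_neqE_nat)
qed

text \<open>A list of the same length as \<open>q\<close> that comes after \<open>q\<close> differs
  from it at some place and is larger there, hence also comes after every extension of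
  \<open>q\<close>.\<close>

lemma lex_between_prefix: "lexless q x \<Longrightarrow> lexless x (q @ r) \<Longrightarrow> length x = length q \<Longrightarrow> False"
proof (induction q arbitrary: x)
  case (Cons a q)
  then obtain b x' where x: "x = b # x'" by (cases x) auto
  have "a < b \<or> a = b \<and> lexless q x'" "b < a \<or> b = a \<and> lexless x' (q @ r)" using Cons.prems x by auto
  then show ?case using Cons.IH[of x'] Cons.prems(3) x by auto
qed simp

text \<open>The own label comes first, so that \<open>take h\<close> gives the next \<open>h\<close>
  labels and \<open>drop h\<close> the list of the \<open>h\<close>-th ancestor. The successor makes
  the entries agree with the codes of start tags.\<close>

definition pathlab :: "xml \<Rightarrow> nat list \<Rightarrow> nat list" where
  "pathlab t p = map (\<lambda>k. Suc (label_at t (take k p))) (rev [0..<Suc (length p)])"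

lemma length_pathlab: "length (pathlab t p) = Suc (length p)"
  by (simp add: pathlab_def)

lemma drop_pathlab:
  assumes "h \<le> length p"
  shows "drop h (pathlab t p) = pathlab t (take (length p - h) p)"
proof -
  have *: "drop h (rev [0..<Suc n]) = rev [0..<Suc (n - h)]" if "h \<le> n" for h n
    using that by (simp add: drop_rev take_upt Suc_diff_le del: upt_Suc)
  have "drop h (pathlab t p) = map (\<lambda>k. Suc (label_at t (take k p))) (rev [0..<Suc (length p - h)])"
    unfolding pathlab_def drop_map using *[OF assms] by simp
  also have "\<dots> = map (\<lambda>k. Suc (label_at t (take k (take (length p - h) p)))) (rev [0..<Suc (length p - h)])"
    by (rule map_cong) (auto simp: min_def simp del: upt_Suc)
  also have "\<dots> = pathlab t (take (length p - h) p)" using assms by (simp add: pathlab_def)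
  finally show ?thesis .
qed

lemma pathlab_snoc: "pathlab t (p @ [i]) = Suc (label_at t (p @ [i])) # pathlab t p"
proof -
  have "pathlab t (p @ [i]) = Suc (label_at t (p @ [i])) # drop 1 (pathlab t (p @ [i]))"
    by (simp add: pathlab_def)
  then show ?thesis using drop_pathlab[of 1 "p @ [i]" t] by simp
qed

lemma pathlab_hd: "take 1 (pathlab t p) = [Suc (label_at t p)]"
  by (simp add: pathlab_def)

text \<open>Document order is the lexicographic order of paths, and no path of the ancestor's length
  lies strictly between the ancestor and its descendant; so the ancestor is the last preceding node
  at its depth.\<close>

lemma doc_ancestor:
  assumes i: "i < length (doc_order t)" and h: "1 \<le> h" "h \<le> length (doc_order t ! i)"
  shows "\<exists>j<i. length (doc_order t ! j) + h = length (doc_order t ! i) \<and>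
    pathlab t (doc_order t ! j) = drop h (pathlab t (doc_order t ! i)) \<and>
    (\<forall>j'<i. length (doc_order t ! j') + h = length (doc_order t ! i) \<longrightarrow> j' \<le> j)"
proof -
  let ?d = "doc_order t"
  let ?p = "?d ! i"
  define q r where "q = take (length ?p - h) ?p" and "r = drop (length ?p - h) ?p"
  have pq: "?p = q @ r" by (simp add: q_def r_def)
  have "q \<in> set ?d" using doc_prefix[of q r t] i pq by (metis nth_mem)
  then obtain j where j: "j < length ?d" "?d ! j = q" by (auto simp: in_set_conv_nth)
  have r: "r \<noteq> []" "length q + h = length ?p" using h by (auto simp: r_def q_def)
  have lq: "lexless q ?p" unfolding pq using r(1) by (simp add: lexord_append_rightI neq_Nil_conv)
  have ji: "j < i"
  proof (rule ccontr)
    assume "\<not> j < i"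
    then have "j = i \<or> i < j" by auto
    then show False using doc_nth_lex[of i j t] j lq lexless_irrefl lexless_trans by metis
  qed
  have "j' \<le> j" if j': "j' < i" "length (?d ! j') + h = length ?p" for j'
  proof (rule ccontr)
    assume "\<not> j' \<le> j"
    then have "lexless q (?d ! j')" using doc_nth_lex[of j j' t] j j' i by simp
    moreover have "lexless (?d ! j') (q @ r)" using doc_nth_lex[OF j'(1) i] pq by simp
    ultimately show False using lex_between_prefix j' r(2) by fastforce
  qed
  moreover have "pathlab t q = drop h (pathlab t ?p)" using drop_pathlab[OF h(2)] by (simp add: q_def)
  ultimately show ?thesis using ji j r(2) by blast
qed

text \<open>The prefixes of a path, including the empty one, are distinct nodes of the
  document.\<close>

lemma doc_length_bound: "p \<in> set (doc_order t) \<Longrightarrow> length p < length (doc_order t)"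
proof -
  assume p: "p \<in> set (doc_order t)"
  have "take k p \<in> set (doc_order t)" for k using doc_prefix[of "take k p" "drop k p" t] p by simp
  then have "(\<lambda>k. take k p) ` {..length p} \<subseteq> set (doc_order t)" by auto
  moreover have "inj_on (\<lambda>k. take k p) {..length p}"
    by (rule inj_onI) (metis atMost_iff length_take min.absorb2)
  ultimately have "card {..length p} \<le> card (set (doc_order t))" by (metis card_image card_mono finite_set)
  then show ?thesis using distinct_card[OF distinct_doc, of t] by simp
qed

section \<open>The tags of a document and what the parser makes of them\<close>

lemma length_tags: "length (tags t) = 2 * length (doc_order t)"
proof (induction t)
  case (Node a ts)
  have "length (concat (map tags us)) = 2 * length (forest_order k us)" if "set us \<subseteq> set ts" for k us
    using that by (induction us arbitrary: k) (auto simp: forest_order_simps Node.IH)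
  from this[of ts 0] show ?case by (simp add: doc_order_Node)
qed

lemma set_tags: "tag_code ` set (tags t) = insert 0 (Suc ` label_at t ` set (doc_order t))"
proof -
  have "tag_code ` set [x \<leftarrow> tags t. x \<noteq> End] = Suc ` label_at t ` set (doc_order t)"
    unfolding starts_doc_order by (auto simp: image_image)
  moreover have "End \<in> set (tags t)" by (cases t) simp
  then have "set (tags t) = insert End (set [x \<leftarrow> tags t. x \<noteq> End])" by auto
  then have "tag_code ` set (tags t) = insert 0 (tag_code ` set [x \<leftarrow> tags t. x \<noteq> End])"
    by (metis image_insert tag_code.simps(2))
  ultimately show ?thesis by (simp only:)
qed

text \<open>The end tag restores the depth while the counter keeps running. The following tags
  \<open>rest\<close> and the initial depth and counter are general so that the claim can be chained
  along siblings.\<close>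

lemma parsed_tags:
  "parsed X d i (map tag_code (tags t) @ rest) =
    map2 (\<lambda>j p. node_rec X j (d + length p) (Suc (label_at t p))) [i..<i + length (doc_order t)] (doc_order t) @
    parsed X d (i + length (doc_order t)) rest"
proof (induction t arbitrary: d i rest)
  case (Node a ts)
  have F: "parsed X (Suc d) i (map tag_code (concat (map tags us)) @ rest) =
     map2 (\<lambda>j p. node_rec X j (d + length p) (Suc (label_at (Node a (vs @ us)) p)))
       [i..<i + length (forest_order (length vs) us)] (forest_order (length vs) us) @
     parsed X (Suc d) (i + length (forest_order (length vs) us)) rest"
    if "set us \<subseteq> set ts" for d i us vs rest
    using that
  proof (induction us arbitrary: vs i)
    case (Cons u us)
    let ?L = "forest_order (Suc (length vs)) us" and ?n = "length (doc_order u)"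
    have IH: "parsed X (Suc d) (i + ?n) (map tag_code (concat (map tags us)) @ rest) =
      map2 (\<lambda>j p. node_rec X j (d + length p) (Suc (label_at (Node a (vs @ u # us)) p)))
       [i + ?n..<i + ?n + length ?L] ?L @ parsed X (Suc d) (i + ?n + length ?L) rest"
      using Cons.IH[of "i + ?n" "vs @ [u]"] Cons.prems by simp
    have u: "parsed X (Suc d) i (map tag_code (tags u) @ (map tag_code (concat (map tags us)) @ rest)) =
      map2 (\<lambda>j p. node_rec X j (Suc d + length p) (Suc (label_at u p))) [i..<i + ?n] (doc_order u) @
      parsed X (Suc d) (i + ?n) (map tag_code (concat (map tags us)) @ rest)"
      using Node.IH Cons.prems by simp
    have m: "map2 (\<lambda>j p. node_rec X j (Suc d + length p) (Suc (label_at u p))) [i..<i + ?n] (doc_order u) =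
      map2 (\<lambda>j p. node_rec X j (d + length p) (Suc (label_at (Node a (vs @ u # us)) p))) [i..<i + ?n] (map ((#) (length vs)) (doc_order u))"
      by (simp add: zip_map2 comp_def case_prod_beta)
    have sp: "[i..<i + (?n + length ?L)] = [i..<i + ?n] @ [i + ?n..<i + ?n + length ?L]"
      using upt_add_eq_append[of i "i + ?n" "length ?L"] by (simp add: add.assoc)
    show ?case
      using u IH unfolding m by (simp add: forest_order_simps sp zip_append add.assoc del: upt_Suc)
  qed (simp add: forest_order_simps)
  have "parsed X d i (map tag_code (tags (Node a ts)) @ rest) =
    node_rec X i d (Suc a) # parsed X (Suc d) (Suc i) (map tag_code (concat (map tags ts)) @ 0 # rest)"
    by simp
  also have "\<dots> = node_rec X i d (Suc a) # map2 (\<lambda>j p. node_rec X j (d + length p) (Suc (label_at (Node a ts) p)))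
       [Suc i..<Suc i + length (forest_order 0 ts)] (forest_order 0 ts) @ parsed X d (Suc i + length (forest_order 0 ts)) rest"
    using F[of ts d "Suc i" "0 # rest" "[]"] by simp
  finally show ?case by (simp add: doc_order_Node upt_conv_Cons del: upt_Suc)
qed

lemma parsed_document:
  "parsed X 0 0 (map tag_code (tags t)) =
    map (\<lambda>i. node_rec X i (length (doc_order t ! i)) (Suc (label_at t (doc_order t ! i)))) [0..<length (doc_order t)]"
proof -
  have "map2 (\<lambda>j p. node_rec X j (0 + length p) (Suc (label_at t p))) [0..<0 + length (doc_order t)] (doc_order t) =
    map (\<lambda>i. node_rec X i (length (doc_order t ! i)) (Suc (label_at t (doc_order t ! i)))) [0..<length (doc_order t)]"
    by (rule nth_equalityI) auto
  then show ?thesis using parsed_tags[of X 0 0 t "[]"] by simp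
qed

section \<open>Backward bisimilarity in a tree\<close>

lemma nodes_xml [simp]: "nodes (xml_graph t) = set (doc_order t)"
  by (simp add: xml_graph_def)

lemma edges_xml: "(p, q) \<in> edges (xml_graph t) \<longleftrightarrow> q \<in> set (doc_order t) \<and> (\<exists>i. q = p @ [i])"
  using doc_prefix by (auto simp: xml_graph_def)

text \<open>A node has at most one parent, so bisimilarity passes from nodes to their unique parents
  up to the root; and the root, having no parent, is bisimilar only to itself. Conversely, equal
  label paths stay equal when both first entries are removed.\<close>

lemma bisimilar_xml:
  "backward_bisimilar (xml_graph t) = {(p, q). p \<in> set (doc_order t) \<and> q \<in> set (doc_order t) \<and> pathlab t p = pathlab t q}"
    (is "?R = ?S")
proof
  have len: "length p = length q" if "pathlab t p = pathlab t q" for p q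
    using that length_pathlab[of t p] length_pathlab[of t q] by simp
  have step: "\<exists>q'. (q', q) \<in> edges (xml_graph t) \<and> (p', q') \<in> ?S"
    if "(p, q) \<in> ?S" "(p', p) \<in> edges (xml_graph t)" for p q p'
  proof -
    from that obtain i where p: "p = p' @ [i]" "p \<in> set (doc_order t)" "q \<in> set (doc_order t)" "pathlab t p = pathlab t q"
      by (auto simp: edges_xml)
    then have "q \<noteq> []" using len[of p q] by auto
    then obtain q' j where q: "q = q' @ [j]" by (metis rev_exhaust)
    have "pathlab t p' = pathlab t q'" using p(4) unfolding p(1) q pathlab_snoc by simp
    then show ?thesis using p q doc_prefix by (intro exI[of _ q']) (auto simp: edges_xml)
  qed
  have lab: "label_at t p = label_at t q" if "pathlab t p = pathlab t q" for p q
    using that pathlab_hd[of t p] pathlab_hd[of t q] by simp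
  have "backward_bisimulation (xml_graph t) ?S"
  proof (rule backward_bisimulationI)
    fix n m assume "(n, m) \<in> ?S"
    then show "n \<in> nodes (xml_graph t) \<and> m \<in> nodes (xml_graph t) \<and> label (xml_graph t) n = label (xml_graph t) m"
      using lab[of n m] by (simp add: xml_graph_def)
  next
    fix n m n' assume "(n, m) \<in> ?S" "(n', n) \<in> edges (xml_graph t)"
    then show "\<exists>m'. (m', m) \<in> edges (xml_graph t) \<and> (n', m') \<in> ?S" by (rule step)
  next
    fix n m m' assume "(n, m) \<in> ?S" and e: "(m', m) \<in> edges (xml_graph t)"
    then have "(m, n) \<in> ?S" by auto
    from step[OF this e] show "\<exists>n'. (n', n) \<in> edges (xml_graph t) \<and> (n', m') \<in> ?S" by auto
  qed
  then show "?S \<subseteq> ?R" unfolding backward_bisimilar_def by blast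
  have "pathlab t p = pathlab t q" if "(p, q) \<in> ?R" for p q
    using that
  proof (induction p arbitrary: q rule: rev_induct)
    case Nil
    note D = backward_bisimulationD[OF backward_bisimulation_bisimilar Nil]
    have "q = []"
    proof (rule ccontr)
      assume "q \<noteq> []"
      then obtain q' j where q: "q = q' @ [j]" by (metis rev_exhaust)
      have "(q', q) \<in> edges (xml_graph t)" using D(2) q by (simp add: edges_xml)
      from D(5)[OF this] show False by (auto simp: edges_xml)
    qed
    then show ?case by simp
  next
    case (snoc i p)
    note D = backward_bisimulationD[OF backward_bisimulation_bisimilar snoc.prems]
    have "(p, p @ [i]) \<in> edges (xml_graph t)" using D(1) by (simp add: edges_xml)
    from D(4)[OF this] obtain q' where q': "(q', q) \<in> edges (xml_graph t)" "(p, q') \<in> ?R" by blast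
    then obtain j where q: "q = q' @ [j]" by (auto simp: edges_xml)
    have "label_at t (p @ [i]) = label_at t q" using D(3) by (simp add: xml_graph_def)
    then show ?case using snoc.IH[OF q'(2)] unfolding q pathlab_snoc by simp
  qed
  then show "?R \<subseteq> ?S"
    using backward_bisimulationD(1,2)[OF backward_bisimulation_bisimilar[of "xml_graph t"]] by auto
qed

lemma one_index_xml:
  assumes "\<And>i j. i < length (doc_order t) \<Longrightarrow> j < length (doc_order t) \<Longrightarrow>
    block_id s i = block_id s j \<longleftrightarrow> pathlab t (doc_order t ! i) = pathlab t (doc_order t ! j)"
  shows "output_partition s (doc_order t) = one_index (xml_graph t)"
proof -
  let ?d = "doc_order t"
  have "{?d ! j | j. j < length ?d \<and> block_id s j = block_id s i} = backward_bisimilar (xml_graph t) `` {?d ! i}"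
    if i: "i < length ?d" for i
  proof -
    have "{?d ! j | j. j < length ?d \<and> block_id s j = block_id s i} = {?d ! j | j. j < length ?d \<and> pathlab t (?d ! j) = pathlab t (?d ! i)}"
      using assms i by blast
    also have "\<dots> = {q \<in> set ?d. pathlab t q = pathlab t (?d ! i)}" by (auto simp: in_set_conv_nth)
    also have "\<dots> = backward_bisimilar (xml_graph t) `` {?d ! i}" unfolding bisimilar_xml using i by auto
    finally show ?thesis .
  qed
  then have "output_partition s ?d = {backward_bisimilar (xml_graph t) `` {?d ! i} | i. i < length ?d}"
    unfolding output_partition_def by (auto; metis)
  also have "\<dots> = one_index (xml_graph t)"
    unfolding one_index_def quotient_def nodes_xml set_conv_nth by blast
  finally show ?thesis .
qed

section \<open>The complexity bound\<close>

text \<open>Each run of a merge needs \<open>w\<close> cells for its window and one for its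
  position, hence the division by \<open>w + 1\<close>. With \<open>w\<close> about a quarter of
  \<open>B\<close> two runs fit even if \<open>M = 2 * B\<close>. The base \<open>X\<close> exceeds
  all codes, and also all positions and shifted depths.\<close>

definition prepare :: prog where
  "prepare = Assign 4 (Reg 1 \<oslash> Const 4 \<oplus> Const 1) ;;
     Assign 5 ((Const 4 \<oplus> Reg 0 \<ominus> Reg 1) \<oslash> (Reg 4 \<oplus> Const 1)) ;; Assign 14 (Reg 2) ;;
     Assign 7 (Const 0) ;; Assign 8 (Reg 2) ;; Assign 9 (Reg 14) ;; stage max_code ;;
     Assign 6 (Reg 30 \<oplus> Reg 2 \<oplus> Const 3) ;;
     Assign 7 (Const 0) ;; Assign 8 (Reg 2) ;; Assign 9 (Reg 14) ;; stage parse ;;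
     Assign 9 (Const 2 \<otimes> Reg 14) ;; core"

text \<open>Reading block 0 establishes the cache invariant at the start, and the last command
  flushes the cached block so that the output is really in external memory. These are the two
  additional IOs in \<open>cost_bound\<close>.\<close>

definition one_index_prog :: prog where
  "one_index_prog = ReadBlock (Const 0) (Const 0) ;; prepare ;; WriteBlock (Reg 3) (Const 0)"

lemma fan_in:
  fixes B M w K :: nat
  assumes B: "1 \<le> B" "2 * B \<le> M" and w: "w = B div 4 + 1" and K: "K = (4 + M - B) div (w + 1)"
  shows "2 \<le> K" "K * (w + 1) \<le> 4 + M - B" "M \<le> 8 * K * B" "B \<le> 4 * w" "w \<le> B" "K \<le> 4 + M"
proof -
  obtain b where b: "w = b + 1" "4 * b \<le> B" "B < 4 * b + 4"
    using w by (metis add.commute dividend_less_times_div times_div_less_eq_dividend zero_less_numeral)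
  show "w \<le> B" using b B(1) by linarith
  show "B \<le> 4 * w" using b by linarith
  have w2: "2 * (w + 1) = 2 * b + 4" "4 * (w + 1) = 4 * b + 8" using b by simp_all
  have "2 * (w + 1) \<le> 4 + M - B" unfolding w2 using b B by linarith
  then show K2: "2 \<le> K" unfolding K by (simp add: less_eq_div_iff_mult_less_eq)
  show "K * (w + 1) \<le> 4 + M - B" unfolding K by (rule div_times_less_eq_dividend)
  show "K \<le> 4 + M" unfolding K using div_le_dividend[of "4 + M - B" "w + 1"] by linarith
  have "4 + M - B < (K + 1) * (w + 1)"
    unfolding K using dividend_less_div_times[of "w + 1" "4 + M - B"] by simp
  then have "4 * (4 + M - B) \<le> (K + 1) * (4 * (w + 1))" by (simp add: algebra_simps)
  \<comment> \<open>\<open>4 * (w + 1) \<le> B + 8 \<le> 9 * B\<close>, because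
    \<open>B \<ge> 1\<close>.\<close>
  also have "\<dots> \<le> (K + 1) * (9 * B)" unfolding w2 using b B by (intro mult_le_mono2) linarith
  also have "\<dots> = 9 * (K * B) + 9 * B" by (simp add: algebra_simps)
  finally have a: "4 * (4 + M - B) \<le> 9 * (K * B) + 9 * B" .
  have "2 * B \<le> K * B" using K2 by simp
  moreover have "2 * M \<le> 4 * (4 + M - B)" using B by linarith
  ultimately have "M \<le> 8 * (K * B)" using a by linarith
  then show "M \<le> 8 * K * B" by (simp add: mult.assoc)
qed

text \<open>\<open>B \<le> 4 * w\<close> turns the second case of \<open>P\<close> into
  \<open>K ^ (P - 1) < 4 * N / B\<close>. As \<open>4 \<le> K ^ 2\<close> and
  \<open>M / B \<le> 8 * K \<le> K ^ 4\<close>, logarithms give \<open>P - 1 < 2 + 4 * L\<close>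
  with the maximum \<open>L\<close> on the right, so that
  \<open>P < 3 + 4 * L \<le> 7 * L\<close>.\<close>

lemma passes_bound:
  fixes B M N w K P :: nat
  assumes B: "1 \<le> B" "2 * B \<le> M" and w: "w = B div 4 + 1" and K: "K = (4 + M - B) div (w + 1)"
    and N: "1 \<le> N" and P: "P = 1 \<or> 1 \<le> P \<and> w * K ^ (P - 1) < N"
  shows "real P \<le> 7 * max 1 (log (real M / real B) (real N / real B))"
proof -
  let ?m = "real M / real B" and ?x = "real N / real B"
  let ?L = "max 1 (log ?m ?x)"
  note F = fan_in[OF B w K]
  from P show ?thesis
  proof
    assume "P = 1" then show ?thesis by simp
  next
    assume P': "1 \<le> P \<and> w * K ^ (P - 1) < N"
    have B0: "0 < real B" using B by simp
    have w0: "0 < w" using w by simp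
    have m2: "2 \<le> ?m" using B B0 by (simp add: le_divide_eq)
    have K0: "2 \<le> real K" using F(1) by simp
    have x0: "0 < ?x" using N B0 by simp
    have lnK: "ln 2 \<le> ln (real K)" "0 < ln (real K)" using K0 by simp_all
    have "real w * real K ^ (P - 1) < real N" using P' by (metis of_nat_less_iff of_nat_mult of_nat_power)
    moreover have "real B * real K ^ (P - 1) \<le> 4 * real w * real K ^ (P - 1)"
      using F(4) by (intro mult_right_mono) (simp_all flip: of_nat_mult add: of_nat_le_iff[symmetric])
    ultimately have "real B * real K ^ (P - 1) < 4 * real N" by linarith
    then have "real K ^ (P - 1) < 4 * ?x" using B0 by (simp add: field_simps)
    then have "ln (real K ^ (P - 1)) < ln (4 * ?x)" using K0 x0 by (subst ln_less_cancel_iff) auto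
    moreover have "ln (4 * ?x) = ln 4 + ln ?x" using N B by (subst ln_mult) auto
    moreover have "ln (real K ^ (P - 1)) = real (P - 1) * ln (real K)" using K0 by (subst ln_realpow) auto
    ultimately have a: "real (P - 1) * ln (real K) < ln 4 + ln ?x" by linarith
    have l4: "ln 4 \<le> 2 * ln (real K)"
    proof -
      have "ln (4 :: real) = 2 * ln 2" using ln_realpow[of 2 2] by simp
      then show ?thesis using lnK by simp
    qed
    have lx: "ln ?x \<le> 4 * ln (real K) * ?L"
    proof (cases "?x \<le> 1")
      case True
      then have "ln ?x \<le> 0" using x0 by simp
      moreover have "0 \<le> 4 * ln (real K) * ?L" using lnK by simp
      ultimately show ?thesis by linarith
    next
      case False
      then have lnx: "0 < ln ?x" by simp
      have lnm: "0 < ln ?m" using m2 by simp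
      have "real M \<le> real (8 * K * B)" using F(3) by (simp only: of_nat_le_iff)
      then have "?m \<le> 8 * real K" using B0 by (simp add: field_simps)
      moreover have "8 * real K \<le> real K ^ 4"
      proof -
        have "(2 :: real) ^ 3 \<le> real K ^ 3" using K0 by (intro power_mono) auto
        then have "8 * real K \<le> real K ^ 3 * real K" using K0 by (intro mult_right_mono) auto
        then show ?thesis by (simp add: eval_nat_numeral)
      qed
      ultimately have "ln ?m \<le> ln (real K ^ 4)" using m2 K0 by (subst ln_le_cancel_iff) auto
      then have m4: "ln ?m \<le> 4 * ln (real K)" using K0 by (simp add: ln_realpow)
      have "ln ?x = ln ?m * log ?m ?x" using lnm by (simp add: log_def)
      also have "\<dots> \<le> 4 * ln (real K) * log ?m ?x"
        using m4 lnx lnm by (intro mult_right_mono) (auto simp: log_def)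
      also have "\<dots> \<le> 4 * ln (real K) * ?L" using lnK by (intro mult_left_mono) auto
      finally show ?thesis .
    qed
    have "real (P - 1) * ln (real K) < (2 + 4 * ?L) * ln (real K)"
      using a l4 lx by (simp add: algebra_simps)
    then have "real (P - 1) < 2 + 4 * ?L" using lnK by simp
    moreover have "real (P - 1) = real P - 1" using P' by (simp add: of_nat_diff)
    ultimately show ?thesis by (simp add: max_def split: if_splits)
  qed
qed

text \<open>Dividing by \<open>w\<close> and using \<open>B \<le> 4 * w\<close> gives the factor 4 *
  1018 + 92 = 4164, where 92 includes the two additional IOs; times 7 from
  \<open>passes_bound\<close> this is below 30000.\<close>

lemma cost_bound:
  fixes B M N w K P c :: nat
  assumes B: "1 \<le> B" "2 * B \<le> M" and w: "w = B div 4 + 1" and K: "K = (4 + M - B) div (w + 1)"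
    and N: "1 \<le> N" and P: "P = 1 \<or> 1 \<le> P \<and> w * K ^ (P - 1) < N" and c: "w * c \<le> 1018 * P * N + 90 * w"
  shows "real (c + 2) \<le> 30000 * Sort M B N"
proof -
  let ?x = "real N / real B" and ?L = "max 1 (log (real M / real B) (real N / real B))"
  let ?C = "real_of_int \<lceil>?x\<rceil>"
  have B0: "0 < real B" using B by simp
  have w0: "0 < real w" using w by simp
  have Bw: "real B \<le> 4 * real w" using fan_in(4)[OF B w K] by (simp flip: of_nat_mult)
  have P1: "1 \<le> real P" using P by auto
  have x0: "0 < ?x" using N B0 by simp
  have C: "?x \<le> ?C" by simp
  have "0 < \<lceil>?x\<rceil>" using x0 by (simp only: zero_less_ceiling)
  then have C1: "1 \<le> ?C" by linarith
  have "real w * real c \<le> 1018 * real P * real N + 90 * real w"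
    using c by (metis (mono_tags, lifting) of_nat_add of_nat_le_iff of_nat_mult of_nat_numeral)
  then have "real c \<le> 1018 * real P * (real N / real w) + 90" using w0 by (simp add: field_simps)
  moreover have "real N / real w \<le> 4 * ?x"
    using mult_left_mono[OF Bw, of "real N"] B0 w0 by (simp add: field_simps)
  then have "1018 * real P * (real N / real w) \<le> 1018 * real P * (4 * ?x)" by (rule mult_left_mono) simp
  ultimately have "real c + 2 \<le> 1018 * real P * (4 * ?x) + 92" by linarith
  also have "\<dots> \<le> 1018 * real P * (4 * ?C) + 92 * (real P * ?C)"
  proof -
    have "1018 * real P * (4 * ?x) \<le> 1018 * real P * (4 * ?C)" using C by (intro mult_left_mono) auto
    moreover have "1 * 1 \<le> real P * ?C" using P1 C1 by (intro mult_mono) auto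
    ultimately show ?thesis by linarith
  qed
  also have "\<dots> = 4164 * (?C * real P)" by (simp add: algebra_simps)
  also have "\<dots> \<le> 4164 * (?C * (7 * ?L))"
    using passes_bound[OF B w K N P] C1 by (intro mult_left_mono) auto
  also have "\<dots> \<le> 30000 * (?C * ?L)"
  proof -
    have "0 \<le> ?C * ?L" using C1 by (intro mult_nonneg_nonneg) auto
    then show ?thesis by simp
  qed
  finally show ?thesis by (simp add: Sort_def)
qed

lemma one_index_prog_correct:
  fixes M B :: nat and t :: xml
  assumes B: "1 \<le> B" "2 * B \<le> M"
  shows "\<exists>q s. exec M B (word_bound 9 M t) one_index_prog (initial M B (tags t)) q s \<and>
     output_partition s (doc_order t) = one_index (xml_graph t) \<and>
     real q \<le> 30000 * Sort M B (card (nodes (xml_graph t)))"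
proof -
  define N where "N = length (doc_order t)"
  define sg where "sg = Max (label (xml_graph t) ` nodes (xml_graph t))"
  define Y where "Y = N + M + sg + 2"
  define W where "W = word_bound 9 M t"
  define U where "U = 2 * Y"
  define w where "w = B div 4 + 1"
  define K where "K = (4 + M - B) div (w + 1)"
  define xs where "xs = map tag_code (tags t)"
  define Z where "Z = 2 * N"
  define mc where "mc = Max (insert 0 (set xs))"
  define X where "X = mc + Z + 3"
  \<comment> \<open>Minimality of \<open>P\<close> is what \<open>passes_bound\<close> uses: unless
    \<open>P = 1\<close>, one pass fewer would not suffice.\<close>
  define P where "P = (LEAST p. 1 \<le> p \<and> N \<le> w * K ^ p)"
  have card_nodes: "card (nodes (xml_graph t)) = N" using distinct_card[OF distinct_doc] by (simp add: N_def)
  have N1: "1 \<le> N" using Nil_in_doc[of t] by (cases "doc_order t") (auto simp: N_def)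
  note F = fan_in[OF B w_def K_def]
  have Y5: "5 \<le> Y" using N1 B by (simp add: Y_def)
  have WY: "W = Y ^ 9" unfolding W_def word_bound_def card_nodes sg_def[symmetric] Y_def ..
  have lx: "length xs = Z" using length_tags[of t] by (simp add: xs_def Z_def N_def)
  have mc: "mc \<le> Suc sg"
  proof -
    have "x \<le> Suc sg" if "x \<in> set xs" for x
    proof -
      have "x \<in> insert 0 (Suc ` label_at t ` set (doc_order t))" using that set_tags[of t] by (simp add: xs_def)
      moreover have "l \<le> sg" if "l \<in> label_at t ` set (doc_order t)" for l
        unfolding sg_def using that by (intro Max_ge) (auto simp: xml_graph_def)
      ultimately show ?thesis by auto
    qed
    then show ?thesis unfolding mc_def by simp
  qed
  have xmc: "x \<le> mc" if "x \<in> set xs" for x unfolding mc_def using that by (intro Max_ge) auto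
  have XU: "X \<le> U" using mc N1 by (simp add: X_def U_def Y_def Z_def)
  \<comment> \<open>\<open>U = 2 * Y\<close> contributes 64 = 2 ^ 6, which three further powers of
    \<open>Y \<ge> 5\<close> absorb; hence the exponent 9 of the word bound.\<close>
  have UW: "U ^ 6 \<le> W"
  proof -
    have "(5 :: nat) ^ 3 \<le> Y ^ 3" using Y5 by (rule power_mono) simp
    then have "64 * Y ^ 6 \<le> Y ^ 3 * Y ^ 6" by (intro mult_le_mono1) simp
    then show ?thesis unfolding WY U_def by (simp add: power_mult_distrib flip: power_add)
  qed
  interpret buffered M B W w K U
    by unfold_locales (use B F Y5 UW in \<open>auto simp: w_def U_def Y_def\<close>)
  have Pex: "\<exists>p. 1 \<le> p \<and> N \<le> w * K ^ p"
  proof -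
    have "N < 2 ^ N" by (rule less_exp)
    also have "(2 :: nat) ^ N \<le> K ^ N" using F(1) by (rule power_mono) simp
    also have "\<dots> \<le> w * K ^ N" using w_pos by simp
    finally show ?thesis using N1 by (intro exI[of _ N]) simp
  qed
  have P: "1 \<le> P \<and> N \<le> w * K ^ P" unfolding P_def by (rule LeastI_ex[OF Pex])
  have Pmin: "P = 1 \<or> 1 \<le> P \<and> w * K ^ (P - 1) < N"
  proof (cases "P = 1")
    case False
    then have "1 \<le> P - 1" "P - 1 < P" using P by auto
    then have "\<not> (1 \<le> P - 1 \<and> N \<le> w * K ^ (P - 1))" unfolding P_def by (intro not_less_Least)
    then show ?thesis using P \<open>1 \<le> P - 1\<close> by simp
  qed simp
  have pas: "passes P N"
    unfolding passes_def
  proof (intro conjI allI impI)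
    fix j assume "w * K ^ j < N"
    then have "w * K ^ j < w * K ^ P" using P by linarith
    then have "K ^ j < K ^ P" by simp
    then show "Suc j \<le> P" using F(1) by (simp add: power_strict_increasing_iff)
  qed (use P in simp)
  let ?D = "\<lambda>i. length (doc_order t ! i)" and ?path = "\<lambda>i. pathlab t (doc_order t ! i)"
  interpret forest N X ?D ?path
  proof
    fix i assume i: "i < N"
    show "length (?path i) = Suc (?D i)" by (rule length_pathlab)
    show "?D i < N" using doc_length_bound[of "doc_order t ! i" t] i by (simp add: N_def)
  next
    show "2 * N + 2 < X" by (simp add: X_def Z_def)
  next
    fix i h assume "i < N" "1 \<le> h" "h \<le> ?D i"
    then show "\<exists>j<i. ?D j + h = ?D i \<and> ?path j = drop h (?path i) \<and> (\<forall>j'<i. ?D j' + h = ?D i \<longrightarrow> j' \<le> j)"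
      unfolding N_def by (rule doc_ancestor)
  qed
  have ZU: "(N + 6) * Z \<le> 2 * U ^ 5"
  proof -
    have "(N + 6) * Z \<le> U * U" using B by (intro mult_le_mono) (auto simp: U_def Y_def Z_def)
    then show ?thesis using U_bounds by (simp add: power2_eq_square)
  qed
  interpret contraction M B W w K U N X ?D ?path Z P
    by unfold_locales (use N1 XU ZU pas in \<open>auto simp: Z_def\<close>)
  define s0 where "s0 = initial M B (tags t)"
  define s1 where "s1 = s0\<lparr>mem := (\<lambda>i. if 0 \<le> i \<and> i < 0 + B then disk s0 (0 * B + (i - 0)) else mem s0 i)\<rparr>"
  \<comment> \<open>The view after the initial read: block 0 is cached, and the virtual memory is
    zero like the untouched internal memory and the registers behind it.\<close>
  define v0 where "v0 = \<lparr>cost = 0, cached = 0, reg = regs s0, vmem = (\<lambda>_. 0), store = disk s0\<rparr>"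
  have rep: "rep s1 v0"
    using W_pos B unfolding rep_def v0_def s1_def s0_def initial_def by (auto simp: div_eq_0_iff)
  have x1: "exec M B W (ReadBlock (Const 0) (Const 0)) s0 1 s1"
    unfolding s1_def using B by (intro exec.ReadBlock) auto
  have r0: "reg v0 0 = M" "reg v0 1 = B" "reg v0 2 = Z"
    using lx by (auto simp: v0_def s0_def initial_def xs_def)
  have old: "store v0 i = xs ! i" if "i < Z" for i
    using that lx by (simp add: v0_def s0_def initial_def xs_def)
  have ZN: "Z \<le> U" by (simp add: Z_def U_def Y_def)
  have ar: "areas (0 * Z) (1 * Z) Z" using N1 by (intro slot_areas) auto
  have W1: "x < W" if "x \<le> 2 * U" for x using that small[of x] U_bounds by linarith
  have xW: "x < W" if "x \<in> set xs" for x using xmc[OF that] XU W1[of x] by (simp add: X_def)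
  define nm where "nm = (\<lambda>i. Suc (label_at t (doc_order t ! i)))"
  have nm: "named {..<N} (\<lambda>i. take 1 (?path i)) nm"
  proof -
    have "nm i < X" if "i < N" for i
    proof -
      have "nm i \<in> set xs" using set_tags[of t] that nth_mem by (auto simp: xs_def nm_def N_def)
      then show ?thesis using xmc by (fastforce simp: X_def)
    qed
    then show ?thesis unfolding named_def pathlab_hd by (auto simp: nm_def)
  qed
  have py: "parsed X 0 0 xs = rows {..<N} nm"
  proof -
    have "sorted_list_of_set {..<N} = [0..<N]" by (simp add: lessThan_atLeast0)
    then show ?thesis using rows(4)[OF subset_refl nm] parsed_document[of X t]
      by (simp add: xs_def nm_def N_def)
  qed
  define Qf where "Qf = (\<lambda>u :: vstate. \<exists>c. named {..<N} ?path c \<and> (\<forall>i<N. store u (reg u 0 + i) = c i) \<and>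
    w * cost u \<le> 1018 * P * N + 90 * w)"
  \<comment> \<open>The two scans over \<open>Z = 2 * N\<close> tags cost 36 per window, that is
    \<open>72 * N + 36 * w\<close> after scaling by \<open>w\<close>; added to the 946 and 54 of
    \<open>wp_core\<close> this gives 1018 and 90.\<close>
  have co_bound: "w * c \<le> 1018 * P * N + 90 * w"
    if "w * c \<le> w * c1 + 946 * P * N + 54 * w" "c1 \<le> 36 * (Z div w + 1)" for c c1
  proof -
    have "w * c1 \<le> w * (36 * (Z div w + 1))" by (rule mult_le_mono2[OF that(2)])
    moreover have "w * (36 * (Z div w + 1)) = 36 * (w * (Z div w)) + 36 * w" by (simp add: algebra_simps)
    moreover have "w * (Z div w) \<le> Z" by simp
    moreover have "36 * Z = 72 * N" by (simp add: Z_def)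
    moreover have "72 * N \<le> P * (72 * N)" using P by simp
    moreover have "1018 * P * N = 946 * P * N + P * (72 * N)" by (simp add: algebra_simps)
    ultimately show ?thesis using that(1) by linarith
  qed
  have "wp prepare Qf v0"
    unfolding prepare_def
  proof (intro wp_Seq wp_Assign, goal_cases)
    case 3 show ?case using r0 W1[of w] F(5) wU by (simp add: w_def)
  next
    case 6 show ?case using r0 W1[of K] KU by (simp add: w_def K_def)
  next
    case 9 show ?case using r0 W1[of Z] ZN by simp
  next
    case 12 show ?case using W_pos by simp
  next
    case 15 show ?case using r0 W1[of Z] ZN by simp
  next
    case 18 show ?case using r0 W1[of Z] ZN by simp
  next
    case 19
    show ?case
    proof (rule wp_max_code[where xs = xs and a = "0 * Z" and dst = "1 * Z"], goal_cases)
      case 5 show ?case using ar lx by simp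
    next
      case (8 u1)
      have r1: "reg u1 4 = w" "reg u1 5 = K" "reg u1 14 = Z" "reg u1 2 = Z" "reg u1 30 = mc"
        using 8(1,2) r0 by (auto simp: w_def K_def mc_def)
      have d1: "store u1 i = xs ! i" if "i < Z" for i using 8(3) old[OF that] that by simp
      have c1: "cost u1 \<le> 18 * (Z div w + 1)" using 8(4) lx by (simp add: v0_def)
      show ?case
      proof (rule wp_Seq, rule wp_Assign, goal_cases)
        case 3 show ?case using r1 W1[of X] XU by (simp add: X_def)
      next
        case 4
        show ?case
        proof (rule wp_Seq, rule wp_Assign, goal_cases)
          case 3 show ?case using W_pos by simp
        next
          case 4
          show ?case
          proof (rule wp_Seq, rule wp_Assign, goal_cases)
            case 3 show ?case using r1 W1[of Z] ZN by simp
          next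
            case 4
            show ?case
            proof (rule wp_Seq, rule wp_Assign, goal_cases)
              case 3 show ?case using r1 W1[of Z] ZN by simp
            next
              case 4
              show ?case
              proof (rule wp_Seq, rule wp_parse[where xs = xs and a = "0 * Z" and dst = "1 * Z" and X = X], goal_cases)
                case 6 show ?case using ar lx by simp
              next
                case (9 x) then show ?case using xmc[OF 9] by (simp add: X_def)
              next
                case (11 u2 ys)
                have ys: "ys = rows {..<N} nm" using 11(1) py by simp
                have r2: "reg u2 4 = w" "reg u2 5 = K" "reg u2 14 = Z" "reg u2 6 = X" "reg u2 7 = 1 * Z"
                  using 11(2,4) r1 by (auto simp: X_def)
                have c2: "cost u2 \<le> 36 * (Z div w + 1)" using 11(6) c1 lx by simp
                show ?case
                proof (rule wp_Seq, rule wp_Assign, goal_cases)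
                  case 3 show ?case using r2 W1[of "2 * Z"] ZN by simp
                next
                  case 4
                  show ?case
                  proof (rule wp_core[OF _ nm], goal_cases)
                    case 1 show ?case using r2 by (simp add: params_def)
                  next
                    case 2 show ?case using r2 11(3,5) ys by (simp add: at_work_def)
                  next
                    case (3 u c)
                    then have "w * cost u \<le> 1018 * P * N + 90 * w" using c2 by (intro co_bound[of "cost u" "cost u2"]) simp_all
                    then show ?case using 3 unfolding Qf_def by blast
                  qed
                qed (simp_all add: reg_ok_def)
              qed (use r1 d1 lx XU in \<open>simp_all add: X_def\<close>)
            qed (simp_all add: reg_ok_def)
          qed (simp_all add: reg_ok_def)
        qed (simp_all add: reg_ok_def)
      qed (simp_all add: reg_ok_def)
    qed (use r0 old lx xW in \<open>simp_all add: w_def\<close>)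
  qed (simp_all add: reg_ok_def)
  then obtain q s2 u where ex: "exec M B W prepare s1 q s2" "rep s2 u" "cost u = cost v0 + q" and Qu: "Qf u"
    using rep unfolding wp_def by blast
  obtain c where c: "named {..<N} ?path c" "\<forall>i<N. store u (reg u 0 + i) = c i" "w * cost u \<le> 1018 * P * N + 90 * w"
    using Qu unfolding Qf_def by blast
  define s3 where "s3 = s2\<lparr>disk := (\<lambda>i. if cached u * B \<le> i \<and> i < cached u * B + B then mem s2 (0 + (i - cached u * B)) else disk s2 i)\<rparr>"
  have x3: "exec M B W (WriteBlock (Reg 3) (Const 0)) s2 1 s3"
    unfolding s3_def using B repD(2)[OF ex(2)] by (intro exec.WriteBlock) auto
  have d3: "disk s3 i = store u i" for i
    using repD(8)[OF ex(2), of i] block_arith(1)[of "cached u" i] block_arith(2)[of i] by (auto simp: s3_def)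
  have "regs s3 0 = reg u 0" using repD(1)[OF ex(2), of 0] by (simp add: s3_def)
  then have bid: "block_id s3 i = c i" if "i < N" for i using that c(2) d3 by (simp add: block_id_def)
  have "exec M B W one_index_prog s0 (1 + (q + 1)) s3"
    unfolding one_index_prog_def by (rule exec.Seq[OF x1 exec.Seq[OF ex(1) x3]])
  moreover have "output_partition s3 (doc_order t) = one_index (xml_graph t)"
    by (rule one_index_xml) (use bid c(1) in \<open>auto simp: named_def N_def\<close>)
  moreover have "real (1 + (q + 1)) \<le> 30000 * Sort M B N"
    using cost_bound[OF B w_def K_def N1 Pmin c(3)] ex(3) by (simp add: v0_def)
  ultimately show ?thesis unfolding W_def s0_def card_nodes by blast
qed

theorem theorem2:
  shows "\<exists>(p :: prog) (k :: nat) (c :: real).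
    \<forall>(M :: nat) (B :: nat) (t :: xml). 1 \<le> B \<longrightarrow> 2 * B \<le> M \<longrightarrow>
      (\<exists>(q :: nat) (s :: config).
         exec M B (word_bound k M t) p (initial M B (tags t)) q s \<and>
         output_partition s (doc_order t) = one_index (xml_graph t) \<and>
         real q \<le> c * Sort M B (card (nodes (xml_graph t))))"
  using one_index_prog_correct by blast

end
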